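(* Let $T(\Gamma)$ be a twisted right-angled Artin group with generators $V\Gamma=\{x_1,\dots,x_n,y\}$ such that the only Klein relations in its defining presentation are of the form $x_iyx_i=y$ with $i\in I$, for some subset $I\subseteq\{1,\dots,n\}$. Then the conjugacy problem in $T(\Gamma)$ can be solved in linear time, i.e. there is an algorithm which, given words $u,v$ over $V\Gamma\sqcup V\Gamma^{-1}$, decides in time linear in $l(u)+l(v)$ whether $u$ and $v$ represent conjugate elements of $T(\Gamma)$.
   Context: A mixed graph $\Gamma=(V,E,D,o,t)$ consists of a simplicial graph $(V,E)$ (no loops, no multiple edges; $E$ is a set of 2-element subsets of the non-empty set $V=V\Gamma$), a subset $D\subseteq E$ of directed edges, and maps $o,t\colon D\to V$ with $\{o(e),t(e)\}=e$ for every $e\in D$. Write $[a,b]$ for an undirected edge and $[a,b\rangle$ for a directed edge with origin $a$ and terminus $b$. The twisted right-angled Artin group (T-RAAG) based on a finite mixed graph $\Gamma$ is $$T(\Gamma)=\langle V \mid ab=ba \text{ if } [a,b]\in E,\ \ aba=b \text{ if } [a,b\rangle\in E\rangle .$$ The relations $aba=b$ coming from directed edges $[a,b\rangle$ are called Klein relations. Thus the hypothesis says that every directed edge of $\Gamma$ is of the form $[x_i,y\rangle$. The length of a word $w$ is denoted $l(w)$. The group (the graph $\Gamma$) is fixed and only the words $u,v$ are the input; no particular model of computation is fixed in the statement. *)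

theory Defs
  imports "HOL-Algebra.Group"
begin

section \<open>Groups given by generators and relations\<close>

text \<open>The letter \<open>(a, True)\<close> stands for the generator \<open>a\<close> and \<open>(a, False)\<close> for its formal inverse.
  A pair \<open>(l, r)\<close> of words in the set of relations stands for the defining relation \<open>l = r\<close>.\<close>

type_synonym 'a letter = "'a \<times> bool"
type_synonym 'a word = "'a letter list"

definition letters :: "'a set \<Rightarrow> 'a letter set" where
  "letters X = X \<times> UNIV"

inductive_set word_eq :: "'a set \<Rightarrow> ('a word \<times> 'a word) set \<Rightarrow> ('a word \<times> 'a word) set"
  for X :: "'a set" and R :: "('a word \<times> 'a word) set"
where
  refl: "w \<in> lists (letters X) \<Longrightarrow> (w, w) \<in> word_eq X R"
| sym: "(v, w) \<in> word_eq X R \<Longrightarrow> (w, v) \<in> word_eq X R"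
| trans: "(u, v) \<in> word_eq X R \<Longrightarrow> (v, w) \<in> word_eq X R \<Longrightarrow> (u, w) \<in> word_eq X R"
| cancel: "p \<in> lists (letters X) \<Longrightarrow> q \<in> lists (letters X) \<Longrightarrow> a \<in> X \<Longrightarrow>
    (p @ [(a, e), (a, \<not> e)] @ q, p @ q) \<in> word_eq X R"
| rel: "p \<in> lists (letters X) \<Longrightarrow> q \<in> lists (letters X) \<Longrightarrow> (l, r) \<in> R \<Longrightarrow>
    l \<in> lists (letters X) \<Longrightarrow> r \<in> lists (letters X) \<Longrightarrow> (p @ l @ q, p @ r @ q) \<in> word_eq X R"

definition word_class :: "'a set \<Rightarrow> ('a word \<times> 'a word) set \<Rightarrow> 'a word \<Rightarrow> 'a word set" where
  "word_class X R w = word_eq X R `` {w}"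

definition presented_group :: "'a set \<Rightarrow> ('a word \<times> 'a word) set \<Rightarrow> 'a word set monoid" where
  "presented_group X R =
    \<lparr> carrier = lists (letters X) // word_eq X R,
      mult = (\<lambda>A B. \<Union>a\<in>A. \<Union>b\<in>B. word_class X R (a @ b)),
      one = word_class X R [] \<rparr>"

lemma word_eq_lists:
  "(v, w) \<in> word_eq X R \<Longrightarrow> v \<in> lists (letters X) \<and> w \<in> lists (letters X)"
  by (induction rule: word_eq.induct) (auto simp: letters_def)

lemma equiv_word_eq: "equiv (lists (letters X)) (word_eq X R)"
proof (rule equivI)
  show "word_eq X R \<subseteq> lists (letters X) \<times> lists (letters X)"
    by (auto dest: word_eq_lists simp del: in_lists_conv_set)
  show "refl_on (lists (letters X)) (word_eq X R)"
    by (simp add: refl_on_def word_eq.refl del: in_lists_conv_set)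
  show "sym (word_eq X R)"
    by (rule symI) (rule word_eq.sym)
  show "trans (word_eq X R)"
    by (rule transI) (rule word_eq.trans)
qed

lemma word_eq_context:
  assumes "(v, w) \<in> word_eq X R" "s \<in> lists (letters X)" "t \<in> lists (letters X)"
  shows "(s @ v @ t, s @ w @ t) \<in> word_eq X R"
  using assms
proof (induction rule: word_eq.induct)
  case (cancel p q a e)
  then show ?case using word_eq.cancel[of "s @ p" X "q @ t" a e R] by simp
next
  case (rel p q l r)
  then show ?case using word_eq.rel[of "s @ p" X "q @ t" l r R] by simp
next
  case (refl w)
  then show ?case by (intro word_eq.refl) simp
next
  case (trans u v w)
  then show ?case using word_eq.trans by blast
qed (auto intro: word_eq.sym)

lemma word_eq_append:
  assumes "(a, a') \<in> word_eq X R" "(b, b') \<in> word_eq X R"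
  shows "(a @ b, a' @ b') \<in> word_eq X R"
proof -
  have "(a @ b, a' @ b) \<in> word_eq X R"
    using word_eq_context[OF assms(1), of "[]" b] word_eq_lists[OF assms(2)] by simp
  moreover have "(a' @ b, a' @ b') \<in> word_eq X R"
    using word_eq_context[OF assms(2), of a' "[]"] word_eq_lists[OF assms(1)] by simp
  ultimately show ?thesis by (rule word_eq.trans)
qed

lemma word_class_eq_iff:
  assumes "v \<in> lists (letters X)" "w \<in> lists (letters X)"
  shows "word_class X R v = word_class X R w \<longleftrightarrow> (v, w) \<in> word_eq X R"
  unfolding word_class_def using eq_equiv_class_iff[OF equiv_word_eq assms] .

lemma mult_word_class:
  assumes "v \<in> lists (letters X)" "w \<in> lists (letters X)"
  shows "word_class X R v \<otimes>\<^bsub>presented_group X R\<^esub> word_class X R w = word_class X R (v @ w)"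
proof -
  have "word_class X R (a @ b) = word_class X R (v @ w)"
    if "a \<in> word_class X R v" "b \<in> word_class X R w" for a b
  proof -
    have "(v @ w, a @ b) \<in> word_eq X R"
      using that by (auto simp: word_class_def intro: word_eq_append)
    from word_class_eq_iff[THEN iffD2, OF _ _ this] word_eq_lists[OF this] show ?thesis by simp
  qed
  note eq = this
  have "v \<in> word_class X R v" "w \<in> word_class X R w"
    using assms by (simp_all add: word_class_def word_eq.refl del: in_lists_conv_set)
  then have "(\<Union>a\<in>word_class X R v. \<Union>b\<in>word_class X R w. word_class X R (a @ b))
      = word_class X R (v @ w)"
    using eq by blast
  then show ?thesis by (simp add: presented_group_def)
qed

lemma carrier_presented_group:
  "carrier (presented_group X R) = word_class X R ` lists (letters X)"
  by (auto simp: presented_group_def quotient_def word_class_def)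

lemma inverse_word:
  assumes "w \<in> lists (letters X)"
  shows "\<exists>v \<in> lists (letters X). (v @ w, []) \<in> word_eq X R"
  using assms
proof (induction w)
  case Nil
  then show ?case by (auto intro: word_eq.refl)
next
  case (Cons z w)
  then obtain v where v: "v \<in> lists (letters X)" "(v @ w, []) \<in> word_eq X R" by auto
  obtain a e where z: "z = (a, e)" "a \<in> X" using Cons by (cases z) (auto simp: letters_def)
  let ?v = "v @ [(a, \<not> e)]"
  have "(?v @ z # w, v @ w) \<in> word_eq X R"
    using word_eq.cancel[of v X w a "\<not> e" R] v(1) z Cons by simp
  then have "(?v @ z # w, []) \<in> word_eq X R" using v(2) by (rule word_eq.trans)
  moreover have "?v \<in> lists (letters X)" using v(1) z(2) by (auto simp: letters_def)
  ultimately show ?case by blast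
qed

lemma group_presented_group: "group (presented_group X R)" (is "group ?G")
proof (rule groupI)
  have one: "\<one>\<^bsub>?G\<^esub> = word_class X R []"
    by (simp add: presented_group_def)
  show "\<one>\<^bsub>?G\<^esub> \<in> carrier ?G"
    unfolding one carrier_presented_group by (rule imageI) simp
  fix x y
  assume "x \<in> carrier ?G" "y \<in> carrier ?G"
  then obtain u v where u: "u \<in> lists (letters X)" "x = word_class X R u"
    and v: "v \<in> lists (letters X)" "y = word_class X R v"
    unfolding carrier_presented_group by blast
  have "u @ v \<in> lists (letters X)" using u v by simp
  then show "x \<otimes>\<^bsub>?G\<^esub> y \<in> carrier ?G"
    unfolding u(2) v(2) mult_word_class[OF u(1) v(1)] carrier_presented_group by (rule imageI)
  fix z
  assume "z \<in> carrier ?G"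
  then obtain w where w: "w \<in> lists (letters X)" "z = word_class X R w"
    unfolding carrier_presented_group by blast
  have vw: "v @ w \<in> lists (letters X)" using v w by simp
  show "x \<otimes>\<^bsub>?G\<^esub> y \<otimes>\<^bsub>?G\<^esub> z = x \<otimes>\<^bsub>?G\<^esub> (y \<otimes>\<^bsub>?G\<^esub> z)"
    unfolding u(2) v(2) w(2) mult_word_class[OF u(1) v(1)] mult_word_class[OF v(1) w(1)]
      mult_word_class[OF \<open>u @ v \<in> _\<close> w(1)] mult_word_class[OF u(1) vw] by simp
next
  have one: "\<one>\<^bsub>?G\<^esub> = word_class X R []"
    by (simp add: presented_group_def)
  fix x
  assume "x \<in> carrier ?G"
  then obtain w where w: "w \<in> lists (letters X)" "x = word_class X R w"
    unfolding carrier_presented_group by blast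
  show "\<one>\<^bsub>?G\<^esub> \<otimes>\<^bsub>?G\<^esub> x = x"
    unfolding one w(2) mult_word_class[OF lists.Nil w(1)] by simp
  obtain v where v: "v \<in> lists (letters X)" "(v @ w, []) \<in> word_eq X R"
    using inverse_word[OF w(1)] by blast
  have "word_class X R v \<otimes>\<^bsub>?G\<^esub> x = \<one>\<^bsub>?G\<^esub>"
    unfolding one w(2) mult_word_class[OF v(1) w(1)]
    using word_class_eq_iff word_eq_lists[OF v(2)] v(2) by blast
  moreover have "word_class X R v \<in> carrier ?G"
    unfolding carrier_presented_group using v(1) by (rule imageI)
  ultimately show "\<exists>y \<in> carrier ?G. y \<otimes>\<^bsub>?G\<^esub> x = \<one>\<^bsub>?G\<^esub>" by blast
qed

definition conjugate_in :: "('g, 'b) monoid_scheme \<Rightarrow> 'g \<Rightarrow> 'g \<Rightarrow> bool" where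
  "conjugate_in G x y \<longleftrightarrow> (\<exists>g \<in> carrier G. y = g \<otimes>\<^bsub>G\<^esub> x \<otimes>\<^bsub>G\<^esub> inv\<^bsub>G\<^esub> g)"


section \<open>Mixed graphs and twisted right-angled Artin groups\<close>

record 'a mixed_graph =
  verts :: "'a set"
  edges :: "'a set set"
  directed :: "'a set set"
  origin :: "'a set \<Rightarrow> 'a"
  terminus :: "'a set \<Rightarrow> 'a"

text \<open>Only the values of \<open>origin\<close> and \<open>terminus\<close> on directed edges matter.\<close>

definition finite_mixed_graph :: "'a mixed_graph \<Rightarrow> bool" where
  "finite_mixed_graph \<Gamma> \<longleftrightarrow>
    finite (verts \<Gamma>) \<and> verts \<Gamma> \<noteq> {} \<and>
    (\<forall>e \<in> edges \<Gamma>. e \<subseteq> verts \<Gamma> \<and> card e = 2) \<and>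
    directed \<Gamma> \<subseteq> edges \<Gamma> \<and>
    (\<forall>e \<in> directed \<Gamma>. {origin \<Gamma> e, terminus \<Gamma> e} = e)"

definition klein_pairs :: "'a mixed_graph \<Rightarrow> ('a \<times> 'a) set" where
  "klein_pairs \<Gamma> = {(origin \<Gamma> e, terminus \<Gamma> e) | e. e \<in> directed \<Gamma>}"

definition traag_relations :: "'a mixed_graph \<Rightarrow> ('a word \<times> 'a word) set" where
  "traag_relations \<Gamma> =
    {([(a, True), (b, True)], [(b, True), (a, True)]) | a b. {a, b} \<in> edges \<Gamma> - directed \<Gamma>} \<union>
    {([(a, True), (b, True), (a, True)], [(b, True)]) | a b. (a, b) \<in> klein_pairs \<Gamma>}"

definition traag :: "'a mixed_graph \<Rightarrow> 'a word set monoid" where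
  "traag \<Gamma> = presented_group (verts \<Gamma>) (traag_relations \<Gamma>)"

definition traag_elem :: "'a mixed_graph \<Rightarrow> 'a word \<Rightarrow> 'a word set" where
  "traag_elem \<Gamma> w = word_class (verts \<Gamma>) (traag_relations \<Gamma>) w"

lemma group_traag: "group (traag \<Gamma>)"
  by (simp add: traag_def group_presented_group)


section \<open>Random access machines and linear time\<close>

text \<open>
  A successor random access machine: registers are addressed directly by the program, memory
  cells are addressed through registers. The only arithmetic is increment and truncated
  decrement, so after \<open>t\<close> steps every number in use is at most \<open>t\<close> plus the largest constant in
  the program and the input; this is what makes counting every instruction as one step legitimate.
\<close>

datatype instr =
    Const nat nat
  | Copy nat nat
  | Incr nat
  | Decr nat
  | Load nat nat
  | Store nat nat
  | JumpEq nat nat nat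
  | Halt bool

type_synonym program = "instr list"

record config =
  pc :: nat
  reg :: "nat \<Rightarrow> nat"
  mem :: "nat \<Rightarrow> nat"

fun exec :: "instr \<Rightarrow> config \<Rightarrow> config" where
  "exec (Const r k) c = c\<lparr>pc := Suc (pc c), reg := (reg c)(r := k)\<rparr>"
| "exec (Copy r s) c = c\<lparr>pc := Suc (pc c), reg := (reg c)(r := reg c s)\<rparr>"
| "exec (Incr r) c = c\<lparr>pc := Suc (pc c), reg := (reg c)(r := reg c r + 1)\<rparr>"
| "exec (Decr r) c = c\<lparr>pc := Suc (pc c), reg := (reg c)(r := reg c r - 1)\<rparr>"
| "exec (Load r s) c = c\<lparr>pc := Suc (pc c), reg := (reg c)(r := mem c (reg c s))\<rparr>"
| "exec (Store r s) c = c\<lparr>pc := Suc (pc c), mem := (mem c)(reg c r := reg c s)\<rparr>"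
| "exec (JumpEq r s l) c = c\<lparr>pc := (if reg c r = reg c s then l else Suc (pc c))\<rparr>"
| "exec (Halt b) c = c"

text \<open>A machine whose program counter has left the program is stuck and gives no answer.\<close>

definition step :: "program \<Rightarrow> config \<Rightarrow> config" where
  "step P c = (if pc c < length P then exec (P ! pc c) c else c)"

definition initial :: "nat list \<Rightarrow> config" where
  "initial xs =
    \<lparr>pc = 0, reg = (\<lambda>_. 0), mem = (\<lambda>i. if i < length xs then xs ! i else 0)\<rparr>"

definition answers :: "program \<Rightarrow> config \<Rightarrow> bool \<Rightarrow> bool" where
  "answers P c b \<longleftrightarrow> pc c < length P \<and> P ! pc c = Halt b"

definition answers_within :: "program \<Rightarrow> nat list \<Rightarrow> nat \<Rightarrow> bool \<Rightarrow> bool" where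
  "answers_within P xs T b \<longleftrightarrow> (\<exists>t \<le> T. answers P ((step P ^^ t) (initial xs)) b)"

text \<open>A halted configuration is a fixed point, so the answer is unique.\<close>

lemma answers_within_unique:
  assumes "answers_within P xs T b" "answers_within P xs T' b'"
  shows "b = b'"
proof -
  have stay: "(step P ^^ (s + d)) c = (step P ^^ s) c"
    if "answers P ((step P ^^ s) c) b" for s d c b
  proof (induction d)
    case (Suc d)
    have "step P ((step P ^^ s) c) = (step P ^^ s) c"
      using that unfolding step_def[of P "(step P ^^ s) c"] answers_def by simp
    with Suc show ?case by simp
  qed simp
  obtain s s' where s: "answers P ((step P ^^ s) (initial xs)) b"
    and s': "answers P ((step P ^^ s') (initial xs)) b'"
    using assms by (auto simp: answers_within_def)
  have "(step P ^^ s) (initial xs) = (step P ^^ s') (initial xs)"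
    using stay[OF s, of s'] stay[OF s', of s] by (simp add: add.commute)
  with s s' show ?thesis by (simp add: answers_def)
qed

text \<open>
  A binary relation \<open>Q\<close> on words over the alphabet \<open>A\<close> is decidable in linear time. The two input
  words are written into memory one after the other, one letter per cell, each terminated by \<open>0\<close>
  (memory beyond the input is \<open>0\<close>); the numbering \<open>code\<close> of the letters by positive numbers is
  arbitrary. The program and the constant depend on \<open>A\<close>, \<open>Q\<close> and \<open>code\<close> only. The summand
  \<open>1\<close> accounts for empty input.
\<close>

definition linear_time_decidable :: "'l set \<Rightarrow> ('l list \<Rightarrow> 'l list \<Rightarrow> bool) \<Rightarrow> bool" where
  "linear_time_decidable A Q \<longleftrightarrow>
    (\<forall>code :: 'l \<Rightarrow> nat. inj_on code A \<and> (\<forall>a \<in> A. code a > 0) \<longrightarrow>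
      (\<exists>P K. \<forall>u \<in> lists A. \<forall>v \<in> lists A.
        answers_within P (map code u @ [0] @ map code v) (K * (length u + length v + 1)) (Q u v)))"

end

theory Submission
  imports Defs "HOL-Library.Confluence" "HOL-Library.Multiset" "HOL-Library.List_Lexorder"
begin

text \<open>Flipping the sign of every letter of \<open>x\<^sub>i, i \<in> I\<close>, that has an odd number of letters \<open>y\<close> before it turns
  \<open>x\<^sub>i y x\<^sub>i = y\<close> into a commutation, so words become words of a right-angled Artin group with involution
  \<open>\<theta>\<close> (conjugation by \<open>y\<close>), and conjugation of \<open>w\<close> becomes \<open>w \<mapsto> b w \<theta>\<^sup>\<epsilon>(b)\<inverse>\<close>, up to applying \<open>\<theta>\<close> to \<open>w\<close>,
  where \<open>\<epsilon>\<close> is the parity of the exponent of \<open>y\<close>. Two cyclically reduced words are then conjugate iff they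
  are related by commutations and by moving a first letter \<open>c\<close> to the end as \<open>\<theta>\<^sup>\<epsilon>(c)\<close>.

  For a generator \<open>r\<close>, moving initial letters other than \<open>r\<close> to the end is confluent; on the letters
  connected with \<open>r\<close> by non-commutation it stops after a bounded number of passes in a word whose only
  initial letters are \<open>r\<close>. If \<open>r\<close> is the last letter of the alphabet, the lexicographic normal forms \<open>z\<close> of
  such words for two conjugate elements differ by a cyclic shift of \<open>z \<theta>\<^sup>\<epsilon>(z)\<close>. So it suffices to compare two
  cyclic strings for each \<open>r\<close>. Reduction and normal forms use pilings, the comparison uses two pointers, and
  all of it runs on a fixed number of deques, which a random access machine interleaves in its memory.\<close>

text \<open>The twisted words come from a semidirect product. Let A be the group of decorated words
  and \<tau> an involution acting on A by \<theta>. Then x_i -> x_i, y -> y \<tau> embeds the group,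
  and conjugating w \<tau>^\<epsilon> by b \<tau>^\<delta> gives b \<theta>^\<delta>(w)
  \<theta>^\<epsilon>(b)^-1 \<tau>^\<epsilon>. The obstacle is that \<delta> is not free: it is the
  parity of y in b. Rotations of a bare cyclic word do not see this parity, and applying \<theta> is
  not a conjugation in general. Hence every y carries a mark for the parity in front of it, which
  fixes the start parity of a word as soon as y occurs. If y does not occur in a cyclically reduced
  word, \<delta> = 1 is possible only when y commutes with all of its letters; this is the second
  conclusion of \<open>conj_cyc_irred\<close>, and \<open>check_link\<close> tests it. Both values
  of \<delta> are tried, and one success suffices.\<close>

locale independence =
  fixes comm :: "'g \<Rightarrow> 'g \<Rightarrow> bool" and gen :: "'l \<Rightarrow> 'g"
  assumes comm_sym: "comm a b \<Longrightarrow> comm b a"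
    and comm_irrefl: "\<not> comm a a"
begin

section \<open>Words modulo commutation (traces)\<close>

definition lcomm :: "'l \<Rightarrow> 'l \<Rightarrow> bool" where
  "lcomm c d \<longleftrightarrow> comm (gen c) (gen d)"

definition pair_proj :: "'g \<Rightarrow> 'g \<Rightarrow> 'l list \<Rightarrow> 'l list" where
  "pair_proj a b w = filter (\<lambda>c. gen c = a \<or> gen c = b) w"

text \<open>Trace equivalence through its projection characterisation: two words differ by swaps of
  adjacent commuting letters iff their projections to all non-commuting pairs of generators agree.
  As an equation between filtered lists it is compatible with contexts, cancellation, reversal,
  filtering and maps almost for free; \<open>teq_Cons_split\<close> recovers the swaps.\<close>

definition teq :: "'l list \<Rightarrow> 'l list \<Rightarrow> bool" (infix "\<simeq>" 50) where
  "u \<simeq> v \<longleftrightarrow> (\<forall>a b. \<not> comm a b \<longrightarrow> pair_proj a b u = pair_proj a b v)"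

lemma lcomm_sym: "lcomm c d \<Longrightarrow> lcomm d c"
  by (simp add: lcomm_def comm_sym)

lemma lcomm_gen: "lcomm c d \<Longrightarrow> gen c \<noteq> gen d"
  using comm_irrefl by (auto simp: lcomm_def)

lemma pair_proj_append [simp]: "pair_proj a b (u @ v) = pair_proj a b u @ pair_proj a b v"
  by (simp add: pair_proj_def)

lemma teq_refl [simp, intro]: "u \<simeq> u"
  by (simp add: teq_def)

lemma teq_sym: "u \<simeq> v \<Longrightarrow> v \<simeq> u"
  by (simp add: teq_def)

lemma teq_trans [trans]: "u \<simeq> v \<Longrightarrow> v \<simeq> w \<Longrightarrow> u \<simeq> w"
  by (simp add: teq_def)

lemma teq_append: "u \<simeq> u' \<Longrightarrow> v \<simeq> v' \<Longrightarrow> u @ v \<simeq> u' @ v'"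
  by (simp add: teq_def)

lemma teq_append_left_iff [simp]: "p @ u \<simeq> p @ v \<longleftrightarrow> u \<simeq> v"
  by (simp add: teq_def)

lemma teq_append_right_iff [simp]: "u @ p \<simeq> v @ p \<longleftrightarrow> u \<simeq> v"
  by (simp add: teq_def)

lemma teq_Cons_iff [simp]: "c # u \<simeq> c # v \<longleftrightarrow> u \<simeq> v"
  using teq_append_left_iff[of "[c]"] by simp

lemma teq_filter:
  assumes "u \<simeq> v"
  shows "filter (\<lambda>c. gen c \<in> G) u \<simeq> filter (\<lambda>c. gen c \<in> G) v"
proof -
  have "pair_proj a b (filter (\<lambda>c. gen c \<in> G) w) = filter (\<lambda>c. gen c \<in> G) (pair_proj a b w)" for a b w
    by (simp add: pair_proj_def conj_commute)
  with assms show ?thesis by (simp add: teq_def)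
qed

lemma teq_rev: "u \<simeq> v \<Longrightarrow> rev u \<simeq> rev v"
  by (simp add: teq_def pair_proj_def rev_filter[symmetric])

lemma teq_map:
  assumes "u \<simeq> v" "\<And>c. gen (f c) = gen c"
  shows "map f u \<simeq> map f v"
proof -
  have "pair_proj a b (map f w) = map f (pair_proj a b w)" for a b w
    using assms(2) by (simp add: pair_proj_def filter_map o_def)
  with assms(1) show ?thesis by (simp add: teq_def)
qed

lemma teq_single_proj:
  assumes "u \<simeq> v"
  shows "filter (\<lambda>c. gen c = a) u = filter (\<lambda>c. gen c = a) v"
proof -
  have "pair_proj a a u = pair_proj a a v"
    using assms comm_irrefl[of a] by (simp add: teq_def)
  then show ?thesis by (simp add: pair_proj_def)
qed

lemma teq_mset:
  assumes "u \<simeq> v"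
  shows "mset u = mset v"
proof (rule multiset_eqI)
  fix c
  have "count (mset w) c = count (mset (filter (\<lambda>d. gen d = gen c) w)) c" for w
    by (induction w) auto
  with teq_single_proj[OF assms, of "gen c"] show "count (mset u) c = count (mset v) c" by metis
qed

lemma teq_set: "u \<simeq> v \<Longrightarrow> set u = set v"
  by (metis teq_mset mset_eq_setD)

lemma teq_length: "u \<simeq> v \<Longrightarrow> length u = length v"
  by (metis teq_mset size_mset)

lemma teq_Nil [simp]: "[] \<simeq> v \<longleftrightarrow> v = []" "v \<simeq> [] \<longleftrightarrow> v = []"
  using teq_length by fastforce+

lemma pair_proj_comm:
  assumes "\<forall>d\<in>set z. lcomm c d" "\<not> comm a b"
  shows "pair_proj a b [c] @ pair_proj a b z = pair_proj a b z @ pair_proj a b [c]"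
proof (cases "gen c = a \<or> gen c = b")
  case True
  then have "pair_proj a b z = []"
    using assms comm_irrefl comm_sym unfolding pair_proj_def lcomm_def
    by (auto simp: filter_empty_conv)
  then show ?thesis by simp
next
  case False
  then show ?thesis by (simp add: pair_proj_def)
qed

lemma teq_move:
  assumes "\<forall>d\<in>set z. lcomm c d"
  shows "c # z \<simeq> z @ [c]"
proof -
  have "[c] @ z \<simeq> z @ [c]"
    unfolding teq_def pair_proj_append using pair_proj_comm[OF assms] by blast
  then show ?thesis by simp
qed

lemma teq_move_in:
  assumes "\<forall>d\<in>set p. lcomm c d"
  shows "p @ c # q \<simeq> c # p @ q"
proof -
  have "(p @ [c]) @ q \<simeq> (c # p) @ q"
    by (rule teq_append[OF teq_sym[OF teq_move[OF assms]]]) simp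
  then show ?thesis by simp
qed

lemma teq_swap_lists:
  assumes "\<forall>c\<in>set u. \<forall>d\<in>set v. lcomm c d"
  shows "u @ v \<simeq> v @ u"
  using assms
proof (induction u)
  case (Cons c u)
  have "c # u @ v \<simeq> c # v @ u" using Cons by simp
  also have "\<dots> \<simeq> v @ c # u" by (rule teq_sym[OF teq_move_in]) (use Cons in simp)
  finally show ?case by simp
qed simp

text \<open>The projection to \<open>gen c\<close> alone shows that the first letter of
  \<open>v\<close> over \<open>gen c\<close> is \<open>c\<close>. A letter \<open>d\<close> in front
  of it that does not commute with \<open>c\<close> would precede \<open>c\<close> in the projection
  to this pair, whereas \<open>c # u\<close> projects to a word starting with
  \<open>c\<close>.\<close>

lemma teq_Cons_split:
  assumes "c # u \<simeq> v"
  obtains p q where "v = p @ c # q" "\<forall>d\<in>set p. lcomm c d" "u \<simeq> p @ q"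
proof -
  have f: "filter (\<lambda>d. gen d = gen c) v = c # filter (\<lambda>d. gen d = gen c) u"
    using teq_single_proj[OF assms, of "gen c"] by simp
  then obtain p q where v: "v = p @ c # q" and p: "\<forall>d\<in>set p. gen d \<noteq> gen c"
    unfolding filter_eq_Cons_iff by blast
  have pc: "lcomm c d" if "d \<in> set p" for d
  proof (rule ccontr)
    assume "\<not> lcomm c d"
    then have eq: "pair_proj (gen c) (gen d) (c # u) = pair_proj (gen c) (gen d) v"
      using assms by (simp add: teq_def lcomm_def)
    have "pair_proj (gen c) (gen d) p \<noteq> []"
      using that by (auto simp: pair_proj_def filter_empty_conv)
    then obtain e p' where e: "pair_proj (gen c) (gen d) p = e # p'"
      by (cases "pair_proj (gen c) (gen d) p") auto
    then have "e \<in> set (pair_proj (gen c) (gen d) p)" by simp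
    then have "e \<in> set p" by (simp add: pair_proj_def)
    moreover have "e = c" using eq e unfolding v pair_proj_append by (simp add: pair_proj_def)
    ultimately show False using p by auto
  qed
  then have "c # u \<simeq> c # p @ q"
    using teq_trans[OF assms[unfolded v] teq_move_in] by blast
  then show ?thesis using that[OF v] pc by simp
qed

text \<open>Two different initial letters commute and can be taken off together: the local diamond
  behind the confluence arguments.\<close>

lemma teq_Cons_Cons:
  assumes "c # u \<simeq> d # v" "c \<noteq> d"
  obtains z where "lcomm c d" "u \<simeq> d # z" "v \<simeq> c # z"
proof -
  from teq_Cons_split[OF assms(1)] obtain p q where
    pq: "d # v = p @ c # q" "\<forall>e\<in>set p. lcomm c e" "u \<simeq> p @ q" .
  with assms(2) obtain p' where p: "p = d # p'" by (cases p) auto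
  with pq have "v \<simeq> c # p' @ q" using teq_move_in[of p' c q] by simp
  then show ?thesis using that[of "p' @ q"] pq p by simp
qed

lemma teq_Cons_gen:
  assumes "c # u \<simeq> d # v" "gen c = gen d"
  shows "c = d" "u \<simeq> v"
proof -
  show "c = d" using teq_Cons_Cons[OF assms(1)] assms(2) lcomm_gen by metis
  with assms(1) show "u \<simeq> v" by simp
qed

lemma teq_Cons_snoc:
  assumes "c # u \<simeq> v @ [d]"
  shows "(c = d \<and> u \<simeq> v \<and> (\<forall>e\<in>set v. lcomm c e)) \<or> (\<exists>z. u \<simeq> z @ [d] \<and> v \<simeq> c # z)"
proof -
  from teq_Cons_split[OF assms] obtain p q where
    pq: "v @ [d] = p @ c # q" "\<forall>e\<in>set p. lcomm c e" "u \<simeq> p @ q" .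
  show ?thesis
  proof (cases q rule: rev_cases)
    case Nil
    then show ?thesis using pq by auto
  next
    case (snoc q' e)
    then have v: "v = p @ c # q'" "e = d" using pq(1) by simp_all
    have "u \<simeq> (p @ q') @ [d]" using pq(3) snoc v by simp
    moreover have "v \<simeq> c # p @ q'" unfolding v by (rule teq_move_in[OF pq(2)])
    ultimately show ?thesis by blast
  qed
qed

lemma teq_append_Cons:
  assumes "u @ v \<simeq> c # w"
  obtains u' where "u \<simeq> c # u'" | v' where "\<forall>e\<in>set u. lcomm c e" "v \<simeq> c # v'"
proof -
  from teq_Cons_split[OF teq_sym[OF assms]] obtain p q where
    pq: "u @ v = p @ c # q" "\<forall>e\<in>set p. lcomm c e" "w \<simeq> p @ q" .
  from pq(1) consider r where "u = p @ c # r" | r where "p = u @ r" "v = r @ c # q"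
    by (auto simp: append_eq_append_conv2 append_eq_Cons_conv)
  then show ?thesis
  proof cases
    case 1
    then show ?thesis using that(1)[of "p @ r"] teq_move_in[OF pq(2)] by simp
  next
    case 2
    then have "v \<simeq> c # r @ q" using teq_move_in pq(2) by simp
    then show ?thesis using that(2) pq(2) 2 by simp
  qed
qed

end

section \<open>Free reduction modulo commutation\<close>

locale involutive_letters = independence comm gen
  for comm :: "'g \<Rightarrow> 'g \<Rightarrow> bool" and gen :: "'l \<Rightarrow> 'g" +
  fixes iv :: "'l \<Rightarrow> 'l"
  assumes gen_inv [simp]: "gen (iv c) = gen c"
    and inv_inv [simp]: "iv (iv c) = c"
    and inv_neq: "iv c \<noteq> c"
begin

lemma lcomm_inv [simp]: "lcomm (iv c) d = lcomm c d" "lcomm c (iv d) = lcomm c d"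
  by (simp_all add: lcomm_def)

definition irred :: "'l list \<Rightarrow> bool" where
  "irred w \<longleftrightarrow> (\<nexists>p c q. w \<simeq> p @ c # iv c # q)"

text \<open>Left multiplication by \<open>c\<close> on reduced words: cancel an initial
  \<open>iv c\<close>, otherwise prepend \<open>c\<close>. The remainder picked by
  \<open>SOME\<close> is determined only up to \<open>\<simeq>\<close>, so the laws of this action
  hold up to \<open>\<simeq>\<close>.\<close>

definition lpush :: "'l \<Rightarrow> 'l list \<Rightarrow> 'l list" where
  "lpush c w = (if \<exists>z. w \<simeq> iv c # z then SOME z. w \<simeq> iv c # z else c # w)"

lemma irred_teq: "irred u \<Longrightarrow> u \<simeq> v \<Longrightarrow> irred v"
  unfolding irred_def using teq_trans by blast

lemma irred_Nil [simp]: "irred []"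
  by (simp add: irred_def)

lemma not_irred_infix: "\<not> irred v \<Longrightarrow> \<not> irred (u @ v @ w)"
  unfolding irred_def
proof clarify
  fix p c q
  assume "v \<simeq> p @ c # iv c # q"
  then have "u @ v @ w \<simeq> u @ (p @ c # iv c # q) @ w" by (intro teq_append) simp_all
  then have "u @ v @ w \<simeq> (u @ p) @ c # iv c # (q @ w)" by simp
  moreover assume "\<nexists>p c q. u @ v @ w \<simeq> p @ c # iv c # q"
  ultimately show False by blast
qed

lemma irred_ConsD: "irred (c # w) \<Longrightarrow> irred w"
  using not_irred_infix[of w "[c]" "[]"] by auto

lemma irred_rev:
  assumes "irred w"
  shows "irred (rev w)"
  unfolding irred_def
proof clarify
  fix p c q
  assume "rev w \<simeq> p @ c # iv c # q"
  then have "w \<simeq> rev q @ iv c # iv (iv c) # rev p"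
    using teq_rev by fastforce
  with assms show False unfolding irred_def by blast
qed

lemma irred_map:
  assumes "irred w" "\<And>c. gen (f c) = gen c" "\<And>c. f (iv c) = iv (f c)" "\<And>c. f (f c) = c"
  shows "irred (map f w)"
  unfolding irred_def
proof clarify
  fix p c q
  assume "map f w \<simeq> p @ c # iv c # q"
  from teq_map[OF this assms(2)] have "w \<simeq> map f p @ f c # iv (f c) # map f q"
    by (simp add: assms o_def)
  with assms show False unfolding irred_def by blast
qed

text \<open>Locate \<open>c\<close> relative to the factor \<open>d, iv d\<close> in a word
  equivalent to \<open>c # w\<close>. If it is neither of the two, the factor survives in
  \<open>w\<close>. It is not the second, because \<open>d\<close> would have to commute with it. So
  it is the first, and \<open>iv c\<close> is initial in \<open>w\<close>.\<close>

lemma reducible_Cons: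
  assumes "irred w" "\<not> irred (c # w)"
  obtains z where "w \<simeq> iv c # z"
proof -
  obtain p d q where "c # w \<simeq> p @ d # iv d # q" using assms(2) by (auto simp: irred_def)
  then obtain p' q' where pq: "p @ d # iv d # q = p' @ c # q'" "\<forall>e\<in>set p'. lcomm c e" "w \<simeq> p' @ q'"
    by (rule teq_Cons_split)
  from pq(1) consider r where "p = p' @ c # r" "q' = r @ d # iv d # q"
    | "p = p'" "c = d" "q' = iv d # q"
    | "p' = p @ [d]" "c = iv d" "q' = q"
    | r where "p' = p @ d # iv d # r" "q = r @ c # q'"
    by (auto simp: append_eq_append_conv2 Cons_eq_append_conv append_eq_Cons_conv)
  then show ?thesis
  proof cases
    case 1
    then have "w \<simeq> (p' @ r) @ d # iv d # q" using pq(3) by simp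
    then show ?thesis using assms(1) unfolding irred_def by blast
  next
    case 2
    then have "w \<simeq> iv c # p' @ q"
      using teq_trans[OF pq(3)] teq_move_in[of p' "iv c" q] pq(2) by simp
    then show ?thesis by (rule that)
  next
    case 3
    then have "lcomm c (iv c)" using pq(2) by simp
    then show ?thesis using lcomm_gen by (metis gen_inv)
  next
    case 4
    then have "w \<simeq> p @ d # iv d # (r @ q')" using pq(3) by simp
    then show ?thesis using assms(1) unfolding irred_def by blast
  qed
qed

lemma lpush_cancel:
  assumes "w \<simeq> iv c # z"
  shows "lpush c w \<simeq> z"
proof -
  have "w \<simeq> iv c # lpush c w"
    using assms unfolding lpush_def by (auto intro: someI)
  then have "iv c # lpush c w \<simeq> iv c # z" using assms teq_sym teq_trans by blast
  then show ?thesis by simp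
qed

lemma lpush_push: "\<nexists>z. w \<simeq> iv c # z \<Longrightarrow> lpush c w = c # w"
  by (simp add: lpush_def)

lemma lpush_teq:
  assumes "w \<simeq> w'"
  shows "lpush c w \<simeq> lpush c w'"
proof (cases "\<exists>z. w \<simeq> iv c # z")
  case True
  then obtain z where z: "w \<simeq> iv c # z" by blast
  then have "w' \<simeq> iv c # z" using assms teq_sym teq_trans by blast
  from lpush_cancel[OF z] lpush_cancel[OF this] show ?thesis using teq_sym teq_trans by blast
next
  case False
  then have "\<nexists>z. w' \<simeq> iv c # z" using assms teq_sym teq_trans by blast
  with False show ?thesis using assms by (simp add: lpush_push)
qed

lemma irred_lpush:
  assumes "irred w"
  shows "irred (lpush c w)"
proof (cases "\<exists>z. w \<simeq> iv c # z")
  case True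
  then obtain z where z: "w \<simeq> iv c # z" by blast
  with assms have "irred z" using irred_teq irred_ConsD by blast
  then show ?thesis using lpush_cancel[OF z] irred_teq teq_sym by blast
next
  case False
  then show ?thesis using reducible_Cons[OF assms, of c] by (auto simp: lpush_push)
qed

lemma lpush_inv:
  assumes "irred w"
  shows "lpush (iv c) (lpush c w) \<simeq> w"
proof (cases "\<exists>z. w \<simeq> iv c # z")
  case True
  then obtain z where z: "w \<simeq> iv c # z" by blast
  have "\<nexists>z'. z \<simeq> iv (iv c) # z'"
  proof clarify
    fix z' assume "z \<simeq> iv (iv c) # z'"
    then have "iv c # z \<simeq> iv c # iv (iv c) # z'" by (subst teq_Cons_iff)
    with z have "w \<simeq> [] @ iv c # iv (iv c) # z'" using teq_trans by fastforce
    with assms show False unfolding irred_def by blast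
  qed
  then have "lpush (iv c) z = iv c # z" by (rule lpush_push)
  then show ?thesis
    using lpush_teq[OF lpush_cancel[OF z], of "iv c"] z teq_trans teq_sym by metis
next
  case False
  then show ?thesis using lpush_cancel[of "c # w" "iv c" w] by (simp add: lpush_push)
qed

lemma lpush_comm_mixed:
  assumes "lcomm c d" "w \<simeq> iv c # z" "\<nexists>z. w \<simeq> iv d # z"
  shows "lpush c (lpush d w) \<simeq> lpush d (lpush c w)"
proof -
  have "\<nexists>x. z \<simeq> iv d # x"
  proof clarify
    fix x assume "z \<simeq> iv d # x"
    then have "iv c # z \<simeq> [iv c] @ iv d # x" by simp
    also have "\<dots> \<simeq> iv d # [iv c] @ x"
      by (rule teq_move_in) (use assms(1) lcomm_sym in auto)
    finally show False using assms(2,3) teq_trans by blast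
  qed
  then have "lpush d z = d # z" by (rule lpush_push)
  then have 1: "lpush d (lpush c w) \<simeq> d # z" using lpush_teq[OF lpush_cancel[OF assms(2)], of d] by simp
  have "d # w \<simeq> [d] @ iv c # z" using assms(2) by simp
  also have "\<dots> \<simeq> iv c # [d] @ z" by (rule teq_move_in) (use assms(1) in auto)
  finally have "lpush c (d # w) \<simeq> d # z" using lpush_cancel by simp
  then show ?thesis using 1 lpush_push[OF assms(3)] teq_sym teq_trans by metis
qed

text \<open>Cases on which of the two letters cancels. Commuting letters have different generators,
  so pushing one neither creates nor destroys an initial inverse of the other.\<close>

lemma lpush_comm:
  assumes "lcomm c d"
  shows "lpush c (lpush d w) \<simeq> lpush d (lpush c w)"
proof (cases "\<exists>z. w \<simeq> iv c # z"; cases "\<exists>z. w \<simeq> iv d # z")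
  assume "\<exists>z. w \<simeq> iv c # z" "\<exists>z. w \<simeq> iv d # z"
  then obtain z z' where z: "w \<simeq> iv c # z" "w \<simeq> iv d # z'" by blast
  have "iv c \<noteq> iv d" using lcomm_gen[OF assms] by (metis gen_inv)
  moreover have "iv c # z \<simeq> iv d # z'" using z teq_sym teq_trans by blast
  ultimately obtain x where x: "z \<simeq> iv d # x" "z' \<simeq> iv c # x" by (metis teq_Cons_Cons)
  have "lpush c (lpush d w) \<simeq> x" "lpush d (lpush c w) \<simeq> x"
    using lpush_teq lpush_cancel z x teq_trans by meson+
  then show ?thesis using teq_sym teq_trans by blast
next
  assume "\<exists>z. w \<simeq> iv c # z" "\<nexists>z. w \<simeq> iv d # z"
  then show ?thesis using lpush_comm_mixed assms by blast
next
  assume "\<nexists>z. w \<simeq> iv c # z" "\<exists>z. w \<simeq> iv d # z"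
  then show ?thesis using lpush_comm_mixed assms lcomm_sym teq_sym by meson
next
  assume nc: "\<nexists>z. w \<simeq> iv c # z" and nd: "\<nexists>z. w \<simeq> iv d # z"
  have no: "\<nexists>z. b # w \<simeq> iv a # z" if "lcomm a b" "\<nexists>z. w \<simeq> iv a # z" for a b
    using that teq_Cons_Cons[of b w "iv a"] lcomm_gen[of a b] by (metis gen_inv)
  have "lpush c (lpush d w) = c # d # w"
    using lpush_push[OF nd] lpush_push[OF no[OF assms nc]] by simp
  moreover have "lpush d (lpush c w) = d # c # w"
    using lpush_push[OF nc] lpush_push[OF no[OF lcomm_sym[OF assms] nd]] by simp
  moreover have "[d] @ c # w \<simeq> c # [d] @ w" by (rule teq_move_in) (use assms in auto)
  ultimately show ?thesis using teq_sym by auto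
qed

lemma foldr_lpush_teq: "z \<simeq> z' \<Longrightarrow> foldr lpush u z \<simeq> foldr lpush u z'"
  by (induction u) (auto intro: lpush_teq)

lemma irred_foldr_lpush: "irred z \<Longrightarrow> irred (foldr lpush u z)"
  by (induction u) (auto intro: irred_lpush)

lemma foldr_lpush_move:
  assumes "\<forall>d\<in>set p. lcomm c d"
  shows "lpush c (foldr lpush p z) \<simeq> foldr lpush p (lpush c z)"
  using assms
proof (induction p)
  case (Cons d p)
  have "lpush c (lpush d (foldr lpush p z)) \<simeq> lpush d (lpush c (foldr lpush p z))"
    using Cons.prems lpush_comm by simp
  also have "\<dots> \<simeq> lpush d (foldr lpush p (lpush c z))" using Cons lpush_teq by simp
  finally show ?case by simp
qed simp

lemma foldr_lpush_teq_word:
  "u \<simeq> v \<Longrightarrow> foldr lpush u z \<simeq> foldr lpush v z"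
proof (induction u arbitrary: v)
  case (Cons c u)
  then obtain p q where v: "v = p @ c # q" "\<forall>d\<in>set p. lcomm c d" "u \<simeq> p @ q"
    using teq_Cons_split by blast
  have "lpush c (foldr lpush u z) \<simeq> lpush c (foldr lpush (p @ q) z)"
    using Cons.IH[OF v(3)] lpush_teq by blast
  also have "\<dots> \<simeq> foldr lpush v z" using foldr_lpush_move[OF v(2)] v(1) by simp
  finally show ?case by simp
qed simp

inductive geq :: "'l list \<Rightarrow> 'l list \<Rightarrow> bool" (infix "\<approx>" 50) where
  geq_teq: "u \<simeq> v \<Longrightarrow> u \<approx> v"
| geq_cancel: "p @ c # iv c # q \<approx> p @ q"
| geq_sym: "u \<approx> v \<Longrightarrow> v \<approx> u"
| geq_trans [trans]: "u \<approx> v \<Longrightarrow> v \<approx> w \<Longrightarrow> u \<approx> w"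

lemma geq_context: "u \<approx> v \<Longrightarrow> s @ u @ t \<approx> s @ v @ t"
proof (induction rule: geq.induct)
  case (geq_cancel p c q)
  then show ?case using geq.geq_cancel[of "s @ p" c "q @ t"] by simp
next
  case (geq_teq u v)
  then show ?case by (intro geq.geq_teq) simp
qed (blast intro: geq_sym geq_trans)+

lemma geq_foldr_lpush:
  assumes "u \<approx> v"
  shows "foldr lpush u [] \<simeq> foldr lpush v []"
  using assms
proof (induction rule: geq.induct)
  case (geq_cancel p c q)
  have "lpush (iv (iv c)) (lpush (iv c) (foldr lpush q [])) \<simeq> foldr lpush q []"
    by (intro lpush_inv irred_foldr_lpush) simp
  then show ?case using foldr_lpush_teq by simp
next
  case (geq_teq u v)
  then show ?case by (rule foldr_lpush_teq_word)
qed (blast intro: teq_sym teq_trans)+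

lemma foldr_lpush_irred: "irred u \<Longrightarrow> foldr lpush u [] = u"
proof (induction u)
  case (Cons c u)
  have "\<nexists>z. u \<simeq> iv c # z"
  proof clarify
    fix z assume "u \<simeq> iv c # z"
    then have "c # u \<simeq> [] @ c # iv c # z" by simp
    with Cons.prems show False unfolding irred_def by blast
  qed
  then show ?case using Cons irred_ConsD lpush_push by auto
qed simp

text \<open>Van der Waerden's trick: the letters act on reduced words by \<open>lpush\<close>, the
  action respects \<open>\<approx>\<close>, and a reduced word sends \<open>[]\<close> to itself. So
  a reduced word can be recovered, up to \<open>\<simeq>\<close>, from its class.\<close>

lemma geq_irred_teq: "u \<approx> v \<Longrightarrow> irred u \<Longrightarrow> irred v \<Longrightarrow> u \<simeq> v"
  using geq_foldr_lpush foldr_lpush_irred by metis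

text \<open>Induction on \<open>u\<close>. If its first letter \<open>d\<close> cancels with a
  letter of \<open>v\<close>, the rest of \<open>u\<close> commutes with \<open>d\<close>, so
  \<open>d\<close> may serve as the last letter.\<close>

lemma reducible_append:
  assumes "irred u" "irred v" "\<not> irred (u @ v)"
  obtains c u' v' where "u \<simeq> u' @ [c]" "v \<simeq> iv c # v'"
  using assms
proof (induction u arbitrary: thesis)
  case (Cons d u)
  have u: "irred u" using Cons irred_ConsD by blast
  show ?case
  proof (cases "irred (u @ v)")
    case True
    then obtain z where "u @ v \<simeq> iv d # z" using reducible_Cons[of "u @ v" d] Cons.prems by auto
    then show ?thesis
    proof (cases rule: teq_append_Cons)
      case (1 u')
      then have "d # u \<simeq> [] @ d # iv d # u'" by simp
      then show ?thesis using Cons.prems(2) unfolding irred_def by blast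
    next
      case (2 v')
      then have "d # u \<simeq> u @ [d]" by (intro teq_move) simp
      then show ?thesis using Cons.prems(1) 2 by blast
    qed
  next
    case False
    from Cons.IH[OF _ u Cons.prems(3) False] obtain c u' v' where
      "u \<simeq> u' @ [c]" "v \<simeq> iv c # v'" by blast
    moreover from this have "d # u \<simeq> (d # u') @ [c]" by simp
    ultimately show ?thesis using Cons.prems(1) by blast
  qed
qed simp

end

section \<open>Twisted cyclic reduction and twisted conjugacy\<close>

locale twisted_letters = involutive_letters comm gen iv
  for comm :: "'g \<Rightarrow> 'g \<Rightarrow> bool" and gen :: "'l \<Rightarrow> 'g" and iv :: "'l \<Rightarrow> 'l" +
  fixes th :: "'l \<Rightarrow> 'l"
  assumes gen_th [simp]: "gen (th c) = gen c"
    and th_iv: "th (iv c) = iv (th c)"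
    and th_th [simp]: "th (th c) = c"
begin

lemma lcomm_th [simp]: "lcomm (th c) d = lcomm c d" "lcomm c (th d) = lcomm c d"
  by (simp_all add: lcomm_def)

lemma th_o_th [simp]: "th \<circ> th = id"
  by auto

lemma teq_map_th: "u \<simeq> v \<Longrightarrow> map th u \<simeq> map th v"
  by (rule teq_map) simp_all

definition winv :: "'l list \<Rightarrow> 'l list" where
  "winv w = rev (map iv w)"

lemma winv_append [simp]: "winv (u @ v) = winv v @ winv u"
  by (simp add: winv_def)

lemma winv_Cons: "winv (c # v) = winv v @ [iv c]"
  by (simp add: winv_def)

lemma winv_Nil [simp]: "winv [] = []"
  by (simp add: winv_def)

lemma winv_winv [simp]: "winv (winv w) = w"
  by (simp add: winv_def rev_map o_def)

lemma winv_map_th: "winv (map th w) = map th (winv w)"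
  by (simp add: winv_def rev_map o_def th_iv)

lemma teq_winv: "u \<simeq> v \<Longrightarrow> winv u \<simeq> winv v"
  unfolding winv_def by (intro teq_rev teq_map) simp_all

lemma irred_winv: "irred w \<Longrightarrow> irred (winv w)"
  unfolding winv_def by (intro irred_rev irred_map) simp_all

lemma irred_map_th: "irred w \<Longrightarrow> irred (map th w)"
  by (intro irred_map) (simp_all add: th_iv)

text \<open>Moved to the end, \<open>c\<close> becomes \<open>th c\<close>, and
  \<open>iv (th c)\<close> is what cancels it there. The pattern has at least two letters, so a
  single letter with \<open>c = iv (th c)\<close> counts as reduced.\<close>

definition cyc_irred :: "'l list \<Rightarrow> bool" where
  "cyc_irred a \<longleftrightarrow> irred a \<and> (\<nexists>c z. a \<simeq> c # z @ [iv (th c)])"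

lemma cyc_irred_teq: "cyc_irred a \<Longrightarrow> a \<simeq> b \<Longrightarrow> cyc_irred b"
  unfolding cyc_irred_def using irred_teq teq_trans by blast

lemma cyc_irred_map_th:
  assumes "cyc_irred a"
  shows "cyc_irred (map th a)"
  unfolding cyc_irred_def
proof (intro conjI notI)
  show "irred (map th a)" using assms irred_map_th by (simp add: cyc_irred_def)
  assume "\<exists>c z. map th a \<simeq> c # z @ [iv (th c)]"
  then obtain c z where "map th a \<simeq> c # z @ [iv (th c)]" by blast
  from teq_map_th[OF this] have "a \<simeq> th c # map th z @ [iv (th (th c))]"
    by (simp add: th_iv o_def)
  then show False using assms unfolding cyc_irred_def by blast
qed

text \<open>A cyclic cancellation in \<open>w @ [th c]\<close> either uses the final
  \<open>th c\<close>, and then \<open>c\<close> cancels inside \<open>c # w\<close>; or it avoids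
  it, and then its letter \<open>d\<close> commutes with \<open>c\<close> and can be brought to the
  front of \<open>c # w\<close>, giving a cyclic cancellation there. The remaining case
  \<open>d = th c\<close> contradicts that \<open>d\<close> commutes with \<open>c\<close>.\<close>

lemma cyc_irred_rotate:
  assumes "cyc_irred (c # w)"
  shows "cyc_irred (w @ [th c])"
  unfolding cyc_irred_def
proof (intro conjI notI)
  have irr: "irred (c # w)" and cyc: "\<nexists>d z. c # w \<simeq> d # z @ [iv (th d)]"
    using assms by (auto simp: cyc_irred_def)
  show "irred (w @ [th c])"
  proof (rule ccontr)
    assume "\<not> irred (w @ [th c])"
    then have "\<not> irred (th c # rev w)" using irred_rev[of "th c # rev w"] by auto
    moreover have "irred (rev w)" using irr irred_ConsD irred_rev by blast
    ultimately obtain z where "rev w \<simeq> iv (th c) # z" using reducible_Cons by blast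
    from teq_rev[OF this] have "c # w \<simeq> c # rev z @ [iv (th c)]" by simp
    with cyc show False by blast
  qed
  assume "\<exists>d z. w @ [th c] \<simeq> d # z @ [iv (th d)]"
  then obtain d z where dz: "w @ [th c] \<simeq> (d # z) @ [iv (th d)]" by auto
  have "th c \<noteq> iv (th d)"
  proof
    assume e: "th c = iv (th d)"
    then have "w \<simeq> d # z" using dz by (simp only: teq_append_right_iff)
    moreover from e have "th (th c) = th (th (iv d))" by (simp add: th_iv)
    then have "c = iv d" by simp
    ultimately have "c # w \<simeq> [] @ c # iv c # z" by simp
    then show False using irr unfolding irred_def by blast
  qed
  moreover have "th c # rev w \<simeq> iv (th d) # rev z @ [d]"
    using teq_rev[OF dz] by simp
  ultimately obtain x where x: "lcomm (th c) (iv (th d))" "rev w \<simeq> iv (th d) # x" "rev z @ [d] \<simeq> th c # x"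
    using teq_Cons_Cons by metis
  from teq_rev[OF x(2)] have w: "w \<simeq> rev x @ [iv (th d)]" by simp
  from teq_rev[OF x(3)] have dz': "d # z \<simeq> rev x @ [th c]" by simp
  have cd: "lcomm c d" using x(1) by simp
  consider y where "rev x \<simeq> d # y" | "d = th c" using teq_Cons_snoc[OF dz'] by blast
  then show False
  proof cases
    case 1
    have "c # w \<simeq> [c] @ rev x @ [iv (th d)]" using w by simp
    also have "\<dots> \<simeq> [c] @ d # y @ [iv (th d)]" using teq_append[OF 1] by fastforce
    also have "\<dots> \<simeq> d # [c] @ y @ [iv (th d)]" using cd by (intro teq_move_in) (auto intro: lcomm_sym)
    finally have "c # w \<simeq> d # (c # y) @ [iv (th d)]" by simp
    with cyc show False by blast
  next
    case 2
    then show False using cd lcomm_gen by (metis gen_th)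
  qed
qed

lemma cyc_irred_rotate_list: "cyc_irred (u @ v) \<Longrightarrow> cyc_irred (v @ map th u)"
proof (induction u arbitrary: v)
  case (Cons c u)
  then have "cyc_irred (u @ v @ [th c])" using cyc_irred_rotate[of c "u @ v"] by simp
  from Cons.IH[OF this] show ?case by simp
qed simp

lemma cyc_irred_rotate_back:
  assumes "cyc_irred (w @ [d])"
  shows "cyc_irred (th d # w)"
  using cyc_irred_map_th[OF cyc_irred_rotate_list[OF assms]] by (simp add: o_def)

inductive rt :: "'l list \<Rightarrow> 'l list \<Rightarrow> bool" (infix "\<sim>" 50) where
  rt_teq: "u \<simeq> v \<Longrightarrow> u \<sim> v"
| rt_rotate: "c # w \<sim> w @ [th c]"
| rt_sym: "u \<sim> v \<Longrightarrow> v \<sim> u"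
| rt_trans [trans]: "u \<sim> v \<Longrightarrow> v \<sim> w \<Longrightarrow> u \<sim> w"

lemma rt_gens: "u \<sim> v \<Longrightarrow> gen ` set u = gen ` set v"
  by (induction rule: rt.induct) (auto dest: teq_set)

lemma rt_length: "u \<sim> v \<Longrightarrow> length u = length v"
  by (induction rule: rt.induct) (auto dest: teq_length)

lemma rt_rotate_list: "u @ v \<sim> v @ map th u"
proof (induction u arbitrary: v)
  case (Cons c u)
  have "c # u @ v \<sim> u @ v @ [th c]" using rt_rotate[of c "u @ v"] by simp
  also have "\<dots> \<sim> v @ th c # map th u" using Cons[of "v @ [th c]"] by simp
  finally show ?case by simp
qed (auto intro: rt_teq)

definition odd_gen :: "'g \<Rightarrow> 'l list \<Rightarrow> bool" where
  "odd_gen y w \<longleftrightarrow> odd (length (filter (\<lambda>c. gen c = y) w))"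

lemma odd_gen_Nil [simp]: "\<not> odd_gen y []"
  by (simp add: odd_gen_def)

lemma odd_gen_append [simp]: "odd_gen y (u @ v) \<longleftrightarrow> odd_gen y u \<noteq> odd_gen y v"
  by (auto simp: odd_gen_def)

lemma odd_gen_Cons [simp]: "odd_gen y (c # v) \<longleftrightarrow> (gen c = y) \<noteq> odd_gen y v"
  by (auto simp: odd_gen_def)

lemma odd_gen_teq: "u \<simeq> v \<Longrightarrow> odd_gen y u = odd_gen y v"
  unfolding odd_gen_def using teq_single_proj by metis

lemma rt_odd_gen: "a \<sim> b \<Longrightarrow> odd_gen g a = odd_gen g b"
  by (induction rule: rt.induct) (auto dest: odd_gen_teq)

text \<open>Induction on the length of the conjugator: in a reducible product \<open>b a \<theta>(b)\<inverse>\<close> of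
  reduced words either a letter of \<open>a\<close> cancels, which amounts to a rotation of \<open>a\<close>, or a letter
  of \<open>b\<close> cancels against its own inverse and hence commutes with \<open>a\<close>.\<close>

lemma conj_cyc_irred:
  assumes "cyc_irred a" "cyc_irred a'" "a' \<approx> b @ a @ map th (winv b)"
  shows "a \<sim> a' \<and> (odd_gen y b \<longrightarrow> y \<in> gen ` set a \<or> (\<forall>g\<in>gen ` set a. comm y g))"
  using assms
proof (induction "length b" arbitrary: a b rule: less_induct)
  case less
  let ?s = "\<lambda>b. map th (winv b)"
  have geq: "x \<approx> y" if "x \<simeq> y" for x y using that by (rule geq_teq)
  have s_teq: "?s u \<simeq> ?s v" if "u \<simeq> v" for u v using that teq_map_th teq_winv by blast
  note a = \<open>cyc_irred a\<close> and a' = \<open>cyc_irred a'\<close>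
  have irr_a: "irred a" "irred a'" using a a' by (auto simp: cyc_irred_def)
  show ?case
  proof (cases "irred b")
    case False
    then obtain p c q where b: "b \<simeq> p @ c # iv c # q" by (auto simp: irred_def)
    have len: "length (p @ q) < length b" using teq_length[OF b] by simp
    have "b @ a @ ?s b \<simeq> (p @ c # iv c # q) @ a @ ?s (p @ c # iv c # q)"
      by (intro teq_append b s_teq) simp
    also have "\<dots> = p @ c # iv c # (q @ a @ ?s q @ [th c] @ [iv (th c)] @ ?s p)"
      by (simp add: winv_Cons th_iv)
    finally have "a' \<approx> p @ c # iv c # (q @ a @ ?s q @ [th c] @ [iv (th c)] @ ?s p)"
      using less.prems(3) geq geq_trans by blast
    also have "\<dots> \<approx> p @ q @ a @ ?s q @ [th c] @ [iv (th c)] @ ?s p"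
      by (rule geq_cancel)
    also have "\<dots> \<approx> p @ q @ a @ ?s q @ ?s p"
      using geq_cancel[of "p @ q @ a @ ?s q" "th c" "?s p"] by simp
    finally have "a' \<approx> (p @ q) @ a @ ?s (p @ q)" by simp
    from less.hyps[OF len a a' this] show ?thesis using odd_gen_teq[OF b, of y] by auto
  next
    case True
    note irr_b = this
    have irr_s: "irred (?s b)" using irr_b irred_winv irred_map_th by blast
    show ?thesis
    proof (cases "irred (b @ a @ ?s b)")
      case True
      then have eq: "a' \<simeq> b @ a @ ?s b" using geq_irred_teq less.prems(3) irr_a by blast
      show ?thesis
      proof (cases b)
        case Nil
        then show ?thesis using eq rt_teq teq_sym by auto
      next
        \<comment> \<open>Nothing cancels in the product here, so a nonempty \<open>b\<close> would
          put \<open>d\<close> first and \<open>iv (th d)\<close> last in \<open>a'\<close>.\<close>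
        case (Cons d b')
        then have "a' \<simeq> d # (b' @ a @ ?s b') @ [iv (th d)]" using eq by (simp add: winv_Cons th_iv)
        then show ?thesis using a' unfolding cyc_irred_def by blast
      qed
    next
      case False
      have s_split: "\<exists>b'. b \<simeq> b' @ [th c]" if "?s b \<simeq> iv c # x" for c x
      proof -
        have "map th (winv (?s b)) \<simeq> map th (winv (iv c # x))" using that by (rule s_teq)
        then show ?thesis by (simp add: winv_map_th winv_Cons) blast
      qed
      \<comment> \<open>The last letter of \<open>b\<close> meets the first letter of
        \<open>a\<close>, or the last letter of \<open>a\<close> meets the right factor, or the two
        outer factors cancel through an \<open>a\<close> that commutes with the letter.\<close>
      consider (1) c b' a0 where "b \<simeq> b' @ [c]" "a \<simeq> iv c # a0"
        | (2) c a0 b' where "a \<simeq> a0 @ [c]" "b \<simeq> b' @ [th c]"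
        | (3) c b' b'' where "b \<simeq> b' @ [c]" "\<forall>e\<in>set a. lcomm c e" "b \<simeq> b'' @ [th c]"
      proof (cases "irred (a @ ?s b)")
        case True
        from reducible_append[OF irr_b True False] obtain c u' v' where
          u': "b \<simeq> u' @ [c]" and v': "a @ ?s b \<simeq> iv c # v'" .
        from v' show thesis
        proof (cases rule: teq_append_Cons)
          case (1 a0)
          with u' show thesis by (rule that(1))
        next
          case (2 v'')
          then have "\<forall>e\<in>set a. lcomm c e" by simp
          moreover obtain b'' where "b \<simeq> b'' @ [th c]" using s_split 2(2) by blast
          ultimately show thesis using u' that(3) by blast
        qed
      next
        case False
        from reducible_append[OF irr_a(1) irr_s False] obtain c u' v' where
          "a \<simeq> u' @ [c]" "?s b \<simeq> iv c # v'" .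
        then show thesis using s_split that(2) by blast
      qed
      then show ?thesis
      proof cases
        case 1
        have len: "length b' < length b" using teq_length[OF 1(1)] by simp
        have "b @ a @ ?s b \<simeq> (b' @ [c]) @ (iv c # a0) @ ?s (b' @ [c])"
          by (intro teq_append 1 s_teq)
        also have "\<dots> = b' @ c # iv c # (a0 @ [th (iv c)] @ ?s b')" by (simp add: winv_Cons)
        finally have "a' \<approx> b' @ c # iv c # (a0 @ [th (iv c)] @ ?s b')"
          using less.prems(3) geq geq_trans by blast
        also have "\<dots> \<approx> b' @ a0 @ [th (iv c)] @ ?s b'" by (rule geq_cancel)
        finally have "a' \<approx> b' @ (a0 @ [th (iv c)]) @ ?s b'" by simp
        moreover have "cyc_irred (a0 @ [th (iv c)])" using cyc_irred_rotate cyc_irred_teq[OF a 1(2)] by blast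
        ultimately have IH: "a0 @ [th (iv c)] \<sim> a'" "odd_gen y b' \<longrightarrow> y \<in> gen ` set (a0 @ [th (iv c)])
            \<or> (\<forall>g\<in>gen ` set (a0 @ [th (iv c)]). comm y g)"
          using less.hyps[OF len _ a'] by blast+
        have rt: "a \<sim> a0 @ [th (iv c)]" using rt_teq[OF 1(2)] rt_rotate rt_trans by blast
        have "a \<sim> a'" using rt IH(1) by (rule rt_trans)
        moreover have "odd_gen y b \<longleftrightarrow> odd_gen y b' \<noteq> (gen c = y)" using odd_gen_teq[OF 1(1), of y] by simp
        moreover have "gen c \<in> gen ` set a" unfolding rt_gens[OF rt] by simp
        ultimately show ?thesis using IH(2) unfolding rt_gens[OF rt] by metis
      next
        case 2
        have len: "length b' < length b" using teq_length[OF 2(2)] by simp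
        have "b @ a @ ?s b \<simeq> (b' @ [th c]) @ (a0 @ [c]) @ ?s (b' @ [th c])"
          by (intro teq_append 2 s_teq)
        also have "\<dots> = (b' @ th c # a0) @ c # iv c # ?s b'" by (simp add: winv_Cons th_iv)
        finally have "a' \<approx> (b' @ th c # a0) @ c # iv c # ?s b'"
          using less.prems(3) geq geq_trans by blast
        also have "\<dots> \<approx> (b' @ th c # a0) @ ?s b'" by (rule geq_cancel)
        finally have "a' \<approx> b' @ (th c # a0) @ ?s b'" by simp
        moreover have "cyc_irred (th c # a0)" using cyc_irred_rotate_back cyc_irred_teq[OF a 2(1)] by blast
        ultimately have IH: "th c # a0 \<sim> a'" "odd_gen y b' \<longrightarrow> y \<in> gen ` set (th c # a0)
            \<or> (\<forall>g\<in>gen ` set (th c # a0). comm y g)"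
          using less.hyps[OF len _ a'] by blast+
        have "th c # a0 \<sim> a0 @ [c]" using rt_rotate[of "th c" a0] by simp
        then have rt: "a \<sim> th c # a0" using rt_teq[OF 2(1)] rt_sym rt_trans by blast
        have "a \<sim> a'" using rt IH(1) by (rule rt_trans)
        moreover have "odd_gen y b \<longleftrightarrow> odd_gen y b' \<noteq> (gen c = y)" using odd_gen_teq[OF 2(2), of y] by simp
        moreover have "gen c \<in> gen ` set a" unfolding rt_gens[OF rt] by simp
        ultimately show ?thesis using IH(2) unfolding rt_gens[OF rt] by metis
      next
        case 3
        have "rev b \<simeq> c # rev b'" "rev b \<simeq> th c # rev b''"
          using teq_rev[OF 3(1)] teq_rev[OF 3(3)] by simp_all
        then have "th c # rev b'' \<simeq> c # rev b'" using teq_sym teq_trans by blast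
        \<comment> \<open>Both \<open>c\<close> and \<open>th c\<close> are last letters of
          \<open>b\<close> over one generator, hence equal. So the outer factors lose
          \<open>c\<close> and \<open>iv c\<close> while \<open>a\<close> stays as it is.\<close>
        then have c: "th c = c" by (rule teq_Cons_gen(1)) simp
        have len: "length b' < length b" using teq_length[OF 3(1)] by simp
        have "b @ a @ ?s b \<simeq> (b' @ [c]) @ a @ ?s (b' @ [c])"
          by (intro teq_append 3 s_teq) simp
        also have "\<dots> = b' @ (c # a) @ iv c # ?s b'" by (simp add: winv_Cons th_iv c)
        also have "\<dots> \<simeq> b' @ (a @ [c]) @ iv c # ?s b'"
          by (intro teq_append teq_move 3) simp_all
        also have "\<dots> = (b' @ a) @ c # iv c # ?s b'" by simp
        finally have "a' \<approx> (b' @ a) @ c # iv c # ?s b'"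
          using less.prems(3) geq geq_trans by blast
        also have "\<dots> \<approx> (b' @ a) @ ?s b'" by (rule geq_cancel)
        finally have "a' \<approx> b' @ a @ ?s b'" by simp
        from less.hyps[OF len a a' this] show ?thesis
          using odd_gen_teq[OF 3(1), of y] 3(2) by (auto simp: lcomm_def)
      qed
    qed
  qed
qed

end

section \<open>Canonical forms of connected cyclic words\<close>

context twisted_letters
begin

text \<open>The disjunct \<open>a \<simeq> b\<close> makes this a relation on traces, so that strong
  confluence can be stated with words instead of classes.\<close>

definition nr_step :: "'g \<Rightarrow> 'l list \<Rightarrow> 'l list \<Rightarrow> bool" where
  "nr_step r a b \<longleftrightarrow> a \<simeq> b \<or> (\<exists>c z. gen c \<noteq> r \<and> a \<simeq> c # z \<and> b \<simeq> z @ [th c])"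

lemma nr_step_teq: "a \<simeq> b \<Longrightarrow> nr_step r a b"
  by (simp add: nr_step_def)

lemma nr_step_rt: "nr_step r a b \<Longrightarrow> a \<sim> b"
  unfolding nr_step_def by (meson rt_rotate rt_sym rt_teq rt_trans)

lemma nr_steps_rt: "(nr_step r)\<^sup>*\<^sup>* a b \<Longrightarrow> a \<sim> b"
  by (induction rule: rtranclp_induct) (auto intro: rt_teq rt_trans nr_step_rt)

text \<open>Different initial letters commute, so the two rotations can be carried out one after the
  other, in either order, with equivalent results.\<close>

lemma rotate_commute:
  assumes "a \<simeq> c # z" "b \<simeq> z @ [th c]" "a \<simeq> d # z'" "b' \<simeq> z' @ [th d]" "c \<noteq> d"
  obtains x where "b \<simeq> d # x @ [th c]" "b' \<simeq> c # x @ [th d]" "x @ [th c, th d] \<simeq> x @ [th d, th c]"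
proof -
  have "c # z \<simeq> d # z'" using assms teq_sym teq_trans by blast
  then obtain x where x: "lcomm c d" "z \<simeq> d # x" "z' \<simeq> c # x"
    using assms(5) by (rule teq_Cons_Cons)
  have "b \<simeq> d # x @ [th c]" using teq_trans[OF assms(2)] x(2) teq_append[OF x(2) teq_refl] by fastforce
  moreover have "b' \<simeq> c # x @ [th d]" using teq_trans[OF assms(4)] x(3) teq_append[OF x(3) teq_refl] by fastforce
  moreover have "[th c, th d] \<simeq> [th d, th c]"
    using teq_move[of "[th d]" "th c"] x(1) by simp
  ultimately show ?thesis using that by simp
qed

lemma nr_step_diamond:
  assumes "nr_step r a b" "nr_step r a b'"
  shows "\<exists>x. nr_step r b x \<and> nr_step r b' x"
proof -
  have *: "nr_step r y x" if "a \<simeq> y" "nr_step r a x" for x y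
    using that unfolding nr_step_def by (meson teq_sym teq_trans)
  consider "a \<simeq> b" | "a \<simeq> b'"
    | c z d z' where "gen c \<noteq> r" "a \<simeq> c # z" "b \<simeq> z @ [th c]" "gen d \<noteq> r" "a \<simeq> d # z'" "b' \<simeq> z' @ [th d]"
    using assms unfolding nr_step_def by blast
  then show ?thesis
  proof cases
    case 1
    then show ?thesis using * assms(2) nr_step_teq by blast
  next
    case 2
    then show ?thesis using * assms(1) nr_step_teq by blast
  next
    case 3
    show ?thesis
    proof (cases "c = d")
      case True
      then have "c # z \<simeq> c # z'" using 3 teq_sym teq_trans by blast
      then have "z @ [th c] \<simeq> z' @ [th c]" by simp
      then have "b \<simeq> b'" using 3 True teq_sym teq_trans by metis
      then show ?thesis using nr_step_teq by blast
    next
      case False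
      obtain x where x: "b \<simeq> d # x @ [th c]" "b' \<simeq> c # x @ [th d]" "x @ [th c, th d] \<simeq> x @ [th d, th c]"
        by (rule rotate_commute[OF 3(2,3,5,6) False])
      have "nr_step r b (x @ [th c, th d])"
        unfolding nr_step_def using 3(4) x(1) by (intro disjI2 exI[of _ d] exI[of _ "x @ [th c]"]) simp
      moreover have "nr_step r b' (x @ [th c, th d])"
        unfolding nr_step_def using 3(1) x(2,3) by (intro disjI2 exI[of _ c] exI[of _ "x @ [th d]"]) simp
      ultimately show ?thesis by blast
    qed
  qed
qed

lemma confluent_nr_step: "confluentp (nr_step r)"
  by (intro strong_confluentp_imp_confluentp strong_confluentpI) (use nr_step_diamond in blast)

text \<open>Viennot's pyramids: in the heap of the word only pieces over \<open>r\<close> lie at the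
  base. On such words \<open>nr_step\<close> can no longer move a letter.\<close>

definition pyramidal :: "'g \<Rightarrow> 'l list \<Rightarrow> bool" where
  "pyramidal r w \<longleftrightarrow> (\<forall>c z. w \<simeq> c # z \<longrightarrow> gen c = r)"

lemma pyramidal_teq: "pyramidal r u \<Longrightarrow> u \<simeq> v \<Longrightarrow> pyramidal r v"
  unfolding pyramidal_def using teq_trans by blast

lemma pyramidal_nr_steps:
  assumes "(nr_step r)\<^sup>*\<^sup>* a b" "pyramidal r a"
  shows "a \<simeq> b"
  using assms
proof (induction rule: rtranclp_induct)
  case (step b c)
  then have "pyramidal r b" using pyramidal_teq by blast
  then have "b \<simeq> c" using step.hyps(2) unfolding nr_step_def pyramidal_def by blast
  then show ?case using step teq_trans by blast
qed simp

text \<open>Comparing generators suffices, because by \<open>teq_Cons_gen\<close> an initial letter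
  is determined by its generator.\<close>

fun lex_normal :: "('g \<Rightarrow> nat) \<Rightarrow> 'l list \<Rightarrow> bool" where
  "lex_normal rk [] \<longleftrightarrow> True"
| "lex_normal rk (c # w) \<longleftrightarrow> (\<forall>d z. c # w \<simeq> d # z \<longrightarrow> rk (gen c) \<le> rk (gen d)) \<and> lex_normal rk w"

lemma lex_normal_hd: "lex_normal rk (c # w) \<Longrightarrow> c # w \<simeq> d # z \<Longrightarrow> rk (gen c) \<le> rk (gen d)"
  by auto

lemma lex_normal_unique:
  assumes "lex_normal rk u" "lex_normal rk v" "u \<simeq> v" "inj_on rk (gen ` set u)"
  shows "u = v"
  using assms
proof (induction u arbitrary: v)
  case (Cons c u)
  then obtain d v' where v: "v = d # v'" by (cases v) auto
  have "c # u \<simeq> d # v'" "d # v' \<simeq> c # u" using Cons.prems(3) v teq_sym by blast+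
  then have "rk (gen c) = rk (gen d)"
    using Cons.prems(1,2) v by (meson lex_normal.simps(2) order_antisym)
  moreover have "gen d \<in> gen ` set (c # u)" using teq_set[OF Cons.prems(3)] v by auto
  ultimately have "gen c = gen d" using Cons.prems(4) by (auto dest: inj_onD)
  with teq_Cons_gen Cons.prems(3) v have "c = d" "u \<simeq> v'" by metis+
  then show ?case using Cons v by (auto intro: inj_on_subset)
qed simp

text \<open>The reason for ranking \<open>r\<close> last: the only letters that could come forward
  out of a pyramidal \<open>v\<close> are over \<open>r\<close>, and these never undercut a letter
  of \<open>u\<close>.\<close>

lemma lex_normal_append:
  assumes "lex_normal rk u" "lex_normal rk v" "pyramidal r v" "\<forall>c\<in>set u. rk (gen c) \<le> rk r"
  shows "lex_normal rk (u @ v)"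
  using assms
proof (induction u)
  case (Cons c u)
  have "rk (gen c) \<le> rk (gen d)" if "(c # u) @ v \<simeq> d # z" for d z
    using that
  proof (cases rule: teq_append_Cons)
    case (1 u')
    with Cons.prems(1) show ?thesis by (rule lex_normal_hd)
  next
    case (2 v')
    then show ?thesis using Cons.prems unfolding pyramidal_def by auto
  qed
  then show ?case using Cons by simp
qed simp

lemma lex_normal_appendD:
  assumes "lex_normal rk (u @ v)"
  shows "lex_normal rk u" "lex_normal rk v"
  using assms
proof (induction u)
  case (Cons c u)
  {
    case 1
    have "rk (gen c) \<le> rk (gen d)" if "c # u \<simeq> d # z" for d z
    proof -
      have "(c # u) @ v \<simeq> (d # z) @ v" using that by (simp only: teq_append_right_iff)
      then show ?thesis using 1 by (intro lex_normal_hd[of rk c "u @ v"]) simp_all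
    qed
    then show ?case using 1 Cons by simp
  next
    case 2
    then show ?case using Cons by simp
  }
qed simp_all

lemma lex_normal_map_th:
  "lex_normal rk w \<Longrightarrow> lex_normal rk (map th w)"
proof (induction w)
  case (Cons c w)
  have "rk (gen c) \<le> rk (gen d)" if "th c # map th w \<simeq> d # z" for d z
    using teq_map_th[OF that] lex_normal_hd[OF Cons.prems, of "th d" "map th z"] by simp
  then show ?case using Cons by simp
qed simp

lemma ex_lex_normal: "\<exists>s. s \<simeq> w \<and> lex_normal rk s"
proof (induction "length w" arbitrary: w)
  case (Suc n)
  define A where "A = {c. \<exists>z. w \<simeq> c # z}"
  have "\<exists>c. c \<in> A" using Suc(2) by (cases w) (auto simp: A_def)
  then obtain c where c: "c \<in> A" "\<And>d. d \<in> A \<Longrightarrow> rk (gen c) \<le> rk (gen d)"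
    using ex_has_least_nat[of "\<lambda>c. c \<in> A" _ "rk \<circ> gen"] by auto
  then obtain z where z: "w \<simeq> c # z" by (auto simp: A_def)
  then have "n = length z" using teq_length[OF z] Suc(2) by simp
  then obtain s where s: "s \<simeq> z" "lex_normal rk s" using Suc(1) by blast
  have "c # s \<simeq> w" using s(1) z teq_sym teq_trans by (metis teq_Cons_iff)
  moreover have "rk (gen c) \<le> rk (gen d)" if "c # s \<simeq> d # z" for d z
    using c(2) teq_trans[OF teq_sym[OF \<open>c # s \<simeq> w\<close>] that] unfolding A_def by blast
  then have "lex_normal rk (c # s)" using s(2) by simp
  ultimately show ?case by blast
qed simp

definition cyc_form :: "'g \<Rightarrow> ('g \<Rightarrow> nat) \<Rightarrow> 'l list \<Rightarrow> 'l list \<Rightarrow> bool" where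
  "cyc_form r rk a s \<longleftrightarrow> lex_normal rk s \<and> pyramidal r s \<and> (nr_step r)\<^sup>*\<^sup>* a s"

lemma cyc_form_rt: "cyc_form r rk a s \<Longrightarrow> a \<sim> s"
  unfolding cyc_form_def using nr_steps_rt by blast

lemma cyc_form_unique:
  assumes "cyc_form r rk a s" "cyc_form r rk a s'" "inj_on rk (gen ` set a)"
  shows "s = s'"
proof -
  obtain x where x: "(nr_step r)\<^sup>*\<^sup>* s x" "(nr_step r)\<^sup>*\<^sup>* s' x"
    using confluentpD[OF confluent_nr_step] assms by (metis cyc_form_def)
  have "s \<simeq> s'"
    using x assms pyramidal_nr_steps teq_sym teq_trans by (metis cyc_form_def)
  moreover have "gen ` set s = gen ` set a" using assms(1) cyc_form_rt rt_gens by metis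
  ultimately show ?thesis using assms lex_normal_unique by (metis cyc_form_def)
qed

lemma cyc_form_steps:
  assumes "cyc_form r rk a s" "(nr_step r)\<^sup>*\<^sup>* a b"
  shows "cyc_form r rk b s"
proof -
  obtain x where x: "(nr_step r)\<^sup>*\<^sup>* s x" "(nr_step r)\<^sup>*\<^sup>* b x"
    using confluentpD[OF confluent_nr_step] assms by (metis cyc_form_def)
  then have "s \<simeq> x" using assms(1) pyramidal_nr_steps by (simp add: cyc_form_def)
  then have "(nr_step r)\<^sup>*\<^sup>* b s" using x(2) nr_step_teq[OF teq_sym] by (meson rtranclp.simps)
  then show ?thesis using assms(1) by (simp add: cyc_form_def)
qed

lemma nr_rotate_list:
  "\<forall>c\<in>set u. gen c \<noteq> r \<Longrightarrow> (nr_step r)\<^sup>*\<^sup>* (u @ v) (v @ map th u)"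
proof (induction u arbitrary: v)
  case (Cons c u)
  have "nr_step r (c # u @ v) (u @ v @ [th c])"
    unfolding nr_step_def using Cons.prems by (intro disjI2 exI[of _ c] exI[of _ "u @ v"]) simp
  moreover have "(nr_step r)\<^sup>*\<^sup>* (u @ v @ [th c]) (v @ th c # map th u)"
    using Cons.IH[of "v @ [th c]"] Cons.prems by simp
  ultimately show ?case by (simp add: converse_rtranclp_into_rtranclp)
qed simp

text \<open>The doubled words turn rotations twisted by \<open>\<theta>\<close> into plain rotations.\<close>

definition same_cycle :: "'l list \<Rightarrow> 'l list \<Rightarrow> bool" where
  "same_cycle s t \<longleftrightarrow> (\<exists>k. t @ map th t = rotate k (s @ map th s))"

lemma same_cycle_refl [simp]: "same_cycle s s"
  unfolding same_cycle_def by (rule exI[of _ 0]) simp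

lemma same_cycle_sym:
  assumes "same_cycle s t"
  shows "same_cycle t s"
proof -
  let ?w = "s @ map th s"
  obtain k where k: "t @ map th t = rotate k ?w" using assms by (auto simp: same_cycle_def)
  define n where "n = length ?w"
  \<comment> \<open>\<open>n * Suc k\<close> is a multiple of the length that is at least
    \<open>k\<close>, so the difference completes \<open>k\<close> to a full turn.\<close>
  have "rotate (n * Suc k - k) (rotate k ?w) = rotate (n * Suc k) ?w"
  proof (cases "n = 0")
    case False
    then have "k \<le> n * Suc k" by (cases n) auto
    then show ?thesis by (simp only: rotate_rotate le_add_diff_inverse2)
  qed (simp add: n_def)
  also have "\<dots> = ?w" by (subst rotate_conv_mod) (simp add: n_def)
  finally show ?thesis using k unfolding same_cycle_def by metis
qed

lemma same_cycle_trans: "same_cycle s t \<Longrightarrow> same_cycle t u \<Longrightarrow> same_cycle s u"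
  unfolding same_cycle_def by (metis rotate_rotate)

lemma same_cycle_rotate: "same_cycle (u @ v) (v @ map th u)"
  unfolding same_cycle_def
  by (rule exI[of _ "length u"]) (use rotate_append[of u "v @ map th (u @ v)"] in \<open>simp add: o_def\<close>)

text \<open>Split by the offset of the shift. Up to \<open>length s\<close> it gives a twisted
  rotation of \<open>s\<close>. Beyond that the second half \<open>map th s\<close> is rotated
  instead, and rotating all of \<open>s\<close> gives \<open>s \<sim> map th s\<close>.\<close>

lemma same_cycle_rt:
  assumes "same_cycle s t"
  shows "s \<sim> t"
proof (cases "s = []")
  case True
  then show ?thesis using assms rt_teq by (auto simp: same_cycle_def)
next
  case False
  obtain k where "t @ map th t = rotate k (s @ map th s)" using assms by (auto simp: same_cycle_def)
  define j where "j = k mod length (s @ map th s)"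
  have "j < length (s @ map th s)" using False by (simp add: j_def)
  have t: "t @ map th t = drop j (s @ map th s) @ take j (s @ map th s)"
    using \<open>t @ _ = _\<close> by (simp add: j_def rotate_drop_take)
  have len: "length t = length s" using arg_cong[OF t, of length] by simp
  have "t = take (length t) (t @ map th t)" by simp
  then have t': "t = take (length s) (drop j (s @ map th s) @ take j (s @ map th s))"
    by (simp only: t len)
  have full: "s \<sim> map th s" using rt_rotate_list[of s "[]"] by simp
  show ?thesis
  proof (cases "j \<le> length s")
    case True
    then have "t = take (length s) (drop j s @ map th s @ take j s)" using t' by simp
    also have "\<dots> = drop j s @ take j (map th s)" using True by simp
    finally have "t = drop j s @ map th (take j s)" by (simp add: take_map)
    then show ?thesis using rt_rotate_list[of "take j s" "drop j s"] by simp
  next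
    case False
    define i where "i = j - length s"
    have i: "j = length s + i" "i < length s" using False \<open>j < _\<close> by (simp_all add: i_def)
    then have "t = drop i (map th s) @ take i s" using t' by simp
    then have "t = drop i (map th s) @ map th (take i (map th s))" by (simp add: take_map o_def)
    moreover have "map th s \<sim> drop i (map th s) @ map th (take i (map th s))"
      using rt_rotate_list[of "take i (map th s)" "drop i (map th s)"] by (simp only: append_take_drop_id)
    ultimately show ?thesis using full rt_trans by metis
  qed
qed

text \<open>Rotating the \<open>r\<close>-letter \<open>c\<close> commutes with every
  \<open>nr_step\<close>, so it may be applied to the finished form \<open>s\<close>. There
  \<open>s = c A B\<close> with no \<open>r\<close> in \<open>A\<close> and with \<open>B\<close>
  empty or starting over \<open>r\<close>. The form of the rotated word is then
  \<open>B \<theta>(c A)\<close>, a twisted rotation of \<open>s\<close>.\<close>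

lemma cyc_form_r_rotate:
  assumes "cyc_form r rk (c # w) s" "cyc_form r rk (w @ [th c]) t" "gen c = r"
    and inj: "inj_on rk (gen ` set (c # w))" and max: "\<forall>d\<in>set (c # w). rk (gen d) \<le> rk r"
  shows "same_cycle s t"
proof -
  let ?Q = "\<lambda>a b. \<exists>z. a \<simeq> c # z \<and> b \<simeq> z @ [th c]"
  have comm: "\<exists>x. ?Q b x \<and> nr_step r b' x" if Q: "?Q a b'" and N: "nr_step r a b" for a b b'
  proof -
    obtain z where z: "a \<simeq> c # z" "b' \<simeq> z @ [th c]" using Q by blast
    from N consider "a \<simeq> b" | d z' where "gen d \<noteq> r" "a \<simeq> d # z'" "b \<simeq> z' @ [th d]"
      unfolding nr_step_def by blast
    then show ?thesis
    proof cases
      case 1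
      then show ?thesis using z nr_step_teq teq_sym teq_trans by metis
    next
      case 2
      then have "c \<noteq> d" using assms(3) by blast
      obtain x where x: "b' \<simeq> d # x @ [th c]" "b \<simeq> c # x @ [th d]" "x @ [th c, th d] \<simeq> x @ [th d, th c]"
        by (rule rotate_commute[OF z 2(2,3) \<open>c \<noteq> d\<close>])
      have "nr_step r b' (x @ [th c, th d])"
        unfolding nr_step_def using 2(1) x(1) by (intro disjI2 exI[of _ d] exI[of _ "x @ [th c]"]) simp
      moreover have "?Q b (x @ [th c, th d])" using x(2,3) by (intro exI[of _ "x @ [th d]"]) simp
      ultimately show ?thesis by blast
    qed
  qed
  have "\<exists>x. ?Q b x \<and> (nr_step r)\<^sup>*\<^sup>* (w @ [th c]) x" if "(nr_step r)\<^sup>*\<^sup>* (c # w) b" for b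
    using that
  proof (induction rule: rtranclp_induct)
    case base
    then show ?case by (intro exI[of _ "w @ [th c]"]) auto
  next
    case (step b b2)
    then obtain x where x: "?Q b x" "(nr_step r)\<^sup>*\<^sup>* (w @ [th c]) x" by blast
    from comm[OF x(1) step.hyps(2)] obtain x2 where "?Q b2 x2" "nr_step r x x2" by blast
    with x(2) show ?case by (meson rtranclp.rtrancl_into_rtrancl)
  qed
  then obtain x z where x: "s \<simeq> c # z" "x \<simeq> z @ [th c]" "(nr_step r)\<^sup>*\<^sup>* (w @ [th c]) x"
    using assms(1) unfolding cyc_form_def by blast
  have ls: "lex_normal rk s" and ps: "pyramidal r s" using assms(1) by (auto simp: cyc_form_def)
  have gs: "gen ` set s = gen ` set (c # w)" using assms(1) cyc_form_rt rt_gens by metis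
  obtain d s' where s: "s = d # s'" using x(1) by (cases s) auto
  have "gen d = r" using ps s unfolding pyramidal_def by blast
  then have d: "d = c" "s' \<simeq> z" using teq_Cons_gen x(1) s assms(3) by metis+
  define A B where "A = takeWhile (\<lambda>e. gen e \<noteq> r) s'" and "B = dropWhile (\<lambda>e. gen e \<noteq> r) s'"
  have sAB: "s = (c # A) @ B" by (simp add: A_def B_def s d)
  have Ar: "\<forall>e\<in>set A. gen e \<noteq> r" unfolding A_def by (auto dest: set_takeWhileD)
  let ?t = "B @ map th (c # A)"
  have maxs: "rk (gen e) \<le> rk r" if "e \<in> set s" for e using that gs max by (metis imageE imageI)
  have "s' = A @ B" by (simp add: A_def B_def)
  then have "z @ [th c] \<simeq> (A @ B) @ [th c]" using teq_sym[OF d(2)] by (simp only: teq_append_right_iff)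
  then have "x \<simeq> A @ B @ [th c]" using teq_trans[OF x(2)] by simp
  then have "nr_step r x (A @ B @ [th c])" by (rule nr_step_teq)
  moreover have "(nr_step r)\<^sup>*\<^sup>* (A @ B @ [th c]) ?t" using nr_rotate_list[OF Ar, of "B @ [th c]"] by simp
  ultimately have steps: "(nr_step r)\<^sup>*\<^sup>* (w @ [th c]) ?t" using x(3)
    by (meson rtranclp.rtrancl_into_rtrancl rtranclp_trans)
  have pA: "pyramidal r (map th (c # A))"
    unfolding pyramidal_def
  proof clarify
    fix e y assume "map th (c # A) \<simeq> e # y"
    from teq_map_th[OF this] have "c # A \<simeq> th e # map th y" by simp
    then have "(c # A) @ B \<simeq> (th e # map th y) @ B" by (simp only: teq_append_right_iff)
    then show "gen e = r" using ps sAB unfolding pyramidal_def by fastforce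
  qed
  have lA: "lex_normal rk (map th (c # A))" and lB: "lex_normal rk B"
    using ls lex_normal_appendD lex_normal_map_th unfolding sAB by blast+
  have "lex_normal rk ?t"
    by (rule lex_normal_append[OF lB lA pA]) (use maxs in \<open>simp add: sAB\<close>)
  moreover have "pyramidal r ?t"
    unfolding pyramidal_def
  proof clarify
    fix e y assume "?t \<simeq> e # y"
    then show "gen e = r"
    proof (cases rule: teq_append_Cons)
      \<comment> \<open>\<open>B\<close> starts with an \<open>r\<close>-letter, whose rank is the
        largest. Since \<open>B\<close> is normal, all its initial letters have that rank.\<close>
      case (1 u')
      then obtain f B' where B: "B = f # B'" by (cases B) auto
      then have "gen f = r" using hd_dropWhile[of "\<lambda>e. gen e \<noteq> r" s'] unfolding B_def by force
      moreover have "rk (gen f) \<le> rk (gen e)" using lB 1 unfolding B by (rule lex_normal_hd)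
      moreover have "e \<in> set s" using teq_set[OF 1] sAB by auto
      ultimately have "rk (gen e) = rk r" using maxs by force
      moreover have "gen e \<in> gen ` set (c # w)" using \<open>e \<in> set s\<close> gs by blast
      moreover have "r \<in> gen ` set (c # w)" using assms(3) by simp
      ultimately show ?thesis by (rule inj_onD[OF inj])
    next
      case (2 v')
      then show ?thesis using pA unfolding pyramidal_def by blast
    qed
  qed
  ultimately have "cyc_form r rk (w @ [th c]) ?t" using steps by (simp add: cyc_form_def)
  moreover have "inj_on rk (gen ` set (w @ [th c]))" using inj by simp
  ultimately have "t = ?t" using assms(2) cyc_form_unique by blast
  then show ?thesis using same_cycle_rotate[of "c # A" B] sAB by simp
qed

text \<open>Induction over the rotations: those of letters other than \<open>r\<close> keep the
  form, those of \<open>r\<close> shift it cyclically. The last hypothesis supplies a form for the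
  intermediate word of a transitivity step.\<close>

lemma rt_same_cycle:
  assumes "a \<sim> b" "cyc_form r rk a s" "cyc_form r rk b t"
    and "inj_on rk (gen ` set a)" "\<forall>g\<in>gen ` set a. rk g \<le> rk r"
    and "\<And>w. gen ` set w = gen ` set a \<Longrightarrow> \<exists>s. cyc_form r rk w s"
  shows "same_cycle s t"
proof -
  have "\<forall>s t. cyc_form r rk u s \<longrightarrow> cyc_form r rk v t \<longrightarrow> same_cycle s t"
    if "u \<sim> v" "gen ` set u = gen ` set a" for u v
    using that
  proof (induction rule: rt.induct)
    case (rt_teq u v)
    show ?case
    proof (intro allI impI)
      fix s t assume s: "cyc_form r rk u s" and t: "cyc_form r rk v t"
      have "cyc_form r rk v s" by (intro cyc_form_steps[OF s] r_into_rtranclp nr_step_teq rt_teq(1))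
      then have "s = t" by (rule cyc_form_unique[OF _ t]) (use rt_teq assms(4) teq_set in metis)
      then show "same_cycle s t" by simp
    qed
  next
    case (rt_rotate c w)
    have inj: "inj_on rk (gen ` set (c # w))" and max: "\<forall>d\<in>set (c # w). rk (gen d) \<le> rk r"
      using assms(4,5) unfolding rt_rotate[symmetric] by simp_all
    show ?case
    proof (intro allI impI)
      fix s t assume s: "cyc_form r rk (c # w) s" and t: "cyc_form r rk (w @ [th c]) t"
      show "same_cycle s t"
      proof (cases "gen c = r")
        case True
        show ?thesis by (rule cyc_form_r_rotate[OF s t True inj max])
      next
        case False
        then have "nr_step r (c # w) (w @ [th c])" unfolding nr_step_def using teq_refl by blast
        then have "cyc_form r rk (w @ [th c]) s" by (intro cyc_form_steps[OF s] r_into_rtranclp)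
        then have "s = t" by (rule cyc_form_unique[OF _ t]) (use inj in simp)
        then show ?thesis by simp
      qed
    qed
  next
    case (rt_sym u v)
    then have "gen ` set u = gen ` set a" using rt_gens[OF rt_sym(1)] by simp
    from rt_sym.IH[OF this] show ?case using same_cycle_sym by blast
  next
    case (rt_trans u v w)
    then have g: "gen ` set v = gen ` set a" using rt_gens[OF rt_trans(1)] by simp
    obtain m where "cyc_form r rk v m" using assms(6)[OF g] ..
    then show ?case
      using rt_trans.IH(1)[OF rt_trans.prems] rt_trans.IH(2)[OF g] by (blast intro: same_cycle_trans)
  qed
  then show ?thesis using assms(1-3) by blast
qed

end

section \<open>Pyramidal normalisation in boundedly many passes, and gluing of components\<close>

context twisted_letters
begin

text \<open>\<open>B\<close> holds the generators of the letters kept so far. A blocked letter lies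
  above some \<open>r\<close> in the heap and has to stay; any other letter can be moved to the
  front past all the kept ones.\<close>

definition blocked :: "'g \<Rightarrow> 'g set \<Rightarrow> 'l \<Rightarrow> bool" where
  "blocked r B c \<longleftrightarrow> gen c = r \<or> (\<exists>b\<in>B. \<not> comm b (gen c))"

fun taken :: "'g \<Rightarrow> 'g set \<Rightarrow> 'l list \<Rightarrow> 'l list" where
  "taken r B [] = []"
| "taken r B (c # w) = (if blocked r B c then c # taken r (insert (gen c) B) w else taken r B w)"

fun skipped :: "'g \<Rightarrow> 'g set \<Rightarrow> 'l list \<Rightarrow> 'l list" where
  "skipped r B [] = []"
| "skipped r B (c # w) = (if blocked r B c then skipped r (insert (gen c) B) w else c # skipped r B w)"

definition pyr_pass :: "'g \<Rightarrow> 'l list \<Rightarrow> 'l list" where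
  "pyr_pass r w = taken r {} w @ map th (skipped r {} w)"

lemma set_taken_skipped: "set w = set (taken r B w) \<union> set (skipped r B w)"
  by (induction r B w rule: taken.induct) auto

lemma skipped_append: "skipped r B (u @ v) = skipped r B u @ skipped r (B \<union> gen ` set (taken r B u)) v"
  by (induction r B u rule: skipped.induct) auto

lemma skipped_taken: "skipped r B (taken r B w) = []"
  by (induction r B w rule: taken.induct) auto

lemma taken_taken: "taken r B (taken r B w) = taken r B w"
  by (induction r B w rule: taken.induct) auto

lemma skipped_not_blocked: "d \<in> set (skipped r B w) \<Longrightarrow> \<not> blocked r B d"
  by (induction r B w rule: skipped.induct) (auto simp: blocked_def split: if_splits)

lemma teq_skipped_taken: "w \<simeq> skipped r B w @ taken r B w"
proof (induction r B w rule: taken.induct)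
  case (2 r B c w)
  show ?case
  proof (cases "blocked r B c")
    case True
    let ?B = "insert (gen c) B"
    have "\<forall>d\<in>set (skipped r ?B w). lcomm c d"
      using skipped_not_blocked by (auto simp: blocked_def lcomm_def)
    then have "skipped r ?B w @ c # taken r ?B w \<simeq> c # skipped r ?B w @ taken r ?B w"
      by (rule teq_move_in)
    moreover have "c # w \<simeq> c # skipped r ?B w @ taken r ?B w" using 2(1)[OF True] by simp
    ultimately have "c # w \<simeq> skipped r ?B w @ c # taken r ?B w" using teq_sym teq_trans by blast
    then show ?thesis using True by simp
  next
    case False
    then show ?thesis using 2(2) by simp
  qed
qed simp

lemma gens_pyr_pass [simp]: "gen ` set (pyr_pass r w) = gen ` set w"
  using set_taken_skipped[of w r "{}"] by (auto simp: pyr_pass_def image_Un image_image)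

lemma gens_pyr_passes [simp]: "gen ` set ((pyr_pass r ^^ n) w) = gen ` set w"
  by (induction n) simp_all

lemma pyr_pass_steps: "(nr_step r)\<^sup>*\<^sup>* w (pyr_pass r w)"
proof -
  have "nr_step r w (skipped r {} w @ taken r {} w)" using teq_skipped_taken by (rule nr_step_teq)
  moreover have "\<forall>c\<in>set (skipped r {} w). gen c \<noteq> r" using skipped_not_blocked by (auto simp: blocked_def)
  then have "(nr_step r)\<^sup>*\<^sup>* (skipped r {} w @ taken r {} w) (pyr_pass r w)"
    unfolding pyr_pass_def by (rule nr_rotate_list)
  ultimately show ?thesis by (rule converse_rtranclp_into_rtranclp)
qed

lemma pyr_passes_steps: "(nr_step r)\<^sup>*\<^sup>* w ((pyr_pass r ^^ n) w)"
  by (induction n) (auto intro: rtranclp_trans pyr_pass_steps)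

text \<open>Scanning \<open>taken r {} w\<close> again skips nothing, but an initial letter other
  than \<open>r\<close> would be skipped.\<close>

lemma pyramidal_taken: "pyramidal r (taken r {} w)"
  unfolding pyramidal_def
proof (intro allI impI, rule ccontr)
  fix c z assume "taken r {} w \<simeq> c # z" and c: "gen c \<noteq> r"
  from teq_Cons_split[OF teq_sym[OF this(1)]] obtain p q where
    pq: "taken r {} w = p @ c # q" "\<forall>d\<in>set p. lcomm c d" "z \<simeq> p @ q" .
  have "c \<in> set (skipped r B (p @ c # q))" if "\<forall>b\<in>B. comm b (gen c)" for B
    using pq(2) that
  proof (induction p arbitrary: B)
    case Nil
    then show ?case using c by (auto simp: blocked_def)
  next
    case (Cons d p)
    then have "comm (gen d) (gen c)" by (simp add: lcomm_def comm_sym)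
    then show ?case using Cons by simp
  qed
  from this[of "{}"] show False using skipped_taken[of r "{}" w] pq(1) by simp
qed

text \<open>After \<open>k\<close> passes every letter at distance at most \<open>k\<close> from \<open>r\<close> in the non-commutation graph is preceded
  by an \<open>r\<close> that it cannot pass, so the number of passes depends on the alphabet only.\<close>

definition component :: "'g set \<Rightarrow> 'g \<Rightarrow> 'g set" where
  "component S r = {g. (\<lambda>g h. g \<in> S \<and> h \<in> S \<and> \<not> comm g h)\<^sup>*\<^sup>* r g}"

primrec near :: "'g set \<Rightarrow> 'g \<Rightarrow> nat \<Rightarrow> 'g set" where
  "near S r 0 = {r}"
| "near S r (Suc k) = near S r k \<union> {g \<in> S. \<exists>h\<in>near S r k. \<not> comm h g}"

lemma near_subset: "r \<in> S \<Longrightarrow> near S r k \<subseteq> S"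
  by (induction k) auto

lemma near_mono: "k \<le> m \<Longrightarrow> near S r k \<subseteq> near S r m"
  by (induction m) (auto simp: le_Suc_eq)

lemma component_self: "r \<in> component S r"
  by (simp add: component_def)

lemma component_closed: "g \<in> component S r \<Longrightarrow> g \<in> S \<Longrightarrow> h \<in> S \<Longrightarrow> \<not> comm g h \<Longrightarrow> h \<in> component S r"
  unfolding component_def by (auto intro: rtranclp.rtrancl_into_rtrancl)

lemma component_subset: "r \<in> S \<Longrightarrow> component S r \<subseteq> S"
  unfolding component_def by (auto elim: rtranclp.cases)

lemma component_eq:
  assumes "g \<in> component S r" "g \<in> component S q"
  shows "component S r = component S q"
proof -
  let ?R = "\<lambda>g h. g \<in> S \<and> h \<in> S \<and> \<not> comm g h"
  have "symp ?R" using comm_sym by (auto intro: sympI)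
  then have "symp ?R\<^sup>*\<^sup>*" by (rule symp_rtranclp)
  then have "?R\<^sup>*\<^sup>* r q" "?R\<^sup>*\<^sup>* q r"
    using assms unfolding component_def by (auto dest: sympD intro: rtranclp_trans)
  then show ?thesis unfolding component_def by (auto intro: rtranclp_trans)
qed

lemma component_component: "component (component S r) r = component S r" if "r \<in> S"
proof
  show "component (component S r) r \<subseteq> component S r"
    using component_subset[of r "component S r"] component_self by blast
  have "g \<in> component (component S r) r" if "(\<lambda>g h. g \<in> S \<and> h \<in> S \<and> \<not> comm g h)\<^sup>*\<^sup>* r g" for g
    using that
  proof (induction rule: rtranclp_induct)
    case (step g h)
    then have "g \<in> component S r" by (simp add: component_def)
    with step show ?case using component_closed by blast
  qed (rule component_self)
  then show "component S r \<subseteq> component (component S r) r" unfolding component_def[of S] by blast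
qed

lemma component_near:
  assumes "finite S" "r \<in> S"
  shows "\<exists>k. component S r \<subseteq> near S r k"
proof -
  have "\<exists>k. g \<in> near S r k" if "g \<in> component S r" for g
    using that unfolding component_def mem_Collect_eq
  proof (induction rule: rtranclp_induct)
    case base
    show ?case by (intro exI[of _ 0]) simp
  next
    case (step g h)
    then obtain k where "g \<in> near S r k" by blast
    then show ?case using step.hyps by (intro exI[of _ "Suc k"]) auto
  qed
  then obtain f where f: "\<And>g. g \<in> component S r \<Longrightarrow> g \<in> near S r (f g)" by metis
  have fin: "finite (component S r)" using component_subset[OF assms(2)] assms(1) finite_subset by blast
  have "g \<in> near S r (Max (f ` component S r))" if "g \<in> component S r" for g
  proof -
    have "f g \<le> Max (f ` component S r)" using fin that by simp
    then show ?thesis using near_mono f[OF that] by blast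
  qed
  then show ?thesis by blast
qed

text \<open>A maximum over the finitely many supports \<open>S\<close> and roots \<open>r\<close>:
  the number of passes has to be a constant written into the program, independent of the
  input.\<close>

lemma component_near_uniform:
  assumes "finite V"
  shows "\<exists>k. \<forall>S\<subseteq>V. \<forall>r\<in>S. component S r \<subseteq> near S r k"
proof -
  have "\<exists>k. component S r \<subseteq> near S r k" if "S \<subseteq> V" "r \<in> S" for S r
    using component_near that assms finite_subset by metis
  then obtain f where f: "\<And>S r. S \<subseteq> V \<Longrightarrow> r \<in> S \<Longrightarrow> component S r \<subseteq> near S r (f S r)" by metis
  let ?F = "(\<lambda>(S, r). f S r) ` (Pow V \<times> V)"
  have "f S r \<le> Max ?F" if "S \<subseteq> V" "r \<in> S" for S r
  proof (rule Max_ge)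
    show "finite ?F" using assms by simp
    show "f S r \<in> ?F" using that by (intro image_eqI[of _ _ "(S, r)"]) auto
  qed
  then have "component S r \<subseteq> near S r (Max ?F)" if "S \<subseteq> V" "r \<in> S" for S r
    using f[OF that] near_mono[of "f S r" "Max ?F" S r] that by blast
  then show ?thesis by blast
qed

lemma gens_taken_component:
  assumes "gen ` set w \<subseteq> S" "r \<in> S" "B \<subseteq> component S r"
  shows "gen ` set (taken r B w) \<subseteq> component S r"
  using assms
proof (induction r B w rule: taken.induct)
  case (2 r B c w)
  have "gen c \<in> component S r" if "blocked r B c"
    using that 2(3-5) component_closed component_self component_subset unfolding blocked_def
    by (metis image_subset_iff list.set_intros(1) subset_iff)
  then show ?case using 2 by auto
qed simp

text \<open>A pass puts the taken letters in front. By hypothesis every letter within distance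
  \<open>k\<close> is among them, so in the next pass each letter at distance \<open>k + 1\<close>
  is blocked by one of its neighbours.\<close>

lemma skipped_pyr_pass_near:
  assumes "\<forall>d\<in>set (skipped r {} w). gen d \<notin> near (gen ` set w) r k" "r \<in> gen ` set w"
    and "d \<in> set (skipped r {} (pyr_pass r w))"
  shows "gen d \<notin> near (gen ` set w) r (Suc k)"
proof
  let ?S = "gen ` set w"
  assume n: "gen d \<in> near ?S r (Suc k)"
  let ?U = "taken r {} w" and ?D = "skipped r {} w"
  have d: "d \<in> set (skipped r (gen ` set ?U) (map th ?D))"
    using assms(3) by (simp add: pyr_pass_def skipped_append skipped_taken taken_taken)
  then have nb: "\<not> blocked r (gen ` set ?U) d" by (rule skipped_not_blocked)
  have "d \<in> set (map th ?D)" using d set_taken_skipped by blast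
  then have "gen d \<in> gen ` set ?D" by (auto simp: image_image)
  then have "gen d \<notin> near ?S r k" using assms(1) by auto
  with n obtain h where h: "h \<in> near ?S r k" "\<not> comm h (gen d)" by auto
  then have "h \<in> ?S" using near_subset[OF assms(2)] by blast
  then have "h \<in> gen ` set ?U" using h(1) assms(1) set_taken_skipped[of w r "{}"] by auto
  with nb h(2) show False by (auto simp: blocked_def)
qed

lemma skipped_pyr_passes:
  assumes "r \<in> gen ` set w" "d \<in> set (skipped r {} ((pyr_pass r ^^ k) w))"
  shows "gen d \<notin> near (gen ` set w) r k"
  using assms(2)
proof (induction k arbitrary: d)
  case 0
  then show ?case using skipped_not_blocked by (fastforce simp: blocked_def)
next
  case (Suc k)
  have "\<forall>d\<in>set (skipped r {} ((pyr_pass r ^^ k) w)). gen d \<notin> near (gen ` set w) r k"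
    using Suc.IH by blast
  moreover have "d \<in> set (skipped r {} (pyr_pass r ((pyr_pass r ^^ k) w)))" using Suc.prems by simp
  ultimately show ?case
    using skipped_pyr_pass_near[of r "(pyr_pass r ^^ k) w" k d] assms(1)
    unfolding gens_pyr_passes by blast
qed

lemma taken_eq_filter:
  assumes "\<forall>c\<in>set (taken r B w). gen c \<in> C" "\<forall>c\<in>set (skipped r B w). gen c \<notin> C"
  shows "taken r B w = filter (\<lambda>c. gen c \<in> C) w"
  using assms
proof (induction r B w rule: taken.induct)
  case (2 r B c w)
  show ?case
  proof (cases "blocked r B c")
    case True
    have "taken r (insert (gen c) B) w = filter (\<lambda>c. gen c \<in> C) w"
      by (rule 2(1)[OF True]) (use 2(3,4) True in simp_all)
    moreover have "gen c \<in> C" using 2(3) True by simp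
    ultimately show ?thesis using True by simp
  next
    case False
    have "taken r B w = filter (\<lambda>c. gen c \<in> C) w"
      by (rule 2(2)[OF False]) (use 2(3,4) False in simp_all)
    moreover have "gen c \<notin> C" using 2(4) False by simp
    ultimately show ?thesis using False by simp
  qed
qed simp

lemma nr_step_filter:
  assumes "nr_step r a b"
  shows "nr_step r (filter (\<lambda>c. gen c \<in> C) a) (filter (\<lambda>c. gen c \<in> C) b)"
proof -
  let ?f = "filter (\<lambda>c. gen c \<in> C)"
  from assms consider "a \<simeq> b" | c z where "gen c \<noteq> r" "a \<simeq> c # z" "b \<simeq> z @ [th c]"
    unfolding nr_step_def by blast
  then show ?thesis
  proof cases
    case 1
    then show ?thesis by (intro nr_step_teq teq_filter)
  next
    case 2
    from teq_filter[OF 2(2), of C] teq_filter[OF 2(3), of C]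
    have f: "?f a \<simeq> ?f (c # z)" "?f b \<simeq> ?f (z @ [th c])" .
    show ?thesis
    proof (cases "gen c \<in> C")
      case True
      then show ?thesis unfolding nr_step_def using f 2(1)
        by (intro disjI2 exI[of _ c] exI[of _ "?f z"]) simp
    next
      case False
      then have "?f a \<simeq> ?f z" "?f b \<simeq> ?f z" using f by simp_all
      then have "?f a \<simeq> ?f b" using teq_sym teq_trans by blast
      then show ?thesis by (rule nr_step_teq)
    qed
  qed
qed

lemma nr_steps_filter:
  assumes "(nr_step r)\<^sup>*\<^sup>* a b"
  shows "(nr_step r)\<^sup>*\<^sup>* (filter (\<lambda>c. gen c \<in> C) a) (filter (\<lambda>c. gen c \<in> C) b)"
  using assms by (induction rule: rtranclp_induct) (auto intro: rtranclp.rtrancl_into_rtrancl nr_step_filter)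

lemma rt_filter:
  assumes "a \<sim> b"
  shows "filter (\<lambda>c. gen c \<in> C) a \<sim> filter (\<lambda>c. gen c \<in> C) b"
  using assms
proof (induction rule: rt.induct)
  case (rt_teq u v)
  then show ?case by (intro rt.rt_teq teq_filter)
next
  case (rt_rotate c w)
  then show ?case using rt.rt_rotate[of c "filter (\<lambda>c. gen c \<in> C) w"] by (simp add: rt.rt_teq)
next
  case (rt_sym u v)
  then show ?case by (blast intro: rt.rt_sym)
next
  case (rt_trans u v w)
  then show ?case by (blast intro: rt.rt_trans)
qed

definition canon :: "nat \<Rightarrow> 'g \<Rightarrow> ('g \<Rightarrow> nat) \<Rightarrow> 'l list \<Rightarrow> 'l list \<Rightarrow> bool" where
  "canon n r rk w s \<longleftrightarrow> lex_normal rk s \<and> s \<simeq> taken r {} ((pyr_pass r ^^ n) w)"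

lemma ex_canon: "\<exists>s. canon n r rk w s"
  unfolding canon_def using ex_lex_normal by blast

lemma canon_gens: "canon n r rk w z \<Longrightarrow> gen ` set z \<subseteq> gen ` set w"
proof -
  let ?w = "(pyr_pass r ^^ n) w"
  assume "canon n r rk w z"
  then have "set z = set (taken r {} ?w)" using teq_set by (auto simp: canon_def)
  then have "gen ` set z \<subseteq> gen ` set ?w" using set_taken_skipped[of ?w r "{}"] by auto
  then show ?thesis by simp
qed

text \<open>The passes run on the whole word, other components included. After enough of them the
  taken letters are exactly those of the component of \<open>r\<close>. Since \<open>nr_step\<close>
  survives restriction to a set of generators, the passes restrict to a normalisation of the
  component.\<close>

lemma canon_cyc_form:
  assumes "canon n r rk w s" "r \<in> gen ` set w"
    and "component (gen ` set w) r \<subseteq> near (gen ` set w) r n"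
  shows "cyc_form r rk (filter (\<lambda>c. gen c \<in> component (gen ` set w) r) w) s"
proof -
  let ?S = "gen ` set w" and ?w = "(pyr_pass r ^^ n) w"
  let ?C = "component ?S r"
  have "taken r {} ?w = filter (\<lambda>c. gen c \<in> ?C) ?w"
  proof (rule taken_eq_filter)
    show "\<forall>c\<in>set (taken r {} ?w). gen c \<in> ?C"
      using gens_taken_component[of ?w ?S r "{}"] assms(2) by auto
    show "\<forall>c\<in>set (skipped r {} ?w). gen c \<notin> ?C"
      using skipped_pyr_passes[OF assms(2)] assms(3) by blast
  qed
  then have "(nr_step r)\<^sup>*\<^sup>* (filter (\<lambda>c. gen c \<in> ?C) w) (taken r {} ?w)"
    using nr_steps_filter[OF pyr_passes_steps] by simp
  moreover have t: "taken r {} ?w \<simeq> s" using assms(1) teq_sym by (simp add: canon_def)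
  ultimately have "(nr_step r)\<^sup>*\<^sup>* (filter (\<lambda>c. gen c \<in> ?C) w) s"
    using nr_step_teq by (meson rtranclp.rtrancl_into_rtrancl)
  moreover have "pyramidal r s" using t pyramidal_taken pyramidal_teq by blast
  ultimately show ?thesis using assms(1) by (simp add: cyc_form_def canon_def)
qed

lemma canon_Nil_iff:
  assumes "canon n r rk w s"
  shows "s = [] \<longleftrightarrow> r \<notin> gen ` set w"
proof -
  let ?w = "(pyr_pass r ^^ n) w"
  have "taken r {} v = []" if "r \<notin> gen ` set v" for v
    using that by (induction v) (auto simp: blocked_def)
  moreover have "taken r B v \<noteq> []" if "r \<in> gen ` set v" for v B
    using that by (induction v arbitrary: B) (auto simp: blocked_def)
  moreover have "s = [] \<longleftrightarrow> taken r {} ?w = []" using assms by (auto simp: canon_def)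
  ultimately show ?thesis using gens_pyr_passes by metis
qed

lemma gens_filter_component: "r \<in> gen ` set w \<Longrightarrow>
    gen ` set (filter (\<lambda>c. gen c \<in> component (gen ` set w) r) w) = component (gen ` set w) r"
  using component_subset[of r "gen ` set w"] by force

theorem rt_canon_same_cycle:
  assumes "a \<sim> b" "canon n r rk a s" "canon n r rk b t"
    and V: "gen ` set a \<subseteq> V" "inj_on rk V" "\<forall>g\<in>V. rk g \<le> rk r"
    and near: "\<forall>S\<subseteq>V. \<forall>r\<in>S. component S r \<subseteq> near S r n"
  shows "same_cycle s t"
proof (cases "r \<in> gen ` set a")
  case False
  then have "s = []" "t = []" using canon_Nil_iff assms(1-3) rt_gens by metis+
  then show ?thesis by simp
next
  case True
  let ?S = "gen ` set a"
  have S: "gen ` set b = ?S" using assms(1) rt_gens by metis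
  let ?C = "component ?S r"
  let ?f = "filter (\<lambda>c. gen c \<in> ?C)"
  have C: "gen ` set (?f a) = ?C" by (rule gens_filter_component[OF True])
  have CV: "?C \<subseteq> V" using component_subset[OF True] V by blast
  show ?thesis
  proof (rule rt_same_cycle)
    show "?f a \<sim> ?f b" using assms(1) by (rule rt_filter)
    show "cyc_form r rk (?f a) s" using canon_cyc_form assms(2) True near V by blast
    show "cyc_form r rk (?f b) t" using canon_cyc_form[of n r rk b t] assms(3) True near V S by simp
    show "inj_on rk (gen ` set (?f a))" unfolding C using V(2) CV by (rule inj_on_subset)
    show "\<forall>g\<in>gen ` set (?f a). rk g \<le> rk r" unfolding C using V(3) CV by blast
    \<comment> \<open>A word whose support is the whole component is its own restriction, so
      \<open>canon\<close> provides the form demanded for intermediate words.\<close>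
    fix w assume "gen ` set w = gen ` set (?f a)"
    then have w: "gen ` set w = ?C" by (simp only: C)
    then have r: "r \<in> gen ` set w" using component_self by metis
    obtain u where u: "canon n r rk w u" using ex_canon by blast
    have cc: "component (gen ` set w) r = ?C" using w component_component[OF True] by simp
    then have "filter (\<lambda>c. gen c \<in> component (gen ` set w) r) w = w"
      using w by (auto simp: filter_id_conv)
    then show "\<exists>s. cyc_form r rk w s"
      using canon_cyc_form[OF u r] near CV w r by metis
  qed
qed

lemma rt_append_commuting:
  assumes "u \<sim> u'" "\<forall>g\<in>gen ` set u. \<forall>d\<in>set v. comm g (gen d)"
  shows "u @ v \<sim> u' @ v"
  using assms
proof (induction rule: rt.induct)
  case (rt_teq u u')
  then show ?case by (intro rt.rt_teq teq_append) simp_all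
next
  case (rt_rotate c w)
  have "c # w @ v \<sim> w @ v @ [th c]" using rt.rt_rotate[of c "w @ v"] by simp
  moreover have "th c # v \<simeq> v @ [th c]" by (rule teq_move) (use rt_rotate in \<open>simp add: lcomm_def\<close>)
  then have "w @ v @ [th c] \<simeq> w @ th c # v" using teq_sym by simp
  then have "w @ v @ [th c] \<sim> w @ th c # v" by (rule rt.rt_teq)
  ultimately have "c # w @ v \<sim> w @ th c # v" by (rule rt.rt_trans)
  then show ?case by simp
next
  case (rt_sym u u')
  then have "u @ v \<sim> u' @ v" using rt_gens[OF rt_sym(1)] by simp
  then show ?case by (rule rt.rt_sym)
next
  case (rt_trans u u' w)
  have "u' @ v \<sim> w @ v" using rt_trans rt_gens[OF rt_trans(1)] by simp
  with rt_trans show ?case by (blast intro: rt.rt_trans)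
qed

lemma rt_filter_Un:
  assumes "filter (\<lambda>c. gen c \<in> G) a \<sim> filter (\<lambda>c. gen c \<in> G) b"
    and "filter (\<lambda>c. gen c \<in> H) a \<sim> filter (\<lambda>c. gen c \<in> H) b"
    and comm: "\<And>g h. g \<in> G \<Longrightarrow> h \<in> H \<Longrightarrow> comm g h"
  shows "filter (\<lambda>c. gen c \<in> G \<union> H) a \<sim> filter (\<lambda>c. gen c \<in> G \<union> H) b"
proof -
  have split: "filter (\<lambda>c. gen c \<in> G \<union> H) w \<simeq> filter (\<lambda>c. gen c \<in> G) w @ filter (\<lambda>c. gen c \<in> H) w" for w
  proof (induction w)
    case (Cons c w)
    have GH: "G \<inter> H = {}" using comm comm_irrefl by blast
    show ?case
    proof (cases "gen c \<in> H")
      case True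
      have "filter (\<lambda>c. gen c \<in> G) w @ c # filter (\<lambda>c. gen c \<in> H) w
          \<simeq> c # filter (\<lambda>c. gen c \<in> G) w @ filter (\<lambda>c. gen c \<in> H) w"
        by (rule teq_move_in) (use True comm comm_sym in \<open>auto simp: lcomm_def\<close>)
      moreover have "c # filter (\<lambda>c. gen c \<in> G \<union> H) w
          \<simeq> c # filter (\<lambda>c. gen c \<in> G) w @ filter (\<lambda>c. gen c \<in> H) w" using Cons by simp
      ultimately have "c # filter (\<lambda>c. gen c \<in> G \<union> H) w
          \<simeq> filter (\<lambda>c. gen c \<in> G) w @ c # filter (\<lambda>c. gen c \<in> H) w"
        using teq_sym teq_trans by blast
      moreover have "gen c \<notin> G" using True GH by blast
      ultimately show ?thesis using True by simp
    next
      case False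
      then show ?thesis using Cons by simp
    qed
  qed simp
  let ?g = "filter (\<lambda>c. gen c \<in> G)" and ?h = "filter (\<lambda>c. gen c \<in> H)"
  have "filter (\<lambda>c. gen c \<in> G \<union> H) a \<sim> ?g a @ ?h a" by (intro rt_teq split)
  also have "?g a @ ?h a \<sim> ?g b @ ?h a" by (rule rt_append_commuting[OF assms(1)]) (use comm in auto)
  \<comment> \<open>\<open>rt_append_commuting\<close> rotates the left factor only, so the two
    commuting factors trade places before the second is rotated.\<close>
  also have "?g b @ ?h a \<sim> ?h a @ ?g b"
    by (intro rt_teq teq_swap_lists) (use comm in \<open>auto simp: lcomm_def\<close>)
  also have "?h a @ ?g b \<sim> ?h b @ ?g b"
    by (rule rt_append_commuting[OF assms(2)]) (use comm comm_sym in auto)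
  also have "?h b @ ?g b \<sim> ?g b @ ?h b"
    by (intro rt_teq teq_swap_lists) (use comm comm_sym in \<open>auto simp: lcomm_def\<close>)
  also have "?g b @ ?h b \<sim> filter (\<lambda>c. gen c \<in> G \<union> H) b" by (intro rt_teq teq_sym[OF split])
  finally show ?thesis .
qed

text \<open>An empty form means that \<open>r\<close> does not occur, so the supports agree. For
  every \<open>r\<close> in the support the forms relate the restrictions to the component of
  \<open>r\<close>. Distinct components commute elementwise, so these restrictions are glued one at
  a time.\<close>

theorem canon_same_cycle_rt:
  assumes canon: "\<And>r. r \<in> V \<Longrightarrow> \<exists>rk s t. canon n r rk a s \<and> canon n r rk b t \<and> same_cycle s t"
    and V: "gen ` set a \<subseteq> V" "gen ` set b \<subseteq> V"
    and near: "\<forall>S\<subseteq>V. \<forall>r\<in>S. component S r \<subseteq> near S r n"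
  shows "a \<sim> b"
proof -
  let ?S = "gen ` set a"
  have "r \<in> gen ` set a \<longleftrightarrow> r \<in> gen ` set b" if "r \<in> V" for r
  proof -
    obtain rk s t where "canon n r rk a s" "canon n r rk b t" "same_cycle s t" using canon \<open>r \<in> V\<close> by blast
    moreover from this have "s = [] \<longleftrightarrow> t = []" using same_cycle_rt rt_length by fastforce
    ultimately show ?thesis using canon_Nil_iff by blast
  qed
  then have S: "gen ` set b = ?S" using V by blast
  let ?f = "\<lambda>R. filter (\<lambda>c. gen c \<in> (\<Union>r\<in>R. component ?S r))"
  have single: "?f {r} a \<sim> ?f {r} b" if "r \<in> ?S" for r
  proof -
    obtain rk s t where "canon n r rk a s" "canon n r rk b t" "same_cycle s t" using canon V \<open>r \<in> ?S\<close> by blast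
    moreover have "component ?S r \<subseteq> near ?S r n" using near V that by blast
    ultimately have "?f {r} a \<sim> s" "?f {r} b \<sim> t"
      using cyc_form_rt[OF canon_cyc_form[of n r rk a s]] cyc_form_rt[OF canon_cyc_form[of n r rk b t]]
        that S by simp_all
    then show ?thesis using same_cycle_rt[OF \<open>same_cycle s t\<close>] rt_sym rt_trans by blast
  qed
  have "?f R a \<sim> ?f R b" if "finite R" "R \<subseteq> ?S" for R
    using that
  proof (induction R rule: finite_induct)
    case empty
    then show ?case by (simp add: rt_teq)
  next
    case (insert r R)
    show ?case
    proof (cases "\<exists>q\<in>R. component ?S r = component ?S q")
      case True
      then have "(\<Union>r\<in>insert r R. component ?S r) = (\<Union>r\<in>R. component ?S r)" by blast
      then show ?thesis using insert by simp
    next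
      case False
      have "filter (\<lambda>c. gen c \<in> component ?S r \<union> (\<Union>r\<in>R. component ?S r)) a
          \<sim> filter (\<lambda>c. gen c \<in> component ?S r \<union> (\<Union>r\<in>R. component ?S r)) b"
      proof (rule rt_filter_Un)
        show "filter (\<lambda>c. gen c \<in> component ?S r) a \<sim> filter (\<lambda>c. gen c \<in> component ?S r) b"
          using single[of r] insert by simp
        show "?f R a \<sim> ?f R b" using insert by simp
        fix g h assume gh: "g \<in> component ?S r" "h \<in> (\<Union>r\<in>R. component ?S r)"
        then obtain q where q: "q \<in> R" "h \<in> component ?S q" by blast
        show "comm g h"
        proof (rule ccontr)
          assume "\<not> comm g h"
          moreover have "g \<in> ?S" "h \<in> ?S"
            using gh(1) q component_subset[of _ ?S] insert.prems by blast+
          ultimately have "h \<in> component ?S r" using component_closed gh(1) by blast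
          then show False using component_eq q False by blast
        qed
      qed
      then show ?thesis by simp
    qed
  qed
  from this[of ?S] have "?f ?S a \<sim> ?f ?S b" by simp
  moreover have "?f ?S w = w" if "gen ` set w = ?S" for w
  proof -
    have "gen c \<in> (\<Union>r\<in>?S. component ?S r)" if "c \<in> set w" for c
    proof
      show "gen c \<in> component ?S (gen c)" by (rule component_self)
      show "gen c \<in> ?S" unfolding \<open>gen ` set w = ?S\<close>[symmetric] using that by (rule imageI)
    qed
    then show ?thesis unfolding filter_id_conv by (intro ballI)
  qed
  ultimately show ?thesis using S by simp
qed

end

section \<open>Deque machines\<close>

definition push :: "'i \<Rightarrow> 'b \<Rightarrow> ('i \<Rightarrow> 'b list) \<Rightarrow> 'i \<Rightarrow> 'b list" where
  "push i c s = s(i := s i @ [c])"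

definition pop_top :: "'i \<Rightarrow> ('i \<Rightarrow> 'b list) \<Rightarrow> 'i \<Rightarrow> 'b list" where
  "pop_top i s = s(i := butlast (s i))"

definition pop_bot :: "'i \<Rightarrow> ('i \<Rightarrow> 'b list) \<Rightarrow> 'i \<Rightarrow> 'b list" where
  "pop_bot i s = s(i := tl (s i))"

definition case_top :: "'i \<Rightarrow> ('b option \<Rightarrow> ('i \<Rightarrow> 'b list) \<Rightarrow> 'i \<Rightarrow> 'b list) \<Rightarrow> ('i \<Rightarrow> 'b list) \<Rightarrow> 'i \<Rightarrow> 'b list" where
  "case_top i F s = F (if s i = [] then None else Some (last (s i))) s"

definition case_bot :: "'i \<Rightarrow> ('b option \<Rightarrow> ('i \<Rightarrow> 'b list) \<Rightarrow> 'i \<Rightarrow> 'b list) \<Rightarrow> ('i \<Rightarrow> 'b list) \<Rightarrow> 'i \<Rightarrow> 'b list" where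
  "case_bot i F s = F (if s i = [] then None else Some (hd (s i))) s"

text \<open>Recursion on a list keeps this total. The list agrees with the contents of deque
  \<open>i\<close> as long as \<open>F\<close> leaves that deque alone, which is demanded when the
  loop is compiled.\<close>

primrec drain :: "'i \<Rightarrow> ('b \<Rightarrow> ('i \<Rightarrow> 'b list) \<Rightarrow> 'i \<Rightarrow> 'b list) \<Rightarrow> 'b list \<Rightarrow> ('i \<Rightarrow> 'b list) \<Rightarrow> 'i \<Rightarrow> 'b list" where
  "drain i F [] s = s"
| "drain i F (c # cs) s = drain i F cs (F c (s(i := cs)))"

definition for_each :: "'i \<Rightarrow> ('b \<Rightarrow> ('i \<Rightarrow> 'b list) \<Rightarrow> 'i \<Rightarrow> 'b list) \<Rightarrow> ('i \<Rightarrow> 'b list) \<Rightarrow> 'i \<Rightarrow> 'b list" where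
  "for_each i F s = drain i F (s i) s"

definition code_at :: "program \<Rightarrow> nat \<Rightarrow> instr list \<Rightarrow> bool" where
  "code_at P a is \<longleftrightarrow> (\<forall>j<length is. a + j < length P \<and> P ! (a + j) = is ! j)"

lemma in_set_tlD: "x \<in> set (tl xs) \<Longrightarrow> x \<in> set xs"
  by (cases xs) auto

lemma code_at_Nil [simp]: "code_at P a []"
  by (simp add: code_at_def)

lemma code_at_Cons [simp]: "code_at P a (x # is) \<longleftrightarrow> a < length P \<and> P ! a = x \<and> code_at P (Suc a) is"
  by (auto simp: code_at_def less_Suc_eq_0_disj All_less_Suc2)

lemma code_at_append [simp]: "code_at P a (is @ js) \<longleftrightarrow> code_at P a is \<and> code_at P (a + length is) js"
  by (induction "is" arbitrary: a) auto

lemma code_at_self: "code_at (is @ js) 0 is"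
  by (simp add: code_at_def nth_append)

lemma step_Incrs:
  assumes "code_at P (pc c) (replicate m (Incr r))"
  shows "(step P ^^ m) c = c\<lparr>pc := pc c + m, reg := (reg c)(r := reg c r + m)\<rparr>"
  using assms
proof (induction m arbitrary: c)
  case (Suc m)
  define d where "d = c\<lparr>pc := Suc (pc c), reg := (reg c)(r := reg c r + 1)\<rparr>"
  have "step P c = d" using Suc.prems by (simp add: step_def d_def)
  then have "(step P ^^ Suc m) c = (step P ^^ m) d" by (simp only: funpow_Suc_right o_apply)
  also have "\<dots> = d\<lparr>pc := pc d + m, reg := (reg d)(r := reg d r + m)\<rparr>"
    by (rule Suc.IH) (use Suc.prems in \<open>simp add: d_def\<close>)
  finally show ?case by (simp add: d_def fun_upd_def cong: if_cong)
qed simp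

lemma step_Decrs:
  assumes "code_at P (pc c) (replicate m (Decr r))"
  shows "(step P ^^ m) c = c\<lparr>pc := pc c + m, reg := (reg c)(r := reg c r - m)\<rparr>"
  using assms
proof (induction m arbitrary: c)
  case (Suc m)
  define d where "d = c\<lparr>pc := Suc (pc c), reg := (reg c)(r := reg c r - 1)\<rparr>"
  have "step P c = d" using Suc.prems by (simp add: step_def d_def)
  then have "(step P ^^ Suc m) c = (step P ^^ m) d" by (simp only: funpow_Suc_right o_apply)
  also have "\<dots> = d\<lparr>pc := pc d + m, reg := (reg d)(r := reg d r - m)\<rparr>"
    by (rule Suc.IH) (use Suc.prems in \<open>simp add: d_def\<close>)
  finally show ?case by (simp add: d_def fun_upd_def cong: if_cong)
qed simp

locale deque_machine =
  fixes I :: "'i set" and A :: "'b set" and num :: "'i \<Rightarrow> nat" and enc :: "'b \<Rightarrow> nat" and k :: nat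
  assumes finite_I: "finite I" and finite_A: "finite A"
    and inj_num: "inj_on num I" and num_less: "i \<in> I \<Longrightarrow> num i < k"
    and inj_enc: "inj_on enc A"
begin

abbreviation "lo i \<equiv> 2 * num i"
abbreviation "hi i \<equiv> 2 * num i + 1"
abbreviation "ta \<equiv> 2 * k"
abbreviation "tb \<equiv> 2 * k + 1"

text \<open>The \<open>k\<close> deques are interleaved: cell \<open>x\<close> of the deque \<open>i\<close> has address \<open>addr base i x\<close>.\<close>

definition addr :: "nat \<Rightarrow> 'i \<Rightarrow> nat \<Rightarrow> nat" where
  "addr base i x = base + num i + k * x"

text \<open>Half-open intervals of cells. Deques grow at the upper end only, so no cell below
  \<open>base\<close> is ever written and no bound on their sizes has to be known in
  advance.\<close>

definition holds :: "nat \<Rightarrow> ('i \<Rightarrow> 'b list) \<Rightarrow> config \<Rightarrow> bool" where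
  "holds base s c \<longleftrightarrow> (\<forall>i\<in>I. \<exists>l. reg c (lo i) = addr base i l \<and> reg c (hi i) = addr base i (l + length (s i))
     \<and> (\<forall>j<length (s i). mem c (addr base i (l + j)) = enc (s i ! j)))"

definition valid :: "('i \<Rightarrow> 'b list) \<Rightarrow> bool" where
  "valid s \<longleftrightarrow> (\<forall>i\<in>I. set (s i) \<subseteq> A)"

definition total :: "('i \<Rightarrow> 'b list) \<Rightarrow> nat" where
  "total s = (\<Sum>i\<in>I. length (s i))"

text \<open>What must survive while the input is being loaded: the input itself, stored below
  \<open>base\<close>, and the registers \<open>rp\<close> and \<open>rz\<close> used for reading
  it.\<close>

definition frame :: "nat \<Rightarrow> config \<Rightarrow> config \<Rightarrow> bool" where
  "frame base c c' \<longleftrightarrow> (\<forall>x<base. mem c' x = mem c x) \<and> (\<forall>r\<ge>2 * k + 2. reg c' r = reg c r)"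

definition reaches :: "program \<Rightarrow> nat \<Rightarrow> nat \<Rightarrow> nat \<Rightarrow> ('i \<Rightarrow> 'b list) \<Rightarrow> config \<Rightarrow> bool" where
  "reaches P T b base s c \<longleftrightarrow>
    (\<exists>t\<le>T. \<exists>c'. (step P ^^ t) c = c' \<and> pc c' = b \<and> holds base s c' \<and> frame base c c')"

text \<open>Code is a function of its start address because jumps are absolute. The constant
  \<open>T\<close> bounds the growth of the deques as well as the time, since the cost of later
  phases depends on the sizes left behind.\<close>

definition realizes :: "(nat \<Rightarrow> instr list) \<Rightarrow> nat \<Rightarrow> nat \<Rightarrow> (('i \<Rightarrow> 'b list) \<Rightarrow> 'i \<Rightarrow> 'b list) \<Rightarrow> bool" where
  "realizes code L T f \<longleftrightarrow> (\<forall>a. length (code a) = L) \<and>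
    (\<forall>s. valid s \<longrightarrow> valid (f s) \<and> total (f s) \<le> total s + T \<and>
      (\<forall>P base c. code_at P (pc c) (code (pc c)) \<longrightarrow> holds base s c \<longrightarrow> reaches P T (pc c + L) base (f s) c))"

definition lin_realizes :: "(nat \<Rightarrow> instr list) \<Rightarrow> nat \<Rightarrow> nat \<Rightarrow> (('i \<Rightarrow> 'b list) \<Rightarrow> 'i \<Rightarrow> 'b list) \<Rightarrow> bool" where
  "lin_realizes code L T f \<longleftrightarrow> (\<forall>a. length (code a) = L) \<and>
    (\<forall>s. valid s \<longrightarrow> valid (f s) \<and> total (f s) \<le> T * (total s + 1) \<and>
      (\<forall>P base c. code_at P (pc c) (code (pc c)) \<longrightarrow> holds base s c \<longrightarrow>
        reaches P (T * (total s + 1)) (pc c + L) base (f s) c))"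

definition sw_realizes :: "('c \<Rightarrow> nat) \<Rightarrow> 'c set \<Rightarrow> (nat \<Rightarrow> instr list) \<Rightarrow> nat \<Rightarrow> nat \<Rightarrow> ('c \<Rightarrow> ('i \<Rightarrow> 'b list) \<Rightarrow> 'i \<Rightarrow> 'b list) \<Rightarrow> bool" where
  "sw_realizes key B code L T F \<longleftrightarrow> (\<forall>a. length (code a) = L) \<and>
    (\<forall>s b. valid s \<longrightarrow> b \<in> B \<longrightarrow> valid (F b s) \<and> total (F b s) \<le> total s + T \<and>
      (\<forall>P base c. code_at P (pc c) (code (pc c)) \<longrightarrow> holds base s c \<longrightarrow> reg c ta = key b \<longrightarrow>
        reaches P T (pc c + L) base (F b s) c))"

lemma realizesD:
  assumes "realizes code L T f"
  shows "length (code a) = L"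
    and "valid s \<Longrightarrow> valid (f s)" and "valid s \<Longrightarrow> total (f s) \<le> total s + T"
    and "valid s \<Longrightarrow> code_at P (pc c) (code (pc c)) \<Longrightarrow> holds base s c \<Longrightarrow>
      reaches P T (pc c + L) base (f s) c"
  using assms unfolding realizes_def by blast+

lemma lin_realizesD:
  assumes "lin_realizes code L T f"
  shows "length (code a) = L"
    and "valid s \<Longrightarrow> valid (f s)" and "valid s \<Longrightarrow> total (f s) \<le> T * (total s + 1)"
    and "valid s \<Longrightarrow> code_at P (pc c) (code (pc c)) \<Longrightarrow> holds base s c \<Longrightarrow>
      reaches P (T * (total s + 1)) (pc c + L) base (f s) c"
  using assms unfolding lin_realizes_def by blast+

lemma sw_realizesD:
  assumes "sw_realizes key B code L T F"
  shows "length (code a) = L"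
    and "valid s \<Longrightarrow> b \<in> B \<Longrightarrow> valid (F b s)" and "valid s \<Longrightarrow> b \<in> B \<Longrightarrow> total (F b s) \<le> total s + T"
    and "valid s \<Longrightarrow> b \<in> B \<Longrightarrow> code_at P (pc c) (code (pc c)) \<Longrightarrow> holds base s c \<Longrightarrow>
      reg c ta = key b \<Longrightarrow> reaches P T (pc c + L) base (F b s) c"
  using assms unfolding sw_realizes_def by blast+

definition imp :: "(('i \<Rightarrow> 'b list) \<Rightarrow> 'i \<Rightarrow> 'b list) \<Rightarrow> bool" where
  "imp f \<longleftrightarrow> (\<exists>code L T. realizes code L T f)"

definition lin_imp :: "(('i \<Rightarrow> 'b list) \<Rightarrow> 'i \<Rightarrow> 'b list) \<Rightarrow> bool" where
  "lin_imp f \<longleftrightarrow> (\<exists>code L T. lin_realizes code L T f)"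

lemma imp_intro:
  assumes "\<And>a. length (code a) = L"
    and "\<And>s. valid s \<Longrightarrow> valid (f s)" "\<And>s. valid s \<Longrightarrow> total (f s) \<le> total s + T"
    and "\<And>s P base c. valid s \<Longrightarrow> code_at P (pc c) (code (pc c)) \<Longrightarrow> holds base s c \<Longrightarrow>
      reaches P T (pc c + L) base (f s) c"
  shows "imp f"
  unfolding imp_def realizes_def using assms by blast

lemma addr_inject:
  assumes "i \<in> I" "j \<in> I"
  shows "addr base i x = addr base j y \<longleftrightarrow> i = j \<and> x = y"
proof
  assume "addr base i x = addr base j y"
  then have e: "num i + k * x = num j + k * y" by (simp add: addr_def)
  then have "(num i + k * x) mod k = (num j + k * y) mod k" by simp
  then have "num i = num j" using num_less assms by simp
  moreover from this e num_less[OF assms(1)] have "x = y" by simp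
  ultimately show "i = j \<and> x = y" using inj_num assms by (auto dest: inj_onD)
qed simp

lemma frame_refl [simp]: "frame base c c"
  by (simp add: frame_def)

lemma frame_trans: "frame base c c' \<Longrightarrow> frame base c' c'' \<Longrightarrow> frame base c c''"
  by (simp add: frame_def)

lemma reaches_trans:
  assumes "reaches P T b base s c"
    and "\<And>c'. pc c' = b \<Longrightarrow> holds base s c' \<Longrightarrow> frame base c c' \<Longrightarrow> reaches P T' b' base s' c'"
  shows "reaches P (T + T') b' base s' c"
proof -
  obtain t c' where 1: "t \<le> T" "(step P ^^ t) c = c'" "pc c' = b" "holds base s c'" "frame base c c'"
    using assms(1) by (auto simp: reaches_def)
  then obtain t' c'' where 2: "t' \<le> T'" "(step P ^^ t') c' = c''" "pc c'' = b'" "holds base s' c''"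
    "frame base c' c''"
    using assms(2) unfolding reaches_def by blast
  have "(step P ^^ (t' + t)) c = c''" using 1(2) 2(2) by (simp add: funpow_add)
  then show ?thesis unfolding reaches_def using 1(1,5) 2 frame_trans
    by (intro exI[of _ "t' + t"]) auto
qed

lemma reaches_mono: "reaches P T b base s c \<Longrightarrow> T \<le> T' \<Longrightarrow> reaches P T' b base s c"
  unfolding reaches_def by (metis le_trans)

lemma reaches_refl: "pc c = b \<Longrightarrow> holds base s c \<Longrightarrow> reaches P T b base s c"
  unfolding reaches_def by (rule exI[of _ 0]) simp

lemma reaches_steps:
  assumes "(step P ^^ t) c = c'" "frame base c c'" "reaches P T b base s c'"
  shows "reaches P (t + T) b base s c"
proof -
  obtain t' c'' where 2: "t' \<le> T" "(step P ^^ t') c' = c''" "pc c'' = b" "holds base s c''" "frame base c' c''"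
    using assms(3) unfolding reaches_def by blast
  have "(step P ^^ (t' + t)) c = c''" using assms(1) 2(2) by (simp add: funpow_add)
  then show ?thesis unfolding reaches_def using 2 assms(2) frame_trans
    by (intro exI[of _ "t' + t"]) auto
qed

lemma reaches_step:
  assumes "step P c = c'" "frame base c c'" "reaches P T b base s c'"
  shows "reaches P (Suc T) b base s c"
  using reaches_steps[where t = 1] assms by simp

lemma holds_cong:
  assumes "holds base s c" "\<And>r. r < 2 * k \<Longrightarrow> reg c' r = reg c r" "mem c' = mem c"
  shows "holds base s c'"
proof -
  have "lo i < 2 * k" "hi i < 2 * k" if "i \<in> I" for i using num_less[OF that] by simp_all
  then show ?thesis using assms by (simp add: holds_def)
qed

lemma regs_distinct:
  assumes "i \<in> I"
  shows "lo i \<noteq> ta" "lo i \<noteq> tb" "hi i \<noteq> ta" "hi i \<noteq> tb" "lo i < 2 * k" "hi i < 2 * k"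
  using num_less[OF assms] by simp_all

lemma empty_iff_lo_eq_hi:
  assumes "holds base s c" "i \<in> I"
  shows "reg c (lo i) = reg c (hi i) \<longleftrightarrow> s i = []"
  using assms addr_inject[of i i base] unfolding holds_def by force

lemma holds_other:
  assumes "holds base s c" "i \<in> I" "l' = addr base i l" "h' = addr base i (l + length w)"
    and "\<forall>j<length w. m' (addr base i (l + j)) = enc (w ! j)"
    and "\<And>j x. j \<in> I \<Longrightarrow> j \<noteq> i \<Longrightarrow> m' (addr base j x) = mem c (addr base j x)"
    and "\<And>r. r < 2 * k \<Longrightarrow> r \<noteq> lo i \<Longrightarrow> r \<noteq> hi i \<Longrightarrow> reg c' r = reg c r"
    and "reg c' (lo i) = l'" "reg c' (hi i) = h'" "mem c' = m'"
  shows "holds base (s(i := w)) c'"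
  unfolding holds_def
proof
  fix j assume j: "j \<in> I"
  show "\<exists>l. reg c' (lo j) = addr base j l \<and> reg c' (hi j) = addr base j (l + length ((s(i := w)) j))
     \<and> (\<forall>x<length ((s(i := w)) j). mem c' (addr base j (l + x)) = enc ((s(i := w)) j ! x))"
  proof (cases "j = i")
    case True
    then show ?thesis using assms by auto
  next
    case False
    then have "num j \<noteq> num i" using inj_num j assms(2) by (auto dest: inj_onD)
    then have "reg c' (lo j) = reg c (lo j)" "reg c' (hi j) = reg c (hi j)"
      using assms(7) regs_distinct[OF j] by (auto; presburger)+
    then show ?thesis using assms(1,6,10) j False by (simp add: holds_def)
  qed
qed

lemma total_upd: "i \<in> I \<Longrightarrow> total (s(i := w)) + length (s i) = total s + length w"
  unfolding total_def using finite_I by (simp add: sum.remove[of I i])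

lemma valid_upd: "valid s \<Longrightarrow> (i \<in> I \<Longrightarrow> set w \<subseteq> A) \<Longrightarrow> valid (s(i := w))"
  by (auto simp: valid_def)

lemma valid_nonempty: "valid s \<Longrightarrow> i \<in> I \<Longrightarrow> s i = c # cs \<Longrightarrow> c \<in> A"
  by (force simp: valid_def)

text \<open>The machine cannot add, so moving a pointer on by one cell of the interleaved memory
  takes \<open>k\<close> increments, a constant of the program.\<close>

lemma imp_push:
  assumes "i \<in> I" "b \<in> A"
  shows "imp (push i b)"
proof (rule imp_intro)
  let ?code = "[Const ta (enc b), Store (hi i) ta] @ replicate k (Incr (hi i))"
  show "length ?code = k + 2" by simp
  fix s assume s: "valid s"
  show "valid (push i b s)" unfolding push_def by (rule valid_upd[OF s]) (use s assms in \<open>auto simp: valid_def\<close>)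
  show "total (push i b s) \<le> total s + (k + 2)"
    using total_upd[OF assms(1), of s "s i @ [b]"] by (simp add: push_def)
  fix P base c
  assume at: "code_at P (pc c) ?code" and h: "holds base s c"
  obtain l where l: "reg c (lo i) = addr base i l" "reg c (hi i) = addr base i (l + length (s i))"
    "\<forall>j<length (s i). mem c (addr base i (l + j)) = enc (s i ! j)"
    using h assms(1) unfolding holds_def by blast
  note rd = regs_distinct[OF assms(1)]
  define c1 where "c1 = c\<lparr>pc := Suc (pc c), reg := (reg c)(ta := enc b)\<rparr>"
  have 1: "step P c = c1" using at by (simp add: step_def c1_def)
  define c2 where "c2 = c1\<lparr>pc := Suc (Suc (pc c)), mem := (mem c)(addr base i (l + length (s i)) := enc b)\<rparr>"
  have 2: "step P c1 = c2" using at rd l by (simp add: step_def c1_def c2_def)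
  define c3 where "c3 = c2\<lparr>pc := pc c2 + k, reg := (reg c2)(hi i := reg c2 (hi i) + k)\<rparr>"
  have 3: "(step P ^^ k) c2 = c3" unfolding c3_def
    by (rule step_Incrs) (use at in \<open>simp add: c1_def c2_def\<close>)
  have "holds base (s(i := s i @ [b])) c3"
  proof (rule holds_other[OF h assms(1), of _ l])
    show "\<forall>j<length (s i @ [b]). mem c3 (addr base i (l + j)) = enc ((s i @ [b]) ! j)"
      using l(3) addr_inject[OF assms(1,1)] by (auto simp: c3_def c2_def nth_append less_Suc_eq)
    show "mem c3 (addr base j x) = mem c (addr base j x)" if "j \<in> I" "j \<noteq> i" for j x
      using addr_inject[OF that(1) assms(1)] that(2) by (simp add: c3_def c2_def)
  qed (use rd l in \<open>auto simp: c3_def c2_def c1_def addr_def algebra_simps\<close>)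
  moreover have "frame base c2 c3" "frame base c1 c2" "frame base c c1"
    using rd by (auto simp: frame_def c1_def c2_def c3_def addr_def)
  ultimately have "reaches P (Suc (Suc (k + 0))) (pc c + (k + 2)) base (push i b s) c"
    unfolding push_def
    by (intro reaches_step[OF 1] reaches_step[OF 2] reaches_steps[OF 3] reaches_refl)
      (simp_all add: c3_def c2_def c1_def)
  then show "reaches P (k + 2) (pc c + (k + 2)) base (push i b s) c" by simp
qed

lemma imp_pop_top:
  assumes "i \<in> I"
  shows "imp (pop_top i)"
proof (rule imp_intro)
  let ?code = "\<lambda>a. JumpEq (lo i) (hi i) (a + Suc k) # replicate k (Decr (hi i))"
  show "length (?code a) = Suc k" for a by simp
  fix s assume s: "valid s"
  show "valid (pop_top i s)" unfolding pop_top_def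
    by (rule valid_upd[OF s]) (use s in \<open>auto simp: valid_def dest: in_set_butlastD\<close>)
  show "total (pop_top i s) \<le> total s + Suc k"
    using total_upd[OF assms, of s "butlast (s i)"] by (simp add: pop_top_def)
  fix P base c
  assume at: "code_at P (pc c) (?code (pc c))" and h: "holds base s c"
  note rd = regs_distinct[OF assms(1)]
  show "reaches P (Suc k) (pc c + Suc k) base (pop_top i s) c"
  proof (cases "s i = []")
    case True
    define c1 where "c1 = c\<lparr>pc := pc c + Suc k\<rparr>"
    have "step P c = c1" using at empty_iff_lo_eq_hi[OF h assms] True by (simp add: step_def c1_def)
    then show ?thesis
    proof (rule reaches_step)
      have "pop_top i s = s" using True by (simp add: pop_top_def fun_upd_idem)
      then show "reaches P k (pc c + Suc k) base (pop_top i s) c1"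
        by (intro reaches_refl) (use holds_cong[OF h] in \<open>simp_all add: c1_def\<close>)
    qed (simp add: c1_def frame_def)
  next
    case False
    obtain l where l: "reg c (lo i) = addr base i l" "reg c (hi i) = addr base i (l + length (s i))"
      "\<forall>j<length (s i). mem c (addr base i (l + j)) = enc (s i ! j)"
      using h assms(1) unfolding holds_def by blast
    define c1 where "c1 = c\<lparr>pc := Suc (pc c)\<rparr>"
    have 1: "step P c = c1" using at empty_iff_lo_eq_hi[OF h assms] False by (simp add: step_def c1_def)
    define c2 where "c2 = c1\<lparr>pc := pc c1 + k, reg := (reg c1)(hi i := reg c1 (hi i) - k)\<rparr>"
    have 2: "(step P ^^ k) c1 = c2" unfolding c2_def
      by (rule step_Decrs) (use at in \<open>simp add: c1_def\<close>)
    have "length (s i) > 0" using False by simp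
    then have e: "addr base i (l + length (s i)) - k = addr base i (l + (length (s i) - 1))"
      by (cases "length (s i)") (simp_all add: addr_def)
    have "holds base (s(i := butlast (s i))) c2"
      by (rule holds_other[OF h assms(1), of _ l])
        (use rd l e in \<open>auto simp: c2_def c1_def nth_butlast\<close>)
    moreover have "frame base c1 c2" "frame base c c1" using rd by (auto simp: frame_def c1_def c2_def)
    ultimately have "reaches P (Suc (k + 0)) (pc c + Suc k) base (pop_top i s) c"
      unfolding pop_top_def
      by (intro reaches_step[OF 1] reaches_steps[OF 2] reaches_refl) (simp_all add: c2_def c1_def)
    then show ?thesis by simp
  qed
qed

lemma imp_pop_bot:
  assumes "i \<in> I"
  shows "imp (pop_bot i)"
proof (rule imp_intro)
  let ?code = "\<lambda>a. JumpEq (lo i) (hi i) (a + Suc k) # replicate k (Incr (lo i))"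
  show "length (?code a) = Suc k" for a by simp
  fix s assume s: "valid s"
  show "valid (pop_bot i s)" unfolding pop_bot_def
    by (rule valid_upd[OF s]) (use s in \<open>auto simp: valid_def dest: in_set_tlD\<close>)
  show "total (pop_bot i s) \<le> total s + Suc k"
    using total_upd[OF assms, of s "tl (s i)"] by (simp add: pop_bot_def)
  fix P base c
  assume at: "code_at P (pc c) (?code (pc c))" and h: "holds base s c"
  note rd = regs_distinct[OF assms(1)]
  show "reaches P (Suc k) (pc c + Suc k) base (pop_bot i s) c"
  proof (cases "s i = []")
    case True
    define c1 where "c1 = c\<lparr>pc := pc c + Suc k\<rparr>"
    have "step P c = c1" using at empty_iff_lo_eq_hi[OF h assms] True by (simp add: step_def c1_def)
    then show ?thesis
    proof (rule reaches_step)
      have "pop_bot i s = s" using True by (simp add: pop_bot_def fun_upd_idem)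
      then show "reaches P k (pc c + Suc k) base (pop_bot i s) c1"
        by (intro reaches_refl) (use holds_cong[OF h] in \<open>simp_all add: c1_def\<close>)
    qed (simp add: c1_def frame_def)
  next
    case False
    obtain l where l: "reg c (lo i) = addr base i l" "reg c (hi i) = addr base i (l + length (s i))"
      "\<forall>j<length (s i). mem c (addr base i (l + j)) = enc (s i ! j)"
      using h assms(1) unfolding holds_def by blast
    define c1 where "c1 = c\<lparr>pc := Suc (pc c)\<rparr>"
    have 1: "step P c = c1" using at empty_iff_lo_eq_hi[OF h assms] False by (simp add: step_def c1_def)
    define c2 where "c2 = c1\<lparr>pc := pc c1 + k, reg := (reg c1)(lo i := reg c1 (lo i) + k)\<rparr>"
    have 2: "(step P ^^ k) c1 = c2" unfolding c2_def
      by (rule step_Incrs) (use at in \<open>simp add: c1_def\<close>)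
    obtain x xs where x: "s i = x # xs" using False by (cases "s i") auto
    have "holds base (s(i := xs)) c2"
    proof (rule holds_other[OF h assms(1), of _ "Suc l"])
      show "\<forall>j<length xs. mem c2 (addr base i (Suc l + j)) = enc (xs ! j)"
      proof (intro allI impI)
        fix j assume "j < length xs"
        then show "mem c2 (addr base i (Suc l + j)) = enc (xs ! j)"
          using l(3)[rule_format, of "Suc j"] x by (simp add: c2_def c1_def)
      qed
    qed (use rd l x in \<open>auto simp: c2_def c1_def addr_def\<close>)
    moreover have "frame base c1 c2" "frame base c c1" using rd by (auto simp: frame_def c1_def c2_def)
    moreover have "pop_bot i s = s(i := xs)" using x by (simp add: pop_bot_def)
    ultimately have "reaches P (Suc (k + 0)) (pc c + Suc k) base (pop_bot i s) c"
      by (intro reaches_step[OF 1] reaches_steps[OF 2] reaches_refl) (simp_all add: c2_def c1_def)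
    then show ?thesis by simp
  qed
qed

lemma imp_id: "imp (\<lambda>s. s)"
  by (rule imp_intro[where code = "\<lambda>_. []" and T = 0]) (auto intro: reaches_refl)

lemma imp_comp:
  assumes "imp f" "imp g"
  shows "imp (\<lambda>s. g (f s))"
proof -
  obtain cf Lf Tf where Rf: "realizes cf Lf Tf f"
    using assms(1) unfolding imp_def by blast
  note f = realizesD[OF Rf]
  obtain cg Lg Tg where Rg: "realizes cg Lg Tg g"
    using assms(2) unfolding imp_def by blast
  note g = realizesD[OF Rg]
  show ?thesis
  proof (rule imp_intro[where code = "\<lambda>a. cf a @ cg (a + Lf)" and L = "Lf + Lg" and T = "Tf + Tg"])
    fix s assume s: "valid s"
    show "total (g (f s)) \<le> total s + (Tf + Tg)" using f(3)[OF s] g(3)[OF f(2)[OF s]] by simp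
    fix P base c
    assume at: "code_at P (pc c) (cf (pc c) @ cg (pc c + Lf))" and h: "holds base s c"
    have "reaches P Tf (pc c + Lf) base (f s) c" using f(4)[OF s _ h] at by simp
    then show "reaches P (Tf + Tg) (pc c + (Lf + Lg)) base (g (f s)) c"
    proof (rule reaches_trans)
      fix c' assume "pc c' = pc c + Lf" "holds base (f s) c'"
      then show "reaches P Tg (pc c + (Lf + Lg)) base (g (f s)) c'"
        using g(4)[OF f(2)[OF s], of P c' base] at f(1) by (simp add: add.assoc)
    qed
  qed (use f g in auto)
qed

lemma switch_code:
  assumes "\<forall>b\<in>set bs. imp (F b)" "distinct bs" "inj_on key (set bs)"
  shows "\<exists>code L T. sw_realizes key (set bs) code L T F"
  using assms
proof (induction bs)
  case Nil
  then show ?case unfolding sw_realizes_def by (intro exI[of _ "\<lambda>_. []"] exI[of _ 0]) simp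
next
  case (Cons b bs)
  then have "\<forall>b\<in>set bs. imp (F b)" "distinct bs" "inj_on key (set bs)" by simp_all
  from Cons.IH[OF this] obtain cr Lr Tr where Rr: "sw_realizes key (set bs) cr Lr Tr F" by blast
  note r = sw_realizesD[OF Rr]
  have Fb: "imp (F b)" using Cons.prems by simp
  obtain cb Lb Tb where Rf: "realizes cb Lb Tb (F b)"
    using Fb unfolding imp_def by blast
  note f = realizesD[OF Rf]
  let ?L = "4 + Lb + Lr" and ?T = "4 + Tb + Tr"
  \<comment> \<open>There is no computed jump, so the switch is a chain of comparisons of
    \<open>ta\<close> with constants loaded into \<open>tb\<close>. \<open>JumpEq ta ta\<close>
    jumps unconditionally: over the body if the comparison failed, over the rest of the chain after
    the body.\<close>
  let ?code = "\<lambda>a. [Const tb (key b), JumpEq ta tb (a + 3), JumpEq ta ta (a + 4 + Lb)] @ cb (a + 3)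
     @ [JumpEq ta ta (a + ?L)] @ cr (a + 4 + Lb)"
  have "length (?code a) = ?L" for a using r(1) f(1) by simp
  moreover have "valid (F d s) \<and> total (F d s) \<le> total s + ?T \<and>
      (\<forall>P base c. code_at P (pc c) (?code (pc c)) \<longrightarrow> holds base s c \<longrightarrow> reg c ta = key d \<longrightarrow>
        reaches P ?T (pc c + ?L) base (F d s) c)" if s: "valid s" and d: "d \<in> set (b # bs)" for s d
  proof (intro conjI allI impI)
    show "valid (F d s)" using r(2)[OF s] f(2)[OF s] d by auto
    show "total (F d s) \<le> total s + ?T"
    proof (cases "d = b")
      case False
      then have "total (F d s) \<le> total s + Tr" using r(3)[OF s, of d] d by simp
      then show ?thesis by simp
    qed (use f(3)[OF s] in simp)
    fix P base c
    assume at: "code_at P (pc c) (?code (pc c))" and h: "holds base s c" and ta: "reg c ta = key d"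
    define c1 where "c1 = c\<lparr>pc := pc c + 1, reg := (reg c)(tb := key b)\<rparr>"
    have 1: "step P c = c1" using at by (simp add: step_def c1_def)
    have fr1: "frame base c c1" by (simp add: frame_def c1_def)
    show "reaches P ?T (pc c + ?L) base (F d s) c"
    proof (cases "d = b")
      case True
      define c2 where "c2 = c1\<lparr>pc := pc c + 3\<rparr>"
      have 2: "step P c1 = c2" using at ta True by (simp add: step_def c1_def c2_def numeral_3_eq_3)
      have "holds base s c2" by (rule holds_cong[OF h]) (simp_all add: c1_def c2_def)
      then have "reaches P Tb (pc c + 3 + Lb) base (F b s) c2"
        using f(4)[OF s, of P c2 base] at f(1) by (simp add: c2_def numeral_3_eq_3)
      then have "reaches P (Tb + 1) (pc c + ?L) base (F b s) c2"
      proof (rule reaches_trans)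
        fix c' assume c': "pc c' = pc c + 3 + Lb" "holds base (F b s) c'"
        have "step P c' = c'\<lparr>pc := pc c + ?L\<rparr>"
          using at c' f(1) by (simp add: step_def numeral_3_eq_3)
        then have "reaches P (Suc 0) (pc c + ?L) base (F b s) c'"
          by (rule reaches_step) (auto intro!: reaches_refl holds_cong[OF c'(2)] simp: frame_def)
        then show "reaches P 1 (pc c + ?L) base (F b s) c'" by simp
      qed
      then have "reaches P (Suc (Suc (Tb + 1))) (pc c + ?L) base (F b s) c"
        by (intro reaches_step[OF 1] reaches_step[OF 2] fr1) (simp add: c2_def frame_def)
      then have "reaches P ?T (pc c + ?L) base (F b s) c" by (rule reaches_mono) simp
      then show ?thesis using True by simp
    next
      case False
      then have db: "d \<in> set bs" using d by simp
      then have "key d \<noteq> key b" using False d Cons.prems(3) by (metis inj_onD list.set_intros(1))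
      define c2 where "c2 = c1\<lparr>pc := pc c + 2\<rparr>"
      have 2: "step P c1 = c2" using at ta \<open>key d \<noteq> key b\<close> by (simp add: step_def c1_def c2_def)
      define c3 where "c3 = c2\<lparr>pc := pc c + 4 + Lb\<rparr>"
      have 3: "step P c2 = c3" using at by (simp add: step_def c3_def c2_def)
      have "holds base s c3" by (rule holds_cong[OF h]) (simp_all add: c1_def c2_def c3_def)
      moreover have "reg c3 ta = key d" using ta by (simp add: c1_def c2_def c3_def)
      moreover have "code_at P (pc c3) (cr (pc c3))" using at f(1) by (simp add: c3_def eval_nat_numeral)
      ultimately have "reaches P Tr (pc c3 + Lr) base (F d s) c3" using r(4)[OF s db] by blast
      then have "reaches P (Suc (Suc (Suc Tr))) (pc c + ?L) base (F d s) c"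
        by (intro reaches_step[OF 1] reaches_step[OF 2] reaches_step[OF 3] fr1)
          (simp_all add: c2_def c3_def frame_def add.assoc)
      then show ?thesis by (rule reaches_mono) simp
    qed
  qed
  ultimately have "sw_realizes key (set (b # bs)) ?code ?L ?T F" unfolding sw_realizes_def by blast
  then show ?case by blast
qed

lemma switch_all:
  assumes "\<forall>b\<in>A. imp (F b)"
  shows "\<exists>code L T. sw_realizes enc A code L T F"
  using finite_distinct_list[OF finite_A] switch_code[of _ F enc] assms inj_enc by blast

text \<open>Shared by both ends of a deque: \<open>load\<close> brings the end letter into
  \<open>ta\<close>, where the switch expects it. The empty deque is branched off beforehand, since
  the cell read would then be meaningless.\<close>

lemma imp_load_case:
  assumes "imp (F None)" "\<forall>b\<in>A. imp (F (Some b))" "i \<in> I"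
    and load: "\<And>P base s c. valid s \<Longrightarrow> holds base s c \<Longrightarrow> s i \<noteq> [] \<Longrightarrow> code_at P (pc c) load \<Longrightarrow>
      \<exists>c'. (step P ^^ length load) c = c' \<and> pc c' = pc c + length load \<and> holds base s c' \<and> frame base c c'
         \<and> reg c' ta = enc (el (s i))"
    and el: "\<And>w. w \<noteq> [] \<Longrightarrow> el w \<in> set w"
  shows "imp (\<lambda>s. F (if s i = [] then None else Some (el (s i))) s)"
proof -
  obtain cn Ln Tn where Rn: "realizes cn Ln Tn (F None)"
    using assms(1) unfolding imp_def by blast
  note n = realizesD[OF Rn]
  obtain cs Ls Ts where Rw: "sw_realizes enc A cs Ls Ts (\<lambda>b. F (Some b))"
    using switch_all[of "\<lambda>b. F (Some b)", OF assms(2)] by blast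
  note w = sw_realizesD[OF Rw]
  let ?f = "\<lambda>s. F (if s i = [] then None else Some (el (s i))) s" and ?m = "length load"
  let ?L = "?m + Ls + Ln + 2" and ?T = "?m + Ts + Tn + 2"
  let ?code = "\<lambda>a. JumpEq (lo i) (hi i) (a + ?m + Ls + 2) # load @ cs (a + ?m + 1)
     @ [JumpEq ta ta (a + ?L)] @ cn (a + ?m + Ls + 2)"
  have elA: "el (s i) \<in> A" if "valid s" "s i \<noteq> []" for s
    using that el[of "s i"] assms(3) by (auto simp: valid_def)
  show ?thesis
  proof (rule imp_intro)
    show "length (?code a) = ?L" for a using n w by simp
    fix s assume s: "valid s"
    show "valid (?f s)" using n(2)[OF s] w(2)[OF s] elA[OF s] by simp
    show "total (?f s) \<le> total s + ?T" using n(3)[OF s] w(3)[OF s] elA[OF s] by (cases "s i = []") force+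
    fix P base c
    assume at: "code_at P (pc c) (?code (pc c))" and h: "holds base s c"
    show "reaches P ?T (pc c + ?L) base (?f s) c"
    proof (cases "s i = []")
      case True
      define c1 where "c1 = c\<lparr>pc := pc c + ?m + Ls + 2\<rparr>"
      have 1: "step P c = c1"
        using at empty_iff_lo_eq_hi[OF h assms(3)] True by (simp add: step_def c1_def)
      have "holds base s c1" by (rule holds_cong[OF h]) (simp_all add: c1_def)
      then have "reaches P Tn (pc c1 + Ln) base (F None s) c1"
        using n(4)[OF s, of P c1 base] at w(1) by (simp add: c1_def add.assoc)
      then have "reaches P (Suc Tn) (pc c + ?L) base (?f s) c"
        by (intro reaches_step[OF 1]) (use True in \<open>simp_all add: c1_def frame_def add.assoc\<close>)
      then show ?thesis by (rule reaches_mono) simp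
    next
      case False
      let ?b = "el (s i)"
      define c1 where "c1 = c\<lparr>pc := pc c + 1\<rparr>"
      have 1: "step P c = c1"
        using at empty_iff_lo_eq_hi[OF h assms(3)] False by (simp add: step_def c1_def)
      have h1: "holds base s c1" by (rule holds_cong[OF h]) (simp_all add: c1_def)
      have "code_at P (pc c1) load" using at by (simp add: c1_def)
      from load[OF s h1 False this] obtain c2 where
        c2: "(step P ^^ ?m) c1 = c2" "pc c2 = pc c1 + ?m" "holds base s c2" "frame base c1 c2"
          "reg c2 ta = enc ?b" by blast
      have "code_at P (pc c2) (cs (pc c2))" using at c2(2) by (simp add: c1_def)
      then have "reaches P Ts (pc c2 + Ls) base (F (Some ?b) s) c2"
        using w(4)[OF s elA[OF s False]] c2 by blast
      then have "reaches P (Ts + 1) (pc c + ?L) base (F (Some ?b) s) c2"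
      proof (rule reaches_trans)
        fix c' assume c': "pc c' = pc c2 + Ls" "holds base (F (Some ?b) s) c'"
        have "step P c' = c'\<lparr>pc := pc c + ?L\<rparr>"
          using at c' w(1) c2(2) by (simp add: step_def c1_def)
        then have "reaches P (Suc 0) (pc c + ?L) base (F (Some ?b) s) c'"
          by (rule reaches_step) (auto intro!: reaches_refl holds_cong[OF c'(2)] simp: frame_def)
        then show "reaches P 1 (pc c + ?L) base (F (Some ?b) s) c'" by simp
      qed
      then have "reaches P (Suc (?m + (Ts + 1))) (pc c + ?L) base (F (Some ?b) s) c"
        by (intro reaches_step[OF 1] reaches_steps[OF c2(1,4)]) (simp_all add: c1_def frame_def)
      then have "reaches P ?T (pc c + ?L) base (F (Some ?b) s) c" by (rule reaches_mono) simp
      then show ?thesis using False by simp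
    qed
  qed
qed

lemma imp_case_top:
  assumes "imp (F None)" "\<And>b. b \<in> A \<Longrightarrow> imp (F (Some b))" "i \<in> I"
  shows "imp (case_top i F)"
proof -
  let ?load = "Copy ta (hi i) # replicate k (Decr ta) @ [Load ta ta]"
  have "imp (\<lambda>s. F (if s i = [] then None else Some (last (s i))) s)"
  proof (rule imp_load_case[where load = ?load])
    fix P base s c
    assume h: "holds base s c" and ne: "s i \<noteq> []" and at: "code_at P (pc c) ?load"
    obtain l where l: "reg c (hi i) = addr base i (l + length (s i))"
      "\<forall>j<length (s i). mem c (addr base i (l + j)) = enc (s i ! j)"
      using h assms(3) unfolding holds_def by blast
    define c1 where "c1 = c\<lparr>pc := pc c + 1, reg := (reg c)(ta := reg c (hi i))\<rparr>"
    have 1: "step P c = c1" using at by (simp add: step_def c1_def)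
    define c2 where "c2 = c1\<lparr>pc := pc c1 + k, reg := (reg c1)(ta := reg c1 ta - k)\<rparr>"
    have 2: "(step P ^^ k) c1 = c2" unfolding c2_def by (rule step_Decrs) (use at in \<open>simp add: c1_def\<close>)
    define c3 where "c3 = c2\<lparr>pc := pc c2 + 1, reg := (reg c2)(ta := mem c2 (reg c2 ta))\<rparr>"
    have 3: "step P c2 = c3" using at by (simp add: step_def c3_def c2_def c1_def)
    have "(step P ^^ length ?load) c = (step P ^^ (Suc (k + 1))) c" by simp
    also have "\<dots> = (step P ^^ (1 + k)) (step P c)" by (simp only: funpow_Suc_right o_apply add.commute)
    also have "\<dots> = c3" unfolding 1 funpow_add o_apply 2 using 3 by simp
    finally have "(step P ^^ length ?load) c = c3" .
    moreover have "length (s i) > 0" using ne by simp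
    then have "addr base i (l + length (s i)) - k = addr base i (l + (length (s i) - 1))"
      by (cases "length (s i)") (simp_all add: addr_def)
    then have "reg c3 ta = enc (last (s i))"
      using l ne by (simp add: c3_def c2_def c1_def last_conv_nth)
    moreover have "holds base s c3" by (rule holds_cong[OF h]) (simp_all add: c1_def c2_def c3_def)
    moreover have "frame base c c3" by (simp add: frame_def c1_def c2_def c3_def)
    moreover have "pc c3 = pc c + length ?load" by (simp add: c1_def c2_def c3_def)
    ultimately show "\<exists>c'. (step P ^^ length ?load) c = c' \<and> pc c' = pc c + length ?load \<and> holds base s c'
         \<and> frame base c c' \<and> reg c' ta = enc (last (s i))" by blast
  qed (use assms in auto)
  then show ?thesis by (simp add: case_top_def[abs_def])
qed

lemma imp_case_bot:
  assumes "imp (F None)" "\<And>b. b \<in> A \<Longrightarrow> imp (F (Some b))" "i \<in> I"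
  shows "imp (case_bot i F)"
proof -
  let ?load = "[Load ta (lo i)]"
  have "imp (\<lambda>s. F (if s i = [] then None else Some (hd (s i))) s)"
  proof (rule imp_load_case[where load = ?load])
    fix P base s c
    assume h: "holds base s c" and ne: "s i \<noteq> []" and at: "code_at P (pc c) ?load"
    obtain l where l: "reg c (lo i) = addr base i l"
      "\<forall>j<length (s i). mem c (addr base i (l + j)) = enc (s i ! j)"
      using h assms(3) unfolding holds_def by blast
    define c1 where "c1 = c\<lparr>pc := pc c + 1, reg := (reg c)(ta := mem c (reg c (lo i)))\<rparr>"
    have "(step P ^^ length ?load) c = c1" using at by (simp add: step_def c1_def)
    moreover have "reg c1 ta = enc (hd (s i))"
      using l(1) l(2)[rule_format, of 0] ne by (simp add: c1_def hd_conv_nth)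
    moreover have "holds base s c1" by (rule holds_cong[OF h]) (simp_all add: c1_def)
    moreover have "frame base c c1" by (simp add: frame_def c1_def)
    moreover have "pc c1 = pc c + length ?load" by (simp add: c1_def)
    ultimately show "\<exists>c'. (step P ^^ length ?load) c = c' \<and> pc c' = pc c + length ?load \<and> holds base s c'
         \<and> frame base c c' \<and> reg c' ta = enc (hd (s i))" by blast
  qed (use assms in auto)
  then show ?thesis by (simp add: case_bot_def[abs_def])
qed

lemma lin_imp_intro:
  assumes "\<And>a. length (code a) = L"
    and "\<And>s. valid s \<Longrightarrow> valid (f s)" "\<And>s. valid s \<Longrightarrow> total (f s) \<le> T * (total s + 1)"
    and "\<And>s P base c. valid s \<Longrightarrow> code_at P (pc c) (code (pc c)) \<Longrightarrow> holds base s c \<Longrightarrow>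
      reaches P (T * (total s + 1)) (pc c + L) base (f s) c"
  shows "lin_imp f"
  unfolding lin_imp_def lin_realizes_def using assms by blast

lemma imp_lin_imp:
  assumes "imp f"
  shows "lin_imp f"
proof -
  obtain cf Lf Tf where Rf: "realizes cf Lf Tf f"
    using assms(1) unfolding imp_def by blast
  note f = realizesD[OF Rf]
  show ?thesis
  proof (rule lin_imp_intro[where T = "Suc Tf"])
    fix s assume s: "valid s"
    show "total (f s) \<le> Suc Tf * (total s + 1)" using f(3)[OF s] by simp
    fix P base c
    assume "code_at P (pc c) (cf (pc c))" "holds base s c"
    from f(4)[OF s this] show "reaches P (Suc Tf * (total s + 1)) (pc c + Lf) base (f s) c"
      by (rule reaches_mono) simp
  qed (use f in auto)
qed

text \<open>Linear bounds compose only because the sizes after the first phase are linear in the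
  sizes before it, which is why \<open>lin_realizes\<close> bounds \<open>total\<close> too.\<close>

lemma lin_imp_comp:
  assumes "lin_imp f" "lin_imp g"
  shows "lin_imp (\<lambda>s. g (f s))"
proof -
  obtain cf Lf Tf where Rf: "lin_realizes cf Lf Tf f"
    using assms(1) unfolding lin_imp_def by blast
  note f = lin_realizesD[OF Rf]
  obtain cg Lg Tg where Rg: "lin_realizes cg Lg Tg g"
    using assms(2) unfolding lin_imp_def by blast
  note g = lin_realizesD[OF Rg]
  let ?T = "Tf + Tg * (Tf + 1)"
  have le: "Tg * (total (f s) + 1) \<le> Tg * (Tf + 1) * (total s + 1)" if "valid s" for s
  proof -
    have "total (f s) + 1 \<le> (Tf + 1) * (total s + 1)" using f(3)[OF that] by simp
    from mult_le_mono2[OF this, of Tg] show ?thesis by (simp only: mult.assoc)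
  qed
  show ?thesis
  proof (rule lin_imp_intro[where code = "\<lambda>a. cf a @ cg (a + Lf)" and L = "Lf + Lg" and T = ?T])
    fix s assume s: "valid s"
    show "total (g (f s)) \<le> ?T * (total s + 1)"
      using g(3)[OF f(2)[OF s]] le[OF s] by (simp only: distrib_right)
    fix P base c
    assume at: "code_at P (pc c) (cf (pc c) @ cg (pc c + Lf))" and h: "holds base s c"
    have "reaches P (Tf * (total s + 1)) (pc c + Lf) base (f s) c" using f(4)[OF s _ h] at by simp
    then have "reaches P (Tf * (total s + 1) + Tg * (total (f s) + 1)) (pc c + (Lf + Lg)) base (g (f s)) c"
    proof (rule reaches_trans)
      fix c' assume "pc c' = pc c + Lf" "holds base (f s) c'"
      then show "reaches P (Tg * (total (f s) + 1)) (pc c + (Lf + Lg)) base (g (f s)) c'"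
        using g(4)[OF f(2)[OF s], of P c' base] at f(1) by (simp add: add.assoc)
    qed
    then show "reaches P (?T * (total s + 1)) (pc c + (Lf + Lg)) base (g (f s)) c"
      by (rule reaches_mono) (use le[OF s] in \<open>simp only: distrib_right add_le_cancel_left\<close>)
  qed (use f g in auto)
qed

text \<open>The body costs a constant and cannot refill the deque being emptied, so there is one
  iteration for each letter initially present.\<close>

lemma lin_imp_for_each:
  assumes "\<And>b. b \<in> A \<Longrightarrow> imp (F b)" "i \<in> I" and frame: "\<And>b s. b \<in> A \<Longrightarrow> F b s i = s i"
  shows "lin_imp (for_each i F)"
proof -
  have F: "\<forall>b\<in>A. imp (F b)" using assms(1) by blast
  obtain cs Ls Ts where Rw: "sw_realizes enc A cs Ls Ts F"
    using switch_all[OF F] by blast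
  note w = sw_realizesD[OF Rw]
  let ?L = "k + Ls + 3" and ?T = "k + Ts + 3"
  let ?code = "\<lambda>a. [JumpEq (lo i) (hi i) (a + ?L), Load ta (lo i)] @ replicate k (Incr (lo i))
     @ cs (a + k + 2) @ [JumpEq ta ta a]"
  have run: "valid (drain i F xs s) \<and> total (drain i F xs s) \<le> total s + Ts * length xs \<and>
      (\<forall>P base c. code_at P (pc c) (?code (pc c)) \<longrightarrow> holds base s c \<longrightarrow>
        reaches P (?T * length xs + 1) (pc c + ?L) base (drain i F xs s) c)"
    if "valid s" "s i = xs" for xs s
    using that
  proof (induction xs arbitrary: s)
    case Nil
    have "reaches P 1 (pc c + ?L) base s c"
      if at: "code_at P (pc c) (?code (pc c))" and h: "holds base s c" for P base c
    proof -
      have "step P c = c\<lparr>pc := pc c + ?L\<rparr>"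
        using at empty_iff_lo_eq_hi[OF h assms(2)] Nil by (simp add: step_def)
      then have "reaches P (Suc 0) (pc c + ?L) base s c"
        by (rule reaches_step) (auto intro!: reaches_refl holds_cong[OF h] simp: frame_def)
      then show ?thesis by simp
    qed
    then show ?case using Nil by simp
  next
    case (Cons x xs)
    let ?s = "s(i := xs)"
    have x: "x \<in> A" using valid_nonempty[OF Cons.prems(1) assms(2) Cons.prems(2)] .
    have "set (s i) \<subseteq> A" using Cons.prems(1) assms(2) unfolding valid_def by blast
    then have vs: "valid ?s" by (intro valid_upd[OF Cons.prems(1)]) (simp add: Cons.prems(2))
    have tot: "total s = total ?s + 1" using total_upd[OF assms(2), of s xs] Cons.prems(2) by simp
    have "F x ?s i = xs" using frame[OF x, of ?s] by simp
    note IH = Cons.IH[OF w(2)[OF vs x] this]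
    show ?case
    proof (intro conjI allI impI)
      show "valid (drain i F (x # xs) s)" unfolding drain.simps using IH by blast
      show "total (drain i F (x # xs) s) \<le> total s + Ts * length (x # xs)"
      proof -
        have "total (drain i F xs (F x ?s)) \<le> total (F x ?s) + Ts * length xs" using IH by blast
        then show ?thesis using w(3)[OF vs x] tot by simp
      qed
      fix P base c
      assume at: "code_at P (pc c) (?code (pc c))" and h: "holds base s c"
      obtain l where l: "reg c (lo i) = addr base i l" "reg c (hi i) = addr base i (l + length (s i))"
        "\<forall>j<length (s i). mem c (addr base i (l + j)) = enc (s i ! j)"
        using h assms(2) unfolding holds_def by blast
      note rd = regs_distinct[OF assms(2)]
      define c1 where "c1 = c\<lparr>pc := pc c + 1\<rparr>"
      have 1: "step P c = c1"
        using at empty_iff_lo_eq_hi[OF h assms(2)] Cons.prems(2) by (simp add: step_def c1_def)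
      define c2 where "c2 = c1\<lparr>pc := pc c + 2, reg := (reg c)(ta := enc x)\<rparr>"
      have 2: "step P c1 = c2"
        using at l(1) l(3)[rule_format, of 0] Cons.prems(2) by (simp add: step_def c1_def c2_def)
      define c3 where "c3 = c2\<lparr>pc := pc c2 + k, reg := (reg c2)(lo i := reg c2 (lo i) + k)\<rparr>"
      have 3: "(step P ^^ k) c2 = c3" unfolding c3_def
        by (rule step_Incrs) (use at in \<open>simp add: c2_def\<close>)
      have "holds base ?s c3"
      proof (rule holds_other[OF h assms(2), of _ "Suc l"])
        show "\<forall>j<length xs. mem c3 (addr base i (Suc l + j)) = enc (xs ! j)"
        proof (intro allI impI)
          fix j assume "j < length xs"
          then show "mem c3 (addr base i (Suc l + j)) = enc (xs ! j)"
            using l(3)[rule_format, of "Suc j"] Cons.prems(2) by (simp add: c3_def c2_def c1_def)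
        qed
      qed (use rd l Cons.prems(2) in \<open>auto simp: c3_def c2_def c1_def addr_def\<close>)
      moreover have "reg c3 ta = enc x" using rd by (simp add: c3_def c2_def)
      moreover have "code_at P (pc c3) (cs (pc c3))" using at by (simp add: c3_def c2_def add.commute)
      ultimately have "reaches P Ts (pc c3 + Ls) base (F x ?s) c3" using w(4)[OF vs x] by blast
      then have "reaches P (Ts + Suc (?T * length xs + 1)) (pc c + ?L) base (drain i F xs (F x ?s)) c3"
      proof (rule reaches_trans)
        fix c' assume c': "pc c' = pc c3 + Ls" "holds base (F x ?s) c'"
        define c4 where "c4 = c'\<lparr>pc := pc c\<rparr>"
        have 4: "step P c' = c4" using at c' w(1) by (simp add: step_def c3_def c2_def c4_def)
        have "holds base (F x ?s) c4" by (rule holds_cong[OF c'(2)]) (simp_all add: c4_def)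
        then have "reaches P (?T * length xs + 1) (pc c4 + ?L) base (drain i F xs (F x ?s)) c4"
        proof -
          have "code_at P (pc c4) (?code (pc c4))" using at by (simp add: c4_def)
          then show ?thesis using IH \<open>holds base (F x ?s) c4\<close> by blast
        qed
        then show "reaches P (Suc (?T * length xs + 1)) (pc c + ?L) base (drain i F xs (F x ?s)) c'"
          by (intro reaches_step[OF 4]) (simp_all add: c4_def frame_def)
      qed
      moreover have "frame base c c1" "frame base c1 c2" "frame base c2 c3"
        using rd by (simp_all add: frame_def c1_def c2_def c3_def)
      ultimately have "reaches P (Suc (Suc (k + (Ts + Suc (?T * length xs + 1))))) (pc c + ?L) base
          (drain i F xs (F x ?s)) c"
        by (intro reaches_step[OF 1] reaches_step[OF 2] reaches_steps[OF 3])
      then show "reaches P (?T * length (x # xs) + 1) (pc c + ?L) base (drain i F (x # xs) s) c"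
        unfolding drain.simps by (rule reaches_mono) (simp add: algebra_simps)
    qed
  qed
  have len: "length (s i) \<le> total s" for s
    unfolding total_def using member_le_sum[OF assms(2), of "\<lambda>i. length (s i)"] finite_I by simp
  show ?thesis
  proof (rule lin_imp_intro[where T = "?T + 1"])
    show "length (?code a) = ?L" for a using w(1) by simp
    fix s assume s: "valid s"
    note r = run[OF s HOL.refl]
    show "valid (for_each i F s)" using r by (simp add: for_each_def)
    have "total (for_each i F s) \<le> total s + Ts * length (s i)" using r unfolding for_each_def by blast
    also have "\<dots> \<le> total s + Ts * total s" using len by (intro add_left_mono mult_le_mono2)
    also have "\<dots> = (Ts + 1) * total s" by simp
    also have "\<dots> \<le> (?T + 1) * (total s + 1)" by (intro mult_le_mono) simp_all
    finally show "total (for_each i F s) \<le> (?T + 1) * (total s + 1)" .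
    fix P base c
    assume "code_at P (pc c) (?code (pc c))" "holds base s c"
    then have "reaches P (?T * length (s i) + 1) (pc c + ?L) base (for_each i F s) c"
      using r unfolding for_each_def by blast
    moreover have "?T * length (s i) \<le> ?T * total s" using len by (intro mult_le_mono2)
    then have "?T * length (s i) + 1 \<le> (?T + 1) * (total s + 1)" by (simp add: algebra_simps)
    ultimately show "reaches P ((?T + 1) * (total s + 1)) (pc c + ?L) base (for_each i F s) c"
      by (rule reaches_mono)
  qed
qed

section \<open>Loading the input and reading off the answer\<close>

definition runs :: "program \<Rightarrow> nat \<Rightarrow> config \<Rightarrow> config \<Rightarrow> bool" where
  "runs P T c c' \<longleftrightarrow> (\<exists>t\<le>T. (step P ^^ t) c = c')"

lemma runs_trans:
  assumes "runs P T c c'" "runs P T' c' c''"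
  shows "runs P (T + T') c c''"
proof -
  obtain t t' where t: "t \<le> T" "(step P ^^ t) c = c'" "t' \<le> T'" "(step P ^^ t') c' = c''"
    using assms by (auto simp: runs_def)
  then have "(step P ^^ (t' + t)) c = c''" by (simp add: funpow_add)
  then show ?thesis unfolding runs_def using t(1,3) by (intro exI[of _ "t' + t"]) simp
qed

lemma runs_refl: "runs P T c c"
  unfolding runs_def by (rule exI[of _ 0]) simp

lemma runs_step: "step P c = c' \<Longrightarrow> runs P T c' c'' \<Longrightarrow> runs P (Suc T) c c''"
  unfolding runs_def
proof (elim exE conjE)
  fix t assume "step P c = c'" "t \<le> T" "(step P ^^ t) c' = c''"
  then have "(step P ^^ Suc t) c = c''" by (simp only: funpow_Suc_right o_apply)
  then show "\<exists>t\<le>Suc T. (step P ^^ t) c = c''" using \<open>t \<le> T\<close> by (intro exI[of _ "Suc t"]) simp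
qed

lemma runs_mono: "runs P T c c' \<Longrightarrow> T \<le> T' \<Longrightarrow> runs P T' c c'"
  unfolding runs_def using le_trans by blast

lemma runs_one: "step P c = c' \<Longrightarrow> runs P 1 c c'"
  by (auto simp: runs_def intro: exI[of _ 1])

lemma reaches_runs:
  "reaches P T b base s c \<longleftrightarrow> (\<exists>c'. runs P T c c' \<and> pc c' = b \<and> holds base s c' \<and> frame base c c')"
  unfolding reaches_def runs_def by blast

abbreviation "rp \<equiv> 2 * k + 2"
abbreviation "rz \<equiv> 2 * k + 3"

text \<open>Moves \<open>rp\<close> behind the next terminating \<open>0\<close>. Run twice, it
  leaves in \<open>rp\<close> the first address behind the input, which becomes \<open>base\<close>.
  Register \<open>rz\<close> keeps its initial value and serves as the constant
  \<open>0\<close>.\<close>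

definition scan :: "nat \<Rightarrow> instr list" where
  "scan a = [Load ta rp, Incr rp, JumpEq ta rz (a + 4), JumpEq ta ta a]"

lemma runs_scan:
  assumes "code_at P (pc c) (scan (pc c))" "reg c rz = 0" "\<forall>j<n. mem c (reg c rp + j) \<noteq> 0"
    "mem c (reg c rp + n) = 0"
  shows "\<exists>c'. runs P (4 * (n + 1)) c c' \<and> pc c' = pc c + 4 \<and> mem c' = mem c \<and> reg c' rz = 0
    \<and> reg c' rp = reg c rp + n + 1"
  using assms
proof (induction n arbitrary: c)
  case 0
  define c1 where "c1 = c\<lparr>pc := pc c + 1, reg := (reg c)(ta := 0)\<rparr>"
  define c2 where "c2 = c1\<lparr>pc := pc c + 2, reg := (reg c1)(rp := reg c rp + 1)\<rparr>"
  define c3 where "c3 = c2\<lparr>pc := pc c + 4\<rparr>"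
  have 1: "step P c = c1" using 0 by (simp add: step_def c1_def scan_def)
  have 2: "step P c1 = c2" using 0 by (simp add: step_def c1_def c2_def scan_def)
  have 3: "step P c2 = c3" using 0 by (simp add: step_def c1_def c2_def c3_def scan_def)
  have "runs P (Suc (Suc (Suc 0))) c c3" by (intro runs_step[OF 1] runs_step[OF 2] runs_step[OF 3] runs_refl)
  then have "runs P (4 * (0 + 1)) c c3" by (rule runs_mono) simp
  then show ?case using 0 by (intro exI[of _ c3]) (simp add: c1_def c2_def c3_def)
next
  case (Suc n)
  define c1 where "c1 = c\<lparr>pc := pc c + 1, reg := (reg c)(ta := mem c (reg c rp))\<rparr>"
  define c2 where "c2 = c1\<lparr>pc := pc c + 2, reg := (reg c1)(rp := reg c rp + 1)\<rparr>"
  define c3 where "c3 = c2\<lparr>pc := pc c + 3\<rparr>"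
  define c4 where "c4 = c3\<lparr>pc := pc c\<rparr>"
  have nz: "mem c (reg c rp) \<noteq> 0" using Suc.prems(3)[rule_format, of 0] by simp
  have 1: "step P c = c1" using Suc.prems by (simp add: step_def c1_def scan_def)
  have 2: "step P c1 = c2" using Suc.prems by (simp add: step_def c1_def c2_def scan_def)
  have 3: "step P c2 = c3" using Suc.prems nz by (simp add: step_def c1_def c2_def c3_def scan_def)
  have 4: "step P c3 = c4" using Suc.prems by (simp add: step_def c1_def c2_def c3_def c4_def scan_def numeral_3_eq_3)
  have "\<exists>c'. runs P (4 * (n + 1)) c4 c' \<and> pc c' = pc c4 + 4 \<and> mem c' = mem c4 \<and> reg c' rz = 0
    \<and> reg c' rp = reg c4 rp + n + 1"
  proof (rule Suc.IH)
    show "\<forall>j<n. mem c4 (reg c4 rp + j) \<noteq> 0"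
    proof (intro allI impI)
      fix j assume "j < n"
      then show "mem c4 (reg c4 rp + j) \<noteq> 0"
        using Suc.prems(3)[rule_format, of "Suc j"] by (simp add: c1_def c2_def c3_def c4_def)
    qed
  qed (use Suc.prems in \<open>simp_all add: c1_def c2_def c3_def c4_def\<close>)
  then obtain c' where c': "runs P (4 * (n + 1)) c4 c'" "pc c' = pc c4 + 4" "mem c' = mem c4" "reg c' rz = 0"
    "reg c' rp = reg c4 rp + n + 1" by blast
  have "runs P (Suc (Suc (Suc (Suc (4 * (n + 1)))))) c c'"
    by (intro runs_step[OF 1] runs_step[OF 2] runs_step[OF 3] runs_step[OF 4] c'(1))
  then show ?case using c' by (intro exI[of _ c']) (simp add: c1_def c2_def c3_def c4_def)
qed

definition init_deques :: "'i list \<Rightarrow> instr list" where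
  "init_deques js = concat (map (\<lambda>i. Copy (lo i) rp # replicate (num i) (Incr (lo i)) @ [Copy (hi i) (lo i)]) js)"

lemma runs_init_deques:
  assumes "code_at P (pc c) (init_deques js)" "set js \<subseteq> I"
  shows "\<exists>c'. runs P (length (init_deques js)) c c' \<and> pc c' = pc c + length (init_deques js) \<and> mem c' = mem c \<and>
    (\<forall>r\<ge>2 * k. reg c' r = reg c r) \<and> (\<forall>i\<in>set js. reg c' (lo i) = reg c rp + num i \<and> reg c' (hi i) = reg c rp + num i)"
  using assms
proof (induction "js" arbitrary: c rule: rev_induct)
  case Nil
  then show ?case by (intro exI[of _ c]) (simp add: init_deques_def runs_refl)
next
  case (snoc i "js")
  have "code_at P (pc c) (init_deques js)" using snoc.prems by (simp add: init_deques_def)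
  with snoc obtain c0 where c0: "runs P (length (init_deques js)) c c0" "pc c0 = pc c + length (init_deques js)" "mem c0 = mem c"
    "\<forall>r\<ge>2 * k. reg c0 r = reg c r"
    "\<forall>i\<in>set js. reg c0 (lo i) = reg c rp + num i \<and> reg c0 (hi i) = reg c rp + num i" by fastforce
  let ?code = "Copy (lo i) rp # replicate (num i) (Incr (lo i)) @ [Copy (hi i) (lo i)]"
  have at: "code_at P (pc c0) ?code" using snoc.prems c0(2) by (simp add: init_deques_def)
  have i: "i \<in> I" using snoc.prems by simp
  note rd = regs_distinct[OF i]
  define c1 where "c1 = c0\<lparr>pc := pc c0 + 1, reg := (reg c0)(lo i := reg c0 rp)\<rparr>"
  define c2 where "c2 = c1\<lparr>pc := pc c1 + num i, reg := (reg c1)(lo i := reg c1 (lo i) + num i)\<rparr>"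
  define c3 where "c3 = c2\<lparr>pc := pc c2 + 1, reg := (reg c2)(hi i := reg c2 (lo i))\<rparr>"
  have 1: "step P c0 = c1" using at by (simp add: step_def c1_def)
  have 2: "(step P ^^ num i) c1 = c2" unfolding c2_def by (rule step_Incrs) (use at in \<open>simp add: c1_def\<close>)
  have 3: "step P c2 = c3" using at by (simp add: step_def c1_def c2_def c3_def)
  have "runs P (num i) c1 c2" using 2 unfolding runs_def by blast
  then have "runs P (length (init_deques js) + (1 + (num i + 1))) c c3" by (intro runs_trans[OF c0(1)] runs_trans[OF runs_one[OF 1]] runs_trans[OF _ runs_one[OF 3]])
  moreover have "length (init_deques (js @ [i])) = length (init_deques js) + (1 + (num i + 1))" by (simp add: init_deques_def)
  moreover have "reg c3 (lo j) = reg c rp + num j \<and> reg c3 (hi j) = reg c rp + num j" if "j \<in> set (js @ [i])" for j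
  proof (cases "num j = num i")
    case True
    then show ?thesis using c0(4) rd by (simp add: c3_def c2_def c1_def)
  next
    case False
    then have "j \<in> set js" using that by auto
    moreover have "lo j \<noteq> hi i" "hi j \<noteq> lo i" by presburger+
    ultimately show ?thesis using c0(5) False by (simp add: c3_def c2_def c1_def)
  qed
  moreover have "\<forall>r\<ge>2 * k. reg c3 r = reg c r" using c0(4) rd by (auto simp: c3_def c2_def c1_def)
  moreover have "mem c3 = mem c" "pc c3 = pc c + (length (init_deques js) + (1 + (num i + 1)))"
    using c0 by (simp_all add: c3_def c2_def c1_def)
  ultimately show ?case by (intro exI[of _ c3]) simp
qed

lemma init_deques_holds:
  assumes "set js = I" "\<forall>i\<in>set js. reg c (lo i) = base + num i \<and> reg c (hi i) = base + num i"
  shows "holds base (\<lambda>_. []) c"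
  unfolding holds_def using assms by (auto intro!: exI[of _ 0] simp: addr_def)

lemma runs_load:
  assumes sw: "sw_realizes key B cs Ls Ts (\<lambda>l. push d (f l))"
    and code: "\<And>a. code a = [Load ta rp, Incr rp, JumpEq ta rz (a + (Ls + 4))] @ cs (a + 3) @ [JumpEq ta ta a]"
    and "code_at P (pc c) (code (pc c))" "holds base s c" "valid s" "reg c rz = 0"
    and "\<forall>l\<in>B. key l > 0" "set u \<subseteq> B"
    and "\<forall>j<length u. mem c (reg c rp + j) = key (u ! j)" "mem c (reg c rp + length u) = 0"
    and "reg c rp + length u < base"
  shows "\<exists>c'. runs P ((Ts + 4) * (length u + 1)) c c' \<and> pc c' = pc c + (Ls + 4)
     \<and> holds base (s(d := s d @ map f u)) c' \<and> valid (s(d := s d @ map f u))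
     \<and> reg c' rz = 0 \<and> reg c' rp = reg c rp + length u + 1 \<and> (\<forall>x<base. mem c' x = mem c x)"
  using assms(3-)
proof (induction u arbitrary: c s)
  case Nil
  note w = sw_realizesD[OF sw]
  define c1 where "c1 = c\<lparr>pc := pc c + 1, reg := (reg c)(ta := 0)\<rparr>"
  define c2 where "c2 = c1\<lparr>pc := pc c + 2, reg := (reg c1)(rp := reg c rp + 1)\<rparr>"
  define c3 where "c3 = c2\<lparr>pc := pc c + (Ls + 4)\<rparr>"
  have at: "code_at P (pc c) ([Load ta rp, Incr rp, JumpEq ta rz (pc c + (Ls + 4))] @ cs (pc c + 3) @ [JumpEq ta ta (pc c)])"
    using Nil(1) by (simp only: code)
  have 1: "step P c = c1" using at Nil by (simp add: step_def c1_def)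
  have 2: "step P c1 = c2" using at by (simp add: step_def c1_def c2_def)
  have 3: "step P c2 = c3" using at Nil by (simp add: step_def c1_def c2_def c3_def)
  have "runs P (Suc (Suc (Suc 0))) c c3" by (intro runs_step[OF 1] runs_step[OF 2] runs_step[OF 3] runs_refl)
  then have "runs P ((Ts + 4) * (length [] + 1)) c c3" by (rule runs_mono) simp
  moreover have "holds base s c3" by (rule holds_cong[OF Nil(2)]) (simp_all add: c1_def c2_def c3_def)
  ultimately show ?case using Nil by (intro exI[of _ c3]) (simp add: c1_def c2_def c3_def fun_upd_idem)
next
  case (Cons l u)
  note w = sw_realizesD[OF sw]
  define c1 where "c1 = c\<lparr>pc := pc c + 1, reg := (reg c)(ta := key l)\<rparr>"
  define c2 where "c2 = c1\<lparr>pc := pc c + 2, reg := (reg c1)(rp := reg c rp + 1)\<rparr>"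
  define c3 where "c3 = c2\<lparr>pc := pc c + 3\<rparr>"
  have at: "code_at P (pc c) ([Load ta rp, Incr rp, JumpEq ta rz (pc c + (Ls + 4))] @ cs (pc c + 3) @ [JumpEq ta ta (pc c)])"
    using Cons.prems(1) by (simp only: code)
  have l: "l \<in> B" "key l \<noteq> 0" using Cons.prems(5,6) by auto
  have 1: "step P c = c1" using at Cons.prems(7)[rule_format, of 0] by (simp add: step_def c1_def)
  have 2: "step P c1 = c2" using at by (simp add: step_def c1_def c2_def)
  have 3: "step P c2 = c3" using at l Cons.prems(4) by (simp add: step_def c1_def c2_def c3_def numeral_3_eq_3)
  have "holds base s c3" by (rule holds_cong[OF Cons.prems(2)]) (simp_all add: c1_def c2_def c3_def)
  moreover have "code_at P (pc c3) (cs (pc c3))" using at by (simp add: c3_def numeral_3_eq_3)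
  ultimately have "reaches P Ts (pc c3 + Ls) base (push d (f l) s) c3"
    using w(4)[OF Cons.prems(3) l(1), of P c3 base] by (simp add: c1_def c2_def c3_def)
  then obtain c4 where c4: "runs P Ts c3 c4" "pc c4 = pc c3 + Ls" "holds base (push d (f l) s) c4" "frame base c3 c4"
    unfolding reaches_runs by blast
  define c5 where "c5 = c4\<lparr>pc := pc c\<rparr>"
  have 5: "step P c4 = c5" using at c4(2) w(1) by (simp add: step_def c5_def c3_def numeral_3_eq_3)
  let ?s = "push d (f l) s"
  have r: "reg c5 rz = 0" "reg c5 rp = reg c rp + 1" "\<And>x. x < base \<Longrightarrow> mem c5 x = mem c x"
    using c4(4) Cons.prems(4) by (simp_all add: frame_def c5_def c1_def c2_def c3_def)
  have "\<exists>c'. runs P ((Ts + 4) * (length u + 1)) c5 c' \<and> pc c' = pc c5 + (Ls + 4)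
     \<and> holds base (?s(d := ?s d @ map f u)) c' \<and> valid (?s(d := ?s d @ map f u))
     \<and> reg c' rz = 0 \<and> reg c' rp = reg c5 rp + length u + 1 \<and> (\<forall>x<base. mem c' x = mem c5 x)"
  proof (rule Cons.IH)
    show "code_at P (pc c5) (code (pc c5))" using Cons.prems(1) by (simp add: c5_def)
    show "holds base ?s c5" by (rule holds_cong[OF c4(3)]) (simp_all add: c5_def)
    show "valid ?s" using w(2)[OF Cons.prems(3) l(1)] .
    show "\<forall>j<length u. mem c5 (reg c5 rp + j) = key (u ! j)"
    proof (intro allI impI)
      fix j assume "j < length u"
      then show "mem c5 (reg c5 rp + j) = key (u ! j)"
        using Cons.prems(7)[rule_format, of "Suc j"] Cons.prems(9) r by simp
    qed
  qed (use Cons.prems r in simp_all)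
  then obtain c' where c': "runs P ((Ts + 4) * (length u + 1)) c5 c'" "pc c' = pc c5 + (Ls + 4)"
     "holds base (?s(d := ?s d @ map f u)) c'" "valid (?s(d := ?s d @ map f u))"
     "reg c' rz = 0" "reg c' rp = reg c5 rp + length u + 1" "\<forall>x<base. mem c' x = mem c5 x" by blast
  have "runs P (Suc (Suc (Suc (Ts + Suc ((Ts + 4) * (length u + 1)))))) c c'"
    by (intro runs_step[OF 1] runs_step[OF 2] runs_step[OF 3] runs_trans[OF c4(1)] runs_step[OF 5] c'(1))
  then have "runs P ((Ts + 4) * (length (l # u) + 1)) c c'" by (rule runs_mono) simp
  moreover have eq: "?s(d := ?s d @ map f u) = s(d := s d @ map f (l # u))" by (simp add: push_def)
  moreover have "pc c' = pc c + (Ls + 4)" "reg c' rp = reg c rp + length (l # u) + 1"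
    "\<forall>x<base. mem c' x = mem c x"
    using c' r by (simp_all add: c5_def)
  ultimately show ?case using c'(3-5) unfolding eq by blast
qed

theorem lin_imp_decides:
  assumes f: "lin_imp f" and d: "d1 \<in> I" "d2 \<in> I" "d1 \<noteq> d2" "out \<in> I"
    and B: "finite B" "inj_on key B" "\<forall>l\<in>B. key l > 0" "\<And>l. l \<in> B \<Longrightarrow> ld l \<in> A"
  shows "\<exists>P K. \<forall>u\<in>lists B. \<forall>v\<in>lists B.
    answers_within P (map key u @ [0] @ map key v) (K * (length u + length v + 1))
      (f ((\<lambda>_. [])(d1 := map ld u, d2 := map ld v)) out \<noteq> [])"
proof -
  obtain cf Lf Tf where R: "lin_realizes cf Lf Tf f" using f unfolding lin_imp_def by blast
  note fr = lin_realizesD[OF R]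
  obtain bs where bs: "set bs = B" "distinct bs" using finite_distinct_list[OF B(1)] by blast
  obtain js where js: "set js = I" using finite_list[OF finite_I] by blast
  have sw: "\<exists>cs Ls Ts. sw_realizes key B cs Ls Ts (\<lambda>l. push d (ld l))" if "d \<in> I" for d
    using switch_code[of bs "\<lambda>l. push d (ld l)" key] bs B imp_push[OF that] by auto
  obtain c1 L1 T1 where sw1: "sw_realizes key B c1 L1 T1 (\<lambda>l. push d1 (ld l))" using sw[OF d(1)] by blast
  obtain c2 L2 T2 where sw2: "sw_realizes key B c2 L2 T2 (\<lambda>l. push d2 (ld l))" using sw[OF d(2)] by blast
  define load1 where "load1 = (\<lambda>a. [Load ta rp, Incr rp, JumpEq ta rz (a + (L1 + 4))] @ c1 (a + 3) @ [JumpEq ta ta a])"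
  define load2 where "load2 = (\<lambda>a. [Load ta rp, Incr rp, JumpEq ta rz (a + (L2 + 4))] @ c2 (a + 3) @ [JumpEq ta ta a])"
  define S where "S = length (init_deques js)"
  \<comment> \<open>Two scanners of 4 instructions each, \<open>S\<close> instructions for the
    pointers, and \<open>Const rp 0\<close>.\<close>
  define a1 where "a1 = 8 + S + 1"
  define a2 where "a2 = a1 + (L1 + 4)"
  define a3 where "a3 = a2 + (L2 + 4)"
  define a4 where "a4 = a3 + Lf"
  \<comment> \<open>The input is read twice: the scanners only locate its end, behind which the
    deques live; after rewinding \<open>rp\<close> the loaders push the letters.\<close>
  define P where "P = scan 0 @ scan 4 @ init_deques js @ [Const rp 0] @ load1 a1 @ load2 a2 @ cf a3
     @ [JumpEq (lo out) (hi out) (a4 + 2), Halt True, Halt False]"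
  \<comment> \<open>One summand for each phase of the run; the cost of a phase is at most its
    summand times \<open>length u + length v + 1\<close>.\<close>
  define K where "K = 4 + 4 + S + 1 + (T1 + 4) + (T2 + 4) + Tf + 1"
  have len: "length (scan a) = 4" "length (load1 a) = L1 + 4" "length (load2 a) = L2 + 4" "length (cf a) = Lf" for a
    using sw_realizesD(1)[OF sw1] sw_realizesD(1)[OF sw2] fr(1) by (simp_all add: scan_def load1_def load2_def)
  have "code_at P 0 P" using code_at_self[of P "[]"] by simp
  then have "code_at P 0 (scan 0 @ scan 4 @ init_deques js @ [Const rp 0] @ load1 a1 @ load2 a2 @ cf a3
     @ [JumpEq (lo out) (hi out) (a4 + 2), Halt True, Halt False])"
    by (subst (asm) (2) P_def)
  then have at: "code_at P 0 (scan 0)" "code_at P 4 (scan 4)" "code_at P 8 (init_deques js)" "code_at P (8 + S) [Const rp 0]"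
    "code_at P a1 (load1 a1)" "code_at P a2 (load2 a2)" "code_at P a3 (cf a3)"
    "code_at P a4 [JumpEq (lo out) (hi out) (a4 + 2), Halt True, Halt False]"
    unfolding code_at_append len by (simp_all add: S_def a1_def a2_def a3_def a4_def add.commute add.left_commute)
  have "answers_within P (map key u @ [0] @ map key v) (K * (length u + length v + 1))
      (f ((\<lambda>_. [])(d1 := map ld u, d2 := map ld v)) out \<noteq> [])" if u: "u \<in> lists B" and v: "v \<in> lists B" for u v
  proof -
    let ?in = "map key u @ [0] @ map key v" and ?n = "length u" and ?m = "length v"
    let ?base = "?n + 1 + (?m + 1)"
    define i0 where "i0 = initial ?in"
    have m0: "\<forall>j<?n. mem i0 j = key (u ! j)" "mem i0 ?n = 0" "\<forall>j<?m. mem i0 (?n + 1 + j) = key (v ! j)"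
      "mem i0 (?n + 1 + ?m) = 0"
      by (auto simp: i0_def initial_def nth_append)
    have pos: "\<forall>j<?n. key (u ! j) \<noteq> 0" "\<forall>j<?m. key (v ! j) \<noteq> 0"
      using u v B(3) by (auto simp: in_lists_conv_set)
    have r0: "reg i0 = (\<lambda>_. 0)" "pc i0 = 0" by (simp_all add: i0_def initial_def)
    obtain i1 where i1: "runs P (4 * (?n + 1)) i0 i1" "pc i1 = 4" "mem i1 = mem i0" "reg i1 rz = 0" "reg i1 rp = ?n + 1"
      using runs_scan[of P i0 ?n] at(1) r0 m0 pos by auto
    obtain i2 where i2: "runs P (4 * (?m + 1)) i1 i2" "pc i2 = 8" "mem i2 = mem i0" "reg i2 rz = 0" "reg i2 rp = ?base"
      using runs_scan[of P i1 ?m] at(2) i1 m0 pos by auto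
    obtain i3 where i3: "runs P S i2 i3" "pc i3 = 8 + S" "mem i3 = mem i0" "reg i3 rz = 0"
      "\<forall>i\<in>set js. reg i3 (lo i) = ?base + num i \<and> reg i3 (hi i) = ?base + num i"
      using runs_init_deques[of P i2 js] at(3) i2 js by (auto simp: S_def)
    define i4 where "i4 = i3\<lparr>pc := a1, reg := (reg i3)(rp := 0)\<rparr>"
    have 4: "step P i3 = i4" using at(4) i3 by (simp add: step_def i4_def a1_def)
    have "holds ?base (\<lambda>_. []) i3" by (rule init_deques_holds[OF js i3(5)])
    then have h4: "holds ?base (\<lambda>_. []) i4" by (rule holds_cong) (simp_all add: i4_def)
    have mem4: "mem i4 = mem i0" "reg i4 rz = 0" "reg i4 rp = 0" "pc i4 = a1" using i3 by (simp_all add: i4_def)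
    let ?s1 = "(\<lambda>_. [])(d1 := map ld u)"
    have "\<exists>c'. runs P ((T1 + 4) * (?n + 1)) i4 c' \<and> pc c' = pc i4 + (L1 + 4)
       \<and> holds ?base ((\<lambda>_. [])(d1 := [] @ map ld u)) c' \<and> valid ((\<lambda>_. [])(d1 := [] @ map ld u))
       \<and> reg c' rz = 0 \<and> reg c' rp = reg i4 rp + ?n + 1 \<and> (\<forall>x<?base. mem c' x = mem i4 x)"
      by (rule runs_load[OF sw1, of load1])
        (use at h4 mem4 B(3) u m0 in \<open>auto simp: load1_def valid_def in_lists_conv_set\<close>)
    then obtain i5 where i5: "runs P ((T1 + 4) * (?n + 1)) i4 i5" "pc i5 = a2" "holds ?base ?s1 i5" "valid ?s1"
       "reg i5 rz = 0" "reg i5 rp = ?n + 1" "\<forall>x<?base. mem i5 x = mem i0 x"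
      using mem4 by (auto simp: a2_def)
    let ?s2 = "(\<lambda>_. [])(d1 := map ld u, d2 := map ld v)"
    have "\<exists>c'. runs P ((T2 + 4) * (?m + 1)) i5 c' \<and> pc c' = pc i5 + (L2 + 4)
       \<and> holds ?base (?s1(d2 := ?s1 d2 @ map ld v)) c' \<and> valid (?s1(d2 := ?s1 d2 @ map ld v))
       \<and> reg c' rz = 0 \<and> reg c' rp = reg i5 rp + ?m + 1 \<and> (\<forall>x<?base. mem c' x = mem i5 x)"
      by (rule runs_load[OF sw2, of load2])
        (use at i5 B(3) v m0 in \<open>auto simp: load2_def in_lists_conv_set\<close>)
    then obtain i6 where i6: "runs P ((T2 + 4) * (?m + 1)) i5 i6" "pc i6 = a3" "holds ?base ?s2 i6" "valid ?s2"
      using d(3) i5(2) by (auto simp: a3_def)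
    have "total ?s2 = (\<Sum>i\<in>I. if i = d1 then ?n else if i = d2 then ?m else 0)"
      unfolding total_def by (rule sum.cong) (use d(3) in auto)
    also have "\<dots> \<le> (\<Sum>i\<in>I. (if i = d1 then ?n else 0) + (if i = d2 then ?m else 0))"
      by (rule sum_mono) simp
    also have "\<dots> = ?n + ?m" using d finite_I by (simp add: sum.distrib)
    finally have tot: "total ?s2 \<le> ?n + ?m" .
    have "reaches P (Tf * (total ?s2 + 1)) (pc i6 + Lf) ?base (f ?s2) i6"
      by (rule fr(4)[OF i6(4) _ i6(3)]) (use at i6 in simp)
    then obtain i7 where i7: "runs P (Tf * (total ?s2 + 1)) i6 i7" "pc i7 = a4" "holds ?base (f ?s2) i7"
      unfolding reaches_runs using i6(2) by (auto simp: a4_def)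
    define i8 where "i8 = step P i7"
    have "answers P i8 (f ?s2 out \<noteq> [])"
      using at(8) i7(2) empty_iff_lo_eq_hi[OF i7(3) d(4)] by (auto simp: i8_def step_def answers_def)
    moreover have "runs P (4 * (?n + 1) + (4 * (?m + 1) + (S + Suc ((T1 + 4) * (?n + 1) + ((T2 + 4) * (?m + 1)
        + (Tf * (total ?s2 + 1) + 1)))))) i0 i8"
      by (intro runs_trans[OF i1(1)] runs_trans[OF i2(1)] runs_trans[OF i3(1)] runs_step[OF 4]
          runs_trans[OF i5(1)] runs_trans[OF i6(1)] runs_trans[OF i7(1)] runs_one) (simp add: i8_def)
    moreover have "4 * (?n + 1) + (4 * (?m + 1) + (S + Suc ((T1 + 4) * (?n + 1) + ((T2 + 4) * (?m + 1)
        + (Tf * (total ?s2 + 1) + 1))))) \<le> K * (?n + ?m + 1)"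
    proof -
      let ?N = "?n + ?m + 1"
      have "4 * (?n + 1) \<le> 4 * ?N" "4 * (?m + 1) \<le> 4 * ?N" "S \<le> S * ?N" "1 \<le> 1 * ?N"
        "(T1 + 4) * (?n + 1) \<le> (T1 + 4) * ?N" "(T2 + 4) * (?m + 1) \<le> (T2 + 4) * ?N"
        by (simp_all add: mult_le_mono trans_le_add1)
      moreover have "Tf * (total ?s2 + 1) \<le> Tf * ?N" using tot by (intro mult_le_mono2) simp
      moreover have "K * ?N = 4 * ?N + 4 * ?N + S * ?N + 1 * ?N + (T1 + 4) * ?N + (T2 + 4) * ?N + Tf * ?N + 1 * ?N"
        unfolding K_def by (simp only: distrib_right)
      ultimately show ?thesis by linarith
    qed
    ultimately show ?thesis
      unfolding answers_within_def runs_def i0_def using le_trans by blast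
  qed
  then show ?thesis by blast
qed

end

section \<open>Twisted right-angled Artin groups as twisted words\<close>

text \<open>\<open>J\<close> is the set of generators inverted by \<open>y\<close>. By
  \<open>J_comm\<close> the relation \<open>comm\<close> contains the Klein edges too, because they
  turn into commutations once the signs are untwisted.\<close>

locale traag_letters =
  fixes V :: "'a set" and comm :: "'a \<Rightarrow> 'a \<Rightarrow> bool" and y :: 'a and J :: "'a set"
  assumes comm_sym: "comm a b \<Longrightarrow> comm b a"
    and comm_irrefl: "\<not> comm a a"
    and comm_V: "comm a b \<Longrightarrow> a \<in> V"
    and y_V: "y \<in> V"
    and J_comm: "a \<in> J \<Longrightarrow> comm a y"
begin

text \<open>A letter \<open>y\<close> changes the parity, so an inverse standing right behind it
  carries the opposite mark. The two marks thus act like two generators exchanged by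
  \<theta>.\<close>

fun iv :: "'a \<times> bool \<times> bool \<Rightarrow> 'a \<times> bool \<times> bool" where
  "iv (a, e, m) = (a, \<not> e, m \<noteq> (a = y))"

fun th :: "bool \<Rightarrow> 'a \<times> bool \<times> bool \<Rightarrow> 'a \<times> bool \<times> bool" where
  "th t (a, e, m) = (a, e \<noteq> (t \<and> a \<in> J), m \<noteq> (t \<and> a = y))"

text \<open>One interpretation for both powers of \<theta>, \<open>th False\<close> being the
  identity. Notions that do not mention \<theta>, such as \<open>tw.teq\<close> and
  \<open>tw.irred\<close>, are common to both.\<close>

sublocale tw: twisted_letters comm fst iv "th eps" for eps
proof
  show "iv c \<noteq> c" for c by (cases c) auto
qed (auto simp: comm_sym comm_irrefl)

definition R :: "('a word \<times> 'a word) set" where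
  "R = {([(a, True), (b, True)], [(b, True), (a, True)]) | a b. comm a b \<and> \<not> (a = y \<and> b \<in> J) \<and> \<not> (b = y \<and> a \<in> J)}
     \<union> {([(a, True), (y, True), (a, True)], [(y, True)]) | a. a \<in> J}"

definition weq :: "'a word \<Rightarrow> 'a word \<Rightarrow> bool" (infix "\<equiv>\<^sub>w" 50) where
  "u \<equiv>\<^sub>w v \<longleftrightarrow> (u, v) \<in> word_eq V R"

declare in_lists_conv_set [simp del]

lemma y_notin_J: "y \<notin> J"
  using J_comm comm_irrefl by blast

lemma J_V: "a \<in> J \<Longrightarrow> a \<in> V"
  using J_comm comm_V by blast

lemma comm_V2: "comm a b \<Longrightarrow> b \<in> V"
  using comm_sym comm_V by blast

definition par :: "'a word \<Rightarrow> bool" where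
  "par w \<longleftrightarrow> odd (length (filter (\<lambda>c. fst c = y) w))"

lemma par_simps [simp]: "\<not> par []" "par (c # w) \<longleftrightarrow> (fst c = y) \<noteq> par w" "par (u @ v) \<longleftrightarrow> par u \<noteq> par v"
  by (auto simp: par_def)

text \<open>The decorated word \<open>hat s w\<close> is the image of \<open>w\<close> in the untwisted group: the sign of a letter
  of \<open>J\<close> is flipped once for every preceding \<open>y\<close>, with \<open>s\<close> the parity at the start, and each \<open>y\<close>
  carries the parity before it as a mark. The automorphism \<open>th True\<close> is conjugation by \<open>y\<close>.\<close>

fun hat :: "bool \<Rightarrow> 'a word \<Rightarrow> ('a \<times> bool \<times> bool) list" where
  "hat s [] = []"
| "hat s ((a, e) # w) = (a, e \<noteq> (s \<and> a \<in> J), s \<and> a = y) # hat (s \<noteq> (a = y)) w"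

fun unhat :: "bool \<Rightarrow> ('a \<times> bool \<times> bool) list \<Rightarrow> 'a word" where
  "unhat s [] = []"
| "unhat s ((a, e, m) # w) = (a, e \<noteq> (s \<and> a \<in> J)) # unhat (s \<noteq> (a = y)) w"

text \<open>The image of \<open>hat s\<close>. Rotations and cancellations make sense on all
  decorated words, but only the marked ones can be read back faithfully.\<close>

fun marked :: "bool \<Rightarrow> ('a \<times> bool \<times> bool) list \<Rightarrow> bool" where
  "marked s [] \<longleftrightarrow> True"
| "marked s ((a, e, m) # w) \<longleftrightarrow> m = (s \<and> a = y) \<and> marked (s \<noteq> (a = y)) w"

lemma unhat_hat [simp]: "unhat s (hat s w) = w"
  by (induction s w rule: hat.induct) auto

lemma hat_unhat: "marked s w \<Longrightarrow> hat s (unhat s w) = w"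
  by (induction s w rule: unhat.induct) auto

lemma marked_hat [simp]: "marked s (hat s w)"
  by (induction s w rule: hat.induct) auto

lemma odd_hat [simp]: "tw.odd_gen y (hat s w) = par w"
  by (induction s w rule: hat.induct) auto

lemma par_unhat [simp]: "par (unhat s w) = tw.odd_gen y w"
  by (induction s w rule: unhat.induct) auto

lemma hat_append: "hat s (u @ v) = hat s u @ hat (s \<noteq> par u) v"
proof (induction s u rule: hat.induct)
  case (2 s a e w)
  have "(s \<noteq> (a = y)) \<noteq> par w \<longleftrightarrow> s \<noteq> ((a = y) \<noteq> par w)" by blast
  with 2 show ?case by simp
qed simp

lemma unhat_append: "unhat s (u @ v) = unhat s u @ unhat (s \<noteq> tw.odd_gen y u) v"
proof (induction s u rule: unhat.induct)
  case (2 s a e m w)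
  have "(s \<noteq> (a = y)) \<noteq> tw.odd_gen y w \<longleftrightarrow> s \<noteq> ((a = y) \<noteq> tw.odd_gen y w)" by blast
  with 2 show ?case by simp
qed simp

lemma marked_append: "marked s (u @ v) \<longleftrightarrow> marked s u \<and> marked (s \<noteq> tw.odd_gen y u) v"
proof (induction s u rule: marked.induct)
  case (2 s a e m w)
  have "(s \<noteq> (a = y)) \<noteq> tw.odd_gen y w \<longleftrightarrow> s \<noteq> ((a = y) \<noteq> tw.odd_gen y w)" by blast
  with 2 show ?case by simp
qed simp

lemma unhat_letters: "fst ` set w \<subseteq> V \<Longrightarrow> unhat s w \<in> lists (letters V)"
  by (induction s w rule: unhat.induct) (auto simp: letters_def)

lemma hat_gens: "w \<in> lists (letters V) \<Longrightarrow> fst ` set (hat s w) \<subseteq> V"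
  by (induction s w rule: hat.induct) (auto simp: letters_def)

lemma map_th_hat: "map (th t) (hat s w) = hat (s \<noteq> t) w"
proof (induction s w rule: hat.induct)
  case (2 s a e w)
  have "(s \<noteq> (a = y)) \<noteq> t \<longleftrightarrow> (s \<noteq> t) \<noteq> (a = y)" by blast
  with 2 show ?case by auto
qed simp

lemma weq_geq_hat:
  assumes "u \<equiv>\<^sub>w v"
  shows "tw.geq (hat s u) (hat s v) \<and> par u = par v"
  using assms unfolding weq_def
proof (induction arbitrary: s rule: word_eq.induct)
  case (refl w)
  then show ?case by (simp add: tw.geq_teq)
next
  case (sym v w)
  then show ?case using tw.geq_sym by metis
next
  case (trans u v w)
  then show ?case using tw.geq_trans by metis
next
  case (cancel p q a e)
  define t where "t = (s \<noteq> par p)"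
  define c where "c = (a, e \<noteq> (t \<and> a \<in> J), t \<and> a = y)"
  have ce: "hat t [(a, e), (a, \<not> e)] = [c, iv c]" using y_notin_J by (auto simp: c_def)
  have "t \<noteq> par [(a, e), (a, \<not> e)] \<longleftrightarrow> t" by auto
  then have "hat s (p @ [(a, e), (a, \<not> e)] @ q) = hat s p @ [c, iv c] @ hat t q"
    unfolding hat_append ce[symmetric] t_def[symmetric] by (simp only:)
  moreover have "hat s (p @ q) = hat s p @ hat t q" by (simp add: hat_append t_def)
  ultimately show ?case using tw.geq_cancel[of "hat s p" c "hat t q"] by auto
next
  case (rel p q l r)
  have "tw.geq (hat t l) (hat t r) \<and> par l = par r" for t
  proof -
    from rel(3) consider a b where "l = [(a, True), (b, True)]" "r = [(b, True), (a, True)]" "comm a b"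
        "\<not> (a = y \<and> b \<in> J)" "\<not> (b = y \<and> a \<in> J)"
      | a where "l = [(a, True), (y, True), (a, True)]" "r = [(y, True)]" "a \<in> J"
      unfolding R_def by blast
    then show ?thesis
    proof cases
      case 1
      have "a \<noteq> b" using 1(3) comm_irrefl by blast
      obtain c d where cd: "hat t l = [c, d]" "hat t r = [d, c]" "fst c = a" "fst d = b"
        using 1 \<open>a \<noteq> b\<close> by auto
      have "tw.teq [c, d] [d, c]" using tw.teq_move[of "[d]" c] cd 1(3) by (simp add: tw.lcomm_def)
      then show ?thesis using cd 1 by (auto intro: tw.geq_teq)
    next
      case 2
      \<comment> \<open>The second \<open>a\<close> stands behind \<open>y\<close> and so is
        decorated with the opposite sign: the Klein relation becomes c d iv(c) = d, where
        \<open>c\<close> and \<open>d\<close> commute.\<close>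
      define c where "c = (a, True \<noteq> t, False)"
      define d where "d = (y, True, t)"
      have "a \<noteq> y" using 2(3) y_notin_J by blast
      then have l: "hat t l = [c, d, iv c]" "hat t r = [d]" using 2 y_notin_J by (auto simp: c_def d_def)
      have "tw.teq [c, d] [d, c]"
        using tw.teq_move[of "[d]" c] J_comm[OF 2(3)] by (simp add: tw.lcomm_def c_def d_def)
      then have "tw.teq ([c, d] @ [iv c]) ([d, c] @ [iv c])" by (intro tw.teq_append) simp_all
      then have "tw.geq [c, d, iv c] ([d] @ c # iv c # [])" by (simp add: tw.geq_teq)
      then have "tw.geq [c, d, iv c] [d]" using tw.geq_cancel[of "[d]" c "[]"] tw.geq_trans by fastforce
      then show ?thesis using l 2 \<open>a \<noteq> y\<close> by simp
    qed
  qed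
  then have "tw.geq (hat s p @ hat (s \<noteq> par p) l @ hat ((s \<noteq> par p) \<noteq> par l) q)
      (hat s p @ hat (s \<noteq> par p) r @ hat ((s \<noteq> par p) \<noteq> par l) q)" and "par l = par r"
    by (blast intro: tw.geq_context)+
  then show ?case by (simp add: hat_append)
qed

lemma weq_lists: "u \<equiv>\<^sub>w v \<Longrightarrow> u \<in> lists (letters V) \<and> v \<in> lists (letters V)"
  unfolding weq_def by (rule word_eq_lists)

lemma weq_refl: "w \<in> lists (letters V) \<Longrightarrow> w \<equiv>\<^sub>w w"
  unfolding weq_def by (rule word_eq.refl)

lemma weq_sym: "u \<equiv>\<^sub>w v \<Longrightarrow> v \<equiv>\<^sub>w u"
  unfolding weq_def by (rule word_eq.sym)

lemma weq_trans [trans]: "u \<equiv>\<^sub>w v \<Longrightarrow> v \<equiv>\<^sub>w w \<Longrightarrow> u \<equiv>\<^sub>w w"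
  unfolding weq_def by (rule word_eq.trans)

lemma weq_context: "u \<equiv>\<^sub>w v \<Longrightarrow> s \<in> lists (letters V) \<Longrightarrow> t \<in> lists (letters V) \<Longrightarrow> s @ u @ t \<equiv>\<^sub>w s @ v @ t"
  unfolding weq_def by (rule word_eq_context)

lemma weq_cancel: "p \<in> lists (letters V) \<Longrightarrow> q \<in> lists (letters V) \<Longrightarrow> a \<in> V \<Longrightarrow> p @ (a, e) # (a, \<not> e) # q \<equiv>\<^sub>w p @ q"
  using word_eq.cancel[of p V q a e R] by (simp add: weq_def)

lemma weq_slide_inv:
  assumes "[(a, e), (b, f)] \<equiv>\<^sub>w [(b, f), (a, g)]"
  shows "[(a, \<not> e), (b, f)] \<equiv>\<^sub>w [(b, f), (a, \<not> g)]" "[(b, \<not> f), (a, e)] \<equiv>\<^sub>w [(a, g), (b, \<not> f)]"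
proof -
  have V: "(a, h) \<in> letters V" "(b, h) \<in> letters V" "a \<in> V" "b \<in> V" for h
    using weq_lists[OF assms] by (auto simp: letters_def)
  have "[(a, \<not> e), (b, f)] @ (a, g) # (a, \<not> g) # [] \<equiv>\<^sub>w [(a, \<not> e), (b, f)] @ []"
    by (rule weq_cancel) (use V in auto)
  moreover have "[(a, \<not> e)] @ [(a, e), (b, f)] @ [(a, \<not> g)] \<equiv>\<^sub>w [(a, \<not> e)] @ [(b, f), (a, g)] @ [(a, \<not> g)]"
    by (rule weq_context[OF assms]) (use V in auto)
  moreover have "[] @ (a, \<not> e) # (a, \<not> \<not> e) # [(b, f), (a, \<not> g)] \<equiv>\<^sub>w [] @ [(b, f), (a, \<not> g)]"
    by (rule weq_cancel) (use V in auto)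
  ultimately show "[(a, \<not> e), (b, f)] \<equiv>\<^sub>w [(b, f), (a, \<not> g)]"
    by (simp only: append_Cons append_Nil append_Nil2 append_assoc not_not) (blast intro: weq_sym weq_trans)
  have "[(b, \<not> f), (a, e)] @ (b, f) # (b, \<not> f) # [] \<equiv>\<^sub>w [(b, \<not> f), (a, e)] @ []"
    by (rule weq_cancel) (use V in auto)
  moreover have "[(b, \<not> f)] @ [(a, e), (b, f)] @ [(b, \<not> f)] \<equiv>\<^sub>w [(b, \<not> f)] @ [(b, f), (a, g)] @ [(b, \<not> f)]"
    by (rule weq_context[OF assms]) (use V in auto)
  moreover have "[] @ (b, \<not> f) # (b, \<not> \<not> f) # [(a, g), (b, \<not> f)] \<equiv>\<^sub>w [] @ [(a, g), (b, \<not> f)]"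
    by (rule weq_cancel) (use V in auto)
  ultimately show "[(b, \<not> f), (a, e)] \<equiv>\<^sub>w [(a, g), (b, \<not> f)]"
    by (simp only: append_Cons append_Nil append_Nil2 append_assoc not_not) (blast intro: weq_sym weq_trans)
qed

lemma weq_commute:
  assumes "comm a b" "\<not> (a = y \<and> b \<in> J)" "\<not> (b = y \<and> a \<in> J)"
  shows "[(a, e), (b, f)] \<equiv>\<^sub>w [(b, f), (a, e)]"
proof -
  have V: "a \<in> V" "b \<in> V" using comm_V comm_V2 assms by blast+
  have "([(a, True), (b, True)], [(b, True), (a, True)]) \<in> R" using assms unfolding R_def by blast
  then have TT: "[(a, True), (b, True)] \<equiv>\<^sub>w [(b, True), (a, True)]"
    using word_eq.rel[of "[]" V "[]" _ _ R] V by (simp add: weq_def letters_def)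
  then have T: "[(a, e), (b, True)] \<equiv>\<^sub>w [(b, True), (a, e)]" for e
    using weq_slide_inv(1)[of a True b True True] by (cases e) simp_all
  then show ?thesis
    using weq_sym[OF weq_slide_inv(2)[OF T[of e]]] T[of e] by (cases f) simp_all
qed

lemma weq_klein:
  assumes "a \<in> J"
  shows "[(a, e), (y, f)] \<equiv>\<^sub>w [(y, f), (a, \<not> e)]"
proof -
  have V: "a \<in> V" "y \<in> V" using J_V assms y_V by blast+
  have "([(a, True), (y, True), (a, True)], [(y, True)]) \<in> R" using assms unfolding R_def by blast
  then have 1: "[(a, True), (y, True), (a, True), (a, False)] \<equiv>\<^sub>w [(y, True), (a, False)]"
    using word_eq.rel[of "[]" V "[(a, False)]" "[(a, True), (y, True), (a, True)]" "[(y, True)]" R] V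
    by (simp add: weq_def letters_def)
  have "[(a, True), (y, True), (a, True), (a, False)] \<equiv>\<^sub>w [(a, True), (y, True)]"
    using weq_cancel[of "[(a, True), (y, True)]" "[]" a True] V by (simp add: letters_def)
  from weq_trans[OF weq_sym[OF this] 1] have "[(a, True), (y, True)] \<equiv>\<^sub>w [(y, True), (a, False)]" .
  then have T: "[(a, e), (y, True)] \<equiv>\<^sub>w [(y, True), (a, \<not> e)]" for e
    using weq_slide_inv(1)[of a True y True False] by (cases e) simp_all
  have F: "[(a, \<not> e), (y, False)] \<equiv>\<^sub>w [(y, False), (a, e)]" for e
    using weq_sym[OF weq_slide_inv(2)[OF T[of e]]] by simp
  show ?thesis using T[of e] F[of "\<not> e"] by (cases f) simp_all
qed

text \<open>Read back, a swap is a commutation relation, unless one letter is \<open>y\<close> and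
  the other is in \<open>J\<close>. Then the latter is read with opposite signs on the two sides of
  \<open>y\<close>, which is the Klein relation.\<close>

lemma unhat_swap:
  assumes "comm (fst c) (fst d)"
  shows "unhat s [c, d] \<equiv>\<^sub>w unhat s [d, c]" "marked s [c, d] \<longleftrightarrow> marked s [d, c]"
proof -
  obtain a e m where c: "c = (a, e, m)" by (cases c)
  obtain b f n where d: "d = (b, f, n)" by (cases d)
  have ab: "comm a b" "a \<noteq> b" using assms comm_irrefl c d by auto
  consider "a = y" "b \<in> J" | "b = y" "a \<in> J" | "\<not> (a = y \<and> b \<in> J)" "\<not> (b = y \<and> a \<in> J)" by blast
  then show "unhat s [c, d] \<equiv>\<^sub>w unhat s [d, c]"
  proof cases
    case 1
    then have "unhat s [c, d] = [(y, e), (b, f \<noteq> (\<not> s))]" "unhat s [d, c] = [(b, f \<noteq> s), (y, e)]"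
      using ab y_notin_J by (auto simp: c d)
    then show ?thesis using weq_sym[OF weq_klein[OF 1(2), of "f \<noteq> s" e]] by (cases f; cases s) simp_all
  next
    case 2
    then have "unhat s [c, d] = [(a, e \<noteq> s), (y, f)]" "unhat s [d, c] = [(y, f), (a, e \<noteq> (\<not> s))]"
      using ab y_notin_J by (auto simp: c d)
    then show ?thesis using weq_klein[OF 2(2), of "e \<noteq> s" f] by (cases e; cases s) simp_all
  next
    case 3
    have "unhat s [c, d] = [(a, e \<noteq> (s \<and> a \<in> J)), (b, f \<noteq> (s \<and> b \<in> J))]"
      "unhat s [d, c] = [(b, f \<noteq> (s \<and> b \<in> J)), (a, e \<noteq> (s \<and> a \<in> J))]"
      using ab 3 by (auto simp: c d)
    then show ?thesis using weq_commute[OF ab(1) 3] by simp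
  qed
  show "marked s [c, d] \<longleftrightarrow> marked s [d, c]" using ab by (auto simp: c d)
qed

lemma unhat_move:
  assumes "\<forall>d\<in>set p. comm (fst c) (fst d)" "fst c \<in> V" "fst ` set p \<subseteq> V" "fst ` set q \<subseteq> V"
  shows "unhat s (c # p @ q) \<equiv>\<^sub>w unhat s (p @ c # q)" "marked s (c # p @ q) \<longleftrightarrow> marked s (p @ c # q)"
proof -
  have "unhat s (c # p @ q) \<equiv>\<^sub>w unhat s (p @ c # q) \<and> (marked s (c # p @ q) \<longleftrightarrow> marked s (p @ c # q))"
    using assms
  proof (induction p arbitrary: s)
    case Nil
    then have "unhat s (c # q) \<in> lists (letters V)" by (intro unhat_letters) simp
    then show ?case by (simp add: weq_refl del: in_lists_conv_set)
  next
    case (Cons d p)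
    have L: "unhat s w \<in> lists (letters V)" if "fst ` set w \<subseteq> V" for s w using that by (rule unhat_letters)
    have "unhat s ([c, d] @ p @ q) = [] @ unhat s [c, d] @ unhat (s \<noteq> tw.odd_gen y [c, d]) (p @ q)"
      by (simp only: unhat_append append_Nil)
    also have "\<dots> \<equiv>\<^sub>w [] @ unhat s [d, c] @ unhat (s \<noteq> tw.odd_gen y [c, d]) (p @ q)"
    proof (rule weq_context[OF unhat_swap(1)])
      show "unhat (s \<noteq> tw.odd_gen y [c, d]) (p @ q) \<in> lists (letters V)" using Cons.prems by (intro L) auto
    qed (use Cons.prems in auto)
    also have "\<dots> = unhat s ([d] @ c # p @ q)"
    proof -
      have "tw.odd_gen y [c, d] = tw.odd_gen y [d, c]" by auto
      then have "[] @ unhat s [d, c] @ unhat (s \<noteq> tw.odd_gen y [c, d]) (p @ q) = unhat s ([d, c] @ p @ q)"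
        by (simp only: unhat_append append_Nil)
      then show ?thesis by simp
    qed
    also have "\<dots> = unhat s [d] @ unhat (s \<noteq> tw.odd_gen y [d]) (c # p @ q) @ []"
      by (simp only: unhat_append append_Nil2)
    also have "\<dots> \<equiv>\<^sub>w unhat s [d] @ unhat (s \<noteq> tw.odd_gen y [d]) (p @ c # q) @ []"
    proof (rule weq_context)
      show "unhat s [d] \<in> lists (letters V)" using Cons.prems by (intro L) auto
      show "unhat (s \<noteq> tw.odd_gen y [d]) (c # p @ q) \<equiv>\<^sub>w unhat (s \<noteq> tw.odd_gen y [d]) (p @ c # q)"
        using Cons by simp
    qed simp
    also have "\<dots> = unhat s ([d] @ p @ c # q)" by (simp only: unhat_append append_Nil2)
    finally have "unhat s (c # (d # p) @ q) \<equiv>\<^sub>w unhat s ((d # p) @ c # q)" by simp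
    moreover have "marked s ([c, d] @ p @ q) \<longleftrightarrow> marked s ([d, c] @ p @ q)"
    proof -
      have "tw.odd_gen y [c, d] = tw.odd_gen y [d, c]" by auto
      moreover have "marked s [c, d] = marked s [d, c]" using unhat_swap(2)[of c d s] Cons.prems(1) by simp
      ultimately show ?thesis by (simp only: marked_append)
    qed
    moreover have "marked s ([d] @ c # p @ q) \<longleftrightarrow> marked s ([d] @ p @ c # q)"
      using Cons unfolding marked_append[of s "[d]"] by auto
    ultimately show ?case by simp
  qed
  then show "unhat s (c # p @ q) \<equiv>\<^sub>w unhat s (p @ c # q)" "marked s (c # p @ q) \<longleftrightarrow> marked s (p @ c # q)" by auto
qed

lemma unhat_teq:
  assumes "tw.teq u v" "fst ` set u \<subseteq> V"
  shows "unhat s u \<equiv>\<^sub>w unhat s v \<and> (marked s u \<longleftrightarrow> marked s v)"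
  using assms
proof (induction u arbitrary: v s)
  case Nil
  then show ?case by (simp add: weq_refl)
next
  case (Cons c u)
  from tw.teq_Cons_split[OF Cons.prems(1)] obtain p q where
    pq: "v = p @ c # q" "\<forall>d\<in>set p. tw.lcomm c d" "tw.teq u (p @ q)" .
  have V: "fst ` set v \<subseteq> V" using Cons.prems tw.teq_set by metis
  then have m: "unhat s (c # p @ q) \<equiv>\<^sub>w unhat s v" "marked s (c # p @ q) \<longleftrightarrow> marked s v"
    using unhat_move[of p c q s] pq(1,2) by (auto simp: tw.lcomm_def)
  have IH: "unhat t u \<equiv>\<^sub>w unhat t (p @ q) \<and> (marked t u \<longleftrightarrow> marked t (p @ q))" for t
    using Cons pq(3) by simp
  have c: "unhat s [c] \<in> lists (letters V)" using Cons.prems(2) by (intro unhat_letters) simp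
  have "unhat s ([c] @ u) = unhat s [c] @ unhat (s \<noteq> tw.odd_gen y [c]) u @ []"
    by (simp only: unhat_append append_Nil2)
  also have "\<dots> \<equiv>\<^sub>w unhat s [c] @ unhat (s \<noteq> tw.odd_gen y [c]) (p @ q) @ []"
    by (rule weq_context) (use IH c in simp_all)
  also have "\<dots> = unhat s ([c] @ p @ q)" by (simp only: unhat_append append_Nil2)
  also have "\<dots> \<equiv>\<^sub>w unhat s v" using m(1) by simp
  finally have "unhat s (c # u) \<equiv>\<^sub>w unhat s v" by simp
  moreover have "marked s ([c] @ u) \<longleftrightarrow> marked s ([c] @ p @ q)" using IH unfolding marked_append by blast
  ultimately show ?case using m(2) by simp
qed

lemma unhat_cancel:
  assumes "fst ` set (p @ c # iv c # q) \<subseteq> V"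
  shows "unhat s (p @ c # iv c # q) \<equiv>\<^sub>w unhat s (p @ q)" "marked s (p @ c # iv c # q) \<Longrightarrow> marked s (p @ q)"
proof -
  obtain a e m where c: "c = (a, e, m)" by (cases c)
  define t where "t = (s \<noteq> tw.odd_gen y p)"
  have "(t \<noteq> (a = y)) \<noteq> (a = y) \<longleftrightarrow> t" by blast
  then have "unhat t (c # iv c # q) = (a, e \<noteq> (t \<and> a \<in> J)) # (a, \<not> (e \<noteq> (t \<and> a \<in> J))) # unhat t q"
    using y_notin_J by (auto simp: c)
  then have "unhat s (p @ c # iv c # q) = unhat s p @ (a, e \<noteq> (t \<and> a \<in> J)) # (a, \<not> (e \<noteq> (t \<and> a \<in> J))) # unhat t q"
    by (simp add: unhat_append t_def)
  also have "\<dots> \<equiv>\<^sub>w unhat s p @ unhat t q" by (rule weq_cancel) (use assms in \<open>auto simp: c intro!: unhat_letters\<close>)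
  finally show "unhat s (p @ c # iv c # q) \<equiv>\<^sub>w unhat s (p @ q)" by (simp add: unhat_append t_def)
  show "marked s (p @ q)" if "marked s (p @ c # iv c # q)" using that by (auto simp: marked_append c)
qed

section \<open>Conjugacy of words as twisted conjugacy of decorated words\<close>

definition tconj :: "'a word \<Rightarrow> 'a word \<Rightarrow> bool" where
  "tconj u v \<longleftrightarrow> u \<in> lists (letters V) \<and> v \<in> lists (letters V) \<and> (\<exists>b\<in>lists (letters V). b @ u \<equiv>\<^sub>w v @ b)"

definition neg :: "'a word \<Rightarrow> 'a word" where
  "neg w = rev (map (\<lambda>(a, e). (a, \<not> e)) w)"

lemma neg_simps [simp]: "neg [] = []" "neg ((a, e) # w) = neg w @ [(a, \<not> e)]"
  by (simp_all add: neg_def)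

lemma neg_letters: "w \<in> lists (letters V) \<Longrightarrow> neg w \<in> lists (letters V)"
  by (induction w) (auto simp: letters_def)

lemma par_neg [simp]: "par (neg w) = par w"
  by (induction w) auto

lemma neg_left: "w \<in> lists (letters V) \<Longrightarrow> p \<in> lists (letters V) \<Longrightarrow> q \<in> lists (letters V) \<Longrightarrow> p @ neg w @ w @ q \<equiv>\<^sub>w p @ q"
proof (induction w arbitrary: p q)
  case (Cons c w)
  obtain a e where c: "c = (a, e)" "a \<in> V" using Cons.prems by (cases c) (auto simp: letters_def)
  have "(p @ neg w) @ (a, \<not> e) # (a, \<not> \<not> e) # (w @ q) \<equiv>\<^sub>w (p @ neg w) @ (w @ q)"
    by (rule weq_cancel) (use Cons.prems neg_letters[of w] c in auto)
  also have "(p @ neg w) @ (w @ q) \<equiv>\<^sub>w p @ q" using Cons by simp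
  finally show ?case by (simp add: c)
qed (simp add: weq_refl)

lemma neg_neg [simp]: "neg (neg w) = w"
  by (induction w) (auto simp: neg_def rev_map o_def case_prod_beta)

lemma neg_right: "w \<in> lists (letters V) \<Longrightarrow> p \<in> lists (letters V) \<Longrightarrow> q \<in> lists (letters V) \<Longrightarrow> p @ w @ neg w @ q \<equiv>\<^sub>w p @ q"
  using neg_left[OF neg_letters[of w]] by simp

lemma weq_tconj: "u \<equiv>\<^sub>w v \<Longrightarrow> tconj u v"
  unfolding tconj_def using weq_lists[of u v] by (auto intro!: bexI[of _ "[]"])

lemma tconj_sym:
  assumes "tconj u v"
  shows "tconj v u"
proof -
  obtain b where b: "u \<in> lists (letters V)" "v \<in> lists (letters V)" "b \<in> lists (letters V)" "b @ u \<equiv>\<^sub>w v @ b"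
    using assms unfolding tconj_def by blast
  let ?w = "neg b"
  have w: "?w \<in> lists (letters V)" using b(3) by (rule neg_letters)
  have "?w @ (v @ b) @ ?w \<equiv>\<^sub>w ?w @ (b @ u) @ ?w" using weq_context[OF weq_sym[OF b(4)] w w] .
  moreover have "[] @ ?w @ b @ (u @ ?w) \<equiv>\<^sub>w [] @ u @ ?w" by (rule neg_left) (use b w in auto)
  moreover have "(?w @ v) @ b @ ?w @ [] \<equiv>\<^sub>w (?w @ v) @ []" by (rule neg_right) (use b w in auto)
  ultimately have "?w @ v \<equiv>\<^sub>w u @ ?w" by (simp only: append_Cons append_Nil append_Nil2 append_assoc not_not) (blast intro: weq_sym weq_trans)
  then show ?thesis unfolding tconj_def using b w by blast
qed

lemma tconj_trans [trans]:
  assumes "tconj u v" "tconj v w"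
  shows "tconj u w"
proof -
  obtain b where b: "u \<in> lists (letters V)" "v \<in> lists (letters V)" "b \<in> lists (letters V)" "b @ u \<equiv>\<^sub>w v @ b"
    using assms unfolding tconj_def by blast
  obtain c where c: "w \<in> lists (letters V)" "c \<in> lists (letters V)" "c @ v \<equiv>\<^sub>w w @ c"
    using assms unfolding tconj_def by blast
  have "c @ (b @ u) @ [] \<equiv>\<^sub>w c @ (v @ b) @ []" by (rule weq_context[OF b(4)]) (use c in auto)
  moreover have "[] @ (c @ v) @ b \<equiv>\<^sub>w [] @ (w @ c) @ b" by (rule weq_context[OF c(3)]) (use b in auto)
  ultimately have "(c @ b) @ u \<equiv>\<^sub>w w @ (c @ b)" by (simp only: append_Cons append_Nil append_Nil2 append_assoc not_not) (blast intro: weq_sym weq_trans)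
  then show ?thesis unfolding tconj_def using b c by (auto intro!: bexI[of _ "c @ b"])
qed

lemma tconj_rotate: "c # w \<in> lists (letters V) \<Longrightarrow> tconj (c # w) (w @ [c])"
proof -
  assume w: "c # w \<in> lists (letters V)"
  obtain a e where c: "c = (a, e)" by (cases c)
  have L: "(a, f) \<in> letters V" for f using w by (simp add: c letters_def)
  have "[] @ (a, \<not> e) # (a, \<not> \<not> e) # w \<equiv>\<^sub>w [] @ w" by (rule weq_cancel) (use w L in \<open>auto simp: letters_def\<close>)
  moreover have "w @ (a, e) # (a, \<not> e) # [] \<equiv>\<^sub>w w @ []" by (rule weq_cancel) (use w L in \<open>auto simp: letters_def\<close>)
  ultimately have "[(a, \<not> e)] @ (c # w) \<equiv>\<^sub>w (w @ [c]) @ [(a, \<not> e)]" unfolding c by (simp only: append_Cons append_Nil append_Nil2 append_assoc not_not) (blast intro: weq_sym weq_trans)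
  then show ?thesis unfolding tconj_def using w L by (auto simp: c intro!: bexI[of _ "[(a, \<not> e)]"])
qed

lemma th_th_comm: "th s (th t c) = th t (th s c)"
  by (cases c) auto

lemma th_False [simp]: "th False = id"
proof
  show "th False c = id c" for c by (cases c) simp
qed

lemma cyc_irred_map_th_any:
  assumes "tw.cyc_irred eps a"
  shows "tw.cyc_irred eps (map (th t) a)"
  unfolding tw.cyc_irred_def
proof (intro conjI notI)
  show "tw.irred (map (th t) a)" using assms tw.irred_map_th unfolding tw.cyc_irred_def by blast
  assume "\<exists>c z. tw.teq (map (th t) a) (c # z @ [iv (th eps c)])"
  then obtain c z where "tw.teq (map (th t) a) (c # z @ [iv (th eps c)])" by blast
  from tw.teq_map_th[OF this, of t] have "tw.teq a (th t c # map (th t) z @ [iv (th eps (th t c))])"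
    by (simp add: tw.th_iv th_th_comm)
  then show False using assms unfolding tw.cyc_irred_def by blast
qed

text \<open>The inverse word runs back through the parities that \<open>b\<close> went through, so
  it is read from the parity at which \<open>b\<close> ended.\<close>

lemma hat_neg: "hat (s \<noteq> par b) (neg b) = tw.winv (hat s b)"
proof (induction s b rule: hat.induct)
  case (2 s a e w)
  define t where "t = (s \<noteq> (a = y))"
  have st: "s \<noteq> par ((a, e) # w) \<longleftrightarrow> t \<noteq> par w" by (auto simp: t_def)
  have "hat (t \<noteq> par w) (neg w @ [(a, \<not> e)]) = hat (t \<noteq> par w) (neg w) @ hat ((t \<noteq> par w) \<noteq> par w) [(a, \<not> e)]"
    by (simp only: hat_append par_neg)
  also have "(t \<noteq> par w) \<noteq> par w \<longleftrightarrow> t" by blast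
  also have "hat (t \<noteq> par w) (neg w) = tw.winv (hat t w)" using 2 by (simp add: t_def)
  also have "hat t [(a, \<not> e)] = [iv (a, e \<noteq> (s \<and> a \<in> J), s \<and> a = y)]"
    using y_notin_J by (auto simp: t_def)
  finally show ?case unfolding st by (simp add: tw.winv_Cons t_def)
qed simp

text \<open>The computation in the semidirect product: in b u b^-1 the factor \<open>u\<close> is
  decorated from the parity of \<open>b\<close>, and the inverse of \<open>b\<close> from that
  parity shifted by the one of \<open>u\<close>. This produces the two powers of \<theta>.\<close>

lemma tconj_geq:
  assumes "tconj u v"
  shows "\<exists>b. tw.geq (hat False v) (b @ map (th (tw.odd_gen y b)) (hat False u) @ map (th (par u)) (tw.winv b))"
    and "par u = par v"
proof -
  obtain b where b: "u \<in> lists (letters V)" "v \<in> lists (letters V)" "b \<in> lists (letters V)" "b @ u \<equiv>\<^sub>w v @ b"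
    using assms unfolding tconj_def by blast
  have "[] @ (b @ u) @ neg b \<equiv>\<^sub>w [] @ (v @ b) @ neg b"
    by (rule weq_context[OF b(4)]) (use b neg_letters in auto)
  moreover have "v @ b @ neg b @ [] \<equiv>\<^sub>w v @ []" by (rule neg_right) (use b in auto)
  ultimately have 1: "b @ u @ neg b \<equiv>\<^sub>w v"
    by (simp only: append_Nil append_Nil2 append_assoc) (rule weq_trans)
  have "hat False (b @ u @ neg b) = hat False b @ hat (par b) u @ hat (par b \<noteq> par u) (neg b)"
    by (simp add: hat_append)
  also have "hat (par b) u = map (th (par b)) (hat False u)" by (simp add: map_th_hat)
  also have "hat (par b \<noteq> par u) (neg b) = map (th (par u)) (hat (par b) (neg b))" by (simp only: map_th_hat)
  also have "hat (par b) (neg b) = tw.winv (hat False b)"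
  proof -
    have "(False \<noteq> par b) = par b" by blast
    with hat_neg[of False b] show ?thesis by (simp only:)
  qed
  finally have e: "hat False (b @ u @ neg b) = hat False b @ map (th (par b)) (hat False u) @ map (th (par u)) (tw.winv (hat False b))" .
  have "tw.geq (hat False b @ map (th (par b)) (hat False u) @ map (th (par u)) (tw.winv (hat False b))) (hat False v)"
    by (rule conjunct1[OF weq_geq_hat[OF 1, of False], unfolded e])
  then show "\<exists>b. tw.geq (hat False v) (b @ map (th (tw.odd_gen y b)) (hat False u) @ map (th (par u)) (tw.winv b))"
    using tw.geq_sym[of _ "hat False v"] by (intro exI[of _ "hat False b"]) simp
  have "par (b @ u @ neg b) = par v" by (rule conjunct2[OF weq_geq_hat[OF 1]])
  then show "par u = par v" unfolding par_simps par_neg by blast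
qed

lemma tconj_rt:
  assumes "tconj u v" and ci: "tw.cyc_irred (par u) (hat False u)" "tw.cyc_irred (par u) (hat False v)"
  shows "\<exists>d. tw.rt (par u) (map (th d) (hat False u)) (hat False v) \<and>
    (d \<longrightarrow> y \<in> fst ` set (hat False u) \<or> (\<forall>g\<in>fst ` set (hat False u). comm y g))"
proof -
  obtain b where b: "tw.geq (hat False v) (b @ map (th (tw.odd_gen y b)) (hat False u) @ map (th (par u)) (tw.winv b))"
    using tconj_geq[OF assms(1)] by blast
  have "fst ` set (map (th d) (hat False u)) = fst ` set (hat False u)" for d
    by (simp add: image_image)
  then show ?thesis
    using tw.conj_cyc_irred[OF cyc_irred_map_th_any[OF ci(1)] ci(2) b, of y] by metis
qed

text \<open>The end of the word is read at the start parity shifted by \<open>eps\<close>, so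
  \<open>th eps c\<close> at the end reads as the same letter as \<open>c\<close> at the front. If
  that letter is \<open>y\<close>, the remaining word starts at the other parity.\<close>

lemma unhat_rotate:
  assumes "fst ` set (c # w) \<subseteq> V" "eps = tw.odd_gen y (c # w)"
  shows "tconj (unhat s (c # w)) (unhat (s \<noteq> (fst c = y)) (w @ [th eps c]))"
    and "marked s (c # w) \<longleftrightarrow> marked (s \<noteq> (fst c = y)) (w @ [th eps c])"
proof -
  obtain a e m where c: "c = (a, e, m)" by (cases c)
  define t where "t = (s \<noteq> (a = y))"
  have p: "t \<noteq> tw.odd_gen y w \<longleftrightarrow> s \<noteq> eps" using assms(2) by (auto simp: c t_def)
  have e: "((e \<noteq> (eps \<and> a \<in> J)) \<noteq> ((s \<noteq> eps) \<and> a \<in> J)) = (e \<noteq> (s \<and> a \<in> J))" by blast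
  have "unhat t (w @ [th eps c]) = unhat t w @ unhat (s \<noteq> eps) [th eps c]" unfolding unhat_append p ..
  also have "\<dots> = unhat t w @ [(a, e \<noteq> (s \<and> a \<in> J))]" by (simp only: c th.simps unhat.simps e)
  finally have 1: "unhat t (w @ [th eps c]) = unhat t w @ [(a, e \<noteq> (s \<and> a \<in> J))]" .
  have "unhat s (c # w) \<in> lists (letters V)" using assms(1) by (rule unhat_letters)
  then show "tconj (unhat s (c # w)) (unhat (s \<noteq> (fst c = y)) (w @ [th eps c]))"
    using tconj_rotate[of "(a, e \<noteq> (s \<and> a \<in> J))" "unhat t w"] 1 by (simp add: c t_def)
  have "marked t (w @ [th eps c]) \<longleftrightarrow> marked t w \<and> marked (s \<noteq> eps) [th eps c]" unfolding marked_append p ..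
  also have "marked (s \<noteq> eps) [th eps c] \<longleftrightarrow> m = (s \<and> a = y)" by (auto simp: c)
  finally show "marked s (c # w) \<longleftrightarrow> marked (s \<noteq> (fst c = y)) (w @ [th eps c])" by (auto simp: c t_def)
qed

text \<open>The start parity is carried along, since rotating a \<open>y\<close> changes it while a
  word without \<open>y\<close> keeps it. Both directions are proved together because
  \<open>rt\<close> has a symmetry rule.\<close>

lemma rt_tconj:
  assumes "tw.rt eps a b" "fst ` set a \<subseteq> V" "tw.odd_gen y a = eps"
  shows "(\<forall>s. marked s a \<longrightarrow> (\<exists>t. marked t b \<and> tconj (unhat s a) (unhat t b) \<and> (y \<notin> fst ` set a \<longrightarrow> t = s))) \<and>
    (\<forall>t. marked t b \<longrightarrow> (\<exists>s. marked s a \<and> tconj (unhat s a) (unhat t b) \<and> (y \<notin> fst ` set a \<longrightarrow> t = s)))"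
  using assms
proof (induction rule: tw.rt.induct)
  case (rt_teq u v)
  then show ?case using unhat_teq weq_tconj by metis
next
  case (rt_rotate c w)
  have A: "marked s (c # w) \<longleftrightarrow> marked (s \<noteq> (fst c = y)) (w @ [th eps c])"
    "tconj (unhat s (c # w)) (unhat (s \<noteq> (fst c = y)) (w @ [th eps c]))"
    "y \<notin> fst ` set (c # w) \<Longrightarrow> (s \<noteq> (fst c = y)) = s" for s
    using unhat_rotate[OF rt_rotate(1), of eps s] rt_rotate(2) by auto
  show ?case
  proof (intro conjI allI impI)
    fix s assume "marked s (c # w)"
    then show "\<exists>t. marked t (w @ [th eps c]) \<and> tconj (unhat s (c # w)) (unhat t (w @ [th eps c]))
      \<and> (y \<notin> fst ` set (c # w) \<longrightarrow> t = s)" using A[of s] by blast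
  next
    fix t assume t: "marked t (w @ [th eps c])"
    define s where "s = (t \<noteq> (fst c = y))"
    have ts: "(s \<noteq> (fst c = y)) = t" by (auto simp: s_def)
    then show "\<exists>s. marked s (c # w) \<and> tconj (unhat s (c # w)) (unhat t (w @ [th eps c]))
      \<and> (y \<notin> fst ` set (c # w) \<longrightarrow> t = s)" using A[of s] t unfolding ts by blast
  qed
next
  case (rt_sym u v)
  have "fst ` set u = fst ` set v" using tw.rt_gens[OF rt_sym(1)] .
  moreover have "tw.odd_gen y u = eps" using tw.rt_odd_gen[OF rt_sym(1), of y] rt_sym(4) by simp
  ultimately show ?case using rt_sym(2,3) tconj_sym by metis
next
  case (rt_trans u v w)
  have g: "fst ` set u = fst ` set v" using tw.rt_gens[OF rt_trans(1)] .
  have "tw.odd_gen y v = eps" using tw.rt_odd_gen[OF rt_trans(1), of y] rt_trans(6) by simp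
  then have 1: "(\<forall>s. marked s u \<longrightarrow> (\<exists>t. marked t v \<and> tconj (unhat s u) (unhat t v) \<and> (y \<notin> fst ` set u \<longrightarrow> t = s))) \<and>
    (\<forall>t. marked t v \<longrightarrow> (\<exists>s. marked s u \<and> tconj (unhat s u) (unhat t v) \<and> (y \<notin> fst ` set u \<longrightarrow> t = s)))"
   and 2: "(\<forall>s. marked s v \<longrightarrow> (\<exists>t. marked t w \<and> tconj (unhat s v) (unhat t w) \<and> (y \<notin> fst ` set u \<longrightarrow> t = s))) \<and>
    (\<forall>t. marked t w \<longrightarrow> (\<exists>s. marked s v \<and> tconj (unhat s v) (unhat t w) \<and> (y \<notin> fst ` set u \<longrightarrow> t = s)))"
    using rt_trans g by simp_all
  show ?case
  proof (intro conjI allI impI)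
    fix s assume "marked s u"
    then obtain t where "marked t v" "tconj (unhat s u) (unhat t v)" "y \<notin> fst ` set u \<longrightarrow> t = s" using 1 by blast
    moreover from this(1) obtain r where "marked r w" "tconj (unhat t v) (unhat r w)" "y \<notin> fst ` set u \<longrightarrow> r = t"
      using 2 by blast
    ultimately show "\<exists>t. marked t w \<and> tconj (unhat s u) (unhat t w) \<and> (y \<notin> fst ` set u \<longrightarrow> t = s)"
      using tconj_trans by (intro exI[of _ r]) blast
  next
    fix r assume "marked r w"
    then obtain t where "marked t v" "tconj (unhat t v) (unhat r w)" "y \<notin> fst ` set u \<longrightarrow> r = t" using 2 by blast
    moreover from this(1) obtain s where "marked s u" "tconj (unhat s u) (unhat t v)" "y \<notin> fst ` set u \<longrightarrow> t = s"
      using 1 by blast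
    ultimately show "\<exists>s. marked s u \<and> tconj (unhat s u) (unhat r w) \<and> (y \<notin> fst ` set u \<longrightarrow> r = s)"
      using tconj_trans by (intro exI[of _ s]) blast
  qed
qed

lemma marked_unique:
  "marked s w \<Longrightarrow> marked t w \<Longrightarrow> y \<in> fst ` set w \<Longrightarrow> s = t"
proof (induction s w arbitrary: t rule: marked.induct)
  case (2 s a e m w)
  then show ?case by (cases "a = y") auto
qed simp

lemma rt_imp_tconj:
  assumes u: "u \<in> lists (letters V)"
    and rt: "tw.rt (par u) (map (th d) (hat False u)) (hat False v)"
    and d: "d \<longrightarrow> y \<in> fst ` set (hat False u) \<or> (\<forall>g\<in>fst ` set (hat False u). comm y g)"
  shows "tconj u v"
proof -
  let ?a = "map (th d) (hat False u)" and ?b = "hat False v"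
  have a: "?a = hat d u" by (simp add: map_th_hat)
  have g: "fst ` set ?a = fst ` set (hat False u)" by (simp add: image_image)
  have aV: "fst ` set ?a \<subseteq> V" unfolding g by (rule hat_gens[OF u])
  have gb: "fst ` set ?b = fst ` set (hat False u)" using tw.rt_gens[OF rt] unfolding g by simp
  have odd: "tw.odd_gen y ?a = par u" by (simp add: a)
  have "marked d ?a" by (simp add: a)
  then obtain t where t: "marked t ?b" "tconj (unhat d ?a) (unhat t ?b)" "y \<notin> fst ` set ?a \<longrightarrow> t = d"
    using rt_tconj[OF rt aV odd] by blast
  have 1: "tconj u (unhat t ?b)" using t(2) by (simp add: a)
  show ?thesis
  proof (cases t)
    case False
    then show ?thesis using 1 by simp
  next
    \<comment> \<open>The rotations have ended at the wrong start parity. The marks then exclude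
      \<open>y\<close> from the word, so \<open>t = d\<close>, and the condition on \<open>d\<close>
      says that \<open>y\<close> commutes with all letters: conjugating by \<open>y\<close> corrects
      the parity.\<close>
    case True
    have ny: "y \<notin> fst ` set ?b" using marked_unique[OF t(1) marked_hat] True by blast
    then have "y \<notin> fst ` set (hat False u)" using gb by simp
    then have comm: "\<forall>g\<in>fst ` set ?b. comm y g" using d t(3) True g gb by auto
    let ?y = "(y, True, False)"
    have "tw.teq (?y # ?b) (?b @ [?y])" by (rule tw.teq_move) (use comm in \<open>auto simp: tw.lcomm_def\<close>)
    moreover have "fst ` set (?y # ?b) \<subseteq> V" using y_V aV g gb by simp
    ultimately have "unhat False (?y # ?b) \<equiv>\<^sub>w unhat False (?b @ [?y])" using unhat_teq by blast
    moreover have "\<forall>c\<in>set ?b. fst c \<noteq> y" using ny by (metis imageI)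
    then have "filter (\<lambda>c. fst c = y) ?b = []" by (simp only: filter_empty_conv)
    then have "\<not> tw.odd_gen y ?b" by (simp add: tw.odd_gen_def)
    then have "unhat False (?b @ [?y]) = v @ [(y, True)]" by (simp only: unhat_append) (simp add: y_notin_J)
    ultimately have "(y, True) # unhat True ?b \<equiv>\<^sub>w v @ [(y, True)]" by simp
    from weq_lists[OF this] this have "unhat True ?b \<in> lists (letters V)" "v \<in> lists (letters V)"
        "[(y, True)] \<in> lists (letters V)" "[(y, True)] @ unhat True ?b \<equiv>\<^sub>w v @ [(y, True)]"
      by simp_all
    then have "tconj (unhat True ?b) v" unfolding tconj_def by blast
    then show ?thesis using 1 True tconj_trans by simp
  qed
qed

lemma conjugate_iff_tconj:
  assumes u: "u \<in> lists (letters V)" and v: "v \<in> lists (letters V)"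
  shows "conjugate_in (presented_group V R) (word_class V R u) (word_class V R v) \<longleftrightarrow> tconj u v"
proof -
  let ?G = "presented_group V R" and ?c = "word_class V R"
  interpret G: group ?G by (rule group_presented_group)
  have carr: "?c w \<in> carrier ?G" if "w \<in> lists (letters V)" for w
    unfolding carrier_presented_group using that by (rule imageI)
  have eq: "?c w = ?c w' \<longleftrightarrow> w \<equiv>\<^sub>w w'" if "w \<in> lists (letters V)" "w' \<in> lists (letters V)" for w w'
    unfolding weq_def using word_class_eq_iff[OF that] .
  have "?c v = ?c b \<otimes>\<^bsub>?G\<^esub> ?c u \<otimes>\<^bsub>?G\<^esub> inv\<^bsub>?G\<^esub> ?c b \<longleftrightarrow> b @ u \<equiv>\<^sub>w v @ b" if b: "b \<in> lists (letters V)" for b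
  proof -
    have "?c v = ?c b \<otimes>\<^bsub>?G\<^esub> ?c u \<otimes>\<^bsub>?G\<^esub> inv\<^bsub>?G\<^esub> ?c b \<longleftrightarrow> ?c v \<otimes>\<^bsub>?G\<^esub> ?c b = ?c b \<otimes>\<^bsub>?G\<^esub> ?c u"
      using carr[OF b] carr[OF u] carr[OF v] G.inv_solve_right[of "?c b \<otimes>\<^bsub>?G\<^esub> ?c u" "?c v" "?c b"]
        G.inv_solve_right by (metis G.m_closed)
    also have "\<dots> \<longleftrightarrow> b @ u \<equiv>\<^sub>w v @ b"
      using mult_word_class[OF b u] mult_word_class[OF v b] eq[of "v @ b" "b @ u"] b u v weq_sym
      by (metis append_in_lists_conv)
    finally show ?thesis .
  qed
  then show ?thesis unfolding conjugate_in_def tconj_def carrier_presented_group using u v by auto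
qed

end

section \<open>Comparing cyclic words\<close>

text \<open>The two-pointer comparison of cyclic words (Shiloach): when \<open>a\<close> and \<open>b\<close> agree on \<open>k\<close> letters from
  positions \<open>i\<close> and \<open>j\<close> on and \<open>a\<close> has the larger next letter, none of the rotations of \<open>a\<close> starting at
  \<open>i, \<dots>, i + k\<close> is the least rotation, so \<open>i\<close> can be advanced by \<open>k + 1\<close>. A state \<open>(p, q, k, m)\<close> has
  its heads at \<open>p = i + k\<close> and \<open>q = j + k\<close>; as heads move by single steps, a mismatch is followed by a
  phase \<open>RewA\<close> or \<open>RewB\<close> moving one head back.\<close>

datatype cmp_mode = Cmp | RewA | RewB | Acc | Rej

locale cyclic_compare =
  fixes a b :: "nat list" and n :: nat
  assumes len: "length a = n" "length b = n"
begin

fun tick :: "nat \<times> nat \<times> nat \<times> cmp_mode \<Rightarrow> nat \<times> nat \<times> nat \<times> cmp_mode" where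
  "tick (p, q, k, Cmp) = (if k = n then (p, q, k, Acc)
     else if p = 2 * n \<or> q = 2 * n then (p, q, k, Rej)
     else if (a @ a) ! p = (b @ b) ! q then (Suc p, Suc q, Suc k, Cmp)
     else if (a @ a) ! p > (b @ b) ! q then (Suc p, q, k, RewB)
     else (p, Suc q, k, RewA))"
| "tick (p, q, k, RewA) = (if k = 0 then (p, q, k, Cmp) else (p - 1, q, k - 1, RewA))"
| "tick (p, q, k, RewB) = (if k = 0 then (p, q, k, Cmp) else (p, q - 1, k - 1, RewB))"
| "tick (p, q, k, Acc) = (p, q, k, Acc)"
| "tick (p, q, k, Rej) = (p, q, k, Rej)"

definition bad_a :: "nat \<Rightarrow> bool" where
  "bad_a x \<longleftrightarrow> (\<exists>z. rotate z b < rotate x a)"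

definition bad_b :: "nat \<Rightarrow> bool" where
  "bad_b x \<longleftrightarrow> (\<exists>z. rotate z a < rotate x b)"

definition rotation :: bool where
  "rotation \<longleftrightarrow> (\<exists>k. b = rotate k a)"

fun invar :: "nat \<times> nat \<times> nat \<times> cmp_mode \<Rightarrow> bool" where
  "invar (p, q, k, Cmp) \<longleftrightarrow> k \<le> p \<and> k \<le> q \<and> k \<le> n \<and> p \<le> 2 * n \<and> q \<le> 2 * n \<and>
     (\<forall>t<k. (a @ a) ! (p - k + t) = (b @ b) ! (q - k + t)) \<and> (\<forall>x<p - k. bad_a x) \<and> (\<forall>x<q - k. bad_b x)"
| "invar (p, q, k, RewA) \<longleftrightarrow> k \<le> p \<and> k \<le> n \<and> p \<le> 2 * n \<and> q \<le> 2 * n \<and> (\<forall>x<p - k. bad_a x) \<and> (\<forall>x<q. bad_b x)"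
| "invar (p, q, k, RewB) \<longleftrightarrow> k \<le> q \<and> k \<le> n \<and> p \<le> 2 * n \<and> q \<le> 2 * n \<and> (\<forall>x<p. bad_a x) \<and> (\<forall>x<q - k. bad_b x)"
| "invar (p, q, k, Acc) \<longleftrightarrow> rotation \<and> p \<le> 2 * n \<and> q \<le> 2 * n \<and> k \<le> n"
| "invar (p, q, k, Rej) \<longleftrightarrow> \<not> rotation \<and> p \<le> 2 * n \<and> q \<le> 2 * n \<and> k \<le> n"

text \<open>The weights let every tick before the verdict lower the value by one: a match gains 4 on
  the heads and loses 3 on \<open>k\<close>; a mismatch gains 2 and pays 1 for the new phase; a step
  back gains 3 and pays 2. The start value is \<open>8 * n\<close>.\<close>

fun meas :: "nat \<times> nat \<times> nat \<times> cmp_mode \<Rightarrow> nat" where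
  "meas (p, q, k, m) = 2 * ((2 * n - p) + (2 * n - q)) + 3 * k + (if m = Cmp then 0 else 1)"

lemma nth_double:
  assumes "s < 2 * n" "length w = n"
  shows "(w @ w) ! s = w ! (s mod n)"
proof (cases "s < n")
  case False
  then have "s mod n = s - n" using assms(1) by (simp add: mod_if)
  then show ?thesis using False assms by (simp add: nth_append)
qed (simp add: assms nth_append)

lemma lex_less:
  assumes "length u = length v" "t < length u" "\<forall>s<t. u ! s = v ! s" "u ! t < v ! t"
  shows "u < (v :: nat list)"
proof -
  have "take t u = take t v" using assms by (intro nth_take_lemma) auto
  then show ?thesis unfolding list_less_def lexord_take_index_conv using assms by auto
qed

text \<open>Starting equally much further on in both words, one still compares equal letters up to
  the same mismatch. So each of the \<open>k + 1\<close> starts in \<open>u\<close> is beaten by the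
  corresponding start in \<open>v\<close>.\<close>

lemma mismatch:
  fixes u v :: "nat list"
  assumes w: "length u = n" "length v = n" and k: "k < n" "p < 2 * n" "q < 2 * n" "k \<le> p" "k \<le> q"
    and eq: "\<forall>t<k. (u @ u) ! (p - k + t) = (v @ v) ! (q - k + t)" and gt: "(v @ v) ! q < (u @ u) ! p"
    and x: "p - k \<le> x" "x \<le> p"
  shows "rotate (q - k + (x - (p - k))) v < rotate x u"
proof -
  let ?off = "x - (p - k)" and ?z = "q - k + (x - (p - k))"
  have off: "?off \<le> k" "x = p - k + ?off" using x k by auto
  have nu: "rotate x u ! s = (u @ u) ! (x + s)" if "x + s < 2 * n" "s < n" for s
    using that w nth_double[of "x + s" u] by (simp add: nth_rotate add.commute)
  have nv: "rotate ?z v ! s = (v @ v) ! (?z + s)" if "?z + s < 2 * n" "s < n" for s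
    using that w nth_double[of "?z + s" v] by (simp add: nth_rotate add.commute)
  show ?thesis
  proof (rule lex_less[where t = "k - ?off"])
    show "\<forall>s<k - ?off. rotate ?z v ! s = rotate x u ! s"
    proof (intro allI impI)
      fix s assume s: "s < k - ?off"
      have "rotate x u ! s = (u @ u) ! (p - k + (?off + s))" using nu[of s] s off k by (simp add: add.assoc)
      also have "\<dots> = (v @ v) ! (q - k + (?off + s))" using eq s by simp
      also have "\<dots> = rotate ?z v ! s" using nv[of s] s off k by (simp add: add.assoc)
      finally show "rotate ?z v ! s = rotate x u ! s" ..
    qed
    have "x + (k - ?off) = p" "?z + (k - ?off) = q" using off k x by auto
    then show "rotate ?z v ! (k - ?off) < rotate x u ! (k - ?off)"
      using nu[of "k - ?off"] nv[of "k - ?off"] gt k by simp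
  qed (use w k in auto)
qed

text \<open>Otherwise the least rotation of \<open>a\<close> would be undercut by a rotation of
  \<open>b\<close>, which is also a rotation of \<open>a\<close>.\<close>

lemma not_rotation:
  assumes "n > 0" "\<forall>x<n. bad_a x"
  shows "\<not> rotation"
proof
  assume rotation
  then obtain k where k: "b = rotate k a" by (auto simp: rotation_def)
  have nonempty: "a \<noteq> []" using assms(1) len by auto
  let ?S = "(\<lambda>x. rotate x a) ` {..<n}"
  have all: "rotate x a \<in> ?S" for x
    using assms(1) len by (auto simp: rotate_conv_mod[of x a] intro!: image_eqI[of _ _ "x mod n"])
  have "Min ?S \<in> ?S" using assms(1) by (intro Min_in) auto
  then obtain x where x: "x < n" "Min ?S = rotate x a" by auto
  then obtain z where "rotate z b < rotate x a" using assms(2) by (auto simp: bad_a_def)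
  moreover have "rotate z b \<in> ?S" using all by (simp add: k rotate_rotate)
  ultimately show False using x(2) Min_le[of ?S "rotate z b"] by auto
qed

end

lemma (in cyclic_compare) swap: "cyclic_compare b a n"
  using len by unfold_locales

lemma (in cyclic_compare) rotation_swap: "cyclic_compare.rotation b a \<longleftrightarrow> rotation"
proof -
  have "\<exists>k. u = rotate k v" if "v = rotate k u" for u v :: "nat list" and k
  proof -
    have "rotate (length u * Suc k - k) v = rotate (length u * Suc k) u"
      unfolding that
    proof (cases "u = []")
      case False
      then have "k \<le> length u * Suc k" by (cases u) auto
      then show "rotate (length u * Suc k - k) (rotate k u) = rotate (length u * Suc k) u"
        by (simp only: rotate_rotate le_add_diff_inverse2)
    qed simp
    also have "\<dots> = u" by (subst rotate_conv_mod) simp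
    finally show ?thesis by metis
  qed
  then show ?thesis
    unfolding rotation_def cyclic_compare.rotation_def[OF swap] by metis
qed

context cyclic_compare
begin

lemma not_rotation_b:
  assumes "n > 0" "\<forall>x<n. bad_b x"
  shows "\<not> rotation"
  using cyclic_compare.not_rotation[OF swap assms(1)] assms(2) rotation_swap
  unfolding bad_b_def cyclic_compare.bad_a_def[OF swap] by blast

lemma invar_tick:
  assumes "invar c"
  shows "invar (tick c)"
proof -
  obtain p q k m where c: "c = (p, q, k, m)" by (cases c)
  show ?thesis
  proof (cases m)
    case Cmp
    have I: "k \<le> p" "k \<le> q" "k \<le> n" "p \<le> 2 * n" "q \<le> 2 * n"
     "\<forall>t<k. (a @ a) ! (p - k + t) = (b @ b) ! (q - k + t)" "\<forall>x<p - k. bad_a x" "\<forall>x<q - k. bad_b x"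
      using assms by (auto simp: c Cmp)
    consider (acc) "k = n" | (end_a) "k < n" "p = 2 * n" | (end_b) "k < n" "q = 2 * n"
      | (eq) "k < n" "p < 2 * n" "q < 2 * n" "(a @ a) ! p = (b @ b) ! q"
      | (gt) "k < n" "p < 2 * n" "q < 2 * n" "(a @ a) ! p > (b @ b) ! q"
      | (lt) "k < n" "p < 2 * n" "q < 2 * n" "(a @ a) ! p < (b @ b) ! q"
      using I(3-5) by linarith
    then show ?thesis
    proof cases
      case acc
      have "rotate (p - k) a = rotate (q - k) b"
      proof (rule nth_equalityI)
        fix t assume "t < length (rotate (p - k) a)"
        then have t: "t < n" using len by simp
        then have "(a @ a) ! (p - k + t) = (b @ b) ! (q - k + t)" using I acc by simp
        then show "rotate (p - k) a ! t = rotate (q - k) b ! t"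
          using nth_double[of "p - k + t" a] nth_double[of "q - k + t" b] I acc t len
          by (simp add: nth_rotate add.commute)
      qed (simp add: len)
      then have "rotate (p - k) a = rotate (q - k) b" .
      \<comment> \<open>A multiple of the length that is at least \<open>q\<close> lets the shift by
        \<open>q - k\<close> be completed to full turns.\<close>
      moreover have "rotate (n * Suc q - (q - k)) (rotate (q - k) b) = b"
      proof (cases "n = 0")
        case False
        then have "q \<le> n * Suc q" by (cases n) auto
        then have "rotate (n * Suc q - (q - k)) (rotate (q - k) b) = rotate (n * Suc q) b"
          by (subst rotate_rotate) simp
        also have "\<dots> = b" by (subst rotate_conv_mod) (simp add: len)
        finally show ?thesis .
      qed (use len in simp)
      ultimately have "b = rotate (n * Suc q - (q - k) + (p - k)) a" by (metis rotate_rotate)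
      then have rotation unfolding rotation_def by blast
      then show ?thesis using acc I by (simp add: c Cmp)
    next
      case end_a
      \<comment> \<open>\<open>p = 2 * n\<close> and \<open>k < n\<close> give
        \<open>p - k > n\<close>, so every start below \<open>n\<close> is already known to be
        bad.\<close>
      then have "\<not> rotation" using I by (intro not_rotation) auto
      then show ?thesis using end_a I by (simp add: c Cmp)
    next
      case end_b
      then have "\<not> rotation" using I by (intro not_rotation_b) auto
      then show ?thesis using end_b I by (simp add: c Cmp)
    next
      case eq
      have "\<forall>t<Suc k. (a @ a) ! (Suc p - Suc k + t) = (b @ b) ! (Suc q - Suc k + t)"
        using I eq by (auto simp: less_Suc_eq)
      then show ?thesis using eq I by (simp add: c Cmp)
    next
      case gt
      have "bad_a x" if "x < Suc p" for x
      proof (cases "x < p - k")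
        case False
        then show ?thesis using mismatch[OF len gt(1-3) I(1,2) I(6) gt(4), of x] that by (auto simp: bad_a_def)
      qed (use I in simp)
      then show ?thesis using gt I by (simp add: c Cmp)
    next
      case lt
      have I6: "\<forall>t<k. (b @ b) ! (q - k + t) = (a @ a) ! (p - k + t)" using I(6) by simp
      have "bad_b x" if "x < Suc q" for x
      proof (cases "x < q - k")
        case False
        then show ?thesis
          using mismatch[OF len(2,1) lt(1) lt(3,2) I(2,1) I6 lt(4), of x] that by (auto simp: bad_b_def)
      qed (use I in simp)
      then show ?thesis using lt I by (simp add: c Cmp)
    qed
  qed (use assms in \<open>auto simp: c\<close>)
qed

lemma meas_tick:
  assumes "invar c" "snd (snd (snd c)) \<notin> {Acc, Rej}" "snd (snd (snd (tick c))) \<notin> {Acc, Rej}"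
  shows "meas (tick c) < meas c"
proof -
  obtain p q k m where c: "c = (p, q, k, m)" by (cases c)
  show ?thesis using assms by (cases m) (auto simp: c split: if_splits)
qed

lemma ticks_stop:
  assumes "invar c" "meas c < t"
  shows "invar ((tick ^^ t) c)" "snd (snd (snd ((tick ^^ t) c))) \<in> {Acc, Rej}"
proof -
  have stay: "snd (snd (snd (tick c))) \<in> {Acc, Rej}" if "snd (snd (snd c)) \<in> {Acc, Rej}" for c
    using that by (cases c rule: tick.cases) auto
  have "invar ((tick ^^ t) c) \<and> (snd (snd (snd ((tick ^^ t) c))) \<in> {Acc, Rej} \<or> meas ((tick ^^ t) c) + t \<le> meas c)" for t
  proof (induction t)
    case (Suc t)
    let ?c = "(tick ^^ t) c"
    show ?case
    proof (cases "snd (snd (snd ?c)) \<in> {Acc, Rej}")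
      case True
      then show ?thesis using Suc stay invar_tick by simp
    next
      case False
      then show ?thesis using Suc invar_tick[of ?c] meas_tick[of ?c] by fastforce
    qed
  qed (simp add: assms)
  from this[of t] show "invar ((tick ^^ t) c)" "snd (snd (snd ((tick ^^ t) c))) \<in> {Acc, Rej}"
    using assms(2) by auto
qed

theorem tick_decides:
  assumes "8 * n < t"
  shows "snd (snd (snd ((tick ^^ t) (0, 0, 0, Cmp)))) = (if rotation then Acc else Rej)"
    and "invar ((tick ^^ t) (0, 0, 0, Cmp))"
proof -
  have i: "invar (0, 0, 0, Cmp)" by simp
  have m: "meas (0, 0, 0, Cmp) < t" using assms by simp
  note r = ticks_stop[OF i m]
  obtain p q k m where c: "(tick ^^ t) (0, 0, 0, Cmp) = (p, q, k, m)" by (cases "(tick ^^ t) (0, 0, 0, Cmp)")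
  show "snd (snd (snd ((tick ^^ t) (0, 0, 0, Cmp)))) = (if rotation then Acc else Rej)"
    using r by (auto simp: c)
  show "invar ((tick ^^ t) (0, 0, 0, Cmp))" using r(1) .
qed

end

section \<open>The program\<close>

text \<open>\<open>Mark\<close> serves as truth value and as unary digit: a deque with at most one
  mark is a flag, one with \<open>k\<close> marks a counter.\<close>

datatype 'a sym = Mark | Lt "'a \<times> bool \<times> bool" | Md cmp_mode

text \<open>The index \<open>False\<close> or \<open>True\<close> tells the two inputs apart, except
  in \<open>Fail\<close>, where it is the exponent of \<theta> under test. \<open>Fu\<close> and
  \<open>Fu2\<close> are fuel for loops, \<open>Sg\<close> is the start parity during reduction,
  \<open>AL\<close>, \<open>AR\<close> and \<open>BL\<close>, \<open>BR\<close> are the two sides of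
  a reading head, \<open>Ks\<close> and \<open>Rs\<close> hold \<open>k\<close> and
  \<open>n - k\<close>.\<close>

datatype 'a dq = Inp bool | Wd bool | Zs bool | Par bool | Fail bool | Pile 'a | Flag 'a
  | Sg | Fu | Fu2 | Xs | Ys | Cs | AL | AR | BL | BR | Ks | Rs | Ls | Mode | Ans

type_synonym 'a store = "'a dq \<Rightarrow> 'a sym list"

definition seq :: "('s \<Rightarrow> 's) \<Rightarrow> ('s \<Rightarrow> 's) \<Rightarrow> 's \<Rightarrow> 's" (infixr ";;" 60) where
  "(f ;; g) = (\<lambda>s. g (f s))"

definition skip :: "'s \<Rightarrow> 's" where
  "skip = (\<lambda>s. s)"

fun on_letter :: "('a \<times> bool \<times> bool \<Rightarrow> 's \<Rightarrow> 's) \<Rightarrow> 'a sym \<Rightarrow> 's \<Rightarrow> 's" where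
  "on_letter F (Lt c) = F c"
| "on_letter F _ = skip"

fun on_top :: "('a \<times> bool \<times> bool \<Rightarrow> 's \<Rightarrow> 's) \<Rightarrow> ('s \<Rightarrow> 's) \<Rightarrow> 'a sym option \<Rightarrow> 's \<Rightarrow> 's" where
  "on_top F g (Some (Lt c)) = F c"
| "on_top F g _ = g"

definition toggle :: "'a dq \<Rightarrow> 'a store \<Rightarrow> 'a store" where
  "toggle i = case_top i (\<lambda>q. if q = None then push i Mark else pop_top i)"

definition clear :: "'a dq \<Rightarrow> 'a store \<Rightarrow> 'a store" where
  "clear i = for_each i (\<lambda>_. skip)"

definition move :: "'a dq \<Rightarrow> 'a dq \<Rightarrow> 'a store \<Rightarrow> 'a store" where
  "move i j = for_each i (\<lambda>x. push j x)"

locale traag_program = traag_letters V comm y J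
  for V :: "'a set" and comm :: "'a \<Rightarrow> 'a \<Rightarrow> bool" and y :: 'a and J :: "'a set" +
  fixes vs :: "'a list" and N :: nat and key :: "'a sym \<Rightarrow> nat"
  assumes vs: "set vs = V" "distinct vs"
    and near: "\<forall>S\<subseteq>V. \<forall>r\<in>S. tw.component S r \<subseteq> tw.near S r N"
    and inj_key: "inj_on key (insert Mark (Lt ` (V \<times> UNIV) \<union> range Md))"
begin

definition syms :: "'a sym set" where
  "syms = insert Mark (Lt ` (V \<times> UNIV) \<union> range Md)"

definition dqs :: "'a dq set" where
  "dqs = range Inp \<union> range Wd \<union> range Zs \<union> range Par \<union> range Fail \<union> Pile ` V \<union> Flag ` V
     \<union> {Sg, Fu, Fu2, Xs, Ys, Cs, AL, AR, BL, BR, Ks, Rs, Ls, Mode, Ans}"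

text \<open>A reduced word \<open>w\<close> is kept as its piling: the pile of \<open>a\<close> lists the letters of \<open>w\<close> that do not
  commute with \<open>a\<close>, those different from \<open>a\<close> being replaced by marks. A letter is initial (or final)
  up to commutation iff it lies at the bottom (or top) of its own pile.\<close>

definition nb :: "'a \<Rightarrow> 'a list" where
  "nb a = filter (\<lambda>b. \<not> comm a b) vs"

definition push_letter :: "'a \<times> bool \<times> bool \<Rightarrow> 'a store \<Rightarrow> 'a store" where
  "push_letter c = fold (\<lambda>b. push (Pile b) (if b = fst c then Lt c else Mark)) (nb (fst c))"

definition drop_top :: "'a \<Rightarrow> 'a store \<Rightarrow> 'a store" where
  "drop_top a = fold (\<lambda>b. pop_top (Pile b)) (nb a)"

definition drop_bot :: "'a \<Rightarrow> 'a store \<Rightarrow> 'a store" where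
  "drop_bot a = fold (\<lambda>b. pop_bot (Pile b)) (nb a)"

definition push_reduce :: "'a \<times> bool \<times> bool \<Rightarrow> 'a store \<Rightarrow> 'a store" where
  "push_reduce c = case_top (Pile (fst c)) (\<lambda>q. if q = Some (Lt (iv c)) then drop_top (fst c) else push_letter c)"

text \<open>The letters are decorated on the fly by the parity kept in \<open>Par b\<close>. The
  marks in \<open>Fu\<close> count the input letters and pace the next loop, which can run only as
  often as some deque has entries.\<close>

definition build :: "bool \<Rightarrow> 'a store \<Rightarrow> 'a store" where
  "build b = for_each (Inp b) (on_letter (\<lambda>(a, e, m).
     case_top (Par b) (\<lambda>q. push_reduce (a, e \<noteq> (q \<noteq> None \<and> a \<in> J), q \<noteq> None \<and> a = y)) ;;
     (if a = y then toggle (Par b) else skip) ;; push Fu Mark))"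

text \<open>The top letter is removed before the bottom is inspected, as otherwise a lone letter
  with \<open>c = iv (th c)\<close> would be cancelled against itself. Without a match it is put
  back. Removing a leading \<open>y\<close> flips the start parity \<open>Sg\<close>.\<close>

definition peel :: "bool \<Rightarrow> 'a \<Rightarrow> ('a store \<Rightarrow> 'a store) \<Rightarrow> 'a store \<Rightarrow> 'a store" where
  "peel b a next = case_top (Pile a) (on_top (\<lambda>c. drop_top a ;; case_top (Par b) (\<lambda>q. case_bot (Pile a) (\<lambda>d.
     if d = Some (Lt (th (q \<noteq> None) (iv c))) then drop_bot a ;; (if a = y then toggle Sg else skip)
     else push_letter c ;; next))) next)"

definition peel_all :: "bool \<Rightarrow> 'a store \<Rightarrow> 'a store" where
  "peel_all b = foldr (peel b) vs skip"

definition take_first :: "'a \<Rightarrow> ('a store \<Rightarrow> 'a store) \<Rightarrow> 'a store \<Rightarrow> 'a store" where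
  "take_first a next = case_bot (Pile a) (on_top (\<lambda>c. drop_bot a ;; push Xs (Lt c)) next)"

definition take_least :: "'a list \<Rightarrow> 'a store \<Rightarrow> 'a store" where
  "take_least os = foldr take_first os skip"

text \<open>Each mark of fuel buys one attempt at a cyclic cancellation, and \<open>Fu2\<close>
  gathers fuel for reading the piles out as a word. Cyclic reduction may leave an odd start parity;
  the last loop then applies \<theta>, so that \<open>Wd b\<close> is decorated from even
  parity.\<close>

definition prep :: "bool \<Rightarrow> 'a store \<Rightarrow> 'a store" where
  "prep b = build b ;; for_each Fu (\<lambda>_. peel_all b ;; push Fu2 Mark) ;; for_each Fu2 (\<lambda>_. take_least vs) ;;
     for_each Xs (on_letter (\<lambda>c. case_top Sg (\<lambda>q. push (Wd b) (Lt (th (q \<noteq> None) c))))) ;; clear Sg"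

definition if_blocked :: "'a \<Rightarrow> 'a \<Rightarrow> ('a store \<Rightarrow> 'a store) \<Rightarrow> ('a store \<Rightarrow> 'a store) \<Rightarrow> 'a store \<Rightarrow> 'a store" where
  "if_blocked r a yes no = (if a = r then yes else
     foldr (\<lambda>b g. case_top (Flag b) (\<lambda>q. if q = None then g else yes)) (nb a) no)"

definition clear_flags :: "'a store \<Rightarrow> 'a store" where
  "clear_flags = fold (\<lambda>a. clear (Flag a)) vs"

definition pass :: "bool \<Rightarrow> 'a \<Rightarrow> 'a store \<Rightarrow> 'a store" where
  "pass b r = for_each Xs (on_letter (\<lambda>c. if_blocked r (fst c)
       (push Ys (Lt c) ;; push (Flag (fst c)) Mark) (case_top (Par b) (\<lambda>q. push Cs (Lt (th (q \<noteq> None) c)))))) ;;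
     move Ys Xs ;; move Cs Xs ;; clear_flags"

definition order :: "'a \<Rightarrow> 'a list" where
  "order r = filter (\<lambda>a. a \<noteq> r) vs @ [r]"

text \<open>The exponent \<open>d\<close> of \<theta> under test concerns the first word only, hence
  \<open>d \<and> \<not> b\<close>. The normal form is doubled on its way into
  \<open>Zs b\<close>.\<close>

definition make_z :: "bool \<Rightarrow> bool \<Rightarrow> 'a \<Rightarrow> 'a store \<Rightarrow> 'a store" where
  "make_z d b r = for_each (Wd b) (on_letter (\<lambda>c. push Cs (Lt c) ;; push Xs (Lt (th (d \<and> \<not> b) c)))) ;;
     move Cs (Wd b) ;; (pass b r ^^ N) ;;
     for_each Xs (on_letter (\<lambda>c. if_blocked r (fst c) (push_letter c ;; push (Flag (fst c)) Mark ;; push Fu Mark) skip)) ;;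
     clear_flags ;; for_each Fu (\<lambda>_. take_least (order r)) ;;
     for_each Xs (on_letter (\<lambda>c. push (Zs b) (Lt c) ;; case_top (Par b) (\<lambda>q. push Ys (Lt (th (q \<noteq> None) c))))) ;;
     move Ys (Zs b)"

definition shift :: "'a dq \<Rightarrow> 'a dq \<Rightarrow> 'a store \<Rightarrow> 'a store" where
  "shift i j = case_top i (\<lambda>q. case q of None \<Rightarrow> skip | Some x \<Rightarrow> pop_top i ;; push j x)"

definition cmp_step :: "'a store \<Rightarrow> 'a store" where
  "cmp_step = case_top Rs (\<lambda>q. if q = None then push Mode (Md Acc) else
     case_top AL (\<lambda>p. case_top BL (\<lambda>q.
       if p = None \<or> q = None then push Mode (Md Rej)
       else if p = q then shift AL AR ;; shift BL BR ;; pop_top Rs ;; push Ks Mark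
       else if key (the p) > key (the q) then shift AL AR ;; push Mode (Md RewB)
       else shift BL BR ;; push Mode (Md RewA))))"

definition rew_step :: "'a dq \<Rightarrow> 'a dq \<Rightarrow> 'a store \<Rightarrow> 'a store" where
  "rew_step i j = case_top Ks (\<lambda>q. if q = None then pop_top Mode else pop_top Ks ;; push Rs Mark ;; shift i j)"

definition cmp_tick :: "'a store \<Rightarrow> 'a store" where
  "cmp_tick = case_top Mode (\<lambda>m. if m = None then cmp_step
     else if m = Some (Md RewA) then rew_step AR AL
     else if m = Some (Md RewB) then rew_step BR BL else skip)"

text \<open>Each word enters its head stack twice, since starts range over more than one turn.
  \<open>Ls\<close> checks that the lengths agree, and eight marks of fuel per letter plus one
  exceed the bound \<open>8 * n\<close> on the number of ticks.\<close>

definition compare :: "bool \<Rightarrow> 'a store \<Rightarrow> 'a store" where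
  "compare d = for_each (Zs False) (\<lambda>x. push AL x ;; push Cs x ;; push Rs Mark ;; push Ls Mark ;;
       fold (\<lambda>_. push Fu Mark) [0..<8]) ;; move Cs AL ;;
     for_each (Zs True) (\<lambda>x. push BL x ;; push Cs x ;;
       case_top Ls (\<lambda>q. if q = None then push (Fail d) Mark else pop_top Ls)) ;; move Cs BL ;;
     case_top Ls (\<lambda>q. if q = None then skip else push (Fail d) Mark) ;; push Fu Mark ;;
     for_each Fu (\<lambda>_. cmp_tick) ;;
     case_top Mode (\<lambda>m. if m = Some (Md Acc) then skip else push (Fail d) Mark) ;;
     fold clear [AL, AR, BL, BR, Ks, Rs, Ls, Mode]"

definition check_par :: "'a store \<Rightarrow> 'a store" where
  "check_par = case_top (Par False) (\<lambda>p. case_top (Par True) (\<lambda>q.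
     if (p = None) = (q = None) then skip else push (Fail False) Mark ;; push (Fail True) Mark))"

text \<open>Only a conjugator with an odd number of letters \<open>y\<close> realises \<theta>. If
  \<open>y\<close> is absent from the cyclically reduced word, such a conjugator exists only if
  \<open>y\<close> commutes with all its letters; otherwise the variant with \<theta> is ruled out
  here.\<close>

definition check_link :: "'a store \<Rightarrow> 'a store" where
  "check_link = for_each (Wd False) (on_letter (\<lambda>c. push Cs (Lt c) ;;
       (if fst c = y then push Sg Mark else if comm y (fst c) then skip else push Fu Mark))) ;;
     move Cs (Wd False) ;;
     case_top Sg (\<lambda>p. case_top Fu (\<lambda>q. if p = None \<and> q \<noteq> None then push (Fail True) Mark else skip)) ;;
     clear Sg ;; clear Fu"

definition decide :: "'a store \<Rightarrow> 'a store" where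
  "decide = case_top (Fail False) (\<lambda>p. case_top (Fail True) (\<lambda>q.
     if p = None \<or> q = None then push Ans Mark else skip))"

definition round :: "bool \<Rightarrow> 'a \<Rightarrow> 'a store \<Rightarrow> 'a store" where
  "round d r = make_z d False r ;; make_z d True r ;; compare d"

definition main :: "'a store \<Rightarrow> 'a store" where
  "main = prep False ;; prep True ;; check_par ;; check_link ;;
     fold (round False) vs ;; fold (round True) vs ;; decide"

end

section \<open>Frame conditions: deques left unchanged by an operation\<close>

definition keeps :: "'i \<Rightarrow> (('i \<Rightarrow> 'b list) \<Rightarrow> 'i \<Rightarrow> 'b list) \<Rightarrow> bool" where
  "keeps i f \<longleftrightarrow> (\<forall>s. f s i = s i)"

lemma keepsD: "keeps i f \<Longrightarrow> f s i = s i"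
  by (simp add: keeps_def)

lemma keeps_basic: "i \<noteq> j \<Longrightarrow> keeps i (push j b)" "i \<noteq> j \<Longrightarrow> keeps i (pop_top j)" "i \<noteq> j \<Longrightarrow> keeps i (pop_bot j)"
  "keeps i skip"
  by (simp_all add: keeps_def push_def pop_top_def pop_bot_def skip_def)

lemma keeps_seq: "keeps i f \<Longrightarrow> keeps i g \<Longrightarrow> keeps i (f ;; g)"
  by (simp add: keeps_def seq_def)

lemma keeps_case: "(\<And>q. keeps i (F q)) \<Longrightarrow> keeps i (case_top j F)" "(\<And>q. keeps i (F q)) \<Longrightarrow> keeps i (case_bot j F)"
  by (simp_all add: keeps_def case_top_def case_bot_def)

lemma keeps_fold: "(\<And>x. x \<in> set xs \<Longrightarrow> keeps i (f x)) \<Longrightarrow> keeps i (fold f xs)"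
  by (induction xs) (auto simp: keeps_def)

lemma keeps_foldr: "(\<And>x g. keeps i g \<Longrightarrow> keeps i (f x g)) \<Longrightarrow> keeps i g \<Longrightarrow> keeps i (foldr f xs g)"
  by (induction xs) auto

lemma keeps_funpow: "keeps i f \<Longrightarrow> keeps i (f ^^ n)"
  by (induction n) (auto simp: keeps_def)

lemma keeps_on: "(\<And>c. keeps i (F c)) \<Longrightarrow> keeps i (on_letter F x)"
  "(\<And>c. keeps i (F c)) \<Longrightarrow> keeps i g \<Longrightarrow> keeps i (on_top F g q)"
  by (cases x; simp add: keeps_basic) (cases "(F, g, q)" rule: on_top.cases; simp)

lemma keeps_if: "keeps i f \<Longrightarrow> keeps i g \<Longrightarrow> keeps i (if P then f else g)"
  by simp

lemma drain_keeps: "i \<noteq> j \<Longrightarrow> (\<And>x. keeps i (F x)) \<Longrightarrow> drain j F xs s i = s i"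
  by (induction xs arbitrary: s) (simp_all add: keeps_def)

lemma keeps_for_each: "i \<noteq> j \<Longrightarrow> (\<And>x. keeps i (F x)) \<Longrightarrow> keeps i (for_each j F)"
  unfolding keeps_def[of i "for_each j F"] for_each_def by (simp add: drain_keeps)

lemmas keeps_rules = keeps_basic keeps_seq keeps_case keeps_fold keeps_foldr keeps_funpow keeps_on keeps_if keeps_for_each

lemma keeps_toggle: "i \<noteq> j \<Longrightarrow> keeps i (toggle j)"
  unfolding toggle_def by (intro keeps_rules)

lemma keeps_move: "i \<noteq> j \<Longrightarrow> i \<noteq> k \<Longrightarrow> keeps i (move j k)"
  unfolding move_def by (intro keeps_rules)

context traag_program
begin

lemma fst_th [simp]: "fst (th t c) = fst c" "fst (iv c) = fst c"
  by (cases c; simp)+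

lemma keeps_push_letter: "\<forall>a. i \<noteq> Pile a \<Longrightarrow> keeps i (push_letter c)"
  unfolding push_letter_def by (intro keeps_rules) simp

lemma keeps_drop: "\<forall>a. i \<noteq> Pile a \<Longrightarrow> keeps i (drop_top b)" "\<forall>a. i \<noteq> Pile a \<Longrightarrow> keeps i (drop_bot b)"
  unfolding drop_top_def drop_bot_def by (intro keeps_rules; simp)+

lemma keeps_push_reduce: "\<forall>a. i \<noteq> Pile a \<Longrightarrow> keeps i (push_reduce c)"
  unfolding push_reduce_def by (intro keeps_rules keeps_push_letter keeps_drop) simp_all

lemma keeps_peel_all: "\<forall>a. i \<noteq> Pile a \<Longrightarrow> i \<noteq> Sg \<Longrightarrow> keeps i (peel_all b)"
  unfolding peel_all_def peel_def
  by (intro keeps_rules keeps_push_letter keeps_drop keeps_toggle) simp_all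

lemma keeps_take_least: "\<forall>a. i \<noteq> Pile a \<Longrightarrow> i \<noteq> Xs \<Longrightarrow> keeps i (take_least os)"
  unfolding take_least_def take_first_def
  by (intro keeps_rules keeps_drop) simp_all

lemma keeps_if_blocked: "keeps i f \<Longrightarrow> keeps i g \<Longrightarrow> keeps i (if_blocked r a f g)"
  unfolding if_blocked_def by (intro keeps_rules)

lemma keeps_shift: "i \<noteq> j \<Longrightarrow> i \<noteq> k \<Longrightarrow> keeps i (shift j k)"
  unfolding shift_def by (intro keeps_case(1)) (auto intro: keeps_rules split: option.split)

lemma keeps_cmp_tick: "i \<notin> {AL, AR, BL, BR, Ks, Rs, Mode} \<Longrightarrow> keeps i cmp_tick"
  unfolding cmp_tick_def cmp_step_def rew_step_def by (intro keeps_rules keeps_shift) simp_all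

end

section \<open>Linear running time of the program\<close>

locale traag_machine = traag_program V comm y J vs N key +
  deque_machine "traag_program.dqs V" "traag_program.syms V" num key k
  for V :: "'a set" and comm :: "'a \<Rightarrow> 'a \<Rightarrow> bool" and y :: 'a and J vs N key num k
begin

lemma imp_seq: "imp f \<Longrightarrow> imp g \<Longrightarrow> imp (f ;; g)"
  unfolding seq_def by (rule imp_comp)

lemma lin_imp_seq: "lin_imp f \<Longrightarrow> lin_imp g \<Longrightarrow> lin_imp (f ;; g)"
  unfolding seq_def by (rule lin_imp_comp)

lemma imp_skip: "imp skip"
  unfolding skip_def by (rule imp_id)

lemma imp_fold: "(\<And>x. x \<in> set xs \<Longrightarrow> imp (f x)) \<Longrightarrow> imp (fold f xs)"
proof (induction xs)
  case (Cons x xs)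
  have "imp (\<lambda>s. fold f xs (f x s))" by (rule imp_comp) (use Cons in simp_all)
  then show ?case by (simp add: o_def)
qed (simp add: id_def imp_id)

lemma lin_imp_fold: "(\<And>x. x \<in> set xs \<Longrightarrow> lin_imp (f x)) \<Longrightarrow> lin_imp (fold f xs)"
proof (induction xs)
  case Nil
  then show ?case using imp_lin_imp[OF imp_id] by (simp add: id_def)
next
  case (Cons x xs)
  have "lin_imp (\<lambda>s. fold f xs (f x s))" by (rule lin_imp_comp) (use Cons in simp_all)
  then show ?case by (simp add: o_def)
qed

lemma imp_foldr: "(\<And>x g. x \<in> set xs \<Longrightarrow> imp g \<Longrightarrow> imp (f x g)) \<Longrightarrow> imp g \<Longrightarrow> imp (foldr f xs g)"
  by (induction xs) auto

lemma lin_imp_funpow: "lin_imp f \<Longrightarrow> lin_imp (f ^^ n)"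
proof (induction n)
  case 0
  then show ?case using imp_lin_imp[OF imp_id] by (simp add: id_def)
next
  case (Suc n)
  have "lin_imp (\<lambda>s. f ((f ^^ n) s))" by (rule lin_imp_comp) (use Suc in simp_all)
  then show ?case by (simp add: o_def)
qed

lemma imp_case: "i \<in> dqs \<Longrightarrow> (\<And>q. q \<in> insert None (Some ` syms) \<Longrightarrow> imp (F q)) \<Longrightarrow> imp (case_top i F)"
  by (rule imp_case_top) simp_all

lemma imp_case': "i \<in> dqs \<Longrightarrow> (\<And>q. q \<in> insert None (Some ` syms) \<Longrightarrow> imp (F q)) \<Longrightarrow> imp (case_bot i F)"
  by (rule imp_case_bot) simp_all

lemma imp_if: "(P \<Longrightarrow> imp f) \<Longrightarrow> (\<not> P \<Longrightarrow> imp g) \<Longrightarrow> imp (if P then f else g)"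
  by simp

lemma dqs_mem [simp]: "Inp b \<in> dqs" "Wd b \<in> dqs" "Zs b \<in> dqs" "Par b \<in> dqs" "Fail b \<in> dqs"
  "Pile a \<in> dqs \<longleftrightarrow> a \<in> V" "Flag a \<in> dqs \<longleftrightarrow> a \<in> V" "Sg \<in> dqs" "Fu \<in> dqs" "Fu2 \<in> dqs" "Xs \<in> dqs" "Ys \<in> dqs"
  "Cs \<in> dqs" "AL \<in> dqs" "AR \<in> dqs" "BL \<in> dqs" "BR \<in> dqs" "Ks \<in> dqs" "Rs \<in> dqs" "Ls \<in> dqs" "Mode \<in> dqs" "Ans \<in> dqs"
  by (auto simp: dqs_def)

lemma syms_mem [simp]: "Mark \<in> syms" "Lt c \<in> syms \<longleftrightarrow> fst c \<in> V" "Md m \<in> syms"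
  by (cases c; auto simp: syms_def)+

lemma imp_on_letter: "x \<in> syms \<Longrightarrow> (\<And>c. fst c \<in> V \<Longrightarrow> imp (F c)) \<Longrightarrow> imp (on_letter F x)"
  by (cases x) (simp_all add: imp_skip)

lemma imp_on_top: "q \<in> insert None (Some ` syms) \<Longrightarrow> (\<And>c. fst c \<in> V \<Longrightarrow> imp (F c)) \<Longrightarrow> imp g \<Longrightarrow> imp (on_top F g q)"
  by (cases "(F, g, q)" rule: on_top.cases) auto

lemma nb_V [simp]: "b \<in> set (nb a) \<Longrightarrow> b \<in> V"
  by (auto simp: nb_def vs)

lemmas imp_rules = imp_seq imp_skip imp_fold imp_foldr imp_case imp_case' imp_on_letter imp_on_top imp_if
  imp_push imp_pop_top imp_pop_bot

lemma imp_toggle: "i \<in> dqs \<Longrightarrow> imp (toggle i)"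
  unfolding toggle_def by (intro imp_rules) simp_all

lemma imp_push_letter: "fst c \<in> V \<Longrightarrow> imp (push_letter c)"
  unfolding push_letter_def by (intro imp_rules) simp_all

lemma imp_drop: "imp (drop_top a)" "imp (drop_bot a)"
  unfolding drop_top_def drop_bot_def by (intro imp_rules; simp)+

lemma imp_push_reduce: "fst c \<in> V \<Longrightarrow> imp (push_reduce c)"
  unfolding push_reduce_def by (intro imp_rules imp_drop imp_push_letter) simp_all

lemma imp_peel_all: "imp (peel_all b)"
  unfolding peel_all_def peel_def
  by (intro imp_rules imp_drop imp_push_letter imp_toggle) (simp_all add: vs)

lemma imp_take_least: "set os \<subseteq> V \<Longrightarrow> imp (take_least os)"
  unfolding take_least_def take_first_def by (intro imp_rules imp_drop) auto

lemma imp_if_blocked: "imp f \<Longrightarrow> imp g \<Longrightarrow> imp (if_blocked r a f g)"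
  unfolding if_blocked_def by (intro imp_rules) simp_all

lemma imp_shift: "i \<in> dqs \<Longrightarrow> j \<in> dqs \<Longrightarrow> imp (shift i j)"
  unfolding shift_def by (intro imp_case) (auto intro!: imp_rules)

lemma imp_cmp_tick: "imp cmp_tick"
  unfolding cmp_tick_def cmp_step_def rew_step_def by (intro imp_rules imp_shift) simp_all

lemma lin_imp_clear: "i \<in> dqs \<Longrightarrow> lin_imp (clear i)"
  unfolding clear_def by (intro lin_imp_for_each imp_skip) (simp_all add: skip_def)

lemma lin_imp_move: "i \<in> dqs \<Longrightarrow> j \<in> dqs \<Longrightarrow> i \<noteq> j \<Longrightarrow> lin_imp (move i j)"
  unfolding move_def by (intro lin_imp_for_each imp_push) (simp_all add: push_def)

lemma lin_imp_for: "i \<in> dqs \<Longrightarrow> (\<And>x. x \<in> syms \<Longrightarrow> imp (F x)) \<Longrightarrow> (\<And>x. keeps i (F x)) \<Longrightarrow> lin_imp (for_each i F)"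
  by (intro lin_imp_for_each) (simp_all add: keepsD)

lemma lin_imp_prep: "lin_imp (prep b)"
  unfolding prep_def build_def
  apply (intro lin_imp_seq lin_imp_for lin_imp_clear)
  apply (auto intro!: imp_rules keeps_rules imp_push_reduce imp_toggle keeps_push_reduce keeps_toggle imp_peel_all keeps_peel_all
      imp_take_least keeps_take_least simp: vs split: prod.split)
  done

lemma lin_imp_clear_flags: "lin_imp clear_flags"
  unfolding clear_flags_def by (intro lin_imp_fold lin_imp_clear) (simp add: vs)

lemma lin_imp_pass: "lin_imp (pass b r)"
  unfolding pass_def
  by (intro lin_imp_seq lin_imp_for lin_imp_clear_flags lin_imp_move)
    (auto intro!: imp_rules keeps_rules imp_if_blocked keeps_if_blocked)

lemma lin_imp_make_z: "r \<in> V \<Longrightarrow> lin_imp (make_z d b r)"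
  unfolding make_z_def
  by (intro lin_imp_seq lin_imp_for lin_imp_clear_flags lin_imp_move lin_imp_funpow lin_imp_pass)
    (auto intro!: imp_rules keeps_rules imp_if_blocked keeps_if_blocked imp_push_letter keeps_push_letter
      imp_take_least keeps_take_least simp: order_def vs)

lemma lin_imp_compare: "lin_imp (compare d)"
  unfolding compare_def
  by (intro lin_imp_seq lin_imp_for lin_imp_move lin_imp_fold lin_imp_clear imp_lin_imp)
    (auto intro!: imp_rules keeps_rules imp_cmp_tick keeps_cmp_tick)

lemma lin_imp_main: "lin_imp main"
  unfolding main_def round_def check_par_def check_link_def decide_def
  by (intro lin_imp_seq lin_imp_prep lin_imp_fold lin_imp_make_z lin_imp_compare lin_imp_for lin_imp_move lin_imp_clear
      imp_lin_imp)
    (auto intro!: imp_rules keeps_rules simp: vs)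

end

section \<open>Correctness of the program\<close>

lemma store_ops: "push i c s = s(i := s i @ [c])" "pop_top i s = s(i := butlast (s i))" "pop_bot i s = s(i := tl (s i))"
  by (simp_all only: push_def pop_top_def pop_bot_def)

text \<open>A loop rule with the invariant indexed by the consumed prefix \<open>ds\<close>. The
  letter is popped before the body runs, hence the body acts on \<open>t(i := rest)\<close>.\<close>

lemma for_each_rule_full:
  assumes "Q [] s"
    and "\<And>ds c rest t. s i = ds @ c # rest \<Longrightarrow> Q ds t \<Longrightarrow> t i = c # rest \<Longrightarrow> Q (ds @ [c]) (F c (t(i := rest)))"
    and "\<And>c. keeps i (F c)"
  shows "Q (s i) (for_each i F s)" "for_each i F s i = []"
proof -
  have "Q (s i) (drain i F rest t) \<and> drain i F rest t i = []" if "s i = ds @ rest" "Q ds t" "t i = rest" for ds rest t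
    using that
  proof (induction rest arbitrary: ds t)
    case (Cons c rest)
    have "Q (ds @ [c]) (F c (t(i := rest)))" using assms(2) Cons.prems by blast
    moreover have "F c (t(i := rest)) i = rest" using keepsD[OF assms(3), of c "t(i := rest)"] by simp
    ultimately show ?case using Cons.IH[of "ds @ [c]"] Cons.prems by simp
  qed simp
  from this[of "[]" "s i" s] show "Q (s i) (for_each i F s)" "for_each i F s i = []"
    using assms(1) by (simp_all add: for_each_def)
qed

lemmas for_each_rule = for_each_rule_full(1)

lemma for_each_empty: "(\<And>c. keeps i (F c)) \<Longrightarrow> for_each i F s i = []"
  by (rule for_each_rule_full(2)[of "\<lambda>_ _. True"]) auto

lemma clear_store: "clear i s = s(i := [])"
proof -
  have "drain i (\<lambda>_. skip) xs s = s(i := [])" if "s i = xs" for xs s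
    using that by (induction xs arbitrary: s) (auto simp: skip_def)
  then show ?thesis by (simp add: clear_def for_each_def)
qed

lemma move_store:
  assumes "i \<noteq> j"
  shows "move i j s = s(i := [], j := s j @ s i)"
proof -
  have "drain i (push j) xs s = s(i := [], j := s j @ xs)" if "s i = xs" for xs s
    using that
  proof (induction xs arbitrary: s)
    case (Cons x xs)
    have "push j x (s(i := xs)) i = xs" using assms by (simp add: store_ops)
    note IH = Cons.IH[of "push j x (s(i := xs))", OF this]
    show ?case unfolding drain.simps IH by (rule ext) (use assms in \<open>simp add: store_ops\<close>)
  qed (use assms in \<open>auto simp: fun_eq_iff\<close>)
  then show ?thesis by (simp add: move_def for_each_def)
qed

definition pm :: "bool \<Rightarrow> 'a sym list" where
  "pm p = (if p then [Mark] else [])"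

lemma pm_simps [simp]: "pm True = [Mark]" "pm False = []" "pm p = [] \<longleftrightarrow> \<not> p"
  by (auto simp: pm_def)

lemma case_pm: "s i = pm p \<Longrightarrow> case_top i F s = F (if p then Some Mark else None) s"
  by (cases p) (simp_all add: case_top_def)

lemma toggle_pm: "s i = pm p \<Longrightarrow> toggle i s = s(i := pm (\<not> p))"
  by (rule ext, cases p) (simp_all add: toggle_def case_top_def store_ops)

section \<open>Pilings as representations of traces\<close>

context traag_program
begin

definition stk :: "'a \<Rightarrow> ('a \<times> bool \<times> bool) list \<Rightarrow> 'a sym list" where
  "stk a w = map (\<lambda>c. if fst c = a then Lt c else Mark) (filter (\<lambda>c. \<not> comm a (fst c)) w)"

definition piles :: "('a \<times> bool \<times> bool) list \<Rightarrow> 'a store \<Rightarrow> bool" where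
  "piles w s \<longleftrightarrow> (\<forall>a\<in>V. s (Pile a) = stk a w)"

lemma stk_Nil [simp]: "stk a [] = []"
  by (simp add: stk_def)

lemma stk_append [simp]: "stk a (u @ v) = stk a u @ stk a v"
  by (simp add: stk_def)

lemma stk_single: "stk a [c] = (if comm a (fst c) then [] else if fst c = a then [Lt c] else [Mark])"
  by (simp add: stk_def)

lemma stk_Cons: "stk a (c # w) = stk a [c] @ stk a w"
  using stk_append[of a "[c]" w] by simp

lemma stk_rev: "stk a (rev w) = rev (stk a w)"
  by (simp add: stk_def rev_map rev_filter)

lemma stk_comm:
  assumes "\<forall>d\<in>set p. tw.lcomm c d"
  shows "stk a p @ stk a [c] = stk a [c] @ stk a p"
proof (cases "comm a (fst c)")
  case False
  show ?thesis
  proof (cases "fst c = a")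
    case True
    then have "stk a p = []" using assms by (auto simp: stk_def tw.lcomm_def filter_empty_conv)
    then show ?thesis by simp
  next
    case c: False
    \<comment> \<open>A letter of \<open>p\<close> over \<open>a\<close> would commute with
      \<open>c\<close>, but \<open>a\<close> does not. So \<open>p\<close> leaves only marks on this
      pile, and the mark of \<open>c\<close> can be moved past them.\<close>
    have "stk a p = replicate (length (stk a p)) Mark"
    proof (rule replicate_eqI)
      fix x assume "x \<in> set (stk a p)"
      then obtain d where d: "d \<in> set p" "\<not> comm a (fst d)" "x = (if fst d = a then Lt d else Mark)"
        by (auto simp: stk_def)
      then have "fst d \<noteq> a" using assms False comm_sym by (auto simp: tw.lcomm_def)
      then show "x = Mark" using d by simp
    qed simp
    then show ?thesis using False c by (simp add: stk_single) (metis replicate_append_same)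
  qed
qed (simp add: stk_single)

lemma stk_teq: "tw.teq u v \<Longrightarrow> stk a u = stk a v"
proof (induction u arbitrary: v)
  case (Cons c u)
  from tw.teq_Cons_split[OF Cons.prems] obtain p q where
    pq: "v = p @ c # q" "\<forall>d\<in>set p. tw.lcomm c d" "tw.teq u (p @ q)" .
  have "stk a (c # u) = stk a [c] @ stk a p @ stk a q"
    using Cons.IH[OF pq(3)] by (simp add: stk_Cons[of a c u])
  also have "\<dots> = stk a v" using stk_comm[OF pq(2)] by (simp add: pq(1) stk_Cons[of a c q])
  finally show ?case .
qed simp

text \<open>Every letter that does not commute with \<open>a\<close> leaves an entry on this pile.
  If the lowest entry is the letter \<open>c\<close> itself, all letters in front of
  \<open>c\<close> commute with it.\<close>

lemma stk_hd: "stk a w \<noteq> [] \<and> hd (stk a w) = Lt c \<longleftrightarrow> fst c = a \<and> (\<exists>z. tw.teq w (c # z))"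
proof
  assume "stk a w \<noteq> [] \<and> hd (stk a w) = Lt c"
  then obtain xs where "stk a w = Lt c # xs" by (cases "stk a w") auto
  then obtain d ds where d: "filter (\<lambda>c. \<not> comm a (fst c)) w = d # ds" "(if fst d = a then Lt d else Mark) = Lt c"
    by (auto simp: stk_def)
  then have dc: "d = c" "fst c = a" by (auto split: if_splits)
  from d(1) obtain p q where w: "w = p @ d # q" "\<forall>e\<in>set p. comm a (fst e)" unfolding filter_eq_Cons_iff by auto
  then have "tw.teq w (c # p @ q)" using tw.teq_move_in[of p c q] dc by (simp add: tw.lcomm_def)
  then show "fst c = a \<and> (\<exists>z. tw.teq w (c # z))" using dc by blast
next
  assume "fst c = a \<and> (\<exists>z. tw.teq w (c # z))"
  then obtain z where z: "fst c = a" "tw.teq w (c # z)" by blast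
  have "stk a w = Lt c # stk a z" using stk_teq[OF z(2)] z(1) comm_irrefl by (simp add: stk_Cons[of a c z] stk_single)
  then show "stk a w \<noteq> [] \<and> hd (stk a w) = Lt c" by simp
qed

lemma stk_last: "stk a w \<noteq> [] \<and> last (stk a w) = Lt c \<longleftrightarrow> fst c = a \<and> (\<exists>z. tw.teq w (z @ [c]))"
proof -
  have "stk a w \<noteq> [] \<and> last (stk a w) = Lt c \<longleftrightarrow> stk a (rev w) \<noteq> [] \<and> hd (stk a (rev w)) = Lt c"
    by (simp add: stk_rev hd_rev)
  also have "\<dots> \<longleftrightarrow> fst c = a \<and> (\<exists>z. tw.teq (rev w) (c # z))" by (rule stk_hd)
  also have "(\<exists>z. tw.teq (rev w) (c # z)) \<longleftrightarrow> (\<exists>z. tw.teq w (z @ [c]))"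
  proof
    assume "\<exists>z. tw.teq (rev w) (c # z)"
    then obtain z where "tw.teq (rev w) (c # z)" by blast
    from tw.teq_rev[OF this] show "\<exists>z. tw.teq w (z @ [c])" by auto
  next
    assume "\<exists>z. tw.teq w (z @ [c])"
    then obtain z where "tw.teq w (z @ [c])" by blast
    from tw.teq_rev[OF this] show "\<exists>z. tw.teq (rev w) (c # z)" by auto
  qed
  finally show ?thesis .
qed

lemma piles_teq: "tw.teq u v \<Longrightarrow> piles u s \<longleftrightarrow> piles v s"
  by (simp add: piles_def stk_teq)

lemma fold_pile:
  assumes "\<And>b s. f b s = s(Pile b := h b (s (Pile b)))" "distinct bs"
  shows "fold f bs s (Pile a) = (if a \<in> set bs then h a (s (Pile a)) else s (Pile a))"
  using assms(2) by (induction bs arbitrary: s) (auto simp: assms(1))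

lemma nb: "distinct (nb a)" "b \<in> set (nb a) \<longleftrightarrow> b \<in> V \<and> \<not> comm a b"
  by (auto simp: nb_def vs)

lemma piles_push_letter:
  assumes "piles w s"
  shows "piles (w @ [c]) (push_letter c s)"
  unfolding piles_def
proof
  fix a assume a: "a \<in> V"
  have "push_letter c s (Pile a) = (if a \<in> set (nb (fst c)) then s (Pile a) @ [if a = fst c then Lt c else Mark] else s (Pile a))"
    unfolding push_letter_def by (rule fold_pile) (simp_all add: store_ops nb fun_eq_iff)
  then show "push_letter c s (Pile a) = stk a (w @ [c])"
    using assms a comm_sym by (auto simp: piles_def nb stk_single)
qed

lemma piles_drop_top:
  assumes "piles w s" "tw.teq w (z @ [c])" "a = fst c"
  shows "piles z (drop_top a s)"
  unfolding piles_def
proof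
  fix b assume b: "b \<in> V"
  have "drop_top a s (Pile b) = (if b \<in> set (nb a) then butlast (s (Pile b)) else s (Pile b))"
    unfolding drop_top_def by (rule fold_pile) (simp_all add: store_ops nb fun_eq_iff)
  then show "drop_top a s (Pile b) = stk b z"
    using assms b comm_sym stk_teq[OF assms(2), of b] by (auto simp: piles_def nb stk_single)
qed

lemma piles_drop_bot:
  assumes "piles w s" "tw.teq w (c # z)" "a = fst c"
  shows "piles z (drop_bot a s)"
  unfolding piles_def
proof
  fix b assume b: "b \<in> V"
  have "drop_bot a s (Pile b) = (if b \<in> set (nb a) then tl (s (Pile b)) else s (Pile b))"
    unfolding drop_bot_def by (rule fold_pile) (simp_all add: store_ops nb fun_eq_iff)
  then show "drop_bot a s (Pile b) = stk b z"
    using assms b comm_sym stk_teq[OF assms(2), of b] by (auto simp: piles_def nb stk_Cons[of b c z] stk_single)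
qed

lemma case_top_pile:
  assumes "piles w s" "a \<in> V"
  obtains c z where "fst c = a" "tw.teq w (z @ [c])" "\<And>F. case_top (Pile a) F s = F (Some (Lt c)) s"
  | q where "\<And>c. q \<noteq> Some (Lt c)" "\<nexists>c z. fst c = a \<and> tw.teq w (z @ [c])" "\<And>F. case_top (Pile a) F s = F q s"
proof -
  have s: "s (Pile a) = stk a w" using assms by (simp add: piles_def)
  show ?thesis
  proof (cases "\<exists>c z. fst c = a \<and> tw.teq w (z @ [c])")
    case True
    then obtain c z where c: "fst c = a" "tw.teq w (z @ [c])" by blast
    then have "stk a w \<noteq> [] \<and> last (stk a w) = Lt c" using stk_last by blast
    then show ?thesis using that(1)[OF c] s by (simp add: case_top_def)
  next
    case False
    then have "\<not> (stk a w \<noteq> [] \<and> last (stk a w) = Lt c)" for c using stk_last by blast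
    then have "(if s (Pile a) = [] then None else Some (last (s (Pile a)))) \<noteq> Some (Lt c)" for c
      unfolding s by (cases "stk a w = []") auto
    then show ?thesis by (rule that(2)[OF _ False]) (simp add: case_top_def)
  qed
qed

lemma case_bot_pile:
  assumes "piles w s" "a \<in> V"
  obtains c z where "fst c = a" "tw.teq w (c # z)" "\<And>F. case_bot (Pile a) F s = F (Some (Lt c)) s"
  | q where "\<And>c. q \<noteq> Some (Lt c)" "\<nexists>c z. fst c = a \<and> tw.teq w (c # z)" "\<And>F. case_bot (Pile a) F s = F q s"
proof -
  have s: "s (Pile a) = stk a w" using assms by (simp add: piles_def)
  show ?thesis
  proof (cases "\<exists>c z. fst c = a \<and> tw.teq w (c # z)")
    case True
    then obtain c z where c: "fst c = a" "tw.teq w (c # z)" by blast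
    then have "stk a w \<noteq> [] \<and> hd (stk a w) = Lt c" using stk_hd by blast
    then show ?thesis using that(1)[OF c] s by (simp add: case_bot_def)
  next
    case False
    then have "\<not> (stk a w \<noteq> [] \<and> hd (stk a w) = Lt c)" for c using stk_hd by blast
    then have "(if s (Pile a) = [] then None else Some (hd (s (Pile a)))) \<noteq> Some (Lt c)" for c
      unfolding s by (cases "stk a w = []") auto
    then show ?thesis by (rule that(2)[OF _ False]) (simp add: case_bot_def)
  qed
qed

lemma on_top_other: "(\<And>c. q \<noteq> Some (Lt c)) \<Longrightarrow> on_top F g q = g"
  by (cases "(F, g, q)" rule: on_top.cases) auto

lemma push_reduce_piles:
  assumes "piles w s" "tw.irred w" "fst c \<in> V"
  obtains w' where "piles w' (push_reduce c s)" "tw.irred w'" "tw.teq w (w' @ [iv c]) \<or> w' = w @ [c]"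
proof -
  have no: "tw.irred (w @ [c])" if "\<nexists>z. tw.teq w (z @ [iv c])"
  proof (rule ccontr)
    assume "\<not> tw.irred (w @ [c])"
    then have "\<not> tw.irred (c # rev w)" using tw.irred_rev[of "c # rev w"] by auto
    then obtain z where "tw.teq (rev w) (iv c # z)" using tw.reducible_Cons tw.irred_rev[OF assms(2)] by blast
    from tw.teq_rev[OF this] show False using that by auto
  qed
  from assms(1,3) show ?thesis
  proof (cases rule: case_top_pile)
    case (1 d z)
    show ?thesis
    proof (cases "d = iv c")
      case True
      have "tw.irred z"
        using tw.not_irred_infix[of z "[]" "[d]"] tw.irred_teq[OF assms(2) 1(2)] by auto
      moreover have "piles z (push_reduce c s)"
        using piles_drop_top[OF assms(1) 1(2)] 1 True by (simp add: push_reduce_def)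
      ultimately show ?thesis using that 1(2) True by blast
    next
      case False
      have "\<nexists>z. tw.teq w (z @ [iv c])"
      proof clarify
        fix z' assume "tw.teq w (z' @ [iv c])"
        then have "fst (iv c) = fst c \<and> (\<exists>z. tw.teq w (z @ [iv c]))" by auto
        then have "last (stk (fst c) w) = Lt (iv c)" using stk_last by blast
        moreover have "last (stk (fst c) w) = Lt d" using stk_last 1 by blast
        ultimately show False using False by simp
      qed
      then show ?thesis using that[of "w @ [c]"] no piles_push_letter[OF assms(1), of c] False 1(3)
        by (simp add: push_reduce_def)
    qed
  next
    case (2 q)
    have "\<nexists>z. tw.teq w (z @ [iv c])" using 2(2) fst_th(2) by blast
    then show ?thesis using that[of "w @ [c]"] no piles_push_letter[OF assms(1), of c] 2(1,3)
      by (simp add: push_reduce_def)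
  qed
qed

definition rank :: "'a list \<Rightarrow> 'a \<Rightarrow> nat" where
  "rank os a = length (takeWhile (\<lambda>b. b \<noteq> a) os)"

lemma take_least_piles:
  assumes "piles w s" "set os \<subseteq> V" "\<exists>c z. fst c \<in> set os \<and> tw.teq w (c # z)"
  shows "\<exists>c z. tw.teq w (c # z) \<and> piles z (take_least os s) \<and> take_least os s Xs = s Xs @ [Lt c] \<and> fst c \<in> set os \<and>
    (\<forall>d z. fst d \<in> set os \<longrightarrow> tw.teq w (d # z) \<longrightarrow> rank os (fst c) \<le> rank os (fst d))"
  using assms(2,3)
proof (induction os)
  case (Cons a os)
  have a: "a \<in> V" using Cons.prems by simp
  from assms(1) a show ?case
  proof (cases rule: case_bot_pile)
    case (1 c z)
    have "take_least (a # os) s = push Xs (Lt c) (drop_bot a s)"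
      using 1(3) by (simp add: take_least_def take_first_def seq_def)
    moreover have "piles z (push Xs (Lt c) (drop_bot a s))"
      using piles_drop_bot[OF assms(1) 1(2)] 1(1) by (simp add: piles_def store_ops)
    moreover have "drop_bot a s Xs = s Xs" by (rule keepsD[OF keeps_drop(2)]) simp
    ultimately have "piles z (take_least (a # os) s)" "take_least (a # os) s Xs = s Xs @ [Lt c]"
      by (simp_all only: store_ops fun_upd_same)
    then show ?thesis using 1(1,2) by (intro exI[of _ c] exI[of _ z]) (simp add: rank_def)
  next
    case (2 q)
    have eq: "take_least (a # os) s = take_least os s"
      using 2(3) by (simp add: take_least_def take_first_def on_top_other[OF 2(1)])
    have "\<exists>c z. fst c \<in> set os \<and> tw.teq w (c # z)" using Cons.prems 2(2) by auto
    then obtain c z where c: "tw.teq w (c # z)" "piles z (take_least os s)" "take_least os s Xs = s Xs @ [Lt c]"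
      "fst c \<in> set os" "\<forall>d z. fst d \<in> set os \<longrightarrow> tw.teq w (d # z) \<longrightarrow> rank os (fst c) \<le> rank os (fst d)"
      using Cons by auto
    have "rank (a # os) g = Suc (rank os g)" if "g \<noteq> a" for g using that by (simp add: rank_def)
    then have "\<forall>d z. fst d \<in> set (a # os) \<longrightarrow> tw.teq w (d # z) \<longrightarrow> rank (a # os) (fst c) \<le> rank (a # os) (fst d)"
      using c 2(2) by (metis Suc_le_mono set_ConsD)
    then show ?thesis unfolding eq using c by (intro exI[of _ c] exI[of _ z]) auto
  qed
qed simp

lemma take_least_Nil:
  assumes "piles [] s" "set os \<subseteq> V"
  shows "take_least os s = s"
  using assms(2)
proof (induction os)
  case (Cons a os)
  have a: "a \<in> V" using Cons.prems by simp
  have "take_least (a # os) s = take_least os s"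
    using assms(1) a by (cases rule: case_bot_pile) (auto simp: take_least_def take_first_def on_top_other)
  then show ?case using Cons by simp
qed (simp add: take_least_def skip_def)

text \<open>\<open>lex_normal\<close> looks at the whole rest of the word, so normality of the
  output so far is no invariant by itself. The invariant says instead that any normal form of the
  remaining piles completes the output to a normal word. Surplus fuel is harmless, since an empty
  piling yields nothing.\<close>

lemma take_least_loop:
  assumes "piles w s" "set os \<subseteq> V" "fst ` set w \<subseteq> set os" "s Xs = []" "length w \<le> length (s f)" "f \<in> {Fu, Fu2}"
  obtains out where "tw.teq out w" "tw.lex_normal (rank os) out" "for_each f (\<lambda>_. take_least os) s Xs = map Lt out"
    "piles [] (for_each f (\<lambda>_. take_least os) s)" "for_each f (\<lambda>_. take_least os) s f = []"
proof -
  let ?Q = "\<lambda>ds t. \<exists>out v. t Xs = map Lt out \<and> piles v t \<and> tw.teq w (out @ v) \<and> length v \<le> length w - length ds \<and>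
    (\<forall>v'. tw.teq v' v \<longrightarrow> tw.lex_normal (rank os) v' \<longrightarrow> tw.lex_normal (rank os) (out @ v'))"
  have f: "f \<noteq> Xs" "\<And>a. f \<noteq> Pile a" "\<And>a. Pile a \<noteq> f" "Xs \<noteq> f" using assms(6) by auto
  have e: "for_each f (\<lambda>_. take_least os) s f = []"
    by (rule for_each_empty, rule keeps_take_least) (use f in auto)
  have "?Q (s f) (for_each f (\<lambda>_. take_least os) s)"
  proof (rule for_each_rule[where Q = ?Q])
    show "?Q [] s" using assms(1,4) by (intro exI[of _ "[]"] exI[of _ w]) auto
    fix ds c rest t assume t: "?Q ds t"
    then obtain out v where v: "t Xs = map Lt out" "piles v t" "tw.teq w (out @ v)" "length v \<le> length w - length ds"
      "\<forall>v'. tw.teq v' v \<longrightarrow> tw.lex_normal (rank os) v' \<longrightarrow> tw.lex_normal (rank os) (out @ v')" by blast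
    let ?t = "t(f := rest)"
    have p: "piles v ?t" using v(2) f by (simp add: piles_def)
    have x: "?t Xs = map Lt out" using v(1) f by simp
    have gens: "fst ` set v \<subseteq> set os" using tw.teq_set[OF v(3)] assms(3) by auto
    show "?Q (ds @ [c]) (take_least os ?t)"
    proof (cases v)
      case Nil
      then have "take_least os ?t = ?t" using take_least_Nil p assms(2) by simp
      then show ?thesis using v p x Nil by (intro exI[of _ out] exI[of _ v]) simp
    next
      case (Cons e v0)
      have "\<exists>c z. fst c \<in> set os \<and> tw.teq v (c # z)" using Cons gens by (intro exI[of _ e] exI[of _ v0]) auto
      from take_least_piles[OF p assms(2) this] obtain c' z where c: "tw.teq v (c' # z)" "piles z (take_least os ?t)"
        "take_least os ?t Xs = ?t Xs @ [Lt c']"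
        "\<forall>d z. fst d \<in> set os \<longrightarrow> tw.teq v (d # z) \<longrightarrow> rank os (fst c') \<le> rank os (fst d)" by blast
      have "tw.teq (out @ v) (out @ c' # z)" using c(1) by simp
      then have "tw.teq w ((out @ [c']) @ z)" using tw.teq_trans[OF v(3)] by simp
      moreover have "length z \<le> length w - length (ds @ [c])" using tw.teq_length[OF c(1)] v(4) by simp
      moreover have "tw.lex_normal (rank os) ((out @ [c']) @ v')" if "tw.teq v' z" "tw.lex_normal (rank os) v'" for v'
      proof -
        have cv: "tw.teq (c' # v') v" using tw.teq_trans[OF _ tw.teq_sym[OF c(1)], of "c' # v'"] that(1) by simp
        have "rank os (fst c') \<le> rank os (fst d)" if "tw.teq (c' # v') (d # y')" for d y'
        proof -
          have d: "tw.teq v (d # y')" using tw.teq_trans[OF tw.teq_sym[OF cv] that] .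
          then have "fst d \<in> set os" using tw.teq_set[OF d] gens by auto
          with d show ?thesis using c(4) by blast
        qed
        then have "tw.lex_normal (rank os) (c' # v')" using that(2) by simp
        then show ?thesis using v(5) cv by simp
      qed
      ultimately show ?thesis using c x by (intro exI[of _ "out @ [c']"] exI[of _ z]) simp
    qed
  qed (rule keeps_take_least; use f in auto)
  then obtain out v where v: "for_each f (\<lambda>_. take_least os) s Xs = map Lt out" "piles v (for_each f (\<lambda>_. take_least os) s)"
    "tw.teq w (out @ v)" "length v \<le> length w - length (s f)"
    "\<forall>v'. tw.teq v' v \<longrightarrow> tw.lex_normal (rank os) v' \<longrightarrow> tw.lex_normal (rank os) (out @ v')" by blast
  have "v = []" using v(4) assms(5) by simp
  have "tw.lex_normal (rank os) (out @ [])" using v(5) \<open>v = []\<close> by simp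
  then show ?thesis using that[of out] v(1-3) e \<open>v = []\<close> tw.teq_sym[of w out] by simp
qed

text \<open>The deques that are empty between phases. Piles and flags are restricted to
  \<open>V\<close> because the machine has no others.\<close>

abbreviation (input) scratch :: "'a dq \<Rightarrow> bool" where
  "scratch i \<equiv> (case i of Inp _ \<Rightarrow> False | Wd _ \<Rightarrow> False | Par _ \<Rightarrow> False | Fail _ \<Rightarrow> False | Ans \<Rightarrow> False
     | Pile a \<Rightarrow> a \<in> V | Flag a \<Rightarrow> a \<in> V | _ \<Rightarrow> True)"

definition clean :: "'a store \<Rightarrow> bool" where
  "clean s \<longleftrightarrow> (\<forall>i. scratch i \<longrightarrow> s i = [])"

lemma clean_piles: "clean s \<Longrightarrow> piles [] s"
  by (auto simp: clean_def piles_def)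

section \<open>Reading and cyclically reducing an input word\<close>

lemma build_spec:
  assumes s: "clean s" "s (Inp b) = map (\<lambda>(a, e). Lt (a, e, False)) u" "u \<in> lists (letters V)" "s (Par b) = []"
  obtains w where "piles w (build b s)" "tw.irred w" "marked False w" "unhat False w \<equiv>\<^sub>w u" "fst ` set w \<subseteq> V"
    "build b s (Par b) = pm (par u)" "length (build b s Fu) = length u" "length w \<le> length u"
proof -
  let ?f = "\<lambda>(a, e). Lt (a, e, False)"
  let ?Q = "\<lambda>ds t. \<forall>u1. ds = map ?f u1 \<longrightarrow> u1 \<in> lists (letters V) \<longrightarrow>
    (\<exists>w. piles w t \<and> tw.irred w \<and> marked False w \<and> unhat False w \<equiv>\<^sub>w u1 \<and> fst ` set w \<subseteq> V \<and>
    t (Par b) = pm (par u1) \<and> length (t Fu) = length u1 \<and> length w \<le> length u1)"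
  have inj: "inj ?f" by (auto simp: inj_def)
  have "?Q (s (Inp b)) (build b s)"
    unfolding build_def
  proof (rule for_each_rule[where Q = ?Q])
    show "?Q [] s" using s clean_piles by (auto simp: clean_def weq_refl)
    fix ds x rest t assume ds: "s (Inp b) = ds @ x # rest" and Q: "?Q ds t"
    from ds have "take (length ds) (s (Inp b)) = ds" "drop (length ds) (s (Inp b)) = x # rest" by simp_all
    then have ux: "ds = map ?f (take (length ds) u)" "map ?f (drop (length ds) u) = x # rest"
      unfolding s(2) take_map drop_map by simp_all
    define u1 where "u1 = take (length ds) u"
    obtain l u2 where l: "drop (length ds) u = l # u2" "x = ?f l" using ux(2) by auto
    obtain a e where ae: "l = (a, e)" by (cases l)
    have "u = u1 @ l # u2" using l(1) unfolding u1_def by (metis append_take_drop_id)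
    then have V: "u1 \<in> lists (letters V)" "a \<in> V" using s(3) ae by (auto simp: letters_def)
    obtain w where w: "piles w t" "tw.irred w" "marked False w" "unhat False w \<equiv>\<^sub>w u1" "fst ` set w \<subseteq> V"
      "t (Par b) = pm (par u1)" "length (t Fu) = length u1" "length w \<le> length u1"
      using Q ux(1) V(1) unfolding u1_def[symmetric] by blast
    let ?p = "par u1"
    define c where "c = (a, e \<noteq> (?p \<and> a \<in> J), ?p \<and> a = y)"
    let ?t = "t(Inp b := rest)"
    have cV: "fst c \<in> V" using V by (simp add: c_def)
    have "piles w ?t" using w(1) by (simp add: piles_def)
    then obtain w' where w': "piles w' (push_reduce c ?t)" "tw.irred w'" "tw.teq w (w' @ [iv c]) \<or> w' = w @ [c]"
      using push_reduce_piles w(2) cV by blast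
    have odd: "tw.odd_gen y w = ?p"
      using conjunct2[OF weq_geq_hat[OF w(4), of False]] by simp
    have "unhat False (w @ [c]) = unhat False w @ unhat ?p [c]" using odd by (simp add: unhat_append)
    also have "unhat ?p [c] = [l]" by (auto simp: c_def ae)
    finally have wc: "unhat False (w @ [c]) = unhat False w @ [l]" .
    have "[] @ unhat False w @ [l] \<equiv>\<^sub>w [] @ u1 @ [l]"
      by (rule weq_context[OF w(4)]) (use V ae in \<open>auto simp: letters_def\<close>)
    then have wcu: "unhat False (w @ [c]) \<equiv>\<^sub>w u1 @ [l]" using wc by simp
    have mc: "marked False (w @ [c])" using w(3) odd by (simp add: marked_append c_def)
    have gc: "fst ` set (w @ [c]) \<subseteq> V" using w(5) cV by simp
    have fin: "marked False w' \<and> unhat False w' \<equiv>\<^sub>w u1 @ [l] \<and> fst ` set w' \<subseteq> V \<and> length w' \<le> Suc (length u1)"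
      using w'(3)
    proof
      assume "w' = w @ [c]"
      then show ?thesis using mc wcu gc w(8) by simp
    next
      assume t: "tw.teq w (w' @ [iv c])"
      then have t2: "tw.teq (w @ [c]) (w' @ iv c # iv (iv c) # [])"
        using tw.teq_append[OF t tw.teq_refl[of "[c]"]] by simp
      have g2: "fst ` set (w' @ iv c # iv (iv c) # []) \<subseteq> V" using tw.teq_set[OF t2] gc by simp
      have "unhat False (w @ [c]) \<equiv>\<^sub>w unhat False (w' @ iv c # iv (iv c) # [])"
        "marked False (w' @ iv c # iv (iv c) # [])"
        using unhat_teq[OF t2 gc, of False] mc by blast+
      then have "unhat False (w @ [c]) \<equiv>\<^sub>w unhat False (w' @ [])" "marked False (w' @ [])"
        using weq_trans unhat_cancel[OF g2, of False] by blast+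
      moreover have "length w' \<le> Suc (length u1)" using tw.teq_length[OF t] w(8) by simp
      ultimately show ?thesis using weq_trans[OF weq_sym wcu] g2 by simp
    qed
    let ?t1 = "push_reduce c ?t"
    have k: "?t1 (Par b) = pm ?p" "?t1 Fu = t Fu"
      using keepsD[OF keeps_push_reduce, of "Par b" c ?t] keepsD[OF keeps_push_reduce, of Fu c ?t] w(6) by simp_all
    let ?F = "on_letter (\<lambda>(a, e, m). case_top (Par b) (\<lambda>q. push_reduce (a, e \<noteq> (q \<noteq> None \<and> a \<in> J), q \<noteq> None \<and> a = y)) ;;
       (if a = y then toggle (Par b) else skip) ;; push Fu Mark)"
    have cp: "case_top (Par b) F ?t = F (if ?p then Some Mark else None) ?t" for F
      by (rule case_pm) (use w(6) in simp)
    have "?F x ?t = push Fu Mark (if a = y then toggle (Par b) ?t1 else ?t1)"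
      using l(2) ae by (simp add: seq_def cp c_def skip_def)
    also have "(if a = y then toggle (Par b) ?t1 else ?t1) = ?t1(Par b := pm (par (u1 @ [l])))"
      using toggle_pm[of ?t1 "Par b" ?p] k(1) ae by auto
    finally have F: "?F x ?t = push Fu Mark (?t1(Par b := pm (par (u1 @ [l]))))" .
    have "piles w' (?F x ?t)" unfolding F using w'(1) by (simp add: piles_def store_ops)
    moreover have "?F x ?t (Par b) = pm (par (u1 @ [l]))" "length (?F x ?t Fu) = Suc (length u1)"
      unfolding F using k w(7) by (simp_all add: store_ops)
    moreover have dsx: "ds @ [x] = map ?f (u1 @ [l])" using ux(1) l(2) by (simp add: u1_def)
    ultimately have "\<exists>w. piles w (?F x ?t) \<and> tw.irred w \<and> marked False w \<and> unhat False w \<equiv>\<^sub>w u1 @ [l] \<and> fst ` set w \<subseteq> V \<and>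
      ?F x ?t (Par b) = pm (par (u1 @ [l])) \<and> length (?F x ?t Fu) = length (u1 @ [l]) \<and> length w \<le> length (u1 @ [l])"
      using fin w'(2) by (intro exI[of _ w'] conjI) simp_all
    then show "?Q (ds @ [x]) (?F x ?t)"
      unfolding dsx inj_map_eq_map[OF inj] by blast
  qed (auto intro!: keeps_rules keeps_push_reduce keeps_toggle)
  from this[rule_format, OF s(2,3)] show ?thesis using that by blast
qed

text \<open>The two letters of a cyclic cancellation have the same generator \<open>a\<close>, and
  the first and the last letter over \<open>a\<close> are unique, so one test for each generator
  suffices. Putting the letter back after a failed test restores the piling of
  \<open>w\<close>.\<close>

lemma peel_piles:
  assumes "piles w s" "set os \<subseteq> V" "s (Par b) = pm eps" "s Sg = pm t"
  shows "(\<exists>c z. tw.teq w (c # z @ [iv (th eps c)]) \<and> piles z (foldr (peel b) os skip s) \<and>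
      foldr (peel b) os skip s Sg = pm (t \<noteq> (fst c = y)))
    \<or> (\<forall>c z. fst c \<in> set os \<longrightarrow> \<not> tw.teq w (c # z @ [iv (th eps c)])) \<and> piles w (foldr (peel b) os skip s) \<and>
      foldr (peel b) os skip s Sg = pm t"
  using assms
proof (induction os arbitrary: s)
  case Nil
  then show ?case by (simp add: skip_def)
next
  case (Cons a os)
  let ?g = "foldr (peel b) os skip"
  have a: "a \<in> V" and os: "set os \<subseteq> V" using Cons.prems(2) by simp_all
  have ab: "foldr (peel b) (a # os) skip = peel b a ?g" by simp
  from Cons.prems(1) a show ?case
  proof (cases rule: case_top_pile)
    case (2 q)
    have "foldr (peel b) (a # os) skip s = ?g s"
      unfolding ab peel_def 2(3) on_top_other[OF 2(1)] ..
    moreover have "\<not> tw.teq w (c # z @ [iv (th eps c)])" if "fst c = a" for c z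
    proof
      assume "tw.teq w (c # z @ [iv (th eps c)])"
      then have "tw.teq w ((c # z) @ [iv (th eps c)])" by simp
      moreover have "fst (iv (th eps c)) = a" using that by simp
      ultimately show False using 2(2) by blast
    qed
    ultimately show ?thesis using Cons.IH[OF Cons.prems(1) os Cons.prems(3,4)] by auto
  next
    case (1 c z0)
    let ?s = "drop_top a s"
    have p0: "piles z0 ?s" using piles_drop_top[OF Cons.prems(1) 1(2)] 1(1) by simp
    have k: "?s (Par b) = pm eps" "?s Sg = pm t"
      using keepsD[OF keeps_drop(1), of "Par b" a s] keepsD[OF keeps_drop(1), of Sg a s] Cons.prems(3,4) by simp_all
    have q: "(if eps then Some Mark else None) \<noteq> None \<longleftrightarrow> eps" by simp
    have e: "foldr (peel b) (a # os) skip s = case_bot (Pile a) (\<lambda>d.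
       if d = Some (Lt (th eps (iv c))) then drop_bot a ;; (if a = y then toggle Sg else skip)
       else push_letter c ;; ?g) ?s"
      unfolding ab peel_def 1(3) by (simp only: on_top.simps seq_def case_pm[of ?s "Par b", OF k(1)] q)
    have fail: ?thesis if "foldr (peel b) (a # os) skip s = ?g (push_letter c ?s)"
      "\<nexists>z. tw.teq z0 (th eps (iv c) # z)"
    proof -
      have "piles (z0 @ [c]) (push_letter c ?s)" using piles_push_letter[OF p0] .
      then have pw: "piles w (push_letter c ?s)" using piles_teq[OF 1(2)] by blast
      have "push_letter c ?s (Par b) = pm eps" "push_letter c ?s Sg = pm t"
        using keepsD[OF keeps_push_letter, of "Par b" c ?s] keepsD[OF keeps_push_letter, of Sg c ?s] k by simp_all
      note IH = Cons.IH[OF pw os this]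
      have "\<not> tw.teq w (d # z @ [iv (th eps d)])" if "fst d = a" for d z
      proof
        assume d: "tw.teq w (d # z @ [iv (th eps d)])"
        then have "tw.teq w ((d # z) @ [iv (th eps d)])" by simp
        moreover have "fst (iv (th eps d)) = a" using that by simp
        ultimately have "last (stk a w) = Lt (iv (th eps d))" using stk_last by blast
        moreover have "last (stk a w) = Lt c" using stk_last[of a w c] 1 by blast
        ultimately have c: "c = iv (th eps d)" by simp
        have "tw.teq (z0 @ [c]) ((d # z) @ [c])" using tw.teq_trans[OF tw.teq_sym[OF 1(2)] d] c by simp
        then have "tw.teq z0 (d # z)" by (simp only: tw.teq_append_right_iff)
        moreover have "th eps (iv c) = d" using c by (simp add: tw.th_iv)
        ultimately show False using \<open>\<nexists>z. tw.teq z0 (th eps (iv c) # z)\<close> by blast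
      qed
      then show ?thesis using IH unfolding that(1) by auto
    qed
    from p0 a show ?thesis
    proof (cases rule: case_bot_pile)
      case (2 q)
      have "\<nexists>z. tw.teq z0 (th eps (iv c) # z)"
      proof
        assume "\<exists>z. tw.teq z0 (th eps (iv c) # z)"
        moreover have "fst (th eps (iv c)) = a" using 1(1) by simp
        ultimately show False using 2(2) by blast
      qed
      moreover have "foldr (peel b) (a # os) skip s = ?g (push_letter c ?s)"
        unfolding e 2(3) using 2(1) by (simp add: seq_def)
      ultimately show ?thesis using fail by blast
    next
      case d: (1 d z)
      show ?thesis
      proof (cases "d = th eps (iv c)")
        case True
        have c: "c = iv (th eps d)" using True by (simp add: tw.th_iv)
        let ?s2 = "drop_bot a ?s"
        have eq: "foldr (peel b) (a # os) skip s = (if a = y then toggle Sg ?s2 else ?s2)"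
          unfolding e d(3) using True by (simp add: seq_def skip_def)
        have "tw.teq (z0 @ [c]) ((d # z) @ [c])" using d(2) by (simp only: tw.teq_append_right_iff)
        then have "tw.teq w (d # z @ [iv (th eps d)])" using tw.teq_trans[OF 1(2)] c by simp
        moreover have p2: "piles z ?s2" using piles_drop_bot[OF p0 d(2)] d(1) by simp
        have k2: "?s2 Sg = pm t" using keepsD[OF keeps_drop(2), of Sg a ?s] k(2) by simp
        have "piles z (foldr (peel b) (a # os) skip s)"
          unfolding eq toggle_pm[of ?s2 Sg, OF k2] using p2 by (auto simp: piles_def)
        moreover have "foldr (peel b) (a # os) skip s Sg = pm (t \<noteq> (fst d = y))"
          unfolding eq toggle_pm[of ?s2 Sg, OF k2] using d(1) k2 by simp
        ultimately show ?thesis by blast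
      next
        case False
        have "foldr (peel b) (a # os) skip s = ?g (push_letter c ?s)"
          unfolding e d(3) using False by (simp add: seq_def)
        moreover have "\<nexists>z. tw.teq z0 (th eps (iv c) # z)"
        proof
          assume "\<exists>z. tw.teq z0 (th eps (iv c) # z)"
          moreover have "fst (th eps (iv c)) = a" using 1(1) by simp
          ultimately have "hd (stk a z0) = Lt (th eps (iv c))" using stk_hd by blast
          moreover have "hd (stk a z0) = Lt d" using stk_hd[of a z0 d] d(1,2) by blast
          ultimately show False using False by simp
        qed
        ultimately show ?thesis using fail by blast
      qed
    qed
  qed
qed

text \<open>Rotate \<open>c\<close> to the end, where it becomes \<open>th eps c\<close> and
  cancels; if it is a \<open>y\<close>, the start parity moves.\<close>

lemma tconj_peel:
  assumes "tw.teq w (c # z @ [iv (th eps c)])" "fst ` set w \<subseteq> V" "tw.odd_gen y w = eps" "marked t w"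
  shows "tconj (unhat t w) (unhat (t \<noteq> (fst c = y)) z) \<and> marked (t \<noteq> (fst c = y)) z \<and> tw.odd_gen y z = eps"
proof -
  let ?w = "c # z @ [iv (th eps c)]" and ?t = "t \<noteq> (fst c = y)"
  have g: "fst ` set ?w \<subseteq> V" using assms(2) tw.teq_set[OF assms(1)] by simp
  have o: "tw.odd_gen y ?w = eps" using assms(3) tw.odd_gen_teq[OF assms(1)] by simp
  have m: "marked t ?w" and u: "unhat t w \<equiv>\<^sub>w unhat t ?w" using unhat_teq[OF assms(1,2)] assms(4) by blast+
  let ?v = "z @ iv (th eps c) # iv (iv (th eps c)) # []"
  have v: "(z @ [iv (th eps c)]) @ [th eps c] = ?v" by simp
  have r: "tconj (unhat t ?w) (unhat ?t ?v)" "marked ?t ?v"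
    using unhat_rotate[OF g o[symmetric], of t] m unfolding v by blast+
  have gv: "fst ` set ?v \<subseteq> V" using g by auto
  have "unhat ?t ?v \<equiv>\<^sub>w unhat ?t (z @ [])" "marked ?t (z @ [])"
    using unhat_cancel[OF gv, of ?t] r(2) by blast+
  moreover have "tw.odd_gen y z = eps" using o by auto
  ultimately show ?thesis using tconj_trans[OF weq_tconj[OF u] tconj_trans[OF r(1) weq_tconj]] by simp
qed

text \<open>A round either removes two letters or finds the word cyclically reduced, and from then
  on the word stays. So \<open>length w\<close> rounds are enough.\<close>

lemma peel_loop:
  assumes "piles w s" "tw.irred w" "marked False w" "fst ` set w \<subseteq> V" "s (Par b) = pm eps" "eps = tw.odd_gen y w"
    "s Sg = []" "s Fu2 = []" "length w \<le> length (s Fu)"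
  obtains v t where "piles v (for_each Fu (\<lambda>_. peel_all b ;; push Fu2 Mark) s)"
    "for_each Fu (\<lambda>_. peel_all b ;; push Fu2 Mark) s Sg = pm t"
    "tw.cyc_irred eps v" "marked t v" "fst ` set v \<subseteq> V" "tconj (unhat False w) (unhat t v)"
    "length v \<le> length (for_each Fu (\<lambda>_. peel_all b ;; push Fu2 Mark) s Fu2)"
proof -
  let ?Q = "\<lambda>ds u. \<exists>v t. piles v u \<and> tw.irred v \<and> marked t v \<and> fst ` set v \<subseteq> V \<and> tw.odd_gen y v = eps \<and>
    u (Par b) = pm eps \<and> u Sg = pm t \<and> tconj (unhat False w) (unhat t v) \<and> length (u Fu2) = length ds \<and>
    (tw.cyc_irred eps v \<or> length v \<le> length w - length ds) \<and> length v \<le> length w"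
  have "?Q (s Fu) (for_each Fu (\<lambda>_. peel_all b ;; push Fu2 Mark) s)"
  proof (rule for_each_rule[where Q = ?Q])
    have "tconj (unhat False w) (unhat False w)" using weq_tconj[OF weq_refl[OF unhat_letters[OF assms(4)]]] .
    then show "?Q [] s" by (intro exI[of _ w] exI[of _ False]) (use assms in simp)
    fix ds c rest u assume "?Q ds u"
    then obtain v t where v: "piles v u" "tw.irred v" "marked t v" "fst ` set v \<subseteq> V" "tw.odd_gen y v = eps"
      "u (Par b) = pm eps" "u Sg = pm t" "tconj (unhat False w) (unhat t v)" "length (u Fu2) = length ds"
      "tw.cyc_irred eps v \<or> length v \<le> length w - length ds" "length v \<le> length w" by blast
    let ?u = "u(Fu := rest)"
    have p: "piles v ?u" using v(1) by (simp add: piles_def)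
    have k: "peel_all b ?u (Par b) = pm eps" "peel_all b ?u Fu2 = u Fu2"
      using keepsD[OF keeps_peel_all, of "Par b" b ?u] keepsD[OF keeps_peel_all, of Fu2 b ?u] v(6) by simp_all
    let ?r = "peel_all b ?u"
    have E: "(peel_all b ;; push Fu2 Mark) ?u = ?r(Fu2 := ?r Fu2 @ [Mark])" by (simp add: seq_def store_ops)
    have "(\<exists>c z. tw.teq v (c # z @ [iv (th eps c)]) \<and> piles z ?r \<and> ?r Sg = pm (t \<noteq> (fst c = y)))
      \<or> (\<forall>c z. fst c \<in> set vs \<longrightarrow> \<not> tw.teq v (c # z @ [iv (th eps c)])) \<and> piles v ?r \<and> ?r Sg = pm t"
      unfolding peel_all_def by (rule peel_piles[OF p]) (use vs v(6,7) in simp_all)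
    then show "?Q (ds @ [c]) ((peel_all b ;; push Fu2 Mark) ?u)"
    proof (elim disjE exE conjE)
      fix c' z assume z: "tw.teq v (c' # z @ [iv (th eps c')])" "piles z ?r" "?r Sg = pm (t \<noteq> (fst c' = y))"
      note tc = tconj_peel[OF z(1) v(4,5,3)]
      have "tw.irred ([c'] @ z @ [iv (th eps c')])" using tw.irred_teq[OF v(2) z(1)] by simp
      then have "tw.irred z" using tw.not_irred_infix by blast
      moreover have "fst ` set z \<subseteq> V" using tw.teq_set[OF z(1)] v(4) by auto
      moreover have l: "length v = Suc (Suc (length z))" using tw.teq_length[OF z(1)] by simp
      have "length z \<le> length w - length (ds @ [c])"
      proof (cases "tw.cyc_irred eps v")
        case True
        then show ?thesis using z(1) unfolding tw.cyc_irred_def by blast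
      next
        case False
        then show ?thesis using v(10) l by simp
      qed
      moreover have "piles z ((peel_all b ;; push Fu2 Mark) ?u)" unfolding E using z(2) by (simp add: piles_def)
      moreover have "tconj (unhat False w) (unhat (t \<noteq> (fst c' = y)) z)" using tconj_trans[OF v(8)] tc by blast
      ultimately show ?thesis using tc k v(9,11) z(3) l unfolding E
        by (intro exI[of _ z] exI[of _ "t \<noteq> (fst c' = y)"] conjI) simp_all
    next
      assume z: "\<forall>c z. fst c \<in> set vs \<longrightarrow> \<not> tw.teq v (c # z @ [iv (th eps c)])" "piles v ?r" "?r Sg = pm t"
      have "\<not> tw.teq v (c # z @ [iv (th eps c)])" for c z
      proof
        assume a: "tw.teq v (c # z @ [iv (th eps c)])"
        then have "fst c \<in> V" using tw.teq_set[OF a] v(4) by auto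
        then show False using a z(1) vs by blast
      qed
      then have "tw.cyc_irred eps v" using v(2) by (simp add: tw.cyc_irred_def)
      moreover have "piles v ((peel_all b ;; push Fu2 Mark) ?u)" unfolding E using z(2) by (simp add: piles_def)
      ultimately show ?thesis using k v z(3) unfolding E
        by (intro exI[of _ v] exI[of _ t] conjI) simp_all
    qed
  qed (intro keeps_rules keeps_peel_all; simp)
  then obtain v t where v: "piles v (for_each Fu (\<lambda>_. peel_all b ;; push Fu2 Mark) s)" "tw.irred v" "marked t v" "fst ` set v \<subseteq> V"
    "for_each Fu (\<lambda>_. peel_all b ;; push Fu2 Mark) s Sg = pm t" "tconj (unhat False w) (unhat t v)"
    "length (for_each Fu (\<lambda>_. peel_all b ;; push Fu2 Mark) s Fu2) = length (s Fu)"
    "tw.cyc_irred eps v \<or> length v \<le> length w - length (s Fu)" "length v \<le> length w" by blast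
  have "tw.cyc_irred eps v"
    using v(8) assms(9) by (auto simp: tw.cyc_irred_def)
  then show ?thesis using that[of v t] v assms(9) by simp
qed

lemma map_letters_loop:
  assumes "\<And>c s. s i = pm t \<Longrightarrow> F (Lt c) s = s(j := s j @ [Lt (g c)])"
    and "\<And>x. keeps k (F x)" "s i = pm t" "s k = map Lt w" "j \<noteq> k" "i \<noteq> k" "i \<noteq> j"
  shows "for_each k F s = s(k := [], j := s j @ map (\<lambda>c. Lt (g c)) w)"
proof -
  have "drain k F (map Lt w) s = s(k := [], j := s j @ map (\<lambda>c. Lt (g c)) w)"
    if "s k = map Lt w" "s i = pm t" for s w
    using that
  proof (induction w arbitrary: s)
    case (Cons c w)
    let ?s = "s(k := map Lt w)"
    have "F (Lt c) ?s = ?s(j := ?s j @ [Lt (g c)])" using assms(1)[of ?s c] Cons.prems assms(6) by simp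
    moreover have "drain k F (map Lt w) (?s(j := ?s j @ [Lt (g c)])) =
      (?s(j := ?s j @ [Lt (g c)]))(k := [], j := (?s(j := ?s j @ [Lt (g c)])) j @ map (\<lambda>c. Lt (g c)) w)"
      by (rule Cons.IH) (use Cons.prems assms(5-7) in simp_all)
    ultimately show ?case unfolding list.map drain.simps by (simp only:) (rule ext, use assms(5) in simp)
  qed (rule ext, simp)
  then show ?thesis using assms(3,4) by (simp add: for_each_def)
qed

lemma keeps_build: "\<forall>a. i \<noteq> Pile a \<Longrightarrow> i \<noteq> Inp b \<Longrightarrow> i \<noteq> Par b \<Longrightarrow> i \<noteq> Fu \<Longrightarrow> keeps i (build b)"
  unfolding build_def case_prod_beta by (intro keeps_rules keeps_push_reduce keeps_toggle) simp_all

lemma build_Inp: "build b s (Inp b) = []"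
  unfolding build_def case_prod_beta
  by (rule for_each_empty) (intro keeps_rules keeps_push_reduce keeps_toggle; simp)

lemma keeps_peel_loop:
  "\<forall>a. i \<noteq> Pile a \<Longrightarrow> i \<notin> {Fu, Fu2, Sg} \<Longrightarrow> keeps i (for_each Fu (\<lambda>_. peel_all b ;; push Fu2 Mark))"
  by (intro keeps_rules keeps_peel_all) simp_all

lemma keeps_take_loop:
  "\<forall>a. i \<noteq> Pile a \<Longrightarrow> i \<notin> {f, Xs} \<Longrightarrow> keeps i (for_each f (\<lambda>_. take_least os))"
  by (intro keeps_rules keeps_take_least) simp_all

lemma prep_spec:
  assumes s: "clean s" "s (Inp b) = map (\<lambda>(a, e). Lt (a, e, False)) u" "u \<in> lists (letters V)" "s (Par b) = []"
    "s (Wd b) = []"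
  obtains u' where "tconj u u'" "par u' = par u" "tw.cyc_irred (par u) (hat False u')" "clean (prep b s)"
    "prep b s (Wd b) = map Lt (hat False u')" "prep b s (Par b) = pm (par u)"
    "prep b s (Inp b) = []" "\<And>d. prep b s (Inp (\<not> b)) = s (Inp (\<not> b))" "prep b s (Wd (\<not> b)) = s (Wd (\<not> b))"
    "prep b s (Par (\<not> b)) = s (Par (\<not> b))" "\<And>d. prep b s (Fail d) = s (Fail d)" "prep b s Ans = s Ans"
proof -
  define s1 where "s1 = build b s"
  define s2 where "s2 = for_each Fu (\<lambda>_. peel_all b ;; push Fu2 Mark) s1"
  define s3 where "s3 = for_each Fu2 (\<lambda>_. take_least vs) s2"
  define s4 where "s4 = for_each Xs (on_letter (\<lambda>c. case_top Sg (\<lambda>q. push (Wd b) (Lt (th (q \<noteq> None) c))))) s3"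
  have s4: "prep b s = s4(Sg := [])" by (simp add: prep_def seq_def s1_def s2_def s3_def s4_def clear_store)
  have k1: "s1 i = s i" if "\<forall>a. i \<noteq> Pile a" "i \<noteq> Inp b" "i \<noteq> Par b" "i \<noteq> Fu" for i
    unfolding s1_def by (rule keepsD[OF keeps_build[OF that]])
  have k2: "s2 i = s1 i" if "\<forall>a. i \<noteq> Pile a" "i \<notin> {Fu, Fu2, Sg}" for i
    unfolding s2_def by (rule keepsD[OF keeps_peel_loop]) (use that in blast)+
  have k3: "s3 i = s2 i" if "\<forall>a. i \<noteq> Pile a" "i \<notin> {Fu2, Xs}" for i
    unfolding s3_def by (rule keepsD[OF keeps_take_loop]) (use that in blast)+
  have cl: "s i = []" if "scratch i" for i using s(1) that by (simp add: clean_def)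
  obtain w where w: "piles w s1" "tw.irred w" "marked False w" "unhat False w \<equiv>\<^sub>w u" "fst ` set w \<subseteq> V"
    "s1 (Par b) = pm (par u)" "length (s1 Fu) = length u" "length w \<le> length u"
    unfolding s1_def using build_spec[OF s(1-4)] .
  have odd: "tw.odd_gen y w = par u" using conjunct2[OF weq_geq_hat[OF w(4), of False]] by simp
  obtain v t where v: "piles v s2" "s2 Sg = pm t" "tw.cyc_irred (par u) v" "marked t v" "fst ` set v \<subseteq> V"
    "tconj (unhat False w) (unhat t v)" "length v \<le> length (s2 Fu2)"
    unfolding s2_def
    by (rule peel_loop[OF w(1-3,5,6)]) (use odd w(7,8) k1 cl in auto)
  have s2x: "s2 Xs = []" using k2[of Xs] k1[of Xs] cl[of Xs] by simp
  obtain out where o: "tw.teq out v" "s3 Xs = map Lt out" "piles [] s3" "s3 Fu2 = []"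
    unfolding s3_def by (rule take_least_loop[OF v(1), of vs Fu2]) (use s2x v(5,7) vs in auto)
  have s3t: "s3 Sg = pm t" using k3[of Sg] v(2) by simp
  have "s4 = s3(Xs := [], Wd b := s3 (Wd b) @ map (\<lambda>c. Lt (th t c)) out)"
    unfolding s4_def
    by (rule map_letters_loop[where i = Sg and t = t])
      (use o(2) s3t in \<open>auto intro!: keeps_rules simp: case_pm store_ops\<close>)
  then have P: "prep b s = s3(Xs := [], Wd b := s3 (Wd b) @ map Lt (map (th t) out), Sg := [])"
    unfolding s4 by (simp add: o_def)
  define u' where "u' = unhat t out"
  have gout: "fst ` set out \<subseteq> V" using tw.teq_set[OF o(1)] v(5) by simp
  have uo: "unhat t out \<equiv>\<^sub>w unhat t v" "marked t out" using unhat_teq[OF o(1) gout, of t] v(4) by blast+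
  have H: "hat False u' = map (th t) out"
    using map_th_hat[of t t u'] hat_unhat[OF uo(2)] by (simp add: u'_def)
  have "tconj u u'"
    using tconj_trans[OF weq_tconj[OF weq_sym[OF w(4)]] tconj_trans[OF v(6) weq_tconj[OF weq_sym[OF uo(1)]]]]
    by (simp only: u'_def)
  moreover from tconj_geq[OF this] have "par u' = par u" by blast
  moreover have "tw.cyc_irred (par u) (hat False u')"
    unfolding H by (rule cyc_irred_map_th_any) (rule tw.cyc_irred_teq[OF v(3) tw.teq_sym[OF o(1)]])
  moreover have i0: "s3 (Inp b) = []" 
    using k3[of "Inp b"] k2[of "Inp b"] build_Inp[of b s] by (simp add: s1_def)
  have fu: "s2 Fu = []" unfolding s2_def by (rule for_each_empty) (simp add: keeps_rules keeps_peel_all)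
  have "s3 i = []" if "scratch i" "i \<noteq> Xs" "i \<noteq> Sg" for i
  proof (cases "i \<in> {Fu, Fu2}")
    case True
    then show ?thesis using o(4) k3[of Fu] fu by auto
  next
    case False
    show ?thesis
    proof (cases "\<exists>a. i = Pile a")
      case True
      then show ?thesis using o(3) that(1) by (auto simp: piles_def)
    next
      case F: False
      have "i \<noteq> Inp b" "i \<noteq> Par b" using that(1) by auto
      then have "s3 i = s i" using k3[of i] k2[of i] k1[of i] False F that(2,3) by auto
      then show ?thesis using cl that(1) by simp
    qed
  qed
  then have "clean (prep b s)" unfolding P clean_def by (auto split: dq.splits)
  moreover have "prep b s (Wd b) = map Lt (hat False u')"
    unfolding P H using k3[of "Wd b"] k2[of "Wd b"] k1[of "Wd b"] s(5) by simp
  moreover have "prep b s (Par b) = pm (par u)" unfolding P using k3[of "Par b"] k2[of "Par b"] w(6) by simp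
  moreover have "prep b s i = s i" if "i \<in> {Inp (\<not> b), Wd (\<not> b), Par (\<not> b), Fail d, Ans}" for i d
    unfolding P using that k3[of i] k2[of i] k1[of i] by auto
  moreover have "prep b s (Inp b) = []" unfolding P using i0 by simp
  ultimately show ?thesis by (intro that[of u']) simp_all
qed

section \<open>Pyramidal passes and normal forms on the machine\<close>

definition flags :: "'a set \<Rightarrow> 'a store \<Rightarrow> bool" where
  "flags B s \<longleftrightarrow> B \<subseteq> V \<and> (\<forall>a\<in>V. s (Flag a) = [] \<longleftrightarrow> a \<notin> B)"

lemma if_blocked:
  assumes "flags B s" "fst c \<in> V" "a = fst c"
  shows "if_blocked r a f g s = (if tw.blocked r B c then f s else g s)"
proof -
  have *: "foldr (\<lambda>b h. case_top (Flag b) (\<lambda>q. if q = None then h else f)) bs g s =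
    (if \<exists>b\<in>set bs. s (Flag b) \<noteq> [] then f s else g s)" for bs
    by (induction bs) (auto simp: case_top_def)
  have "(\<exists>b\<in>set (nb a). s (Flag b) \<noteq> []) \<longleftrightarrow> (\<exists>b\<in>B. \<not> comm b a)"
    using assms(1) comm_sym unfolding flags_def Bex_def nb(2) by blast
  then show ?thesis by (simp add: if_blocked_def tw.blocked_def * assms(3))
qed

lemma flags_push: "flags B s \<Longrightarrow> a \<in> V \<Longrightarrow> (\<And>b. b \<in> V \<Longrightarrow> t (Flag b) = (if b = a then s (Flag b) @ [x] else s (Flag b)))
  \<Longrightarrow> flags (insert a B) t"
  by (auto simp: flags_def)

lemma flags_cong: "flags B s \<Longrightarrow> (\<And>b. b \<in> V \<Longrightarrow> t (Flag b) = s (Flag b)) \<Longrightarrow> flags B t"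
  by (simp add: flags_def)

lemma clear_flags_store: "clear_flags s i = (if i \<in> Flag ` V then [] else s i)"
proof -
  have "fold (\<lambda>a. clear (Flag a)) as s i = (if i \<in> Flag ` set as then [] else s i)" for as
    by (induction as arbitrary: s) (auto simp: clear_store)
  then show ?thesis by (simp add: clear_flags_def vs)
qed

lemma keeps_clear_flags: "\<forall>a. i \<noteq> Flag a \<Longrightarrow> keeps i clear_flags"
  by (auto simp: keeps_def clear_flags_store)

lemma pass_drain:
  assumes "flags B s" "s (Par b) = pm eps" "fst ` set w \<subseteq> V"
    and F: "F = on_letter (\<lambda>c. if_blocked r (fst c) (push Ys (Lt c) ;; push (Flag (fst c)) Mark)
       (case_top (Par b) (\<lambda>q. push Cs (Lt (th (q \<noteq> None) c)))))"
  shows "drain Xs F (map Lt w) s Ys = s Ys @ map Lt (tw.taken r B w) \<and>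
    drain Xs F (map Lt w) s Cs = s Cs @ map Lt (map (th eps) (tw.skipped r B w))"
  using assms(1-3)
proof (induction w arbitrary: s B)
  case (Cons c w)
  let ?s = "s(Xs := map Lt w)"
  have fl: "flags B ?s" using Cons.prems(1) by (rule flags_cong) simp
  have c: "fst c \<in> V" using Cons.prems by simp
  have w: "fst ` set w \<subseteq> V" using Cons.prems by simp
  have p: "?s (Par b) = pm eps" using Cons.prems(2) by simp
  have q: "(if eps then Some Mark else None) \<noteq> None \<longleftrightarrow> eps" by simp
  let ?u = "F (Lt c) ?s"
  have e: "?u = (if tw.blocked r B c then ?s(Ys := s Ys @ [Lt c], Flag (fst c) := s (Flag (fst c)) @ [Mark])
      else ?s(Cs := s Cs @ [Lt (th eps c)]))"
    unfolding F on_letter.simps if_blocked[OF fl c HOL.refl] case_pm[of ?s "Par b", OF p] q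
    by (simp add: seq_def store_ops)
  have u: "?u (Par b) = pm eps" unfolding e using p by simp
  show ?case
  proof (cases "tw.blocked r B c")
    case True
    have f: "flags (insert (fst c) B) ?u"
      using flags_push[OF fl c, of ?u Mark] True unfolding e by simp
    have "?u Ys = s Ys @ [Lt c]" "?u Cs = s Cs" unfolding e using True by simp_all
    then show ?thesis using Cons.IH[OF f u w] True by (simp del: fun_upd_apply)
  next
    case False
    have f: "flags B ?u"
      using flags_cong[OF fl, of ?u] False unfolding e by simp
    have "?u Ys = s Ys" "?u Cs = s Cs @ [Lt (th eps c)]" unfolding e using False by simp_all
    then show ?thesis using Cons.IH[OF f u w] False by (simp del: fun_upd_apply)
  qed
qed simp

lemma pass_spec:
  assumes "s Xs = map Lt w" "s Ys = []" "s Cs = []" "flags {} s" "s (Par b) = pm eps" "fst ` set w \<subseteq> V"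
  shows "pass b r s Xs = map Lt (tw.pyr_pass eps r w)" "pass b r s Ys = []" "pass b r s Cs = []" "flags {} (pass b r s)"
proof -
  let ?F = "on_letter (\<lambda>c. if_blocked r (fst c) (push Ys (Lt c) ;; push (Flag (fst c)) Mark)
       (case_top (Par b) (\<lambda>q. push Cs (Lt (th (q \<noteq> None) c)))))"
  define t where "t = for_each Xs ?F s"
  have t: "t Ys = map Lt (tw.taken r {} w)" "t Cs = map Lt (map (th eps) (tw.skipped r {} w))"
    using pass_drain[OF assms(4,5,6) HOL.refl, of r] assms(1-3) by (simp_all add: for_each_def t_def)
  have x: "t Xs = []" unfolding t_def by (rule for_each_empty) (intro keeps_rules keeps_if_blocked; simp)
  have "move Cs Xs (move Ys Xs t) = t(Ys := [], Cs := [], Xs := t Ys @ t Cs)"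
    by (rule ext) (simp add: move_store x)
  then have "pass b r s = clear_flags (t(Ys := [], Cs := [], Xs := t Ys @ t Cs))"
    unfolding pass_def seq_def t_def by (simp only:)
  then show "pass b r s Xs = map Lt (tw.pyr_pass eps r w)" "pass b r s Ys = []" "pass b r s Cs = []" "flags {} (pass b r s)"
    using t by (simp_all add: clear_flags_store tw.pyr_pass_def flags_def image_iff)
qed

lemma keeps_pass: "\<forall>a. i \<noteq> Flag a \<Longrightarrow> i \<notin> {Xs, Ys, Cs} \<Longrightarrow> keeps i (pass b r)"
  unfolding pass_def
  by (intro keeps_rules keeps_if_blocked keeps_move keeps_clear_flags) simp_all

lemma passes_spec:
  assumes "s Xs = map Lt w" "s Ys = []" "s Cs = []" "flags {} s" "s (Par b) = pm eps" "fst ` set w \<subseteq> V"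
  shows "(pass b r ^^ n) s Xs = map Lt ((tw.pyr_pass eps r ^^ n) w) \<and> (pass b r ^^ n) s Ys = [] \<and>
    (pass b r ^^ n) s Cs = [] \<and> flags {} ((pass b r ^^ n) s)"
proof (induction n)
  case (Suc n)
  let ?s = "(pass b r ^^ n) s"
  have "?s (Par b) = pm eps" using keepsD[OF keeps_funpow[OF keeps_pass], of "Par b" n b r s] assms(5) by simp
  moreover have "fst ` set ((tw.pyr_pass eps r ^^ n) w) \<subseteq> V" using assms(6) by simp
  ultimately show ?case using Suc pass_spec[of ?s "(tw.pyr_pass eps r ^^ n) w" b eps r] by simp
qed (use assms in simp)

lemma taken_drain:
  assumes "flags B s" "piles p s" "fst ` set w \<subseteq> V"
    and F: "F = on_letter (\<lambda>c. if_blocked r (fst c) (push_letter c ;; push (Flag (fst c)) Mark ;; push Fu Mark) skip)"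
  shows "piles (p @ tw.taken r B w) (drain Xs F (map Lt w) s) \<and>
    length (drain Xs F (map Lt w) s Fu) = length (s Fu) + length (tw.taken r B w)"
  using assms(1-3)
proof (induction w arbitrary: s B p)
  case (Cons c w)
  let ?s = "s(Xs := map Lt w)" and ?a = "fst c"
  have fl: "flags B ?s" using Cons.prems(1) by (rule flags_cong) simp
  have pl: "piles p ?s" using Cons.prems(2) by (simp add: piles_def)
  have c: "?a \<in> V" using Cons.prems by simp
  have w: "fst ` set w \<subseteq> V" using Cons.prems by simp
  let ?t = "push_letter c ?s"
  let ?u = "F (Lt c) ?s"
  have e: "?u = (if tw.blocked r B c then ?t(Flag ?a := ?t (Flag ?a) @ [Mark], Fu := ?t Fu @ [Mark]) else ?s)"
    unfolding F on_letter.simps if_blocked[OF fl c HOL.refl]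
    by (simp add: seq_def store_ops skip_def)
  show ?case
  proof (cases "tw.blocked r B c")
    case True
    have k: "?t (Flag b) = s (Flag b)" "?t Fu = s Fu" for b
      using keepsD[OF keeps_push_letter, of "Flag b" c ?s] keepsD[OF keeps_push_letter, of Fu c ?s] by simp_all
    have f: "flags (insert ?a B) ?u"
      using flags_push[OF fl c, of ?u Mark] True k unfolding e by simp
    have p: "piles (p @ [c]) ?u"
      using piles_push_letter[OF pl, of c] True unfolding e by (simp add: piles_def)
    have "?u Fu = s Fu @ [Mark]" unfolding e using True k by simp
    then show ?thesis using Cons.IH[OF f p w] True by (simp del: fun_upd_apply)
  next
    case False
    have "?u = ?s" "?s Fu = s Fu" unfolding e using False by simp_all
    then show ?thesis using Cons.IH[OF fl pl w] False by (simp del: fun_upd_apply)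
  qed
qed simp

lemma map_letters_loop2:
  assumes "\<And>c s. s i = pm t \<Longrightarrow> F (Lt c) s = s(j := s j @ [Lt (g c)], j' := s j' @ [Lt (h c)])"
    and "s i = pm t" "s k = map Lt w" "distinct [i, j, j', k]"
  shows "for_each k F s = s(k := [], j := s j @ map (\<lambda>c. Lt (g c)) w, j' := s j' @ map (\<lambda>c. Lt (h c)) w)"
proof -
  have "drain k F (map Lt w) s = s(k := [], j := s j @ map (\<lambda>c. Lt (g c)) w, j' := s j' @ map (\<lambda>c. Lt (h c)) w)"
    if "s k = map Lt w" "s i = pm t" for s w
    using that
  proof (induction w arbitrary: s)
    case (Cons c w)
    let ?s = "s(k := map Lt w)"
    let ?u = "?s(j := ?s j @ [Lt (g c)], j' := ?s j' @ [Lt (h c)])"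
    have "F (Lt c) ?s = ?u" using assms(1)[of ?s c] Cons.prems assms(4) by simp
    moreover have "drain k F (map Lt w) ?u =
      ?u(k := [], j := ?u j @ map (\<lambda>c. Lt (g c)) w, j' := ?u j' @ map (\<lambda>c. Lt (h c)) w)"
      by (rule Cons.IH) (use Cons.prems assms(4) in auto)
    ultimately show ?case unfolding list.map drain.simps by (simp only:) (rule ext, use assms(4) in auto)
  qed (rule ext, simp)
  then show ?thesis using assms(2,3) by (simp add: for_each_def)
qed

lemma set_order: "r \<in> V \<Longrightarrow> set (order r) = V"
  by (auto simp: order_def vs)

lemma keeps_z_loop:
  "\<forall>a. i \<noteq> Pile a \<Longrightarrow> \<forall>a. i \<noteq> Flag a \<Longrightarrow> i \<notin> {Xs, Fu} \<Longrightarrow>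
    keeps i (for_each Xs (on_letter (\<lambda>c. if_blocked r (fst c) (push_letter c ;; push (Flag (fst c)) Mark ;; push Fu Mark) skip)))"
  by (intro keeps_rules keeps_if_blocked keeps_push_letter) simp_all

lemma z_loop_Xs:
  "for_each Xs (on_letter (\<lambda>c. if_blocked r (fst c) (push_letter c ;; push (Flag (fst c)) Mark ;; push Fu Mark) skip)) s Xs = []"
  by (rule for_each_empty) (intro keeps_rules keeps_if_blocked keeps_push_letter; simp)

lemma make_z_spec:
  assumes "\<forall>i. scratch i \<longrightarrow> i \<noteq> Zs (\<not> b) \<longrightarrow> s i = []" "r \<in> V" "s (Wd b) = map Lt w" "fst ` set w \<subseteq> V"
    "s (Par b) = pm eps"
  obtains z where "tw.canon eps N r (rank (order r)) (map (th (d \<and> \<not> b)) w) z"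
    "make_z d b r s (Zs b) = map Lt (z @ map (th eps) z)"
    "\<And>i. i \<in> dqs \<Longrightarrow> i \<noteq> Zs b \<Longrightarrow> make_z d b r s i = s i"
proof -
  let ?w = "map (th (d \<and> \<not> b)) w" and ?rk = "rank (order r)"
  have s0: "s i = []" if "scratch i" "i \<noteq> Zs (\<not> b)" for i using assms(1) that by blast
  define s1 where "s1 = s(Wd b := map Lt w, Xs := map Lt ?w, Cs := [])"
  have 1: "(for_each (Wd b) (on_letter (\<lambda>c. push Cs (Lt c) ;; push Xs (Lt (th (d \<and> \<not> b) c)))) ;; move Cs (Wd b)) s = s1"
  proof -
    have "for_each (Wd b) (on_letter (\<lambda>c. push Cs (Lt c) ;; push Xs (Lt (th (d \<and> \<not> b) c)))) s =
      s(Wd b := [], Cs := s Cs @ map (\<lambda>c. Lt c) w, Xs := s Xs @ map (\<lambda>c. Lt (th (d \<and> \<not> b) c)) w)"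
      by (rule map_letters_loop2[where i = "Par b" and t = eps, OF _ assms(5,3)]) (simp_all add: seq_def store_ops)
    then show ?thesis using s0[of Xs] s0[of Cs]
      by (intro ext) (simp add: seq_def move_store s1_def o_def)
  qed
  define s2 where "s2 = (pass b r ^^ N) s1"
  have w': "fst ` set ?w \<subseteq> V" using assms(4) by auto
  have s1: "s1 Ys = []" "flags {} s1" "s1 (Par b) = pm eps" "s1 Xs = map Lt ?w" "s1 Cs = []"
    using s0 assms(5) by (simp_all add: s1_def flags_def)
  let ?v = "(tw.pyr_pass eps r ^^ N) ?w"
  have s2: "s2 Xs = map Lt ?v" "s2 Ys = []" "s2 Cs = []" "flags {} s2"
    unfolding s2_def using passes_spec[OF s1(4,1,5,2,3) w'] by blast+
  have k2: "s2 i = s1 i" if "\<forall>a. i \<noteq> Flag a" "i \<notin> {Xs, Ys, Cs}" for i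
    unfolding s2_def by (rule keepsD[OF keeps_funpow[OF keeps_pass[OF that]]])
  let ?F = "on_letter (\<lambda>c. if_blocked r (fst c) (push_letter c ;; push (Flag (fst c)) Mark ;; push Fu Mark) skip)"
  define s3 where "s3 = for_each Xs ?F s2"
  define s4 where "s4 = clear_flags s3"
  let ?t = "tw.taken r {} ?v"
  have v: "fst ` set ?v \<subseteq> V" using w' by simp
  have p2: "piles [] s2" using k2 s0 by (simp add: piles_def s1_def)
  have s3: "piles ?t s3" "length (s3 Fu) = length ?t"
    using taken_drain[OF s2(4) p2 v HOL.refl, of r] s2(1) k2[of Fu] s0[of Fu] 
    by (simp_all add: s3_def for_each_def s1_def)
  have k3: "s3 i = s2 i" if "\<forall>a. i \<noteq> Pile a" "\<forall>a. i \<noteq> Flag a" "i \<notin> {Xs, Fu}" for i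
    unfolding s3_def by (rule keepsD[OF keeps_z_loop[OF that]])
  have s4: "piles ?t s4" "length ?t \<le> length (s4 Fu)" "s4 Xs = []"
    using s3 z_loop_Xs[of r s2] by (auto simp: s4_def clear_flags_store piles_def s3_def)
  define s5 where "s5 = for_each Fu (\<lambda>_. take_least (order r)) s4"
  have gt: "fst ` set ?t \<subseteq> set (order r)"
    using tw.set_taken_skipped[of ?v r "{}"] v set_order[OF assms(2)] by auto
  have so: "set (order r) \<subseteq> V" using set_order[OF assms(2)] by simp
  obtain z where z: "tw.teq z ?t" "tw.lex_normal ?rk z" "s5 Xs = map Lt z" "piles [] s5" "s5 Fu = []"
    unfolding s5_def using take_least_loop[OF s4(1) so gt s4(3,2), of thesis] by blast
  have k5: "s5 i = s4 i" if "\<forall>a. i \<noteq> Pile a" "i \<notin> {Fu, Xs}" for i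
    unfolding s5_def by (rule keepsD[OF keeps_take_loop[OF that]])
  have all: "s5 i = s1 i" if "\<forall>a. i \<noteq> Pile a" "\<forall>a. i \<noteq> Flag a" "i \<notin> {Fu, Xs, Ys, Cs}" for i
    using k5[of i] k3[of i] k2[of i] that by (auto simp: s4_def clear_flags_store)
  have y5: "s5 Ys = []" "s5 Cs = []"
    using k5[of Ys] k3[of Ys] s2 k5[of Cs] k3[of Cs] by (simp_all add: s4_def clear_flags_store image_iff)
  have p5: "s5 (Par b) = pm eps" using all[of "Par b"] s1(3) by simp
  have z5: "s5 (Zs b) = []" using all[of "Zs b"] s0[of "Zs b"] by (simp add: s1_def)
  have "for_each Xs (on_letter (\<lambda>c. push (Zs b) (Lt c) ;; case_top (Par b) (\<lambda>q. push Ys (Lt (th (q \<noteq> None) c))))) s5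
    = s5(Xs := [], Zs b := s5 (Zs b) @ map (\<lambda>c. Lt c) z, Ys := s5 Ys @ map (\<lambda>c. Lt (th eps c)) z)"
    by (rule map_letters_loop2[where i = "Par b" and t = eps, OF _ p5 z(3)], rule ext) (simp_all add: seq_def store_ops case_pm)
  then have M: "make_z d b r s = s5(Xs := [], Ys := [], Zs b := map Lt (z @ map (th eps) z))"
    unfolding make_z_def s5_def s4_def s3_def s2_def 1[symmetric]
    using y5 z5 by (intro ext) (simp add: seq_def move_store o_def s5_def s4_def s3_def s2_def 1[symmetric])
  have "make_z d b r s i = s i" if i: "i \<in> dqs" "i \<noteq> Zs b" for i
  proof -
    consider a where "i = Pile a" "a \<in> V" | a where "i = Flag a" "a \<in> V" | "i \<in> {Fu, Xs, Ys, Cs}" |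
      "\<forall>a. i \<noteq> Pile a" "\<forall>a. i \<noteq> Flag a" "i \<notin> {Fu, Xs, Ys, Cs}" using i(1) unfolding dqs_def by blast
    then show ?thesis
    proof cases
      case 1
      then show ?thesis using z(4) s0[of i] by (simp add: M piles_def)
    next
      case 2
      then show ?thesis using k5[of i] s0[of i] by (simp add: M s4_def clear_flags_store)
    next
      case 3
      then show ?thesis using z(5) y5(2) s0 by (auto simp: M)
    next
      case 4
      then show ?thesis using all[OF 4] i(2) assms(3) by (auto simp: M s1_def)
    qed
  qed
  moreover have "tw.canon eps N r ?rk ?w z" using z(1,2) by (simp add: tw.canon_def)
  moreover have "make_z d b r s (Zs b) = map Lt (z @ map (th eps) z)" by (simp add: M)
  ultimately show ?thesis using that by blast
qed

section \<open>Simulation of the two-pointer comparison\<close>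

definition rel :: "'a sym list \<Rightarrow> 'a sym list \<Rightarrow> nat \<Rightarrow> nat \<times> nat \<times> nat \<times> cmp_mode \<Rightarrow> 'a store \<Rightarrow> bool" where
  "rel A B n = (\<lambda>(p, q, k, m) s. s AL = rev (drop p A) \<and> s AR = take p A \<and> s BL = rev (drop q B) \<and> s BR = take q B \<and>
     s Ks = replicate k Mark \<and> s Rs = replicate (n - k) Mark \<and> s Mode = (if m = Cmp then [] else [Md m]))"

text \<open>A head at position \<open>p\<close> splits \<open>A\<close> over two stacks. The letter
  under the head is the top of \<open>rev (drop p A)\<close>, so one step of the head carries one
  letter across.\<close>

lemma shift_forward:
  assumes "s i = rev (drop p A)" "s j = take p A" "p < length A" "i \<noteq> j"
  shows "shift i j s = s(i := rev (drop (Suc p) A), j := take (Suc p) A)"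
proof -
  have "s i = rev (drop (Suc p) A) @ [A ! p]" using assms(1,3) by (simp add: Cons_nth_drop_Suc[symmetric])
  then show ?thesis using assms(2-4)
    by (intro ext) (simp add: shift_def case_top_def seq_def store_ops take_Suc_conv_app_nth)
qed

lemma shift_backward:
  assumes "s i = take p A" "s j = rev (drop p A)" "p \<le> length A" "0 < p" "i \<noteq> j"
  shows "shift i j s = s(i := take (p - 1) A, j := rev (drop (p - 1) A))"
proof -
  obtain p' where p: "p = Suc p'" using assms(4) by (cases p) auto
  have "s i = take p' A @ [A ! p']" using assms(1,3) p by (simp add: take_Suc_conv_app_nth)
  moreover have "rev (drop p' A) = rev (drop p A) @ [A ! p']" using assms(3) p by (simp add: Cons_nth_drop_Suc[symmetric])
  ultimately show ?thesis using assms(2,5) p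
    by (intro ext) (simp add: shift_def case_top_def seq_def store_ops)
qed

lemma case_top_rev_drop:
  "s i = rev (drop p A) \<Longrightarrow> case_top i F s = F (if p < length A then Some (A ! p) else None) s"
  by (simp add: case_top_def hd_drop_conv_nth last_rev not_le)

lemma case_top_marks:
  "s i = replicate k Mark \<Longrightarrow> case_top i F s = F (if k = 0 then None else Some Mark) s"
  by (simp add: case_top_def last_replicate)

lemma butlast_replicate: "butlast (replicate k x) = replicate (k - 1) x"
  by (cases k) (simp_all flip: replicate_append_same)

end

text \<open>The stacks hand out the words backwards, so the comparison speaks about reversed words;
  this transfers its verdict.\<close>

lemma rotate_rev: "(\<exists>k. rev v = rotate k (rev u)) \<longleftrightarrow> (\<exists>k. v = rotate k u)"
proof -
  have *: "\<exists>k. rev v = rotate k (rev u)" if "v = rotate k u" for u v :: "'c list" and k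
  proof -
    have "v = drop (k mod length u) u @ take (k mod length u) u" using that by (simp add: rotate_drop_take)
    then have "rev v = rev (take (k mod length u) u) @ rev (drop (k mod length u) u)" by simp
    also have "\<dots> = rotate (length u - k mod length u) (rev (drop (k mod length u) u) @ rev (take (k mod length u) u))"
      using rotate_append[of "rev (drop (k mod length u) u)" "rev (take (k mod length u) u)"] by simp
    also have "rev (drop (k mod length u) u) @ rev (take (k mod length u) u) = rev u"
      by (simp flip: rev_append)
    finally show ?thesis by blast
  qed
  show ?thesis
  proof
    assume "\<exists>k. rev v = rotate k (rev u)"
    then obtain k where "rev v = rotate k (rev u)" by blast
    from *[OF this] show "\<exists>k. v = rotate k u" by simp
  next
    assume "\<exists>k. v = rotate k u"
    then show "\<exists>k. rev v = rotate k (rev u)" using * by blast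
  qed
qed

locale traag_compare = traag_program V comm y J vs N key + cyclic_compare a b n
  for V :: "'a set" and comm :: "'a \<Rightarrow> 'a \<Rightarrow> bool" and y :: 'a and J vs N key a b n +
  fixes A B :: "'a sym list"
  assumes A: "map key A = a @ a" "set A \<subseteq> syms" and B: "map key B = b @ b" "set B \<subseteq> syms"
begin

lemma rel_tick:
  assumes "invar c" "rel A B n c s"
  shows "rel A B n (tick c) (cmp_tick s)"
proof -
  obtain p q k m where c: "c = (p, q, k, m)" by (cases c)
  have lA: "length A = 2 * n" using arg_cong[OF A(1), of length] len by simp
  have lB: "length B = 2 * n" using arg_cong[OF B(1), of length] len by simp
  have s: "s AL = rev (drop p A)" "s AR = take p A" "s BL = rev (drop q B)" "s BR = take q B"
     "s Ks = replicate k Mark" "s Rs = replicate (n - k) Mark" "s Mode = (if m = Cmp then [] else [Md m])"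
    using assms(2) by (simp_all add: rel_def c)
  have mode: "case_top Mode F s = F (if m = Cmp then None else Some (Md m)) s" for F
    using s(7) by (simp add: case_top_def)
  have Ks: "case_top Ks F s = F (if k = 0 then None else Some Mark) s" for F
    using case_top_marks[of s Ks k] s(5) by blast
  show ?thesis
  proof (cases m)
    case Acc
    then show ?thesis using s by (simp add: c rel_def cmp_tick_def mode skip_def)
  next
    case Rej
    then show ?thesis using s by (simp add: c rel_def cmp_tick_def mode skip_def)
  next
    case m: RewA
    have cmp: "cmp_tick s = rew_step AR AL s" using m by (simp add: cmp_tick_def mode)
    show ?thesis
    proof (cases "k = 0")
      case True
      then show ?thesis using s m by (simp add: c cmp rew_step_def Ks rel_def store_ops)
    next
      case False
      let ?t = "s(Ks := replicate (k - 1) Mark, Rs := s Rs @ [Mark])"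
      have i: "k \<le> p" "p \<le> 2 * n" "k \<le> n" using assms(1) m by (simp_all add: c)
      have "cmp_tick s = shift AR AL ?t"
        using False unfolding cmp rew_step_def Ks by (simp add: seq_def store_ops s(5) butlast_replicate)
      also have "\<dots> = ?t(AR := take (p - 1) A, AL := rev (drop (p - 1) A))"
        by (rule shift_backward) (use s i False lA in simp_all)
      finally show ?thesis using s m False i by (simp add: c rel_def replicate_append_same flip: replicate_Suc)
    qed
  next
    case m: RewB
    have cmp: "cmp_tick s = rew_step BR BL s" using m by (simp add: cmp_tick_def mode)
    show ?thesis
    proof (cases "k = 0")
      case True
      then show ?thesis using s m by (simp add: c cmp rew_step_def Ks rel_def store_ops)
    next
      case False
      let ?t = "s(Ks := replicate (k - 1) Mark, Rs := s Rs @ [Mark])"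
      have i: "k \<le> q" "q \<le> 2 * n" "k \<le> n" using assms(1) m by (simp_all add: c)
      have "cmp_tick s = shift BR BL ?t"
        using False unfolding cmp rew_step_def Ks by (simp add: seq_def store_ops s(5) butlast_replicate)
      also have "\<dots> = ?t(BR := take (q - 1) B, BL := rev (drop (q - 1) B))"
        by (rule shift_backward) (use s i False lB in simp_all)
      finally show ?thesis using s m False i by (simp add: c rel_def replicate_append_same flip: replicate_Suc)
    qed
  next
    case m: Cmp
    have i: "k \<le> n" "p \<le> 2 * n" "q \<le> 2 * n" using assms(1) m by (simp_all add: c)
    have cmp: "cmp_tick s = cmp_step s" using m by (simp add: cmp_tick_def mode)
    have Rs: "case_top Rs F s = F (if n - k = 0 then None else Some Mark) s" for F
      using case_top_marks[of s Rs "n - k"] s(6) by blast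
    have AL: "case_top AL F s = F (if p < 2 * n then Some (A ! p) else None) s" for F
      using case_top_rev_drop[of s AL p A] s(1) lA by simp
    have BL: "case_top BL F s = F (if q < 2 * n then Some (B ! q) else None) s" for F
      using case_top_rev_drop[of s BL q B] s(3) lB by simp
    consider "k = n" | "k < n" "p = 2 * n \<or> q = 2 * n" | "k < n" "p < 2 * n" "q < 2 * n" using i by linarith
    then show ?thesis
    proof cases
      case 1
      then show ?thesis using s m by (simp add: c cmp cmp_step_def Rs rel_def store_ops)
    next
      case 2
      then show ?thesis using s m by (auto simp: c cmp cmp_step_def Rs AL BL rel_def store_ops)
    next
      case 3
      have kA: "key (A ! p) = (a @ a) ! p" using A(1) 3 lA by (metis nth_map)
      have kB: "key (B ! q) = (b @ b) ! q" using B(1) 3 lB by (metis nth_map)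
      have "A ! p \<in> syms" "B ! q \<in> syms" using A(2) B(2) 3 lA lB by (auto simp: subset_iff)
      then have eq: "A ! p = B ! q \<longleftrightarrow> (a @ a) ! p = (b @ b) ! q"
        using inj_key kA kB unfolding syms_def[symmetric] by (metis inj_onD)
      have sA: "shift AL AR s = s(AL := rev (drop (Suc p) A), AR := take (Suc p) A)"
        by (rule shift_forward) (use s 3 lA in simp_all)
      have sB: "shift BL BR t = t(BL := rev (drop (Suc q) B), BR := take (Suc q) B)"
        if "t BL = s BL" "t BR = s BR" for t
        by (rule shift_forward) (use s 3 lB that in simp_all)
      have nn: "(None :: 'a sym option) \<noteq> Some x" for x by simp
      have C: "cmp_tick s = (if A ! p = B ! q then (shift AL AR ;; shift BL BR ;; pop_top Rs ;; push Ks Mark) s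
         else if key (A ! p) > key (B ! q) then (shift AL AR ;; push Mode (Md RewB)) s
         else (shift BL BR ;; push Mode (Md RewA)) s)"
        unfolding cmp cmp_step_def Rs using 3 by (simp add: AL BL)
      consider "A ! p = B ! q" | "A ! p \<noteq> B ! q" "key (A ! p) > key (B ! q)" | "A ! p \<noteq> B ! q" "\<not> key (A ! p) > key (B ! q)"
        by blast
      then show ?thesis
      proof cases
        case 1
        then have "cmp_tick s = (s(AL := rev (drop (Suc p) A), AR := take (Suc p) A, BL := rev (drop (Suc q) B),
          BR := take (Suc q) B, Rs := butlast (s Rs), Ks := s Ks @ [Mark]))"
          unfolding C using sB by (simp add: seq_def sA store_ops)
        moreover have "tick c = (Suc p, Suc q, Suc k, Cmp)" using 1 3 m eq by (simp add: c)
        ultimately show ?thesis using s m by (simp add: rel_def butlast_replicate replicate_append_same)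
      next
        case 2
        then have "cmp_tick s = (s(AL := rev (drop (Suc p) A), AR := take (Suc p) A, Mode := [Md RewB]))"
          unfolding C using s(7) m by (simp add: seq_def sA store_ops)
        moreover have "tick c = (Suc p, q, k, RewB)" using 2 3 m eq kA kB by (simp add: c)
        ultimately show ?thesis using s by (simp add: rel_def)
      next
        case neq: 3
        then have "cmp_tick s = (s(BL := rev (drop (Suc q) B), BR := take (Suc q) B, Mode := [Md RewA]))"
          unfolding C using s(7) m sB[of s] by (simp add: seq_def store_ops)
        moreover have "tick c = (p, Suc q, k, RewA)" using neq 3 m eq kA kB by (simp add: c)
        ultimately show ?thesis using s by (simp add: rel_def)
      qed
    qed
  qed
qed

lemma cmp_loop:
  assumes "s AL = rev A" "s AR = []" "s BL = rev B" "s BR = []" "s Ks = []" "s Rs = replicate n Mark" "s Mode = []"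
    "8 * n < length (s Fu)"
  shows "for_each Fu (\<lambda>_. cmp_tick) s Mode = [Md (if rotation then Acc else Rej)]"
proof -
  let ?c = "(0, 0, 0, Cmp)"
  let ?Q = "\<lambda>ds t. invar ((tick ^^ length ds) ?c) \<and> rel A B n ((tick ^^ length ds) ?c) t"
  have "?Q (s Fu) (for_each Fu (\<lambda>_. cmp_tick) s)"
  proof (rule for_each_rule[where Q = ?Q])
    show "?Q [] s" using assms by (simp add: rel_def)
    fix ds c rest t assume Q: "?Q ds t"
    have "rel A B n ((tick ^^ length ds) ?c) (t(Fu := rest))"
      using Q by (simp add: rel_def split: prod.splits)
    then show "?Q (ds @ [c]) (cmp_tick (t(Fu := rest)))"
      using Q rel_tick invar_tick by simp
  qed (intro keeps_cmp_tick, simp)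
  then show ?thesis using tick_decides(1)[OF assms(8)] by (auto simp: rel_def split: prod.splits)
qed

end

section \<open>Correctness of the comparison and of the whole program\<close>

context traag_program
begin

lemma fold_push: "fold (\<lambda>_. push i x) xs s = s(i := s i @ replicate (length xs) x)"
proof (induction xs arbitrary: s)
  case (Cons c xs)
  then show ?case by (intro ext) (simp add: store_ops)
qed simp

lemma compare_spec:
  assumes s: "\<forall>i. scratch i \<longrightarrow> i \<notin> range Zs \<longrightarrow> s i = []" "s (Zs False) = map Lt zf" "s (Zs True) = map Lt zt"
    and V: "fst ` set zf \<subseteq> V" "fst ` set zt \<subseteq> V"
  shows "compare d s (Fail d) = [] \<longleftrightarrow> s (Fail d) = [] \<and> (\<exists>k. zt = rotate k zf)"
    and "\<And>i. i \<in> dqs \<Longrightarrow> i \<noteq> Fail d \<Longrightarrow> compare d s i = (if i \<in> range Zs then [] else s i)"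
proof -
  let ?n = "length zf"
  have s0: "s i = []" if "scratch i" "i \<notin> range Zs" for i using s(1) that by blast
  have s00: "s AL = []" "s AR = []" "s BL = []" "s BR = []" "s Ks = []" "s Rs = []" "s Ls = []" "s Mode = []" "s Cs = []" "s Fu = []"
    by (rule s0; auto)+
  let ?F1 = "\<lambda>x. push AL x ;; push Cs x ;; push Rs Mark ;; push Ls Mark ;; fold (\<lambda>_. push Fu Mark) [0..<8]"
  define s1 where "s1 = for_each (Zs False) ?F1 s"
  have k1: "s1 i = s i" if "i \<notin> {Zs False, AL, Cs, Rs, Ls, Fu}" for i
  proof -
    have "keeps i (for_each (Zs False) ?F1)" by (intro keeps_rules) (use that in simp_all)
    from keepsD[OF this] show ?thesis by (simp only: s1_def)
  qed
  let ?Q1 = "\<lambda>ds t. t AL = ds \<and> t Cs = ds \<and> t Rs = replicate (length ds) Mark \<and> t Ls = replicate (length ds) Mark \<and>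
    length (t Fu) = 8 * length ds"
  have Q1: "?Q1 (s (Zs False)) s1"
    unfolding s1_def
  proof (rule for_each_rule[where Q = ?Q1])
    show "?Q1 [] s" using s00 by simp
    show "?Q1 (ds @ [c]) (?F1 c (t(Zs False := rest)))" if "?Q1 ds t" for ds c rest t
      using that by (simp add: seq_def fold_push store_ops replicate_append_same)
  qed (simp add: keeps_rules)
  define s2 where "s2 = move Cs AL s1"
  have s2: "s2 = s1(Cs := [], AL := s1 AL @ s1 Cs)" unfolding s2_def by (rule move_store) simp
  let ?F2 = "\<lambda>x. push BL x ;; push Cs x ;; case_top Ls (\<lambda>q. if q = None then push (Fail d) Mark else pop_top Ls)"
  define s3 where "s3 = for_each (Zs True) ?F2 s2"
  have k3: "s3 i = s2 i" if "i \<notin> {Zs True, BL, Cs, Ls, Fail d}" for i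
  proof -
    have "keeps i (for_each (Zs True) ?F2)" by (intro keeps_rules) (use that in simp_all)
    from keepsD[OF this] show ?thesis by (simp only: s3_def)
  qed
  \<comment> \<open>\<open>Ls\<close> starts with \<open>?n\<close> marks and loses one for each
    letter of the second word. A second word that is too long is recorded in \<open>Fail d\<close>
    here; one that is too short is revealed afterwards by the marks left over.\<close>
  let ?Q2 = "\<lambda>ds t. t BL = ds \<and> t Cs = ds \<and> t Ls = replicate (?n - length ds) Mark \<and>
    (t (Fail d) = [] \<longleftrightarrow> s (Fail d) = [] \<and> length ds \<le> ?n)"
  have Q2: "?Q2 (s2 (Zs True)) s3"
    unfolding s3_def
  proof (rule for_each_rule[where Q = ?Q2])
    show "?Q2 [] s2" using s00 k1[of BL] k1[of "Fail d"] Q1 s(2) by (simp add: s2)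
    fix ds c rest t assume t: "?Q2 ds t"
    let ?t = "t(Zs True := rest, BL := ds @ [c], Cs := ds @ [c])"
    have "(push BL c ;; push Cs c) (t(Zs True := rest)) = ?t" using t by (simp add: seq_def store_ops)
    then have "?F2 c (t(Zs True := rest)) = case_top Ls (\<lambda>q. if q = None then push (Fail d) Mark else pop_top Ls) ?t"
      by (simp only: seq_def)
    also have "\<dots> = (if ?n - length ds = 0 then ?t(Fail d := t (Fail d) @ [Mark]) else ?t(Ls := replicate (?n - length ds - 1) Mark))"
      using t case_top_marks[of ?t Ls "?n - length ds"] by (intro ext) (simp add: store_ops butlast_replicate)
    finally have e: "?F2 c (t(Zs True := rest)) = \<dots>" .
    show "?Q2 (ds @ [c]) (?F2 c (t(Zs True := rest)))" unfolding e using t by auto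
  qed (simp add: keeps_rules)
  define s4 where "s4 = move Cs BL s3"
  have s4: "s4 = s3(Cs := [], BL := s3 BL @ s3 Cs)" unfolding s4_def by (rule move_store) simp
  define s5 where "s5 = push Fu Mark (case_top Ls (\<lambda>q. if q = None then skip else push (Fail d) Mark) s4)"
  have zt: "s2 (Zs True) = map Lt zt" using s(3) k1[of "Zs True"] by (simp add: s2)
  have "case_top Ls (\<lambda>q. if q = None then skip else push (Fail d) Mark) s4 =
    (if ?n - length zt = 0 then s4 else s4(Fail d := s4 (Fail d) @ [Mark]))"
    using case_top_marks[of s4 Ls "?n - length zt"] Q2 zt by (intro ext) (simp add: s4 store_ops skip_def)
  then have s5: "s5 = (if ?n - length zt = 0 then s4 else s4(Fail d := s4 (Fail d) @ [Mark]))(Fu := s4 Fu @ [Mark])"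
    by (intro ext) (simp add: s5_def store_ops)
  have f5: "s5 (Fail d) = [] \<longleftrightarrow> s (Fail d) = [] \<and> length zt = ?n"
    using Q2 zt by (auto simp: s5 s4)
  define s6 where "s6 = for_each Fu (\<lambda>_. cmp_tick) s5"
  have k6: "s6 i = s5 i" if "i \<notin> {AL, AR, BL, BR, Ks, Rs, Mode, Fu}" for i
  proof -
    have "keeps i (for_each Fu (\<lambda>_. cmp_tick))" by (intro keeps_rules keeps_cmp_tick) (use that in simp_all)
    from keepsD[OF this] show ?thesis by (simp only: s6_def)
  qed
  define s7 where "s7 = case_top Mode (\<lambda>m. if m = Some (Md Acc) then skip else push (Fail d) Mark) s6"
  have C: "compare d s = fold clear [AL, AR, BL, BR, Ks, Rs, Ls, Mode] s7"
    by (simp only: compare_def seq_def s1_def s2_def s3_def s4_def s5_def s6_def s7_def)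
  have k7: "s7 i = s6 i" if "i \<noteq> Fail d" for i
    using that by (auto simp: s7_def case_top_def store_ops skip_def)
  have f7: "s7 (Fail d) = [] \<longleftrightarrow> s5 (Fail d) = [] \<and> s6 Mode \<noteq> [] \<and> last (s6 Mode) = Md Acc"
    using k6[of "Fail d"] by (auto simp: s7_def case_top_def store_ops skip_def)
  have syms: "set (map Lt w) \<subseteq> syms" if "fst ` set w \<subseteq> V" for w using that by (force simp: syms_def)
  have m: "s6 Mode = [Md (if \<exists>k. zt = rotate k zf then Acc else Rej)]" if l: "length zt = ?n"
  proof -
    \<comment> \<open>Reversed, because the stacks are read from their tops, that is, from the ends
      of the words.\<close>
    let ?a = "rev (map key (map Lt zf))" and ?b = "rev (map key (map Lt zt))"
    interpret traag_compare V comm y J vs N key ?a ?b ?n "rev (map Lt zf @ map Lt zf)" "rev (map Lt zt @ map Lt zt)"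
      by unfold_locales (use l syms[OF V(1)] syms[OF V(2)] in \<open>simp_all add: rev_map\<close>)
    have "s6 Mode = [Md (if rotation then Acc else Rej)]"
      unfolding s6_def
    proof (rule cmp_loop)
      show "s5 AL = rev (rev (map Lt zf @ map Lt zf))" using Q1 s(2) k3[of AL] by (simp add: s5 s4 s2)
      show "s5 BL = rev (rev (map Lt zt @ map Lt zt))" using Q2 zt by (simp add: s5 s4)
      show "8 * ?n < length (s5 Fu)" using Q1 s(2) k3[of Fu] by (simp add: s5 s4 s2)
      show "s5 Rs = replicate ?n Mark" using Q1 s(2) k3[of Rs] by (simp add: s5 s4 s2)
    qed (use s00 k1 k3 in \<open>simp_all add: s5 s4 s2\<close>)
    moreover have "rotation \<longleftrightarrow> (\<exists>k. zt = rotate k zf)"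
    proof -
      have "rotation \<longleftrightarrow> (\<exists>k. map key (map Lt zt) = map key (rotate k (map Lt zf)))"
        unfolding rotation_def rotate_rev by (simp only: rotate_map)
      also have "\<dots> \<longleftrightarrow> (\<exists>k. map Lt zt = rotate k (map Lt zf))"
      proof -
        have "inj_on key (set (map Lt zt) \<union> set (rotate k (map Lt zf)))" for k
          by (rule inj_on_subset[OF inj_key]) (use syms[OF V(1)] syms[OF V(2)] in \<open>simp add: syms_def\<close>)
        then show ?thesis by (simp only: inj_on_map_eq_map)
      qed
      also have "\<dots> \<longleftrightarrow> (\<exists>k. zt = rotate k zf)"
        by (simp add: rotate_map inj_map_eq_map inj_def)
      finally show ?thesis .
    qed
    ultimately show ?thesis by simp
  qed
  have "compare d s (Fail d) = s7 (Fail d)" by (simp add: C clear_store)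
  then show "compare d s (Fail d) = [] \<longleftrightarrow> s (Fail d) = [] \<and> (\<exists>k. zt = rotate k zf)"
    using f7 f5 m by (cases "length zt = ?n") auto
  have z: "s1 (Zs False) = []" "s3 (Zs True) = []" "s6 Fu = []"
    unfolding s1_def s3_def s6_def
    by (rule for_each_empty, simp add: keeps_rules, rule for_each_empty, simp add: keeps_rules,
        rule for_each_empty, rule keeps_cmp_tick, simp)
  fix i assume i: "i \<in> dqs" "i \<noteq> Fail d"
  show "compare d s i = (if i \<in> range Zs then [] else s i)"
  proof (cases "i \<in> {AL, AR, BL, BR, Ks, Rs, Ls, Mode, Fu}")
    case True
    then have "scratch i" "i \<notin> range Zs" by auto
    moreover have "compare d s i = []" using True z(3) k7[of Fu] by (auto simp: C clear_store)
    ultimately show ?thesis using s0 by simp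
  next
    case False
    then have "compare d s i = s4 i" using i(2) k7[of i] k6[of i] by (auto simp: C clear_store s5)
    also have "\<dots> = (if i \<in> range Zs then [] else s i)"
    proof (cases "i \<in> {Zs False, Zs True, Cs}")
      case True
      then show ?thesis using z k3[of "Zs False"] s0[of Cs] by (auto simp: s4 s2)
    next
      case F: False
      then have "i \<notin> range Zs" by (metis (full_types) insertCI rangeE)
      then show ?thesis using F False k3[of i] k1[of i] i(2) by (simp add: s4 s2)
    qed
    finally show ?thesis .
  qed
qed

lemma scratch_dqs: "scratch i \<Longrightarrow> i \<in> dqs"
  by (cases i) (auto simp: dqs_def)

lemma main_dqs: "Inp b \<in> dqs" "Wd b \<in> dqs" "Par b \<in> dqs" "Fail b \<in> dqs" "Zs b \<in> dqs" "Ans \<in> dqs"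
  by (auto simp: dqs_def)

lemma clean_cong: "clean s \<Longrightarrow> (\<And>i. i \<in> dqs \<Longrightarrow> scratch i \<Longrightarrow> t i = s i) \<Longrightarrow> clean t"
  using scratch_dqs by (auto simp: clean_def)

lemma round_spec:
  assumes s: "clean s" "\<And>b. s (Wd b) = map Lt (w b)" "\<And>b. s (Par b) = pm (eps b)" and V: "\<And>b. fst ` set (w b) \<subseteq> V"
    and r: "r \<in> V"
  obtains z1 z2 where "tw.canon (eps False) N r (rank (order r)) (map (th d) (w False)) z1"
    "tw.canon (eps True) N r (rank (order r)) (w True) z2"
    "round d r s (Fail d) = [] \<longleftrightarrow> s (Fail d) = [] \<and>
       (\<exists>k. z2 @ map (th (eps True)) z2 = rotate k (z1 @ map (th (eps False)) z1))"
    "\<And>i. i \<in> dqs \<Longrightarrow> i \<noteq> Fail d \<Longrightarrow> round d r s i = s i"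
proof -
  define s1 where "s1 = make_z d False r s"
  define s2 where "s2 = make_z d True r s1"
  obtain z1 where z1: "tw.canon (eps False) N r (rank (order r)) (map (th (d \<and> \<not> False)) (w False)) z1"
    "s1 (Zs False) = map Lt (z1 @ map (th (eps False)) z1)" "\<And>i. i \<in> dqs \<Longrightarrow> i \<noteq> Zs False \<Longrightarrow> s1 i = s i"
    unfolding s1_def
    by (rule make_z_spec[of False s r "w False" "eps False" d]) (use s V r in \<open>simp_all add: clean_def\<close>)
  have c1: "\<forall>i. scratch i \<longrightarrow> i \<noteq> Zs (\<not> True) \<longrightarrow> s1 i = []"
    using z1(3) s(1) scratch_dqs by (simp add: clean_def)
  obtain z2 where z2: "tw.canon (eps True) N r (rank (order r)) (map (th (d \<and> \<not> True)) (w True)) z2"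
    "s2 (Zs True) = map Lt (z2 @ map (th (eps True)) z2)" "\<And>i. i \<in> dqs \<Longrightarrow> i \<noteq> Zs True \<Longrightarrow> s2 i = s1 i"
    unfolding s2_def
    by (rule make_z_spec[OF c1 r _ V, of True "eps True" d]) (use s z1(3) main_dqs in simp_all)
  have c2: "\<forall>i. scratch i \<longrightarrow> i \<notin> range Zs \<longrightarrow> s2 i = []"
  proof (intro allI impI)
    fix i assume i: "scratch i" "i \<notin> range Zs"
    then have "i \<noteq> Zs True" "i \<noteq> Zs (\<not> True)" by auto
    then show "s2 i = []" using z2(3)[OF scratch_dqs[OF i(1)]] c1 i(1) by simp
  qed
  have o2: "s2 i = s i" if "i \<in> dqs" "i \<notin> range Zs" for i
  proof -
    have "i \<noteq> Zs False" "i \<noteq> Zs True" using that(2) by blast+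
    then show ?thesis using z1(3) z2(3) that(1) by metis
  qed
  have zf: "s2 (Zs False) = map Lt (z1 @ map (th (eps False)) z1)" using z1(2) z2(3) main_dqs by simp
  have g1: "fst ` set (z1 @ map (th (eps False)) z1) \<subseteq> V"
    using tw.canon_gens[OF z1(1)] V[of False] by (simp add: image_Un image_image)
  have g2: "fst ` set (z2 @ map (th (eps True)) z2) \<subseteq> V"
    using tw.canon_gens[OF z2(1)] V[of True] by (simp add: image_Un image_image)
  note C = compare_spec[OF c2 zf z2(2) g1 g2, where d = d]
  have R: "round d r s = compare d s2" by (simp add: round_def seq_def s1_def s2_def)
  have F: "s2 (Fail d) = s (Fail d)" using o2[of "Fail d"] main_dqs by auto
  have "round d r s i = s i" if i: "i \<in> dqs" "i \<noteq> Fail d" for i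
  proof (cases "i \<in> range Zs")
    case True
    then have "s i = []" using s(1) by (auto simp: clean_def)
    then show ?thesis using C(2)[OF i] True R by simp
  next
    case False
    then show ?thesis using C(2)[OF i] o2[OF i(1)] R by simp
  qed
  then show ?thesis using that[of z1 z2] z1(1) z2(1) C(1) F R by simp
qed

lemma rank_order:
  assumes "r \<in> V"
  shows "inj_on (rank (order r)) V" "\<forall>g\<in>V. rank (order r) g \<le> rank (order r) r"
proof -
  have nth: "rank os g < length os \<and> os ! rank os g = g" if "g \<in> set os" for os g
    using that unfolding rank_def by (induction os) auto
  show "inj_on (rank (order r)) V"
    by (rule inj_onI) (metis nth set_order[OF assms])
  have "rank (order r) r = length (filter (\<lambda>a. a \<noteq> r) vs)"
    by (simp add: rank_def order_def takeWhile_append)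
  moreover have "rank (order r) g < length (order r)" if "g \<in> V" for g using nth set_order[OF assms] that by blast
  ultimately show "\<forall>g\<in>V. rank (order r) g \<le> rank (order r) r" by (auto simp: order_def less_Suc_eq_le)
qed

lemma rounds_spec:
  assumes s: "clean s" "\<And>b. s (Wd b) = map Lt (w b)" "\<And>b. s (Par b) = pm (eps b)" and V: "\<And>b. fst ` set (w b) \<subseteq> V"
  shows "fold (round d) vs s (Fail d) = [] \<longrightarrow> s (Fail d) = []"
    and "eps True = eps False \<Longrightarrow> fold (round d) vs s (Fail d) = [] \<longleftrightarrow> s (Fail d) = [] \<and>
      tw.rt (eps False) (map (th d) (w False)) (w True)"
    and "\<And>i. i \<in> dqs \<Longrightarrow> i \<noteq> Fail d \<Longrightarrow> fold (round d) vs s i = s i"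
proof -
  let ?a = "map (th d) (w False)" and ?e = "eps False"
  have ga: "fst ` set ?a \<subseteq> V" using V[of False] by (simp add: image_image)
  \<comment> \<open>The two directions differ: twisted conjugacy makes each single round succeed,
    whereas a successful round yields a witness only for its own \<open>r\<close>, and the witnesses
    for all of \<open>V\<close> together are needed to conclude.\<close>
  have L: "(fold (round d) rs s (Fail d) = [] \<longrightarrow> s (Fail d) = []) \<and>
    (eps True = ?e \<longrightarrow> tw.rt ?e ?a (w True) \<longrightarrow> s (Fail d) = [] \<longrightarrow> fold (round d) rs s (Fail d) = []) \<and>
    (eps True = ?e \<longrightarrow> fold (round d) rs s (Fail d) = [] \<longrightarrow>
      (\<forall>r\<in>set rs. \<exists>rk z1 z2. tw.canon ?e N r rk ?a z1 \<and> tw.canon ?e N r rk (w True) z2 \<and> tw.same_cycle ?e z1 z2)) \<and>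
    (\<forall>i\<in>dqs. i \<noteq> Fail d \<longrightarrow> fold (round d) rs s i = s i)" if "set rs \<subseteq> V" for rs
    using that s
  proof (induction rs arbitrary: s)
    case (Cons r rs)
    have r: "r \<in> V" using Cons.prems(1) by simp
    let ?s = "round d r s"
    obtain z1 z2 where z: "tw.canon ?e N r (rank (order r)) ?a z1"
      "tw.canon (eps True) N r (rank (order r)) (w True) z2"
      "?s (Fail d) = [] \<longleftrightarrow> s (Fail d) = [] \<and> (\<exists>k. z2 @ map (th (eps True)) z2 = rotate k (z1 @ map (th ?e) z1))"
      "\<And>i. i \<in> dqs \<Longrightarrow> i \<noteq> Fail d \<Longrightarrow> ?s i = s i"
      using round_spec[OF Cons.prems(2-4) V r] by metis
    have "clean ?s" by (rule clean_cong[OF Cons.prems(2)], rule z(4)) auto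
    moreover have "?s (Wd b) = map Lt (w b)" "?s (Par b) = pm (eps b)" for b
      using z(4)[of "Wd b"] z(4)[of "Par b"] Cons.prems(3,4) main_dqs by simp_all
    ultimately have IH: "(fold (round d) rs ?s (Fail d) = [] \<longrightarrow> ?s (Fail d) = []) \<and>
      (eps True = ?e \<longrightarrow> tw.rt ?e ?a (w True) \<longrightarrow> ?s (Fail d) = [] \<longrightarrow> fold (round d) rs ?s (Fail d) = []) \<and>
      (eps True = ?e \<longrightarrow> fold (round d) rs ?s (Fail d) = [] \<longrightarrow>
        (\<forall>r\<in>set rs. \<exists>rk z1 z2. tw.canon ?e N r rk ?a z1 \<and> tw.canon ?e N r rk (w True) z2 \<and> tw.same_cycle ?e z1 z2)) \<and>
      (\<forall>i\<in>dqs. i \<noteq> Fail d \<longrightarrow> fold (round d) rs ?s i = ?s i)"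
      using Cons.prems(1) by (intro Cons.IH) simp_all
    have sc: "tw.same_cycle ?e z1 z2 \<longleftrightarrow> (\<exists>k. z2 @ map (th (eps True)) z2 = rotate k (z1 @ map (th ?e) z1))"
      if "eps True = ?e" using that by (simp add: tw.same_cycle_def)
    have rt: "tw.same_cycle ?e z1 z2" if e: "eps True = ?e" and "tw.rt ?e ?a (w True)"
      using tw.rt_canon_same_cycle[OF that(2) z(1) z(2)[unfolded e] ga rank_order[OF r] near] .
    have f: "fold (round d) (r # rs) s = fold (round d) rs ?s" by simp
    show ?case unfolding f
      using IH z(1-3) sc rt z(4) by (intro conjI impI) (blast, blast, force, simp)
  qed simp
  have vV: "set vs \<subseteq> V" by (simp add: vs)
  note L = L[OF vV]
  show "fold (round d) vs s (Fail d) = [] \<longrightarrow> s (Fail d) = []" using L by blast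
  show "fold (round d) vs s i = s i" if "i \<in> dqs" "i \<noteq> Fail d" for i using L that by blast
  assume e: "eps True = ?e"
  show "fold (round d) vs s (Fail d) = [] \<longleftrightarrow> s (Fail d) = [] \<and> tw.rt ?e ?a (w True)"
  proof
    assume F: "fold (round d) vs s (Fail d) = []"
    have "tw.rt ?e ?a (w True)"
      by (rule tw.canon_same_cycle_rt[OF _ ga V near]) (use L F e vs in blast)
    then show "s (Fail d) = [] \<and> tw.rt ?e ?a (w True)" using L F by blast
  qed (use L e in blast)
qed

lemma check_link_spec:
  assumes s: "clean s" "s (Wd False) = map Lt w"
  shows "check_link s (Fail True) = [] \<longleftrightarrow> s (Fail True) = [] \<and> (y \<in> fst ` set w \<or> (\<forall>g\<in>fst ` set w. comm y g))"
    and "\<And>i. i \<noteq> Fail True \<Longrightarrow> check_link s i = s i"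
proof -
  let ?F = "on_letter (\<lambda>c. push Cs (Lt c) ;; (if fst c = y then push Sg Mark else if comm y (fst c) then skip else push Fu Mark))"
  have D: "drain (Wd False) ?F (map Lt w) s Cs = s Cs @ map Lt w \<and>
    (drain (Wd False) ?F (map Lt w) s Sg = [] \<longleftrightarrow> s Sg = [] \<and> y \<notin> fst ` set w) \<and>
    (drain (Wd False) ?F (map Lt w) s Fu = [] \<longleftrightarrow> s Fu = [] \<and> (\<forall>g\<in>fst ` set w. g = y \<or> comm y g))" for w s
  proof (induction w arbitrary: s)
    case (Cons c w)
    define u where "u = ?F (Lt c) (s(Wd False := map Lt w))"
    have u: "u Cs = s Cs @ [Lt c]" "u Sg = [] \<longleftrightarrow> s Sg = [] \<and> fst c \<noteq> y" "u Fu = [] \<longleftrightarrow> s Fu = [] \<and> (fst c = y \<or> comm y (fst c))"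
      by (simp_all add: u_def seq_def store_ops skip_def)
    have "drain (Wd False) ?F (map Lt (c # w)) s = drain (Wd False) ?F (map Lt w) u" by (simp add: u_def)
    then show ?case using Cons.IH[of u] u by (simp only:) auto
  qed simp
  define t where "t = for_each (Wd False) ?F s"
  have c: "s Cs = []" "s Sg = []" "s Fu = []" using s(1) by (simp_all add: clean_def)
  have t: "t Cs = map Lt w" "t Sg = [] \<longleftrightarrow> y \<notin> fst ` set w" "t Fu = [] \<longleftrightarrow> (\<forall>g\<in>fst ` set w. g = y \<or> comm y g)"
    using D[of w s] s(2) c by (simp_all add: t_def for_each_def)
  have k: "t i = s i" if "i \<notin> {Wd False, Cs, Sg, Fu}" for i
  proof -
    have "keeps i (for_each (Wd False) ?F)" by (intro keeps_rules) (use that in simp_all)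
    from keepsD[OF this] show ?thesis by (simp only: t_def)
  qed
  have w: "t (Wd False) = []" unfolding t_def by (rule for_each_empty) (intro keeps_rules; simp)
  define t2 where "t2 = move Cs (Wd False) t"
  have t2: "t2 = t(Cs := [], Wd False := map Lt w)" using w t(1) by (intro ext) (simp add: t2_def move_store)
  define t3 where "t3 = case_top Sg (\<lambda>p. case_top Fu (\<lambda>q. if p = None \<and> q \<noteq> None then push (Fail True) Mark else skip)) t2"
  have t3: "t3 i = (if i = Fail True \<and> t Sg = [] \<and> t Fu \<noteq> [] then t i @ [Mark] else t2 i)" for i
    by (simp add: t3_def case_top_def store_ops skip_def t2)
  have C: "check_link s = t3(Sg := [], Fu := [])"
    by (simp only: check_link_def seq_def t_def t2_def t3_def clear_store)
  show "check_link s (Fail True) = [] \<longleftrightarrow> s (Fail True) = [] \<and> (y \<in> fst ` set w \<or> (\<forall>g\<in>fst ` set w. comm y g))"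
    unfolding C using t k[of "Fail True"] by (auto simp: t3 t2)
  show "check_link s i = s i" if "i \<noteq> Fail True" for i
    unfolding C using that k[of i] c s(2) by (auto simp: t3 t2)
qed

text \<open>Passing to conjugates with cyclically reduced decorations does not affect conjugacy. For
  these, \<open>tconj_rt\<close> and \<open>rt_imp_tconj\<close> give the two directions, the
  exponent \<open>d\<close> selecting the \<open>Fail\<close> deque that stays empty.\<close>

theorem main_spec:
  assumes u: "u \<in> lists (letters V)" "v \<in> lists (letters V)"
  shows "main ((\<lambda>_. [])(Inp False := map (\<lambda>(a, e). Lt (a, e, False)) u, Inp True := map (\<lambda>(a, e). Lt (a, e, False)) v)) Ans \<noteq> []
    \<longleftrightarrow> tconj u v"
proof -
  let ?s = "(\<lambda>_. [])(Inp False := map (\<lambda>(a, e). Lt (a, e, False)) u, Inp True := map (\<lambda>(a, e). Lt (a, e, False)) v)"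
  have c: "clean ?s" by (auto simp: clean_def)
  define s1 where "s1 = prep False ?s"
  define s2 where "s2 = prep True s1"
  obtain u' where u': "tconj u u'" "par u' = par u" "tw.cyc_irred (par u) (hat False u')" "clean s1"
    "s1 (Wd False) = map Lt (hat False u')" "s1 (Par False) = pm (par u)" "s1 (Inp True) = ?s (Inp True)"
    "s1 (Wd True) = []" "s1 (Par True) = []" "\<And>d. s1 (Fail d) = []" "s1 Ans = []"
    unfolding s1_def by (rule prep_spec[OF c, of False u]) (use u in simp_all)
  obtain v' where v': "tconj v v'" "par v' = par v" "tw.cyc_irred (par v) (hat False v')" "clean s2"
    "s2 (Wd True) = map Lt (hat False v')" "s2 (Par True) = pm (par v)" "s2 (Wd False) = s1 (Wd False)"
    "s2 (Par False) = s1 (Par False)" "\<And>d. s2 (Fail d) = s1 (Fail d)" "s2 Ans = s1 Ans"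
    unfolding s2_def by (rule prep_spec[OF u'(4), of True v]) (use u u' in simp_all)
  define s3 where "s3 = check_par s2"
  have s3: "s3 = (if par u = par v then s2 else s2(Fail False := s2 (Fail False) @ [Mark], Fail True := s2 (Fail True) @ [Mark]))"
    using case_pm[of s2 "Par False" "par u"] case_pm[of s2 "Par True" "par v"] u'(6) v'(6,8)
    by (intro ext) (auto simp: s3_def check_par_def seq_def store_ops skip_def)
  let ?wu = "hat False u'" and ?wv = "hat False v'"
  have o3: "s3 i = s2 i" if "\<forall>d. i \<noteq> Fail d" for i using that by (simp add: s3)
  have c3: "clean s3" by (rule clean_cong[OF v'(4)], rule o3) auto
  have w3: "s3 (Wd False) = map Lt ?wu" using o3[of "Wd False"] u'(5) v'(7) by simp
  define s4 where "s4 = check_link s3"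
  note l4 = check_link_spec[OF c3 w3, folded s4_def]
  have c4: "clean s4" by (rule clean_cong[OF c3], rule l4(2)) auto
  define w where "w = (\<lambda>b. if b then ?wv else ?wu)"
  define eps where "eps = (\<lambda>b. if b then par v else par u)"
  have V: "fst ` set (w b) \<subseteq> V" for b
    using u'(1) v'(1) hat_gens by (simp add: w_def tconj_def)
  have s4: "s4 (Wd b) = map Lt (w b)" "s4 (Par b) = pm (eps b)" for b
    using l4(2)[of "Wd b"] l4(2)[of "Par b"] o3[of "Wd b"] o3[of "Par b"] u'(5,6) v'(5-8)
    by (cases b; simp add: w_def eps_def)+
  define s5 where "s5 = fold (round False) vs s4"
  note r5 = rounds_spec[OF c4 s4 V, where d = False, folded s5_def]
  have c5: "clean s5" by (rule clean_cong[OF c4], rule r5(3)) auto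
  have s5: "s5 (Wd b) = map Lt (w b)" "s5 (Par b) = pm (eps b)" for b
    using r5(3)[of "Wd b"] r5(3)[of "Par b"] s4 main_dqs by simp_all
  define s6 where "s6 = fold (round True) vs s5"
  note r6 = rounds_spec[OF c5 s5 V, where d = True, folded s6_def]
  have M: "main ?s = decide s6"
    by (simp only: main_def seq_def s1_def s2_def s3_def s4_def s5_def s6_def)
  have "s6 Ans = []"
    using r6(3)[of Ans] r5(3)[of Ans] l4(2)[of Ans] o3[of Ans] v'(10) u'(11) main_dqs by simp
  then have A: "main ?s Ans \<noteq> [] \<longleftrightarrow> s6 (Fail False) = [] \<or> s6 (Fail True) = []"
    by (auto simp: M decide_def case_top_def store_ops skip_def)
  have f: "s6 (Fail False) = s5 (Fail False)" "s5 (Fail True) = s4 (Fail True)" "s4 (Fail False) = s3 (Fail False)"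
    using r6(3)[of "Fail False"] r5(3)[of "Fail True"] l4(2)[of "Fail False"] main_dqs by simp_all
  have f3: "s3 (Fail d) = [] \<longleftrightarrow> par u = par v" for d
    using v'(9) u'(10) by (cases d) (simp_all add: s3)
  have tc: "tconj u v \<longleftrightarrow> tconj u' v'"
    using tconj_trans tconj_sym u'(1) v'(1) by blast
  let ?P = "\<lambda>d. tw.rt (par u) (map (th d) ?wu) ?wv \<and> (d \<longrightarrow> y \<in> fst ` set ?wu \<or> (\<forall>g\<in>fst ` set ?wu. comm y g))"
  have F: "s6 (Fail d) = [] \<longleftrightarrow> par u = par v \<and> ?P d" for d
  proof (cases "par u = par v")
    case True
    then have e: "eps True = eps False" by (simp add: eps_def)
    show ?thesis
    proof (cases d)
      case d: True
      show ?thesis using r6(2)[OF e] f(2) l4(1) f3[of True] True d by (auto simp: w_def eps_def)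
    next
      case d: False
      show ?thesis using r5(2)[OF e] f(1,3) f3[of False] True d by (simp add: w_def eps_def)
    qed
  next
    case False
    then show ?thesis using r6(1) r5(1) f l4(1) f3 by (cases d) auto
  qed
  show ?thesis unfolding A tc
  proof
    assume "s6 (Fail False) = [] \<or> s6 (Fail True) = []"
    then obtain d where "s6 (Fail d) = []" by blast
    then have "tw.rt (par u') (map (th d) ?wu) ?wv" "d \<longrightarrow> y \<in> fst ` set ?wu \<or> (\<forall>g\<in>fst ` set ?wu. comm y g)"
      using F[of d] u'(2) by metis+
    moreover have "u' \<in> lists (letters V)" using u'(1) by (simp add: tconj_def)
    ultimately show "tconj u' v'" using rt_imp_tconj by blast
  next
    assume t: "tconj u' v'"
    have p: "par u = par v" using tconj_geq[OF t] u'(2) v'(2) by blast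
    have "tw.cyc_irred (par u') ?wu" "tw.cyc_irred (par u') ?wv" using u'(2,3) v'(3) p by simp_all
    from tconj_rt[OF t this] obtain d where "?P d" using u'(2) by auto
    then have "s6 (Fail d) = []" using F p by blast
    then show "s6 (Fail False) = [] \<or> s6 (Fail True) = []" by (cases d) auto
  qed
qed

end

lemma (in traag_program) finite_dqs: "finite dqs"
proof -
  have "finite V" using vs(1) finite_set by metis
  then show ?thesis by (simp add: dqs_def)
qed

lemma finite_symbols:
  assumes "finite V"
  shows "finite (insert Mark (Lt ` (V \<times> UNIV) \<union> range Md))"
proof -
  have "(UNIV :: cmp_mode set) = {Cmp, RewA, RewB, Acc, Rej}" using cmp_mode.exhaust by blast
  then have "finite (UNIV :: cmp_mode set)" by (metis finite.emptyI finite_insert)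
  then show ?thesis using assms by simp
qed

theorem (in traag_letters) linear_time_conjugacy:
  assumes "finite V"
  shows "linear_time_decidable (letters V)
    (\<lambda>u v. conjugate_in (presented_group V R) (word_class V R u) (word_class V R v))"
  unfolding linear_time_decidable_def
proof (intro allI impI)
  fix code :: "'a \<times> bool \<Rightarrow> nat"
  assume code: "inj_on code (letters V) \<and> (\<forall>a\<in>letters V. 0 < code a)"
  obtain vs where vs: "set vs = V" "distinct vs" using finite_distinct_list[OF assms] by blast
  obtain N where near: "\<forall>S\<subseteq>V. \<forall>r\<in>S. tw.component S r \<subseteq> tw.near S r N"
    using tw.component_near_uniform[OF assms] by blast
  \<comment> \<open>The numbering \<open>key\<close> used inside the machine is independent of
    \<open>code\<close>, which matters only while the input is loaded.\<close>
  obtain key :: "'a sym \<Rightarrow> nat" where key: "inj_on key (insert Mark (Lt ` (V \<times> UNIV) \<union> range Md))"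
    using finite_imp_inj_to_nat_seg[OF finite_symbols[OF assms]] by blast
  interpret P: traag_program V comm y J vs N key
    by unfold_locales (use vs near key in auto)
  obtain k and num :: "'a dq \<Rightarrow> nat" where num: "num ` P.dqs = {i. i < k}" "inj_on num P.dqs"
    using finite_imp_inj_to_nat_seg[OF P.finite_dqs] by blast
  interpret Q: traag_machine V comm y J vs N key num k
  proof unfold_locales
    show "num i < k" if "i \<in> P.dqs" for i using num(1) that by blast
    show "finite P.syms" unfolding P.syms_def by (rule finite_symbols[OF assms])
    show "inj_on key P.syms" unfolding P.syms_def by (rule key)
  qed (use num P.finite_dqs in simp_all)
  let ?ld = "\<lambda>(a, e). Lt (a, e, False)"
  have "finite (letters V)" using assms by (simp add: letters_def)
  then have "\<exists>P K. \<forall>u\<in>lists (letters V). \<forall>v\<in>lists (letters V).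
    answers_within P (map code u @ [0] @ map code v) (K * (length u + length v + 1))
      (P.main ((\<lambda>_. [])(Inp False := map ?ld u, Inp True := map ?ld v)) Ans \<noteq> [])"
    by (intro Q.lin_imp_decides[OF Q.lin_imp_main]) (use code in \<open>auto simp: letters_def\<close>)
  then show "\<exists>P K. \<forall>u\<in>lists (letters V). \<forall>v\<in>lists (letters V).
    answers_within P (map code u @ [0] @ map code v) (K * (length u + length v + 1))
      (conjugate_in (presented_group V R) (word_class V R u) (word_class V R v))"
    using P.main_spec conjugate_iff_tconj by simp
qed

theorem theoremB:
  fixes \<Gamma> :: "'a mixed_graph"
    and x :: "nat \<Rightarrow> 'a" and y :: 'a
    and n :: nat and I :: "nat set"
  assumes "finite_mixed_graph \<Gamma>"
    and "inj_on x {1..n}"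
    and "y \<notin> x ` {1..n}"
    and "verts \<Gamma> = insert y (x ` {1..n})"
    and "I \<subseteq> {1..n}"
    and "klein_pairs \<Gamma> = {(x i, y) | i. i \<in> I}"
  shows "linear_time_decidable (letters (verts \<Gamma>))
           (\<lambda>u v. conjugate_in (traag \<Gamma>) (traag_elem \<Gamma> u) (traag_elem \<Gamma> v))"
proof -
  let ?V = "verts \<Gamma>" and ?comm = "\<lambda>a b. {a, b} \<in> edges \<Gamma>" and ?J = "x ` I"
  have fin: "finite ?V" and edge: "\<And>e. e \<in> edges \<Gamma> \<Longrightarrow> e \<subseteq> ?V \<and> card e = 2" and sub: "directed \<Gamma> \<subseteq> edges \<Gamma>"
    and ends: "\<And>e. e \<in> directed \<Gamma> \<Longrightarrow> {origin \<Gamma> e, terminus \<Gamma> e} = e"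
    using assms(1) by (auto simp: finite_mixed_graph_def)
  have klein: "(a, b) \<in> klein_pairs \<Gamma> \<longleftrightarrow> a \<in> ?J \<and> b = y" for a b using assms(6) by auto
  \<comment> \<open>The Klein pairs determine the directed edges, so an edge at \<open>y\<close> is
    undirected exactly if its other end lies outside \<open>?J\<close>. This matches the side
    conditions on commutations in \<open>T.R\<close>.\<close>
  have dir: "e \<in> directed \<Gamma> \<longleftrightarrow> (\<exists>a\<in>?J. e = {a, y})" for e
  proof
    assume e: "e \<in> directed \<Gamma>"
    then have "(origin \<Gamma> e, terminus \<Gamma> e) \<in> klein_pairs \<Gamma>" by (auto simp: klein_pairs_def)
    then show "\<exists>a\<in>?J. e = {a, y}" using klein ends[OF e] by metis
  next
    assume "\<exists>a\<in>?J. e = {a, y}"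
    then obtain a where a: "a \<in> ?J" "e = {a, y}" by blast
    then have "(a, y) \<in> klein_pairs \<Gamma>" using klein by blast
    then obtain f where f: "f \<in> directed \<Gamma>" "a = origin \<Gamma> f" "y = terminus \<Gamma> f" by (auto simp: klein_pairs_def)
    then show "e \<in> directed \<Gamma>" using a(2) ends[OF f(1)] by simp
  qed
  interpret T: traag_letters ?V ?comm y ?J
  proof
    show "\<not> ?comm a a" for a using edge[of "{a, a}"] by auto
    show "?comm a y" if "a \<in> ?J" for a using dir sub that by blast
  qed (use edge assms(4) in \<open>auto simp: insert_commute\<close>)
  have "{a, b} \<in> edges \<Gamma> - directed \<Gamma> \<longleftrightarrow> ?comm a b \<and> \<not> (a = y \<and> b \<in> ?J) \<and> \<not> (b = y \<and> a \<in> ?J)" for a b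
    using dir by (auto simp: doubleton_eq_iff)
  note commuting = this
  have "{([(a, True), (b, True), (a, True)], [(b, True)]) | a b. (a, b) \<in> klein_pairs \<Gamma>} =
    {([(a, True), (y, True), (a, True)], [(y, True)]) | a. a \<in> ?J}"
    unfolding klein by blast
  then have "traag_relations \<Gamma> = T.R"
    unfolding traag_relations_def T.R_def by (simp only: commuting)
  then show ?thesis
    using T.linear_time_conjugacy[OF fin] by (simp add: traag_def traag_elem_def)
qed

end
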